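(* Let $\omega$, $L$ and $\sigma$ be as described in the context. Let $A,B\in L^q(\mathbb T^2;\mathbb C)$ with $q>2+\sigma$, and let $u$ be a Hölder continuous complex-valued function on $\mathbb T^2$ satisfying $$Lu=Au+B\overline u\quad\text{on }\mathbb T^2 .$$ If $u$ is not identically zero, then $u(p)\neq0$ for every $p\in\mathbb T^2$.
   Context: Setting. Let $\mathbb T^2=\mathbb R^2/\mathbb Z^2$ with coordinates $(x,y)$ and covering map $\Pi:\mathbb R^2\to\mathbb T^2$. Let $\omega=a\,dx+b\,dy$ be a nowhere vanishing closed complex-valued one-form on $\mathbb T^2$ with $a,b\in C^{1+\varepsilon}(\mathbb T^2;\mathbb C)$, $\varepsilon>0$, such that: (a) the set $\Sigma=\{p\in\mathbb T^2:\ \omega(p)\wedge\overline{\omega(p)}=0\}$ is a one-dimensional (embedded) manifold, with connected components $\Sigma_1,\dots,\Sigma_N$; (b) for each $i$ there is a number $\sigma_i>0$ such that every $p\in\Sigma_i$ has a neighborhood in which $\omega\wedge\overline\omega=|\rho_i|^{\sigma_i}g\,dx\wedge dy$, where $\rho_i$ is a (real-valued) defining function of $\Sigma_i$ near $p$ and $g$ is a non-vanishing continuous function; (c) $\omega$ is hypocomplex: every $p\in\mathbb T^2$ has an open neighborhood $U$ with a first integral $\zeta\in C^{1+\varepsilon}(U;\mathbb C)$ (that is, $d\zeta\neq0$ and $d\zeta\wedge\omega=0$ on $U$) such that $\zeta:U\to\zeta(U)\subset\mathbb C$ is a homeomorphism; (d) near each $p\in\Sigma_i$ there are local ($C^1$)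 coordinates $(s,t)$ in which $\omega$ is a non-vanishing multiple of $ds+i|t|^{\sigma_i}dt$. Put $\sigma=\max_{1\le i\le N}\sigma_i$ and $L=b\,\partial_x-a\,\partial_y$ on $\mathbb T^2$. With $Z(x,y)=\int_{(0,0)}^{(x,y)}\Pi^\ast\omega$ on $\mathbb R^2$, it is assumed (normalization) that $Z(x+1,y)=Z(x,y)+1$ and $Z(x,y+1)=Z(x,y)+\tau$ for all $(x,y)$, where $\tau\in\mathbb C$, $\mathrm{Im}(\tau)>0$. Equations are understood in the sense of distributions: since $\omega$ is closed, $L$ is divergence free, and $Lu=f$ means $-\int_{\mathbb T^2}u\,L\phi\,dxdy=\int_{\mathbb T^2}f\phi\,dxdy$ for all $\phi\in C^\infty(\mathbb T^2)$. *)

theory Defs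
  imports "HOL-Analysis.Analysis"
begin

section \<open>The torus\<close>

definition torus_rel :: "real \<times> real \<Rightarrow> real \<times> real \<Rightarrow> bool"
  where "torus_rel z w \<longleftrightarrow> fst z - fst w \<in> \<int> \<and> snd z - snd w \<in> \<int>"

quotient_type torus = "real \<times> real" / torus_rel
proof (rule equivpI)
  show "reflp torus_rel"
    by (simp add: reflp_def torus_rel_def)
  show "symp torus_rel"
    unfolding symp_def torus_rel_def by (metis Ints_minus minus_diff_eq)
  show "transp torus_rel"
    unfolding transp_def torus_rel_def by (metis Ints_add diff_add_cancel add_diff_eq)
qed

text \<open>The covering map.\<close>

definition proj :: "real \<times> real \<Rightarrow> torus"
  where "proj = abs_torus"

lemma proj_eq_iff: "proj z = proj w \<longleftrightarrow> fst z - fst w \<in> \<int> \<and> snd z - snd w \<in> \<int>"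
  by (simp add: proj_def torus.abs_eq_iff torus_rel_def)

lemma proj_surj: "\<exists>z. proj z = p"
  by (metis Quotient3_abs_rep Quotient3_torus proj_def)

instantiation torus :: topological_space
begin

definition open_torus :: "torus set \<Rightarrow> bool"
  where "open_torus U \<longleftrightarrow> open (proj -` U)"

instance
  by standard (auto simp: open_torus_def vimage_Int vimage_Union)

end

text \<open>A function on the torus is differentiated and integrated through its lift along
  \<^term>\<open>proj\<close>; the unit square is a fundamental domain.\<close>

definition unit_square :: "(real \<times> real) set"
  where "unit_square = cbox (0, 0) (1, 1)"


section \<open>Regularity classes\<close>

definition partial_x :: "(real \<times> real \<Rightarrow> 'a::real_normed_vector) \<Rightarrow> real \<times> real \<Rightarrow> 'a"
  where "partial_x f z = frechet_derivative f (at z) (1, 0)"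

definition partial_y :: "(real \<times> real \<Rightarrow> 'a::real_normed_vector) \<Rightarrow> real \<times> real \<Rightarrow> 'a"
  where "partial_y f z = frechet_derivative f (at z) (0, 1)"

text \<open>The set \<open>U\<close> is meant to be open in the following definitions.\<close>

definition C1_on :: "torus set \<Rightarrow> (torus \<Rightarrow> 'a::real_normed_vector) \<Rightarrow> bool"
  where "C1_on U f \<longleftrightarrow>
    (\<forall>z \<in> proj -` U. (f \<circ> proj) differentiable (at z)) \<and>
    continuous_on (proj -` U) (partial_x (f \<circ> proj)) \<and>
    continuous_on (proj -` U) (partial_y (f \<circ> proj))"

definition locally_Holder_on ::
    "real \<Rightarrow> (real \<times> real) set \<Rightarrow> (real \<times> real \<Rightarrow> 'a::real_normed_vector) \<Rightarrow> bool"
  where "locally_Holder_on \<epsilon> S f \<longleftrightarrow>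
    (\<forall>z \<in> S. \<exists>r > 0. \<exists>C. \<forall>v \<in> ball z r \<inter> S. \<forall>w \<in> ball z r \<inter> S.
       norm (f v - f w) \<le> C * dist v w powr \<epsilon>)"

text \<open>The class $C^{1+\varepsilon}(U)$ for $0 < \varepsilon < 1$. By compactness the local
  condition is the global one for \<open>U = UNIV\<close>.\<close>

definition C1_Holder_on :: "real \<Rightarrow> torus set \<Rightarrow> (torus \<Rightarrow> 'a::real_normed_vector) \<Rightarrow> bool"
  where "C1_Holder_on \<epsilon> U f \<longleftrightarrow>
    C1_on U f \<and>
    locally_Holder_on \<epsilon> (proj -` U) (partial_x (f \<circ> proj)) \<and>
    locally_Holder_on \<epsilon> (proj -` U) (partial_y (f \<circ> proj))"

text \<open>Bounding by the distance of arbitrary lifts is the same as bounding by the flat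
  quotient distance on the torus.\<close>

definition Holder_continuous :: "(torus \<Rightarrow> complex) \<Rightarrow> bool"
  where "Holder_continuous u \<longleftrightarrow>
    (\<exists>\<alpha> C. 0 < \<alpha> \<and> \<alpha> \<le> 1 \<and>
      (\<forall>z w. norm (u (proj z) - u (proj w)) \<le> C * dist z w powr \<alpha>))"

primrec Ck :: "nat \<Rightarrow> (real \<times> real \<Rightarrow> complex) \<Rightarrow> bool"
  where
    "Ck 0 f \<longleftrightarrow> continuous_on UNIV f"
  | "Ck (Suc k) f \<longleftrightarrow>
       (\<forall>z. f differentiable (at z)) \<and> Ck k (partial_x f) \<and> Ck k (partial_y f)"

definition smooth :: "(torus \<Rightarrow> complex) \<Rightarrow> bool"
  where "smooth \<phi> \<longleftrightarrow> (\<forall>k. Ck k (\<phi> \<circ> proj))"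

definition Lq :: "real \<Rightarrow> (torus \<Rightarrow> complex) \<Rightarrow> bool"
  where "Lq q f \<longleftrightarrow>
    f \<circ> proj \<in> borel_measurable (lebesgue_on unit_square) \<and>
    integrable (lebesgue_on unit_square) (\<lambda>z. norm (f (proj z)) powr q)"


section \<open>One-forms\<close>

text \<open>A one-form \<open>a dx + b dy\<close> is given by its coefficients; at a point it is the pair of their
  values, and \<open>wedge\<close> is the coefficient of $dx \wedge dy$ in the exterior product.\<close>

fun wedge :: "complex \<times> complex \<Rightarrow> complex \<times> complex \<Rightarrow> complex"
  where "wedge (a, b) (c, d) = a * d - b * c"

text \<open>The differential of a function on the torus, at the image of a point of the plane.\<close>

definition differential ::
    "(torus \<Rightarrow> 'a::real_normed_vector) \<Rightarrow> real \<times> real \<Rightarrow> 'a \<times> 'a"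
  where "differential f z = (partial_x (f \<circ> proj) z, partial_y (f \<circ> proj) z)"

definition closed_form :: "(torus \<Rightarrow> complex) \<Rightarrow> (torus \<Rightarrow> complex) \<Rightarrow> bool"
  where "closed_form a b \<longleftrightarrow>
    (\<forall>z. partial_x (b \<circ> proj) z = partial_y (a \<circ> proj) z)"

definition form_wedge_cnj :: "(torus \<Rightarrow> complex) \<Rightarrow> (torus \<Rightarrow> complex) \<Rightarrow> torus \<Rightarrow> complex"
  where "form_wedge_cnj a b p = wedge (a p, b p) (cnj (a p), cnj (b p))"

definition char_set :: "(torus \<Rightarrow> complex) \<Rightarrow> (torus \<Rightarrow> complex) \<Rightarrow> torus set"
  where "char_set a b = {p. form_wedge_cnj a b p = 0}"

text \<open>Local $C^1$ coordinates \<open>(s, t)\<close> on the open set \<open>U\<close>; the inverse is $C^1$ by the inverse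
  function theorem.\<close>

definition C1_coords :: "torus set \<Rightarrow> (torus \<Rightarrow> real) \<Rightarrow> (torus \<Rightarrow> real) \<Rightarrow> bool"
  where "C1_coords U s t \<longleftrightarrow>
    open U \<and> C1_on U s \<and> C1_on U t \<and> inj_on (\<lambda>p. (s p, t p)) U \<and>
    (\<forall>z \<in> proj -` U.
       partial_x (s \<circ> proj) z * partial_y (t \<circ> proj) z
       - partial_y (s \<circ> proj) z * partial_x (t \<circ> proj) z \<noteq> 0)"

text \<open>Embedded one-dimensional $C^1$ submanifolds, by slice charts.\<close>

definition embedded_curve :: "torus set \<Rightarrow> bool"
  where "embedded_curve M \<longleftrightarrow>
    (\<forall>p \<in> M. \<exists>U s t. p \<in> U \<and> C1_coords U s t \<and> M \<inter> U = {p \<in> U. t p = 0})"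

text \<open>\<open>\<rho>\<close> is a defining function of \<open>M\<close> in the open set \<open>U\<close>.\<close>

definition defining_function :: "torus set \<Rightarrow> torus set \<Rightarrow> (torus \<Rightarrow> real) \<Rightarrow> bool"
  where "defining_function M U \<rho> \<longleftrightarrow>
    C1_on U \<rho> \<and> M \<inter> U = {p \<in> U. \<rho> p = 0} \<and>
    (\<forall>z \<in> proj -` (M \<inter> U). differential \<rho> z \<noteq> (0, 0))"

definition vanishes_to_order ::
    "(torus \<Rightarrow> complex) \<Rightarrow> (torus \<Rightarrow> complex) \<Rightarrow> torus set \<Rightarrow> real \<Rightarrow> bool"
  where "vanishes_to_order a b M \<sigma> \<longleftrightarrow>
    (\<forall>p \<in> M. \<exists>U \<rho> (g :: torus \<Rightarrow> complex).
       open U \<and> p \<in> U \<and> defining_function M U \<rho> \<and> continuous_on U g \<and>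
       (\<forall>r \<in> U. g r \<noteq> 0 \<and> form_wedge_cnj a b r = of_real (\<bar>\<rho> r\<bar> powr \<sigma>) * g r))"

definition hypocomplex :: "real \<Rightarrow> (torus \<Rightarrow> complex) \<Rightarrow> (torus \<Rightarrow> complex) \<Rightarrow> bool"
  where "hypocomplex \<epsilon> a b \<longleftrightarrow>
    (\<forall>p. \<exists>U \<zeta>. open U \<and> p \<in> U \<and> C1_Holder_on \<epsilon> U \<zeta> \<and>
       (\<forall>z \<in> proj -` U. differential \<zeta> z \<noteq> (0, 0) \<and>
          wedge (differential \<zeta> z) (a (proj z), b (proj z)) = 0) \<and>
       (\<exists>\<xi>. homeomorphism U (\<zeta> ` U) \<zeta> \<xi>))"

text \<open>Near every point of \<open>M\<close> there are coordinates in which the form is a non-vanishing multiple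
  \<open>m\<close> of $ds + i|t|^\sigma dt$.\<close>

definition normal_form_along ::
    "(torus \<Rightarrow> complex) \<Rightarrow> (torus \<Rightarrow> complex) \<Rightarrow> torus set \<Rightarrow> real \<Rightarrow> bool"
  where "normal_form_along a b M \<sigma> \<longleftrightarrow>
    (\<forall>p \<in> M. \<exists>U s t (m :: torus \<Rightarrow> complex).
       p \<in> U \<and> C1_coords U s t \<and>
       (\<forall>z \<in> proj -` U. m (proj z) \<noteq> 0 \<and>
          a (proj z) = m (proj z) * (of_real (partial_x (s \<circ> proj) z)
            + \<i> * of_real (\<bar>t (proj z)\<bar> powr \<sigma>) * of_real (partial_x (t \<circ> proj) z)) \<and>
          b (proj z) = m (proj z) * (of_real (partial_y (s \<circ> proj) z)
            + \<i> * of_real (\<bar>t (proj z)\<bar> powr \<sigma>) * of_real (partial_y (t \<circ> proj) z))))"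

text \<open>The integral of the lifted form from the origin to \<open>(x, y)\<close>, taken along the segment; for a
  closed form the choice of the path is irrelevant.\<close>

definition form_integral :: "(torus \<Rightarrow> complex) \<Rightarrow> (torus \<Rightarrow> complex) \<Rightarrow> real \<Rightarrow> real \<Rightarrow> complex"
  where "form_integral a b x y =
    integral {0..1} (\<lambda>r. a (proj (r * x, r * y)) * of_real x + b (proj (r * x, r * y)) * of_real y)"


section \<open>The operator\<close>

definition L_op ::
    "(torus \<Rightarrow> complex) \<Rightarrow> (torus \<Rightarrow> complex) \<Rightarrow> (torus \<Rightarrow> complex) \<Rightarrow> real \<times> real \<Rightarrow> complex"
  where "L_op a b \<phi> z =
    b (proj z) * partial_x (\<phi> \<circ> proj) z - a (proj z) * partial_y (\<phi> \<circ> proj) z"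

text \<open>\<open>Lu = f\<close> in the sense of distributions, for a closed form.\<close>

definition weak_L_eq ::
    "(torus \<Rightarrow> complex) \<Rightarrow> (torus \<Rightarrow> complex) \<Rightarrow> (torus \<Rightarrow> complex) \<Rightarrow> (torus \<Rightarrow> complex) \<Rightarrow> bool"
  where "weak_L_eq a b u f \<longleftrightarrow>
    (\<forall>\<phi>. smooth \<phi> \<longrightarrow>
       - (LINT z|lebesgue_on unit_square. u (proj z) * L_op a b \<phi> z)
       = (LINT z|lebesgue_on unit_square. f (proj z) * \<phi> (proj z)))"

text \<open>The largest exponent over the connected components of the characteristic set. All exponents
  are positive, so the element 0 only fixes the value when that set is empty.\<close>

definition max_exponent ::
    "(torus \<Rightarrow> complex) \<Rightarrow> (torus \<Rightarrow> complex) \<Rightarrow> (torus set \<Rightarrow> real) \<Rightarrow> real"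
  where "max_exponent a b \<sigma> = Max (insert 0 (\<sigma> ` components (char_set a b)))"

end

theory Submission
  imports Defs "HOL-Complex_Analysis.Complex_Analysis"
begin

text \<open>
  Lift everything to the plane. The first integral \<open>Z\<close> is locally injective by the normal forms, and its
  quasi-periodicity makes it a homeomorphism of the plane onto the complex plane. In the coordinate \<open>Z\<close>
  the equation reads: the integral of \<open>u dZ\<close> over the boundary of a rectangle is the integral of \<open>C u\<close>
  over the rectangle, with \<open>C = A + B cnj u / u\<close>. A sublevel set \<open>norm (Z p - Z q) \<le> \<delta>\<close> has measure
  \<open>O(\<delta> powr (1 + 1 / (1 + \<sigma>)))\<close>, and \<open>q > 2 + \<sigma>\<close> is exactly what makes \<open>C\<close> integrable against
  \<open>norm (Z p - Z q) powr - (1 + \<theta>)\<close> for some \<open>\<theta> > 0\<close>. So the Cauchy transform \<open>W\<close> of \<open>C\<close> is continuous,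
  and \<open>u exp (- W)\<close> is holomorphic in \<open>Z\<close>. The zeros of \<open>u\<close> are therefore isolated and of positive
  multiplicity, while their number in a period parallelogram is the degree of the doubly periodic
  function \<open>u\<close> along its boundary, which is zero.
\<close>

subsection \<open>Local charts\<close>

text \<open>The obstacle is that \<open>Z\<close> is only a homeomorphism: on the characteristic set
  its differential has rank one, so its inverse is not differentiable there, and neither a chain
  rule nor a change of variables is at hand. Everything is therefore integrated in the
  \<open>(x, y)\<close> plane, and holomorphy in \<open>Z\<close> is always reached through Morera:
  vanishing boundary integrals give a primitive \<open>F\<close> with dF = v dZ, and the normal
  forms show that difference quotients of \<open>F\<close> against \<open>Z\<close> tend to
  \<open>v\<close>. For the same reason the rule for differentiating exp(-W) is replaced by integral
  identities for the Cauchy transform. Rectangles enter because \<open>u\<close> need not be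
  differentiable: the weak equation is traded for boundary integrals, with product test functions
  whose derivatives concentrate on the sides. The exponent 1 + 1/(1 + \<sigma>) adds up the two
  directions of the normal form ds + i |t|^\<sigma> dt: when \<open>Z\<close> varies by \<delta>, s
  varies by about \<delta> and t by about \<delta> to the power 1/(1 + \<sigma>).\<close>

declare split_paired_All [simp del] split_paired_Ex [simp del]

text \<open>The value of the one-form a dx + b dy on the vector \<open>h\<close>. Values in a normed
  space let real coordinates and complex functions share one notation.\<close>

definition dform :: "'a::real_normed_vector \<Rightarrow> 'a \<Rightarrow> real \<times> real \<Rightarrow> 'a"
  where "dform a b h = fst h *\<^sub>R a + snd h *\<^sub>R b"

lemma norm_dform_le: "norm (dform a b h) \<le> (norm a + norm b) * norm h"
proof -
  have "norm (dform a b h) \<le> \<bar>fst h\<bar> * norm a + \<bar>snd h\<bar> * norm b"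
    unfolding dform_def by (rule order_trans[OF norm_triangle_ineq]) simp
  also have "\<dots> \<le> norm h * norm a + norm h * norm b"
    using norm_fst_le[of "fst h" "snd h"] norm_snd_le[of "snd h" "fst h"]
    by (intro add_mono mult_right_mono) auto
  finally show ?thesis by (simp add: algebra_simps)
qed

text \<open>Strict differentiability: the mean value inequality is applied to \<open>g\<close> minus
  its linear part at \<open>p0\<close>, so two arbitrary nearby points are compared, not just a
  point with \<open>p0\<close>. This is what later gives injectivity and two-point lower
  bounds.\<close>

lemma dform_linearization:
  fixes g :: "real \<times> real \<Rightarrow> 'a::real_normed_vector"
  assumes "open S" "p0 \<in> S" "e > 0"
    and der: "\<And>p. p \<in> S \<Longrightarrow> (g has_derivative dform (gx p) (gy p)) (at p)"
    and cx: "continuous (at p0) gx" and cy: "continuous (at p0) gy"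
  shows "\<exists>r>0. ball p0 r \<subseteq> S \<and>
    (\<forall>p\<in>ball p0 r. \<forall>q\<in>ball p0 r.
       norm (g q - g p - dform (gx p0) (gy p0) (q - p)) \<le> e * norm (q - p))"
proof -
  obtain r1 where r1: "r1 > 0" "ball p0 r1 \<subseteq> S"
    using assms(1,2) open_contains_ball by blast
  obtain r2 where r2: "r2 > 0" "\<And>p. dist p p0 < r2 \<Longrightarrow> dist (gx p) (gx p0) < e/2"
    using cx \<open>e > 0\<close> unfolding continuous_at_eps_delta by (meson half_gt_zero)
  obtain r3 where r3: "r3 > 0" "\<And>p. dist p p0 < r3 \<Longrightarrow> dist (gy p) (gy p0) < e/2"
    using cy \<open>e > 0\<close> unfolding continuous_at_eps_delta by (meson half_gt_zero)
  define r where "r = min r1 (min r2 r3)"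
  have r: "r > 0" "ball p0 r \<subseteq> S" using r1 r2 r3 by (auto simp: r_def)
  have bd: "onorm (\<lambda>h. dform (gx p) (gy p) h - dform (gx p0) (gy p0) h) \<le> e"
    if "p \<in> ball p0 r" for p
  proof (rule onorm_bound)
    show "0 \<le> e" using \<open>e > 0\<close> by simp
    fix h
    have "dform (gx p) (gy p) h - dform (gx p0) (gy p0) h = dform (gx p - gx p0) (gy p - gy p0) h"
      by (simp add: dform_def algebra_simps)
    also have "norm \<dots> \<le> (norm (gx p - gx p0) + norm (gy p - gy p0)) * norm h"
      by (rule norm_dform_le)
    also have "\<dots> \<le> (e/2 + e/2) * norm h"
      using that r2(2)[of p] r3(2)[of p]
      by (intro mult_right_mono add_mono) (auto simp: r_def dist_norm norm_minus_commute)
    finally show "norm (dform (gx p) (gy p) h - dform (gx p0) (gy p0) h) \<le> e * norm h" by simp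
  qed
  show ?thesis
  proof (intro exI[of _ r] conjI ballI r)
    fix p q assume pq: "p \<in> ball p0 r" "q \<in> ball p0 r"
    have "norm (g q - g p - dform (gx p0) (gy p0) (q - p)) \<le> norm (q - p) * e"
    proof (rule differentiable_bound_linearization[where S = "ball p0 r" and f' = "\<lambda>p. dform (gx p) (gy p)"])
      fix t :: real assume "t \<in> {0..1}"
      then have "(1 - t) *\<^sub>R p + t *\<^sub>R q \<in> ball p0 r"
        using pq convexD_alt[OF convex_ball] by (metis atLeastAtMost_iff)
      then show "p + t *\<^sub>R (q - p) \<in> ball p0 r" by (simp add: algebra_simps)
    next
      fix x assume "x \<in> ball p0 r"
      then show "(g has_derivative dform (gx x) (gy x)) (at x within ball p0 r)"
        using der r by (meson has_derivative_at_withinI subsetD)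
    next
      fix x assume "x \<in> ball p0 r"
      then show "onorm (dform (gx x) (gy x) - dform (gx p0) (gy p0)) \<le> e"
        using bd by (simp add: fun_diff_def)
    qed (use r in auto)
    then show "norm (g q - g p - dform (gx p0) (gy p0) (q - p)) \<le> e * norm (q - p)"
      by (simp add: mult.commute)
  qed
qed

lemma has_derivative_has_vector_derivative_line:
  assumes "(f has_derivative f') (at (\<gamma> x))" "(\<gamma> has_vector_derivative v) (at x)"
  shows "((\<lambda>x. f (\<gamma> x)) has_vector_derivative f' v) (at x)"
proof -
  interpret bounded_linear f' using assms(1) by (rule has_derivative_bounded_linear)
  have "((\<lambda>x. f (\<gamma> x)) has_derivative (\<lambda>h. f' (h *\<^sub>R v))) (at x)"
    using has_derivative_compose[OF assms(2)[unfolded has_vector_derivative_def] assms(1)] .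
  then show ?thesis by (simp add: has_vector_derivative_def scaleR)
qed

text \<open>The majorant is a function and not a constant because the speed along a vertical
  coordinate line is governed by \<open>lam\<close>, which may vanish; the increment has to be
  compared with that of \<open>Lam\<close>. The segment may have either orientation.\<close>

lemma vector_derivative_bound_le:
  fixes f :: "real \<Rightarrow> 'a::real_normed_vector"
  assumes f: "\<And>x. x \<in> closed_segment a b \<Longrightarrow> (f has_vector_derivative f' x) (at x)"
    and phi: "\<And>x. x \<in> closed_segment a b \<Longrightarrow> (\<phi> has_real_derivative \<phi>' x) (at x)"
    and bnd: "\<And>x. x \<in> closed_segment a b \<Longrightarrow> norm (f' x) \<le> \<phi>' x"
  shows "norm (f b - f a) \<le> \<bar>\<phi> b - \<phi> a\<bar>"
proof -
  have main: "norm (f v - f u) \<le> \<phi> v - \<phi> u"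
    if uv: "u < v" and sub: "{u..v} \<subseteq> closed_segment a b" for u v
  proof (rule differentiable_bound_general[OF uv, where f' = f' and \<phi>' = \<phi>'])
    show "continuous_on {u..v} f"
      using f sub by (meson continuous_at_imp_continuous_on has_vector_derivative_continuous subsetD)
    show "continuous_on {u..v} \<phi>"
      using phi sub by (meson continuous_at_imp_continuous_on DERIV_isCont subsetD)
  next
    fix x assume x: "u < x" "x < v"
    then have "x \<in> closed_segment a b" using sub by auto
    then show "(f has_vector_derivative f' x) (at x)" "(\<phi> has_vector_derivative \<phi>' x) (at x)"
      "norm (f' x) \<le> \<phi>' x"
      using f phi bnd by (auto simp flip: has_real_derivative_iff_has_vector_derivative)
  qed
  consider "a = b" | "a < b" | "b < a" by linarith
  then show ?thesis
  proof cases
    case 2 then show ?thesis using main[of a b] by (auto simp: closed_segment_eq_real_ivl)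
  next
    case 3 then show ?thesis using main[of b a]
      by (auto simp: closed_segment_eq_real_ivl norm_minus_commute)
  qed auto
qed

text \<open>Two-point linear bounds for a local diffeomorphism: injectivity and the Lipschitz bound of
  the inverse come from the same estimate.\<close>

lemma coords_lower_bound:
  fixes s t :: "real \<times> real \<Rightarrow> real"
  assumes "open S" "p0 \<in> S"
    and ds: "\<And>p. p \<in> S \<Longrightarrow> (s has_derivative dform (sx p) (sy p)) (at p)"
    and dt: "\<And>p. p \<in> S \<Longrightarrow> (t has_derivative dform (tx p) (ty p)) (at p)"
    and cont: "continuous (at p0) sx" "continuous (at p0) sy" "continuous (at p0) tx" "continuous (at p0) ty"
    and det: "sx p0 * ty p0 - sy p0 * tx p0 \<noteq> 0"
  shows "\<exists>r>0. \<exists>c>0. ball p0 r \<subseteq> S \<and>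
    (\<forall>p\<in>ball p0 r. \<forall>q\<in>ball p0 r. norm (q - p) \<le> c * (\<bar>s q - s p\<bar> + \<bar>t q - t p\<bar>))"
proof -
  define d where "d = \<bar>sx p0 * ty p0 - sy p0 * tx p0\<bar>"
  define B where "B = \<bar>sx p0\<bar> + \<bar>sy p0\<bar> + \<bar>tx p0\<bar> + \<bar>ty p0\<bar>"
  have d: "d > 0" using det by (simp add: d_def)
  have "B \<noteq> 0" using det by (auto simp: B_def add_nonneg_eq_0_iff)
  then have B: "B > 0" by (simp add: B_def less_le)
  \<comment> \<open>Each of the two linearization errors enters with the factor \<open>B\<close>;
    with this \<open>e\<close> they sum to half of \<open>d * norm (q - p)\<close> and can be
    absorbed on the left.\<close>
  define e where "e = d / (4 * B)"
  have e: "e > 0" using d B by (simp add: e_def)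
  obtain r1 where r1: "r1 > 0" "ball p0 r1 \<subseteq> S"
    and b1: "\<And>p q. p \<in> ball p0 r1 \<Longrightarrow> q \<in> ball p0 r1 \<Longrightarrow>
       norm (s q - s p - dform (sx p0) (sy p0) (q - p)) \<le> e * norm (q - p)"
    using dform_linearization[OF assms(1,2) e ds cont(1,2)] by blast
  obtain r2 where r2: "r2 > 0"
    and b2: "\<And>p q. p \<in> ball p0 r2 \<Longrightarrow> q \<in> ball p0 r2 \<Longrightarrow>
       norm (t q - t p - dform (tx p0) (ty p0) (q - p)) \<le> e * norm (q - p)"
    using dform_linearization[OF assms(1,2) e dt cont(3,4)] by blast
  define r where "r = min r1 r2"
  have r: "r > 0" "ball p0 r \<subseteq> S" using r1 r2 by (auto simp: r_def)
  have c: "2 * B / d > 0" using d B by simp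
  have "norm (q - p) \<le> 2 * B / d * (\<bar>s q - s p\<bar> + \<bar>t q - t p\<bar>)"
    if "p \<in> ball p0 r" "q \<in> ball p0 r" for p q
  proof -
    from that have pq: "p \<in> ball p0 r1" "q \<in> ball p0 r1" "p \<in> ball p0 r2" "q \<in> ball p0 r2"
      by (auto simp: r_def)
    define u w where "u = fst (q - p)" and "w = snd (q - p)"
    define A1 A2 where "A1 = u * sx p0 + w * sy p0" and "A2 = u * tx p0 + w * ty p0"
    have A: "\<bar>A1\<bar> \<le> \<bar>s q - s p\<bar> + e * norm (q - p)" "\<bar>A2\<bar> \<le> \<bar>t q - t p\<bar> + e * norm (q - p)"
      using b1[OF pq(1,2)] b2[OF pq(3,4)] by (auto simp: A1_def A2_def dform_def u_def w_def)
    \<comment> \<open>Cramer's rule for the linear system with right-hand sides \<open>A1\<close>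
      and \<open>A2\<close>.\<close>
    have "d * \<bar>u\<bar> = \<bar>ty p0 * A1 - sy p0 * A2\<bar>"
      unfolding d_def A1_def A2_def abs_mult[symmetric] by (rule arg_cong[of _ _ abs]) algebra
    also have "\<dots> \<le> \<bar>ty p0\<bar> * \<bar>A1\<bar> + \<bar>sy p0\<bar> * \<bar>A2\<bar>"
      by (rule order_trans[OF abs_triangle_ineq4]) (simp add: abs_mult)
    finally have 1: "d * \<bar>u\<bar> \<le> \<bar>ty p0\<bar> * \<bar>A1\<bar> + \<bar>sy p0\<bar> * \<bar>A2\<bar>" .
    have "d * \<bar>w\<bar> = \<bar>sx p0 * A2 - tx p0 * A1\<bar>"
      unfolding d_def A1_def A2_def abs_mult[symmetric] by (rule arg_cong[of _ _ abs]) algebra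
    also have "\<dots> \<le> \<bar>sx p0\<bar> * \<bar>A2\<bar> + \<bar>tx p0\<bar> * \<bar>A1\<bar>"
      by (rule order_trans[OF abs_triangle_ineq4]) (simp add: abs_mult)
    finally have 2: "d * \<bar>w\<bar> \<le> \<bar>sx p0\<bar> * \<bar>A2\<bar> + \<bar>tx p0\<bar> * \<bar>A1\<bar>" .
    have "norm (q - p) \<le> \<bar>u\<bar> + \<bar>w\<bar>"
      using norm_Pair_le[of u w] unfolding u_def w_def prod.collapse real_norm_def .
    then have "d * norm (q - p) \<le> d * \<bar>u\<bar> + d * \<bar>w\<bar>"
      using d by (metis distrib_left mult_le_cancel_left_pos)
    also have "\<dots> \<le> B * \<bar>A1\<bar> + B * \<bar>A2\<bar>"
    proof -
      have n: "\<bar>x\<bar> * \<bar>y\<bar> \<ge> 0" for x y :: real by simp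
      show ?thesis
        using 1 2 n[of "sx p0" A1] n[of "sy p0" A1] n[of "tx p0" A2] n[of "ty p0" A2]
        unfolding B_def ring_distribs by linarith
    qed
    also have "\<dots> \<le> B * (\<bar>s q - s p\<bar> + e * norm (q - p)) + B * (\<bar>t q - t p\<bar> + e * norm (q - p))"
      using A B by (intro add_mono mult_left_mono) auto
    also have "\<dots> = B * (\<bar>s q - s p\<bar> + \<bar>t q - t p\<bar>) + d / 2 * norm (q - p)"
      using B by (simp add: e_def field_simps)
    finally have "d / 2 * norm (q - p) \<le> B * (\<bar>s q - s p\<bar> + \<bar>t q - t p\<bar>)" by simp
    then show ?thesis using d by (simp add: field_simps)
  qed
  with r c show ?thesis by blast
qed

text \<open>In the coordinates \<open>(s, t)\<close> two points are joined by a horizontal and a vertical segment, and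
  on both of them the increment of \<open>W = s + \<i> Lam t\<close> is controlled by its real or imaginary part.\<close>

lemma primitive_increment:
  fixes s t :: "real \<times> real \<Rightarrow> real" and F k :: "real \<times> real \<Rightarrow> complex" and lam Lam :: "real \<Rightarrow> real"
  assumes "open S" "p0 \<in> S"
    and ds: "\<And>p. p \<in> S \<Longrightarrow> (s has_derivative dform (sx p) (sy p)) (at p)"
    and dt: "\<And>p. p \<in> S \<Longrightarrow> (t has_derivative dform (tx p) (ty p)) (at p)"
    and cont: "continuous_on S sx" "continuous_on S sy" "continuous_on S tx" "continuous_on S ty"
    and det: "\<And>p. p \<in> S \<Longrightarrow> sx p * ty p - sy p * tx p \<noteq> 0"
    and Lam: "\<And>x. (Lam has_real_derivative lam x) (at x)" "\<And>x. lam x \<ge> 0"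
    and F: "\<And>p. p \<in> S \<Longrightarrow> (F has_derivative
       (\<lambda>h. k p * (of_real (dform (sx p) (sy p) h) + \<i> * of_real (lam (t p) * dform (tx p) (ty p) h)))) (at p)"
    and k: "continuous (at p0) k"
    and e: "e > 0"
  shows "\<exists>r>0. \<forall>p\<in>ball p0 r. \<forall>q\<in>ball p0 r.
     norm (F q - F p - k p0 * (Complex (s q) (Lam (t q)) - Complex (s p) (Lam (t p))))
       \<le> e * norm (Complex (s q) (Lam (t q)) - Complex (s p) (Lam (t p)))"
proof -
  have cont_at: "continuous (at p) sx" "continuous (at p) sy" "continuous (at p) tx" "continuous (at p) ty"
    if "p \<in> S" for p
    using cont that \<open>open S\<close> by (auto simp: continuous_on_eq_continuous_at)
  obtain r1 c where r1: "r1 > 0" "c > 0" "ball p0 r1 \<subseteq> S"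
    and lb: "\<And>p q. p \<in> ball p0 r1 \<Longrightarrow> q \<in> ball p0 r1 \<Longrightarrow>
       norm (q - p) \<le> c * (\<bar>s q - s p\<bar> + \<bar>t q - t p\<bar>)"
    using coords_lower_bound[OF assms(1,2) ds dt cont_at[OF assms(2)] det[OF assms(2)]] by blast
  obtain r2 where r2: "r2 > 0" "\<And>p. dist p p0 < r2 \<Longrightarrow> dist (k p) (k p0) < e/2"
    using k e unfolding continuous_at_eps_delta by (meson half_gt_zero)
  define r where "r = min r1 r2"
  define V where "V = ball p0 r"
  have r: "r > 0" "V \<subseteq> S" "V \<subseteq> ball p0 r1" using r1 r2 by (auto simp: r_def V_def)
  have p0V: "p0 \<in> V" using r by (simp add: V_def)
  define \<Phi> where "\<Phi> = (\<lambda>p. (s p, t p))"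
  have d\<Phi>: "(\<Phi> has_derivative (\<lambda>h. (dform (sx p) (sy p) h, dform (tx p) (ty p) h))) (at p)" if "p \<in> V" for p
  proof -
    have "p \<in> S" using that r by blast
    then show ?thesis unfolding \<Phi>_def by (intro has_derivative_Pair ds dt)
  qed
  have c\<Phi>: "continuous_on V \<Phi>"
    using d\<Phi> by (meson continuous_at_imp_continuous_on has_derivative_continuous)
  have inj: "inj_on \<Phi> V"
  proof (rule inj_onI)
    fix p q assume "p \<in> V" "q \<in> V" "\<Phi> p = \<Phi> q"
    moreover from this have "p \<in> ball p0 r1" "q \<in> ball p0 r1" using r by blast+
    ultimately show "p = q" using lb[of p q] by (simp add: \<Phi>_def)
  qed
  define \<Psi> where "\<Psi> = inv_into V \<Phi>"
  have \<Psi>\<Phi>: "\<Psi> (\<Phi> p) = p" if "p \<in> V" for p using inj that by (simp add: \<Psi>_def)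
  have \<Phi>\<Psi>: "\<Phi> (\<Psi> z) = z" "\<Psi> z \<in> V" if "z \<in> \<Phi> ` V" for z
    using that by (auto simp: \<Psi>_def f_inv_into_f inv_into_into)
  have d\<Psi>: "(\<Psi> has_derivative (\<lambda>h. ((fst h * ty p - snd h * sy p) / (sx p * ty p - sy p * tx p),
                                     (snd h * sx p - fst h * tx p) / (sx p * ty p - sy p * tx p)))) (at (\<Phi> p))"
    if "p \<in> V" for p
  proof (rule has_derivative_inverse_strong[OF _ that c\<Phi> \<Psi>\<Phi> d\<Phi>[OF that]])
    have "sx p * ty p - sy p * tx p \<noteq> 0" using det that r by blast
    then show "(\<lambda>h. (dform (sx p) (sy p) h, dform (tx p) (ty p) h)) \<circ>
       (\<lambda>h. ((fst h * ty p - snd h * sy p) / (sx p * ty p - sy p * tx p),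
             (snd h * sx p - fst h * tx p) / (sx p * ty p - sy p * tx p))) = id"
      by (auto simp: fun_eq_iff dform_def divide_simps) (auto simp: algebra_simps)
  qed (auto simp: V_def)
  have "open (\<Phi> ` V)"
    by (rule invariance_of_domain_gen[OF _ c\<Phi> inj]) (auto simp: V_def)
  then obtain \<rho> where \<rho>: "\<rho> > 0" "ball (\<Phi> p0) \<rho> \<subseteq> \<Phi> ` V"
    using p0V open_contains_ball by (metis imageI)
  \<comment> \<open>A product box in the coordinate plane, so that the corner
    \<open>(s q, t p)\<close> and both legs of the path between two of its points stay inside the
    image of \<open>V\<close>.\<close>
  define B where "B = ball (s p0) (\<rho>/2) \<times> ball (t p0) (\<rho>/2)"
  have B: "B \<subseteq> \<Phi> ` V"
  proof
    fix z assume "z \<in> B"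
    then have "dist (s p0) (fst z) < \<rho>/2" "dist (t p0) (snd z) < \<rho>/2" by (auto simp: B_def)
    moreover have "dist (\<Phi> p0) z \<le> dist (s p0) (fst z) + dist (t p0) (snd z)"
      using sqrt_sum_squares_le_sum[of "dist (s p0) (fst z)" "dist (t p0) (snd z)"]
      by (simp add: \<Phi>_def dist_prod_def)
    ultimately have "z \<in> ball (\<Phi> p0) \<rho>" by simp
    then show "z \<in> \<Phi> ` V" using \<rho> by blast
  qed
  define G where "G = F \<circ> \<Psi>"
  have dG: "(G has_derivative (\<lambda>h. k (\<Psi> z) * (of_real (fst h) + \<i> * of_real (lam (snd z) * snd h)))) (at z)"
    if "z \<in> B" for z
  proof -
    define p where "p = \<Psi> z"
    have "z \<in> \<Phi> ` V" using that B by blast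
    then have p: "p \<in> V" "z = \<Phi> p" using \<Phi>\<Psi>[of z] unfolding p_def by simp_all
    have dt: "sx p * ty p - sy p * tx p \<noteq> 0" using det p r by blast
    have tp: "t p = snd z" by (simp add: p(2) \<Phi>_def)
    have "(G has_derivative (\<lambda>h. k p * (of_real (dform (sx p) (sy p) h) + \<i> * of_real (lam (t p) * dform (tx p) (ty p) h)))
        \<circ> (\<lambda>h. ((fst h * ty p - snd h * sy p) / (sx p * ty p - sy p * tx p),
                                     (snd h * sx p - fst h * tx p) / (sx p * ty p - sy p * tx p)))) (at z)"
      unfolding G_def using F[of p] p r \<Psi>\<Phi> d\<Psi>[OF p(1)]
      by (intro diff_chain_at) (auto simp: subset_iff)
    moreover have "dform (sx p) (sy p) ((fst h * ty p - snd h * sy p) / (sx p * ty p - sy p * tx p),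
                                     (snd h * sx p - fst h * tx p) / (sx p * ty p - sy p * tx p)) = fst h" 
      "dform (tx p) (ty p) ((fst h * ty p - snd h * sy p) / (sx p * ty p - sy p * tx p),
                                     (snd h * sx p - fst h * tx p) / (sx p * ty p - sy p * tx p)) = snd h" for h
      using dt by (auto simp: dform_def divide_simps) (auto simp: algebra_simps)
    ultimately show ?thesis
      unfolding comp_def by (simp only: tp flip: p_def)
  qed
  have kb: "norm (k (\<Psi> z) - k p0) \<le> e/2" if "z \<in> B" for z
    using that B \<Phi>\<Psi>(2)[of z] r2(2)[of "\<Psi> z"]
    by (force simp: V_def r_def dist_norm norm_minus_commute)
  have "\<exists>r'>0. ball p0 r' \<subseteq> V \<and> \<Phi> ` ball p0 r' \<subseteq> B"
  proof -
    have "open (V \<inter> \<Phi> -` B)"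
      using c\<Phi> by (intro continuous_open_preimage) (auto simp: V_def B_def intro!: open_Times)
    moreover have "p0 \<in> V \<inter> \<Phi> -` B" using p0V \<rho> by (auto simp: B_def \<Phi>_def)
    ultimately obtain r' where "r' > 0" "ball p0 r' \<subseteq> V \<inter> \<Phi> -` B"
      using open_contains_ball by metis
    then show ?thesis by (intro exI[of _ r']) auto
  qed
  then obtain r' where r': "r' > 0" "ball p0 r' \<subseteq> V" "\<Phi> ` ball p0 r' \<subseteq> B" by blast
  show ?thesis
  proof (intro exI[of _ r'] conjI ballI r')
    fix p q assume pq: "p \<in> ball p0 r'" "q \<in> ball p0 r'"
    have pB: "(s p, t p) \<in> B" "(s q, t q) \<in> B" using r'(3) pq by (auto simp: \<Phi>_def)
    have Fp: "F p = G (s p, t p)" "F q = G (s q, t q)"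
      using \<Psi>\<Phi>[of p] \<Psi>\<Phi>[of q] pq r'(2) by (auto simp: G_def \<Phi>_def subset_iff)
    have hor: "(x, t p) \<in> B" if "x \<in> closed_segment (s p) (s q)" for x
      using that pB convex_ball[of "s p0" "\<rho>/2"] unfolding B_def
      by (metis closed_segment_subset mem_Sigma_iff subsetD)
    have ver: "(s q, y) \<in> B" if "y \<in> closed_segment (t p) (t q)" for y
      using that pB convex_ball[of "t p0" "\<rho>/2"] unfolding B_def
      by (metis closed_segment_subset mem_Sigma_iff subsetD)
    have 1: "norm ((G (s q, t p) - k p0 * of_real (s q)) - (G (s p, t p) - k p0 * of_real (s p)))
       \<le> \<bar>e/2 * s q - e/2 * s p\<bar>"
    proof (rule vector_derivative_bound_le)
      fix x assume x: "x \<in> closed_segment (s p) (s q)"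
      have "((\<lambda>x. G (x, t p)) has_vector_derivative k (\<Psi> (x, t p))) (at x)"
        using has_derivative_has_vector_derivative_line[where \<gamma> = "\<lambda>x. (x, t p)", OF dG[OF hor[OF x]], of "(1, 0)"]
        by (simp add: has_vector_derivative_Pair)
      then show "((\<lambda>x. G (x, t p) - k p0 * of_real x) has_vector_derivative k (\<Psi> (x, t p)) - k p0) (at x)"
        by (auto intro!: derivative_eq_intros)
      show "((\<lambda>x. e/2 * x) has_real_derivative e/2) (at x)"
        by (auto intro!: derivative_eq_intros)
      show "norm (k (\<Psi> (x, t p)) - k p0) \<le> e/2" using kb hor x by blast
    qed
    \<comment> \<open>On the vertical leg the speed is at most \<open>e/2 * lam y\<close>, whose
      primitive is \<open>e/2 * Lam\<close>; since \<open>lam\<close> is nonnegative, the bound adds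
      up to the increment of \<open>Lam\<close> alone.\<close>
    have 2: "norm ((G (s q, t q) - k p0 * (\<i> * of_real (Lam (t q)))) - (G (s q, t p) - k p0 * (\<i> * of_real (Lam (t p)))))
       \<le> \<bar>e/2 * Lam (t q) - e/2 * Lam (t p)\<bar>"
    proof (rule vector_derivative_bound_le)
      fix y assume y: "y \<in> closed_segment (t p) (t q)"
      have "((\<lambda>y. G (s q, y)) has_vector_derivative k (\<Psi> (s q, y)) * (\<i> * of_real (lam y))) (at y)"
        using has_derivative_has_vector_derivative_line[where \<gamma> = "\<lambda>y. (s q, y)", OF dG[OF ver[OF y]], of "(0, 1)"]
        by (simp add: has_vector_derivative_Pair)
      then show "((\<lambda>y. G (s q, y) - k p0 * (\<i> * of_real (Lam y))) has_vector_derivative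
         (k (\<Psi> (s q, y)) - k p0) * (\<i> * of_real (lam y))) (at y)"
        using Lam(1)[of y]
        by (auto intro!: derivative_eq_intros has_vector_derivative_of_real simp: has_real_derivative_iff_has_vector_derivative algebra_simps)
      show "((\<lambda>y. e/2 * Lam y) has_real_derivative e/2 * lam y) (at y)"
        using Lam(1)[of y] by (auto intro!: derivative_eq_intros)
      show "norm ((k (\<Psi> (s q, y)) - k p0) * (\<i> * of_real (lam y))) \<le> e/2 * lam y"
        using mult_right_mono[OF kb[OF ver[OF y]] Lam(2)[of y]] Lam(2)[of y] by (simp add: norm_mult)
    qed
    define D where "D = Complex (s q) (Lam (t q)) - Complex (s p) (Lam (t p))"
    have D: "\<bar>s q - s p\<bar> \<le> norm D" "\<bar>Lam (t q) - Lam (t p)\<bar> \<le> norm D"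
      using abs_Re_le_cmod[of D] abs_Im_le_cmod[of D] by (auto simp: D_def)
    have eq: "F q - F p - k p0 * D = 
       ((G (s q, t p) - k p0 * of_real (s q)) - (G (s p, t p) - k p0 * of_real (s p))) +
       ((G (s q, t q) - k p0 * (\<i> * of_real (Lam (t q)))) - (G (s q, t p) - k p0 * (\<i> * of_real (Lam (t p)))))"
      by (simp add: Fp D_def Complex_eq algebra_simps)
    have "norm (F q - F p - k p0 * D) \<le> \<bar>e/2 * s q - e/2 * s p\<bar> + \<bar>e/2 * Lam (t q) - e/2 * Lam (t p)\<bar>"
      unfolding eq by (rule order_trans[OF norm_triangle_ineq add_mono[OF 1 2]])
    also have "\<dots> = e/2 * \<bar>s q - s p\<bar> + e/2 * \<bar>Lam (t q) - Lam (t p)\<bar>"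
      unfolding right_diff_distrib[symmetric] abs_mult using e by simp
    also have "\<dots> \<le> e/2 * norm D + e/2 * norm D"
      using D e by (intro add_mono mult_left_mono) auto
    finally show "norm (F q - F p - k p0 * (Complex (s q) (Lam (t q)) - Complex (s p) (Lam (t p))))
       \<le> e * norm (Complex (s q) (Lam (t q)) - Complex (s p) (Lam (t p)))"
      by (simp add: D_def)
  qed
qed

subsection \<open>Global injectivity of the first integral\<close>

text \<open>The sizes attached to a finite subcover are replaced by their minimum, which
  \<open>anti\<close> permits. It serves for injectivity radii, for radii of covered discs and,
  through reciprocals, for upper bounds.\<close>

lemma uniform_on_compact:
  fixes K :: "'a::metric_space set" and P :: "'a \<Rightarrow> real \<Rightarrow> bool"
  assumes "compact K"
    and loc: "\<And>p0. p0 \<in> K \<Longrightarrow> \<exists>\<eta>>0. \<exists>\<delta>>0. \<forall>p\<in>ball p0 \<eta>. P p \<delta>"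
    and anti: "\<And>p \<delta> \<delta>'. P p \<delta> \<Longrightarrow> 0 < \<delta>' \<Longrightarrow> \<delta>' \<le> \<delta> \<Longrightarrow> P p \<delta>'"
  shows "\<exists>\<delta>>0. \<forall>p\<in>K. P p \<delta>"
proof (cases "K = {}")
  case False
  obtain \<eta> \<delta> where \<eta>: "\<And>p0. p0 \<in> K \<Longrightarrow> \<eta> p0 > 0" and \<delta>: "\<And>p0. p0 \<in> K \<Longrightarrow> \<delta> p0 > 0"
    and P: "\<And>p0 p. p0 \<in> K \<Longrightarrow> p \<in> ball p0 (\<eta> p0) \<Longrightarrow> P p (\<delta> p0)"
    using loc by metis
  have "K \<subseteq> (\<Union>p\<in>K. ball p (\<eta> p))" using \<eta> by force
  then obtain C where C: "C \<subseteq> K" "finite C" "K \<subseteq> (\<Union>p\<in>C. ball p (\<eta> p))"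
    using compactE_image[OF \<open>compact K\<close>, of K "\<lambda>p. ball p (\<eta> p)"] by auto
  have "C \<noteq> {}" using C(3) False by auto
  define d where "d = Min (\<delta> ` C)"
  have "d > 0" unfolding d_def using C \<delta> \<open>C \<noteq> {}\<close> by (subst Min_gr_iff) auto
  moreover have "P p d" if p: "p \<in> K" for p
  proof -
    obtain p0 where p0: "p0 \<in> C" "p \<in> ball p0 (\<eta> p0)" using C(3) p by blast
    have "d \<le> \<delta> p0" unfolding d_def using C p0 by (intro Min_le) auto
    then show ?thesis using anti[OF P[of p0 p]] p0 C \<open>d > 0\<close> by blast
  qed
  ultimately show ?thesis by blast
qed (auto intro: exI[of _ 1])

text \<open>A local homeomorphism whose local inverses have a uniform size is a covering map, and a
  covering map onto a simply connected space is injective.\<close>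

lemma bij_if_uniformly_locally_injective:
  fixes Z :: "'a::euclidean_space \<Rightarrow> 'b::euclidean_space"
  assumes dim: "DIM('b) = DIM('a)" and cont: "continuous_on UNIV Z" and r: "r > 0" and \<delta>: "\<delta> > 0"
    and inj: "\<And>p. inj_on Z (ball p (4 * r))"
    and cover: "\<And>p. ball (Z p) \<delta> \<subseteq> Z ` ball p r"
  shows "bij Z"
proof -
  have surj: "surj Z"
  proof -
    have "open (range Z)"
      unfolding open_contains_ball using cover \<delta> by (metis image_mono rangeE subset_UNIV subset_trans)
    moreover have "closed (range Z)"
      unfolding closed_def open_contains_ball
    proof (intro ballI exI[of _ \<delta>] conjI \<delta>)
      fix y assume y: "y \<in> - range Z"
      show "ball y \<delta> \<subseteq> - range Z"
      proof
        fix w assume w: "w \<in> ball y \<delta>"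
        show "w \<in> - range Z"
        proof
          assume "w \<in> range Z"
          then obtain p where "w = Z p" by blast
          then have "y \<in> ball (Z p) \<delta>" using w by (simp add: dist_commute)
          then show False using cover y by blast
        qed
      qed
    qed
    ultimately show ?thesis using clopen[of "range Z"] by auto
  qed
  have cov: "covering_space UNIV Z UNIV"
    unfolding covering_space_def
  proof (intro conjI ballI surj cont)
    fix y :: 'b
    define T where "T = ball y \<delta>"
    \<comment> \<open>The sheets: pieces of balls of radius \<open>r\<close> around the points of
      the fibre. If two of them meet at \<open>p\<close>, both centres lie in the ball of radius
      \<open>4 * r\<close> around \<open>p\<close> and coincide by injectivity.\<close>
    define v where "v = (\<lambda>x. ball x r \<inter> Z -` T) ` {x. Z x = y}"
    have contb: "continuous_on S Z" for S using cont continuous_on_subset by blast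
    have oT: "open (ball x r \<inter> Z -` T)" for x
      using contb by (intro continuous_open_preimage) (auto simp: T_def)
    show "\<exists>T. y \<in> T \<and> openin (top_of_set UNIV) T \<and> (\<exists>v. \<Union>v = UNIV \<inter> Z -` T \<and>
       (\<forall>u\<in>v. openin (top_of_set UNIV) u) \<and> pairwise disjnt v \<and> (\<forall>u\<in>v. \<exists>q. homeomorphism u T Z q))"
    proof (intro exI[of _ T] exI[of _ v] conjI ballI)
      show "y \<in> T" "openin (top_of_set UNIV) T" using \<delta> by (auto simp: T_def)
      show "\<Union>v = UNIV \<inter> Z -` T"
      proof -
        have "\<exists>x. Z x = y \<and> p \<in> ball x r" if "Z p \<in> T" for p
        proof -
          have "y \<in> ball (Z p) \<delta>" using that by (simp add: T_def dist_commute)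
          then obtain x where "x \<in> ball p r" "Z x = y" using cover[of p] by auto
          then show ?thesis by (auto simp: dist_commute)
        qed
        then show ?thesis by (auto simp: v_def)
      qed
      show "openin (top_of_set UNIV) u" if "u \<in> v" for u using that oT by (auto simp: v_def)
      show "pairwise disjnt v"
      proof (rule pairwiseI)
        fix u1 u2 assume u: "u1 \<in> v" "u2 \<in> v" "u1 \<noteq> u2"
        then obtain x1 x2 where x: "u1 = ball x1 r \<inter> Z -` T" "u2 = ball x2 r \<inter> Z -` T" "Z x1 = y" "Z x2 = y"
          by (auto simp: v_def)
        show "disjnt u1 u2"
        proof (rule ccontr)
          assume "\<not> disjnt u1 u2"
          then obtain p where p: "dist x1 p < r" "dist x2 p < r" by (auto simp: disjnt_def x)
          then have "x1 \<in> ball p (4 * r)" "x2 \<in> ball p (4 * r)" using r by (auto simp: dist_commute)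
          then have "x1 = x2" using inj x(3,4) by (metis inj_onD)
          then show False using u x by simp
        qed
      qed
      show "\<exists>q. homeomorphism u T Z q" if uv: "u \<in> v" for u
      proof -
        obtain x where x: "u = ball x r \<inter> Z -` T" "Z x = y" using uv by (auto simp: v_def)
        have "ball x r \<subseteq> ball x (4 * r)" using r by auto
        then have "inj_on Z u" using inj[of x] x by (meson Int_lower1 inj_on_subset subset_trans)
        moreover have "Z ` u = T" using cover[of x] x by (auto simp: T_def)
        ultimately show ?thesis
          using invariance_of_domain_homeomorphism[of u Z] oT[of x] contb[of u] x dim by (metis order_refl)
      qed
    qed
  qed
  have "simply_connected (UNIV :: 'b set)" by (simp add: convex_imp_simply_connected)
  moreover have "locally path_connected (UNIV :: 'b set)" by (simp add: convex_imp_locally_path_connected)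
  moreover have "continuous_on UNIV (\<lambda>y::'b. y)" by simp
  \<comment> \<open>Lifting the identity gives a section \<open>g\<close> of \<open>Z\<close>. Then
    \<open>g (Z x)\<close> and \<open>x\<close> are two lifts of \<open>Z\<close> that agree at 0,
    hence everywhere.\<close>
  ultimately obtain g where g: "continuous_on UNIV g" "g (Z 0) = 0" "\<And>y. Z (g y) = y"
    using covering_space_lift_strong[OF cov, of 0 "Z 0" UNIV "\<lambda>y. y"] by auto
  have "g (Z x) = x" for x
    using covering_space_lift_unique[OF cov, of "\<lambda>x. g (Z x)" 0 "\<lambda>x. x" UNIV Z x] g cont
    by (auto intro: continuous_on_compose2)
  then show "bij Z" using surj by (metis bijI injI)
qed

lemma lattice_representative:
  fixes p :: "real \<times> real"
  obtains m n :: int and p' where "p = p' + (of_int m, of_int n)" "p' \<in> cbox (0, 0) (1, 1)"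
proof (rule that[of "(frac (fst p), frac (snd p))" "\<lfloor>fst p\<rfloor>" "\<lfloor>snd p\<rfloor>"])
  show "p = (frac (fst p), frac (snd p)) + (real_of_int \<lfloor>fst p\<rfloor>, real_of_int \<lfloor>snd p\<rfloor>)"
    by (simp add: frac_def prod_eq_iff)
  show "(frac (fst p), frac (snd p)) \<in> cbox (0, 0) (1, 1)"
    by (simp add: cbox_Pair_eq frac_ge_0 frac_lt_1 less_imp_le)
qed

text \<open>A lattice translation of the plane acts on the values of \<open>Z\<close> as a
  translation, so injectivity radii and sizes of covered discs found on the compact unit square hold
  at every point.\<close>

lemma bij_if_quasiperiodic_locally_injective:
  fixes Z :: "real \<times> real \<Rightarrow> complex"
  assumes cont: "continuous_on UNIV Z"
    and per: "\<And>p (m::int) (n::int). Z (p + (of_int m, of_int n)) = Z p + of_int m + of_int n * \<tau>"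
    and loc: "\<And>p. \<exists>\<rho>>0. inj_on Z (ball p \<rho>)"
  shows "bij Z"
proof -
  have tr: "ball (p + v) \<rho> = (\<lambda>x. x + v) ` ball p \<rho>" for p v :: "real \<times> real" and \<rho>
    using ball_translation[of v p \<rho>] by (simp add: add.commute)
  have "\<exists>R>0. \<forall>p\<in>cbox (0, 0) (1, 1). inj_on Z (ball p R)"
  proof (rule uniform_on_compact[OF compact_cbox])
    fix p0 :: "real \<times> real"
    obtain \<rho> where \<rho>: "\<rho> > 0" "inj_on Z (ball p0 \<rho>)" using loc by blast
    have "inj_on Z (ball p (\<rho>/2))" if p: "p \<in> ball p0 (\<rho>/2)" for p
    proof -
      have "dist p0 q < \<rho>" if "dist p q < \<rho>/2" for q
        using p that dist_triangle[of p0 q p] by simp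
      then have "ball p (\<rho>/2) \<subseteq> ball p0 \<rho>" by auto
      then show ?thesis using \<rho> inj_on_subset by blast
    qed
    then show "\<exists>\<eta>>0. \<exists>\<delta>>0. \<forall>p\<in>ball p0 \<eta>. inj_on Z (ball p \<delta>)" using \<rho> half_gt_zero by blast
  qed (meson inj_on_subset subset_ball)
  then obtain R where R: "R > 0" and R0: "\<And>p. p \<in> cbox (0, 0) (1, 1) \<Longrightarrow> inj_on Z (ball p R)" by blast
  have injR: "inj_on Z (ball p R)" for p
  proof -
    obtain m n p' where p: "p = p' + (of_int m, of_int n)" "p' \<in> cbox (0, 0) (1, 1)"
      by (rule lattice_representative)
    show ?thesis using R0[OF p(2)] by (auto simp: p(1) tr inj_on_def per)
  qed
  \<comment> \<open>Matches the factor 4 in the injectivity hypothesis of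
    \<open>bij_if_uniformly_locally_injective\<close>.\<close>
  define r where "r = R/4"
  have r: "r > 0" using R by (simp add: r_def)
  have sub: "ball p s \<subseteq> ball p R" if "s \<le> R" for p :: "real \<times> real" and s using that by auto
  have "\<exists>\<delta>>0. \<forall>p\<in>cbox (0, 0) (1, 1). ball (Z p) \<delta> \<subseteq> Z ` ball p r"
  proof (rule uniform_on_compact[OF compact_cbox])
    fix p0 :: "real \<times> real"
    have "open (Z ` ball p0 (r/2))"
    proof (rule invariance_of_domain_gen)
      show "continuous_on (ball p0 (r/2)) Z" using cont continuous_on_subset by blast
      show "inj_on Z (ball p0 (r/2))" by (rule inj_on_subset[OF injR sub]) (use R in \<open>simp add: r_def\<close>)
    qed auto
    then obtain e where e: "e > 0" "ball (Z p0) e \<subseteq> Z ` ball p0 (r/2)"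
      using r open_contains_ball by (metis centre_in_ball half_gt_zero imageI)
    have "continuous (at p0) Z" using cont by (simp add: continuous_on_eq_continuous_at)
    then obtain d where d: "d > 0" "\<And>p. dist p p0 < d \<Longrightarrow> dist (Z p) (Z p0) < e/2"
      using e(1) unfolding continuous_at_eps_delta by (meson half_gt_zero)
    \<comment> \<open>Half of \<open>e\<close> pays for moving the centre from \<open>Z p0\<close>
      to \<open>Z p\<close>, half of \<open>r\<close> for moving the ball of preimages from
      \<open>p0\<close> to \<open>p\<close>.\<close>
    have "ball (Z p) (e/2) \<subseteq> Z ` ball p r" if p: "p \<in> ball p0 (min d (r/2))" for p
    proof -
      have 1: "dist (Z p0) w < e" if "dist (Z p) w < e/2" for w
        using d(2)[of p] p that dist_triangle[of "Z p0" w "Z p"] by (auto simp: dist_commute)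
      have 2: "dist p q < r" if "dist p0 q < r/2" for q
        using p that dist_triangle[of p q p0] by (auto simp: dist_commute)
      have "ball (Z p) (e/2) \<subseteq> ball (Z p0) e" using 1 by auto
      also have "\<dots> \<subseteq> Z ` ball p0 (r/2)" by (rule e(2))
      also have "\<dots> \<subseteq> Z ` ball p r" using 2 by auto
      finally show ?thesis .
    qed
    then show "\<exists>\<eta>>0. \<exists>\<delta>>0. \<forall>p\<in>ball p0 \<eta>. ball (Z p) \<delta> \<subseteq> Z ` ball p r"
      using d r e by (intro exI[of _ "min d (r/2)"] conjI exI[of _ "e/2"]) auto
  qed (meson subset_ball subset_trans)
  then obtain \<delta> where \<delta>: "\<delta> > 0"
    and \<delta>0: "\<And>p. p \<in> cbox (0, 0) (1, 1) \<Longrightarrow> ball (Z p) \<delta> \<subseteq> Z ` ball p r" by blast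
  show ?thesis
  proof (rule bij_if_uniformly_locally_injective[OF _ cont r \<delta>])
    fix p
    show "inj_on Z (ball p (4 * r))" using injR by (simp add: r_def)
    obtain m n p' where p: "p = p' + (of_int m, of_int n)" "p' \<in> cbox (0, 0) (1, 1)"
      by (rule lattice_representative)
    have "ball (Z p) \<delta> = (\<lambda>w. w + (of_int m + of_int n * \<tau>)) ` ball (Z p') \<delta>"
      using ball_translation[of "of_int m + of_int n * \<tau>" "Z p'" \<delta>] by (simp add: p(1) per add_ac)
    also have "\<dots> \<subseteq> (\<lambda>w. w + (of_int m + of_int n * \<tau>)) ` (Z ` ball p' r)"
      using \<delta>0[OF p(2)] by (rule image_mono)
    also have "\<dots> = Z ` ball p r" by (simp add: p(1) tr image_image per add_ac)
    finally show "ball (Z p) \<delta> \<subseteq> Z ` ball p r" .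
  qed auto
qed

subsection \<open>Contour integrals over rectangles\<close>

definition side_x :: "(real \<times> real \<Rightarrow> complex) \<Rightarrow> real \<Rightarrow> real \<Rightarrow> real \<Rightarrow> complex"
  where "side_x f x0 x1 y = integral {x0..x1} (\<lambda>x. f (x, y))"

definition side_y :: "(real \<times> real \<Rightarrow> complex) \<Rightarrow> real \<Rightarrow> real \<Rightarrow> real \<Rightarrow> complex"
  where "side_y f x y0 y1 = integral {y0..y1} (\<lambda>y. f (x, y))"

text \<open>The integral of f dx + g dy over the counterclockwise boundary. Being made of four
  one-dimensional integrals, it makes sense for continuous coefficients, so closed forms are
  recognised without differentiating them.\<close>

definition rect_integral ::
    "(real \<times> real \<Rightarrow> complex) \<Rightarrow> (real \<times> real \<Rightarrow> complex) \<Rightarrow> real \<Rightarrow> real \<Rightarrow> real \<Rightarrow> real \<Rightarrow> complex"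
  where "rect_integral f g x0 x1 y0 y1 =
    side_x f x0 x1 y0 + side_y g x1 y0 y1 - side_x f x0 x1 y1 - side_y g x0 y0 y1"

lemma continuous_on_slice_x:
  "continuous_on S f \<Longrightarrow> (\<And>x. x \<in> T \<Longrightarrow> (x, y) \<in> S) \<Longrightarrow> continuous_on T (\<lambda>x. f (x, y))"
  by (rule continuous_on_compose2[where f = "\<lambda>x. (x, y)"]) (auto intro!: continuous_intros)

lemma continuous_on_slice_y:
  "continuous_on S f \<Longrightarrow> (\<And>y. y \<in> T \<Longrightarrow> (x, y) \<in> S) \<Longrightarrow> continuous_on T (\<lambda>y. f (x, y))"
  by (rule continuous_on_compose2[where f = "\<lambda>y. (x, y)"]) (auto intro!: continuous_intros)

text \<open>Closed forms on a rectangle are exact: both L-shaped paths from the corner give the primitive,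
  and each of them differentiates trivially in one variable.\<close>

lemma rect_integral_zero_imp_primitive:
  fixes f g :: "real \<times> real \<Rightarrow> complex"
  assumes f: "continuous_on (cbox (a1, a2) (b1, b2)) f" and g: "continuous_on (cbox (a1, a2) (b1, b2)) g"
    and zero: "\<And>x0 x1 y0 y1. a1 \<le> x0 \<Longrightarrow> x0 \<le> x1 \<Longrightarrow> x1 \<le> b1 \<Longrightarrow> a2 \<le> y0 \<Longrightarrow> y0 \<le> y1 \<Longrightarrow> y1 \<le> b2 \<Longrightarrow>
       rect_integral f g x0 x1 y0 y1 = 0"
  shows "\<exists>F. \<forall>p\<in>box (a1, a2) (b1, b2). (F has_derivative dform (f p) (g p)) (at p)"
proof -
  define F where "F = (\<lambda>x y. side_x f a1 x a2 + side_y g x a2 y)"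
  have F2: "F x y = side_y g a1 a2 y + side_x f a1 x y" if "x \<in> {a1..b1}" "y \<in> {a2..b2}" for x y
    using zero[of a1 x a2 y] that by (simp add: F_def rect_integral_def algebra_simps)
  have Fx: "((\<lambda>x. F x y) has_derivative (\<lambda>h. h *\<^sub>R f (x, y))) (at x within {a1<..<b1})"
    if "x \<in> {a1<..<b1}" "y \<in> {a2<..<b2}" for x y
  proof -
    have "continuous_on {a1..b1} (\<lambda>x. f (x, y))"
      by (rule continuous_on_slice_x[OF f]) (use that in auto)
    then have "((\<lambda>x. side_x f a1 x y) has_vector_derivative f (x, y)) (at x within {a1..b1})"
      unfolding side_x_def using integral_has_vector_derivative that by fastforce
    then have "((\<lambda>x. side_y g a1 a2 y + side_x f a1 x y) has_vector_derivative f (x, y)) (at x within {a1..b1})"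
      by (auto intro!: derivative_eq_intros)
    then have "((\<lambda>x. F x y) has_vector_derivative f (x, y)) (at x within {a1..b1})"
      by (rule has_vector_derivative_transform[rotated 2]) (use F2 that in auto)
    then show ?thesis
      by (auto simp: has_vector_derivative_def intro: has_derivative_subset)
  qed
  have Fy: "((\<lambda>y. F x y) has_derivative blinfun_apply (blinfun_scaleR_left (g (x, y)))) (at y within {a2<..<b2})"
    if "x \<in> {a1<..<b1}" "y \<in> {a2<..<b2}" for x y
  proof -
    have "continuous_on {a2..b2} (\<lambda>y. g (x, y))"
      by (rule continuous_on_slice_y[OF g]) (use that in auto)
    then have "((\<lambda>y. side_y g x a2 y) has_vector_derivative g (x, y)) (at y within {a2..b2})"
      unfolding side_y_def using integral_has_vector_derivative that by fastforce
    then have "((\<lambda>y. F x y) has_vector_derivative g (x, y)) (at y within {a2..b2})"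
      unfolding F_def by (auto intro!: derivative_eq_intros)
    then show ?thesis
      by (auto simp: has_vector_derivative_def blinfun_scaleR_left.rep_eq intro: has_derivative_subset)
  qed
  have opn: "open ({a1<..<b1} \<times> {a2<..<b2})" by (intro open_Times) auto
  have bx: "box (a1, a2) (b1, b2) = {a1<..<b1} \<times> {a2<..<b2}"
    by (auto simp: mem_box Basis_prod_def)
  have "((\<lambda>(x, y). F x y) has_derivative dform (f p) (g p)) (at p)" if pb: "p \<in> box (a1, a2) (b1, b2)" for p
  proof -
    obtain x y where p: "p = (x, y)" "x \<in> {a1<..<b1}" "y \<in> {a2<..<b2}" using pb unfolding bx by (cases p) auto
    have sub: "{a1<..<b1} \<times> {a2<..<b2} \<subseteq> cbox (a1, a2) (b1, b2)" by (auto simp: cbox_Pair_eq)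
    \<comment> \<open>Both partial derivatives exist; continuity of the second one turns them into a
      total derivative.\<close>
    have "continuous_on ({a1<..<b1} \<times> {a2<..<b2}) (\<lambda>p. blinfun_scaleR_left (g p))"
      using continuous_on_subset[OF g sub] by (intro continuous_intros)
    then have "continuous (at (x, y) within {a1<..<b1} \<times> {a2<..<b2}) (\<lambda>(x, y). blinfun_scaleR_left (g (x, y)))"
      using p by (simp add: continuous_on_eq_continuous_within case_prod_unfold)
    then have "((\<lambda>(x, y). F x y) has_derivative (\<lambda>(tx, ty). tx *\<^sub>R f (x, y) + blinfun_scaleR_left (g (x, y)) ty))
        (at (x, y) within {a1<..<b1} \<times> {a2<..<b2})"
      using Fx Fy p by (intro has_derivative_partialsI) auto
    then have "((\<lambda>(x, y). F x y) has_derivative (\<lambda>(tx, ty). tx *\<^sub>R f (x, y) + ty *\<^sub>R g (x, y))) (at (x, y))"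
      using at_within_open[OF _ opn, of "(x, y)"] p by (simp add: blinfun_scaleR_left.rep_eq)
    then show ?thesis by (simp add: p dform_def[abs_def] case_prod_unfold)
  qed
  then show ?thesis by blast
qed

text \<open>The function \<open>h\<close> is an antiderivative of the pulled-back integrand along
  the path, not of \<open>f\<close> in the plane; it will be an indefinite integral of a continuous
  function.\<close>

lemma has_contour_integral_antiderivative:
  assumes g: "\<And>t. t \<in> {0..1} \<Longrightarrow> (g has_vector_derivative g' t) (at t)"
    and h: "\<And>t. t \<in> {0..1} \<Longrightarrow> (h has_vector_derivative f (g t) * g' t) (at t within {0..1})"
  shows "(f has_contour_integral (h 1 - h 0)) g"
  unfolding has_contour_integral_def
proof (rule has_integral_eq)
  show "((\<lambda>t. f (g t) * g' t) has_integral (h 1 - h 0)) {0..1}"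
    using h by (intro fundamental_theorem_of_calculus) auto
  show "f (g t) * g' t = f (g t) * vector_derivative g (at t within {0..1})" if "t \<in> {0..1}" for t
    using that vector_derivative_at_within_ivl[OF g] by auto
qed

definition pair_of :: "complex \<Rightarrow> real \<times> real"
  where "pair_of c = (Re c, Im c)"

lemma pair_of_simps [simp]: "pair_of (Complex x y) = (x, y)" "fst (pair_of c) = Re c" "snd (pair_of c) = Im c"
  by (auto simp: pair_of_def)

lemma continuous_on_pair_of [continuous_intros]:
  "continuous_on S f \<Longrightarrow> continuous_on S (\<lambda>x. pair_of (f x))"
  unfolding pair_of_def by (intro continuous_intros)

lemma bij_pair_of: "bij pair_of"
  by (rule bij_betw_byWitness[where f' = "\<lambda>p. Complex (fst p) (snd p)"]) (auto simp: pair_of_def)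

text \<open>The index \<open>n\<close> is the orientation of \<open>f\<close>; it must not depend on the rectangle.\<close>

lemma winding_number_homeomorphic_rectpath:
  fixes f :: "complex \<Rightarrow> complex" and N :: real
  assumes bij_f: "bij f" and cont: "continuous_on UNIV f"
  obtains n :: complex where "n \<noteq> 0"
    "\<And>x0 x1 y0 y1 c. x0 < x1 \<Longrightarrow> y0 < y1 \<Longrightarrow> x0 \<ge> - N \<Longrightarrow> x1 \<le> N \<Longrightarrow> y0 \<ge> - N \<Longrightarrow> y1 \<le> N \<Longrightarrow> c \<in> box (Complex x0 y0) (Complex x1 y1) \<Longrightarrow>
       winding_number (f \<circ> rectpath (Complex x0 y0) (Complex x1 y1)) (f c) = n"
    "\<And>x0 x1 y0 y1 c. x0 \<le> x1 \<Longrightarrow> y0 \<le> y1 \<Longrightarrow> c \<notin> cbox (Complex x0 y0) (Complex x1 y1) \<Longrightarrow>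
       winding_number (f \<circ> rectpath (Complex x0 y0) (Complex x1 y1)) (f c) = 0"
proof -
  have cont_f: "continuous_on S f" for S using cont continuous_on_subset by blast
  have f_eq_iff [simp]: "f c = f d \<longleftrightarrow> c = d" for c d using bij_f by (simp add: bij_is_inj inj_eq)
  \<comment> \<open>One large reference rectangle has every admissible \<open>c\<close> strictly
    inside. The smaller loops around \<open>c\<close> are homotopic to it in the complement of
    \<open>c\<close>, so all of them inherit its index. The added 1 also keeps it
    nondegenerate.\<close>
  define M where "M = \<bar>N\<bar> + 1"
  define P where "P = rectpath (Complex (-M) (-M)) (Complex M M)"
  have M: "M > 0" by (simp add: M_def)
  have img: "homotopic_loops (- {f c}) (f \<circ> p) (f \<circ> q)" if "homotopic_loops (- {c}) p q" for p q c
    using that by (rule homotopic_loops_continuous_image) (auto intro: cont_f)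
  have simple: "simple_path (f \<circ> P)"
    unfolding P_def using M bij_f
    by (intro simple_path_continuous_image simple_path_rectpath cont_f)
      (auto simp: inj_on_def)
  have ins: "f c \<in> inside (path_image (f \<circ> P))" if c: "c \<in> box (Complex (-M) (-M)) (Complex M M)" for c
  proof -
    let ?B = "cbox (Complex (-M) (-M)) (Complex M M)"
    have PI: "path_image (f \<circ> P) = f ` path_image P" by (simp add: path_image_compose)
    have fr: "path_image P = frontier ?B"
      unfolding P_def using M by (intro path_image_rectpath_cbox_minus_box[THEN trans]) (auto simp: frontier_cbox)
    have cP: "f c \<notin> path_image (f \<circ> P)"
      using c by (auto simp: PI fr frontier_cbox)
    \<comment> \<open>The component of \<open>f c\<close> cannot leave the image of the rectangle:
      its preimage under \<open>f\<close> is connected, contains \<open>c\<close> and misses the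
      frontier. So the component is bounded, and \<open>f c\<close> lies inside the curve.\<close>
    have "connected_component_set (- path_image (f \<circ> P)) (f c) \<subseteq> f ` ?B"
    proof
      fix w assume w: "w \<in> connected_component_set (- path_image (f \<circ> P)) (f c)"
      define C where "C = connected_component_set (- path_image (f \<circ> P)) (f c)"
      have "homeomorphism UNIV UNIV f (inv f)"
      proof -
        have "continuous_on (f ` UNIV) (inv f)"
          using bij_f by (intro continuous_on_inverse_open) (auto intro: cont_f simp: bij_is_inj)
        then show ?thesis using bij_f
          by (auto simp: homeomorphism_def cont_f bij_is_surj bij_is_inj surj_f_inv_f surj_imp_inj_inv inj_imp_surj_inv)
      qed
      then have cinv: "continuous_on C (inv f)"
        unfolding homeomorphism_def using continuous_on_subset by blast
      have "connected (inv f ` C)"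
        by (rule connected_continuous_image[OF cinv]) (simp add: C_def)
      moreover have "inv f ` C \<inter> frontier ?B = {}"
      proof -
        have "inv f x \<notin> path_image P" if "x \<in> C" for x
        proof
          assume "inv f x \<in> path_image P"
          then have "f (inv f x) \<in> path_image (f \<circ> P)" by (auto simp: PI)
          then have "x \<in> path_image (f \<circ> P)" using bij_f by (simp add: bij_is_surj surj_f_inv_f)
          then show False using that connected_component_subset[of "- path_image (f \<circ> P)" "f c"] by (auto simp: C_def)
        qed
        then show ?thesis by (auto simp: fr)
      qed
      moreover have "c \<in> inv f ` C \<inter> ?B"
      proof -
        have "f c \<in> C" using cP by (auto simp: C_def)
        moreover have "inv f (f c) = c" using bij_f by (simp add: bij_is_inj)
        ultimately show ?thesis using c box_subset_cbox by (metis IntI image_eqI subsetD)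
      qed
      ultimately have "inv f ` C \<subseteq> ?B" using connected_Int_frontier[of "inv f ` C" ?B] by blast
      then have "inv f w \<in> ?B" using w by (auto simp: C_def)
      moreover have "w = f (inv f w)" using bij_f by (simp add: bij_is_surj surj_f_inv_f)
      ultimately show "w \<in> f ` ?B" by blast
    qed
    moreover have "bounded (f ` ?B)"
      by (intro compact_imp_bounded compact_continuous_image cont_f compact_cbox)
    ultimately show ?thesis using cP by (auto simp: inside_def intro: bounded_subset)
  qed
  obtain n :: complex where n: "n \<noteq> 0" "\<And>z. z \<in> inside (path_image (f \<circ> P)) \<Longrightarrow> winding_number (f \<circ> P) z = n"
    using simple_closed_path_winding_number_inside[OF simple] by (metis one_neq_zero zero_neq_neg_one)
  show ?thesis
  proof (rule that[OF n(1)])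
    fix x0 x1 y0 y1 c
    assume *: "x0 < x1" "y0 < y1" "x0 \<ge> - N" "x1 \<le> N" "y0 \<ge> - N" "y1 \<le> N" and c: "c \<in> box (Complex x0 y0) (Complex x1 y1)"
    have cM: "c \<in> box (Complex (-M) (-M)) (Complex M M)"
      using * c by (auto simp: in_box_complex_iff M_def)
    \<comment> \<open>In the complement of a single point, loops with equal winding number are
      homotopic; \<open>f\<close> then carries the homotopy to the complement of
      \<open>f c\<close>.\<close>
    have "homotopic_loops (- {c}) (rectpath (Complex x0 y0) (Complex x1 y1)) P"
    proof (subst winding_number_homotopic_loops_eq[symmetric])
      show "c \<notin> path_image (rectpath (Complex x0 y0) (Complex x1 y1))"
        using c * by (auto simp: path_image_rectpath in_box_complex_iff)
      show "c \<notin> path_image P"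
        using cM M by (auto simp: path_image_rectpath in_box_complex_iff P_def)
      show "winding_number (rectpath (Complex x0 y0) (Complex x1 y1)) c = winding_number P c"
        unfolding P_def using c cM by (simp add: winding_number_rectpath)
    qed (auto simp: P_def)
    then have "winding_number (f \<circ> rectpath (Complex x0 y0) (Complex x1 y1)) (f c) = winding_number (f \<circ> P) (f c)"
      by (intro winding_number_homotopic_loops img)
    then show "winding_number (f \<circ> rectpath (Complex x0 y0) (Complex x1 y1)) (f c) = n"
      using n(2)[OF ins[OF cM]] by simp
  next
    fix x0 x1 y0 y1 c
    assume *: "x0 \<le> x1" "y0 \<le> y1" and c: "c \<notin> cbox (Complex x0 y0) (Complex x1 y1)"
    have nc: "c \<notin> path_image (rectpath (Complex x0 y0) (Complex x1 y1))"
      using c path_image_rectpath_subset_cbox[of "Complex x0 y0" "Complex x1 y1"] * by auto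
    have "winding_number (rectpath (Complex x0 y0) (Complex x1 y1)) c = 0"
      using c * by (intro winding_number_rectpath_outside) auto
    then obtain d where d: "homotopic_loops (- {c}) (rectpath (Complex x0 y0) (Complex x1 y1)) (\<lambda>t. d)"
      using winding_number_homotopic_loops_null_eq[OF path_rectpath nc] by blast
    have "winding_number (f \<circ> rectpath (Complex x0 y0) (Complex x1 y1)) (f c) = winding_number (\<lambda>t. f d) (f c)"
      using winding_number_homotopic_loops[OF img[OF d]] by (simp add: comp_def)
    also have "\<dots> = 0"
    proof -
      have "d \<noteq> c" using homotopic_loops_imp_subset[OF d] by (auto simp: path_image_def)
      then have "winding_number (linepath (f d) (f d)) (f c) = 0" by (intro winding_number_trivial) simp
      then show ?thesis by (simp add: linepath_refl)
    qed
    finally show "winding_number (f \<circ> rectpath (Complex x0 y0) (Complex x1 y1)) (f c) = 0" .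
  qed
qed

text \<open>The assumption \<open>primitive_quotient\<close> takes the place of a chain rule for the
  inverse of \<open>Z\<close>. Where \<open>a p\<close> and \<open>b p\<close> are linearly
  dependent over the reals, the derivative of \<open>Z\<close> has rank at most one and gives no
  lower bound for \<open>Z p - Z p0\<close>; the normal forms will supply the limit.\<close>

locale plane_chart =
  fixes a b Z :: "real \<times> real \<Rightarrow> complex"
  assumes cont_a: "continuous_on UNIV a" and cont_b: "continuous_on UNIV b"
    and Z_deriv: "\<And>p. (Z has_derivative dform (a p) (b p)) (at p)"
    and bij_Z: "bij Z"
    and primitive_quotient: "\<And>S F v p0. open S \<Longrightarrow> p0 \<in> S \<Longrightarrow> continuous_on S v \<Longrightarrow>
       (\<And>p. p \<in> S \<Longrightarrow> (F has_derivative dform (v p * a p) (v p * b p)) (at p)) \<Longrightarrow>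
       ((\<lambda>p. (F p - F p0) / (Z p - Z p0)) \<longlongrightarrow> v p0) (at p0)"
begin

lemma cont_Z: "continuous_on S Z"
  using Z_deriv by (meson continuous_at_imp_continuous_on has_derivative_continuous)

lemma inj_Z: "inj_on Z S"
  using bij_Z by (meson bij_is_inj inj_on_subset subset_UNIV)

lemma Z_eq_iff [simp]: "Z p = Z q \<longleftrightarrow> p = q"
  using inj_Z[of UNIV] by (auto simp: inj_on_def)

abbreviation Zi :: "complex \<Rightarrow> real \<times> real" where "Zi \<equiv> inv Z"

lemma Zi_Z [simp]: "Zi (Z p) = p" and Z_Zi [simp]: "Z (Zi w) = w"
  using bij_Z by (simp_all add: bij_is_inj bij_is_surj surj_f_inv_f)

lemma open_Z: "open S \<Longrightarrow> open (Z ` S)"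
  by (rule invariance_of_domain_gen) (auto intro: cont_Z inj_Z)

lemma cont_Zi: "continuous_on S Zi"
proof -
  have "continuous_on (Z ` UNIV) Zi" by (rule continuous_on_inverse_open) (auto intro: cont_Z)
  then show ?thesis using bij_Z by (metis bij_is_surj continuous_on_subset subset_UNIV)
qed

text \<open>The quotient limit says that \<open>F \<circ> Zi\<close> has the complex derivative
  \<open>v \<circ> Zi\<close>, and the derivative of a holomorphic function is holomorphic.\<close>

lemma primitive_imp_holomorphic:
  assumes S: "open S" and v: "continuous_on S v"
    and F: "\<And>p. p \<in> S \<Longrightarrow> (F has_derivative dform (v p * a p) (v p * b p)) (at p)"
  shows "(v \<circ> Zi) holomorphic_on (Z ` S)"
proof -
  have D: "((F \<circ> Zi) has_field_derivative v (Zi w)) (at w)" if wS: "w \<in> Z ` S" for w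
  proof -
    obtain p where p: "p \<in> S" "w = Z p" using wS by blast
    have "(Zi \<longlongrightarrow> p) (at w)"
      using cont_Zi[of UNIV] Zi_Z[of p] p(2) 
      unfolding continuous_on_eq_continuous_at[OF open_UNIV] isCont_def by (metis UNIV_I)
    moreover have "\<forall>\<^sub>F x in at w. Zi x \<noteq> p"
      unfolding eventually_at_topological using p by (intro exI[of _ UNIV]) auto
    ultimately have "filterlim Zi (at p) (at w)" by (simp add: filterlim_at)
    from filterlim_compose[OF primitive_quotient[OF S p(1) v F] this]
    show ?thesis by (simp add: has_field_derivative_iff p)
  qed
  have "(F \<circ> Zi) holomorphic_on (Z ` S)"
    using D by (meson DERIV_subset field_differentiable_def holomorphic_onI subset_UNIV)
  then have "deriv (F \<circ> Zi) holomorphic_on (Z ` S)"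
    by (rule holomorphic_deriv) (rule open_Z[OF S])
  then show ?thesis
    by (rule holomorphic_transform) (use D DERIV_imp_deriv in auto)
qed

lemma Morera:
  assumes v: "continuous_on (cbox (a1, a2) (b1, b2)) v"
    and zero: "\<And>x0 x1 y0 y1. a1 \<le> x0 \<Longrightarrow> x0 \<le> x1 \<Longrightarrow> x1 \<le> b1 \<Longrightarrow> a2 \<le> y0 \<Longrightarrow> y0 \<le> y1 \<Longrightarrow> y1 \<le> b2 \<Longrightarrow>
       rect_integral (\<lambda>p. v p * a p) (\<lambda>p. v p * b p) x0 x1 y0 y1 = 0"
  shows "(v \<circ> Zi) holomorphic_on (Z ` box (a1, a2) (b1, b2))"
proof -
  have "\<exists>F. \<forall>p\<in>box (a1, a2) (b1, b2). (F has_derivative dform (v p * a p) (v p * b p)) (at p)"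
    using cont_a cont_b v zero
    by (intro rect_integral_zero_imp_primitive continuous_on_mult) (auto intro: continuous_on_subset)
  then obtain F where "\<And>p. p \<in> box (a1, a2) (b1, b2) \<Longrightarrow> (F has_derivative dform (v p * a p) (v p * b p)) (at p)"
    by blast
  then show ?thesis
    by (rule primitive_imp_holomorphic[OF open_box continuous_on_subset[OF v box_subset_cbox]])
qed

text \<open>The map \<open>Z\<close> with its arguments read as complex numbers, where paths and
  winding numbers live.\<close>

definition Zc :: "complex \<Rightarrow> complex" where "Zc c = Z (pair_of c)"

lemma bij_Zc: "bij Zc"
  using bij_comp[OF bij_pair_of bij_Z] by (simp add: Zc_def[abs_def] comp_def)

lemma cont_Zc: "continuous_on S Zc"
  unfolding Zc_def[abs_def]
  by (rule continuous_on_compose2[OF cont_Z[of UNIV]]) (auto intro!: continuous_intros)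

lemma Zc_Complex [simp]: "Zc (Complex x y) = Z (x, y)" by (simp add: Zc_def)

lemma Zc_eq_iff [simp]: "Zc c = Zc d \<longleftrightarrow> c = d"
  using bij_Zc by (simp add: bij_is_inj inj_eq)

lemma Zc_line_deriv:
  "(Zc \<circ> linepath c d has_vector_derivative dform (a (pair_of (linepath c d t))) (b (pair_of (linepath c d t))) (pair_of (d - c))) (at t)"
proof -
  have "(linepath c d has_vector_derivative (d - c)) (at t)"
    by (rule has_vector_derivative_linepath_within)
  then have "((\<lambda>t. pair_of (linepath c d t)) has_vector_derivative pair_of (d - c)) (at t)"
    unfolding pair_of_def 
    by (intro has_vector_derivative_Pair bounded_linear.has_vector_derivative[OF bounded_linear_Re] bounded_linear.has_vector_derivative[OF bounded_linear_Im])
  from has_derivative_has_vector_derivative_line[OF Z_deriv this]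
  show ?thesis by (simp add: comp_def Zc_def[abs_def])
qed

lemma valid_path_line: "valid_path (Zc \<circ> linepath c d)"
  unfolding valid_path_def
proof (rule C1_differentiable_imp_piecewise)
  have "continuous_on {0..1} (\<lambda>t. a (pair_of (linepath c d t)))" "continuous_on {0..1} (\<lambda>t. b (pair_of (linepath c d t)))"
    by (auto intro!: continuous_on_compose2[OF cont_a] continuous_on_compose2[OF cont_b] continuous_intros continuous_on_linepath)
  then have "continuous_on {0..1} (\<lambda>t. dform (a (pair_of (linepath c d t))) (b (pair_of (linepath c d t))) (pair_of (d - c)))"
    unfolding dform_def by (intro continuous_intros)
  then show "Zc \<circ> linepath c d C1_differentiable_on {0..1}"
    unfolding C1_differentiable_on_def using Zc_line_deriv[of c d] by (intro exI conjI ballI)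
qed

lemma valid_path_rect: "valid_path (Zc \<circ> rectpath c d)"
  by (auto simp: rectpath_def Let_def path_compose_join pathfinish_compose pathstart_compose
      intro!: valid_path_join valid_path_line)

text \<open>Both endpoints are measured from a common base \<open>u\<close>, so the order of
  \<open>x0\<close> and \<open>x1\<close> is free and one statement covers the lower and the upper
  side of a rectangle with their opposite directions.\<close>

lemma contour_integral_horizontal:
  assumes f: "continuous_on {u..w} (\<lambda>x. f (Z (x, y)) * a (x, y))"
    and x: "x0 \<in> {u..w}" "x1 \<in> {u..w}"
  shows "(f has_contour_integral (integral {u..x1} (\<lambda>x. f (Z (x, y)) * a (x, y)) - integral {u..x0} (\<lambda>x. f (Z (x, y)) * a (x, y))))
           (Zc \<circ> linepath (Complex x0 y) (Complex x1 y))"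
proof -
  define G where "G x = integral {u..x} (\<lambda>x. f (Z (x, y)) * a (x, y))" for x
  define l where "l t = x0 + t * (x1 - x0)" for t
  have l: "l t \<in> {u..w}" if "t \<in> {0..1}" for t
    using convexD_alt[of "{u..w}" x0 x1 t] x that by (auto simp: l_def algebra_simps)
  have ll: "linepath (Complex x0 y) (Complex x1 y) t = Complex (l t) y" for t
    by (simp add: linepath_def l_def complex_eq_iff algebra_simps)
  have "(f has_contour_integral (G (l 1) - G (l 0))) (Zc \<circ> linepath (Complex x0 y) (Complex x1 y))"
  proof (rule has_contour_integral_antiderivative[where h = "G \<circ> l", unfolded comp_def[of G l]])
    fix t :: real assume t: "t \<in> {0..1}"
    show "(Zc \<circ> linepath (Complex x0 y) (Complex x1 y) has_vector_derivative of_real (x1 - x0) * a (l t, y)) (at t)"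
      using Zc_line_deriv[of "Complex x0 y" "Complex x1 y" t]
      by (simp add: ll dform_def scaleR_conv_of_real)
    have "(G has_vector_derivative f (Z (l t, y)) * a (l t, y)) (at (l t) within {u..w})"
      unfolding G_def using integral_has_vector_derivative[OF f l[OF t]] .
    then have "(G has_vector_derivative f (Z (l t, y)) * a (l t, y)) (at (l t) within l ` {0..1})"
      by (rule has_vector_derivative_within_subset) (use l in auto)
    moreover have "(l has_vector_derivative (x1 - x0)) (at t within {0..1})"
      unfolding l_def by (auto intro!: derivative_eq_intros)
    ultimately have "((\<lambda>t. G (l t)) has_vector_derivative (x1 - x0) *\<^sub>R (f (Z (l t, y)) * a (l t, y))) (at t within {0..1})"
      using vector_diff_chain_within[of l _ t "{0..1}" G] by (simp add: comp_def)
    then show "((\<lambda>t. G (l t)) has_vector_derivative f ((Zc \<circ> linepath (Complex x0 y) (Complex x1 y)) t) *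
        (of_real (x1 - x0) * a (l t, y))) (at t within {0..1})"
      by (simp add: ll scaleR_conv_of_real mult_ac)
  qed
  then show ?thesis by (simp add: l_def G_def)
qed

lemma contour_integral_vertical:
  assumes f: "continuous_on {u..w} (\<lambda>y. f (Z (x, y)) * b (x, y))"
    and y: "y0 \<in> {u..w}" "y1 \<in> {u..w}"
  shows "(f has_contour_integral (integral {u..y1} (\<lambda>y. f (Z (x, y)) * b (x, y)) - integral {u..y0} (\<lambda>y. f (Z (x, y)) * b (x, y))))
           (Zc \<circ> linepath (Complex x y0) (Complex x y1))"
proof -
  define G where "G y = integral {u..y} (\<lambda>y. f (Z (x, y)) * b (x, y))" for y
  define l where "l t = y0 + t * (y1 - y0)" for t
  have l: "l t \<in> {u..w}" if "t \<in> {0..1}" for t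
    using convexD_alt[of "{u..w}" y0 y1 t] y that by (auto simp: l_def algebra_simps)
  have ll: "linepath (Complex x y0) (Complex x y1) t = Complex x (l t)" for t
    by (simp add: linepath_def l_def complex_eq_iff algebra_simps)
  have "(f has_contour_integral (G (l 1) - G (l 0))) (Zc \<circ> linepath (Complex x y0) (Complex x y1))"
  proof (rule has_contour_integral_antiderivative[where h = "G \<circ> l", unfolded comp_def[of G l]])
    fix t :: real assume t: "t \<in> {0..1}"
    show "(Zc \<circ> linepath (Complex x y0) (Complex x y1) has_vector_derivative of_real (y1 - y0) * b (x, l t)) (at t)"
      using Zc_line_deriv[of "Complex x y0" "Complex x y1" t]
      by (simp add: ll dform_def scaleR_conv_of_real)
    have "(G has_vector_derivative f (Z (x, l t)) * b (x, l t)) (at (l t) within {u..w})"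
      unfolding G_def using integral_has_vector_derivative[OF f l[OF t]] .
    then have "(G has_vector_derivative f (Z (x, l t)) * b (x, l t)) (at (l t) within l ` {0..1})"
      by (rule has_vector_derivative_within_subset) (use l in auto)
    moreover have "(l has_vector_derivative (y1 - y0)) (at t within {0..1})"
      unfolding l_def by (auto intro!: derivative_eq_intros)
    ultimately have "((\<lambda>t. G (l t)) has_vector_derivative (y1 - y0) *\<^sub>R (f (Z (x, l t)) * b (x, l t))) (at t within {0..1})"
      using vector_diff_chain_within[of l _ t "{0..1}" G] by (simp add: comp_def)
    then show "((\<lambda>t. G (l t)) has_vector_derivative f ((Zc \<circ> linepath (Complex x y0) (Complex x y1)) t) *
        (of_real (y1 - y0) * b (x, l t))) (at t within {0..1})"
      by (simp add: ll scaleR_conv_of_real mult_ac)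
  qed
  then show ?thesis by (simp add: l_def G_def)
qed

lemma contour_integral_rect:
  assumes "x0 \<le> x1" "y0 \<le> y1"
    and f: "continuous_on (Zc ` path_image (rectpath (Complex x0 y0) (Complex x1 y1))) f"
  shows "(f has_contour_integral rect_integral (\<lambda>p. f (Z p) * a p) (\<lambda>p. f (Z p) * b p) x0 x1 y0 y1)
           (Zc \<circ> rectpath (Complex x0 y0) (Complex x1 y1))"
proof -
  have ca: "continuous_on S a" and cb: "continuous_on S b" for S
    using cont_a cont_b continuous_on_subset by blast+
  have hor: "continuous_on {x0..x1} (\<lambda>x. f (Z (x, y)) * a (x, y))" if "y \<in> {y0, y1}" for y
  proof -
    have "Z (x, y) \<in> Zc ` path_image (rectpath (Complex x0 y0) (Complex x1 y1))" if "x \<in> {x0..x1}" for x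
      using that \<open>y \<in> {y0, y1}\<close> assms by (intro image_eqI[of _ _ "Complex x y"]) (auto simp: path_image_rectpath)
    then show ?thesis
      by (intro continuous_on_mult continuous_on_compose2[OF f] continuous_on_slice_x[OF cont_Z[of UNIV]]
          continuous_on_slice_x[OF ca[of UNIV]]) auto
  qed
  have ver: "continuous_on {y0..y1} (\<lambda>y. f (Z (x, y)) * b (x, y))" if "x \<in> {x0, x1}" for x
  proof -
    have "Z (x, y) \<in> Zc ` path_image (rectpath (Complex x0 y0) (Complex x1 y1))" if "y \<in> {y0..y1}" for y
      using that \<open>x \<in> {x0, x1}\<close> assms by (intro image_eqI[of _ _ "Complex x y"]) (auto simp: path_image_rectpath)
    then show ?thesis
      by (intro continuous_on_mult continuous_on_compose2[OF f] continuous_on_slice_y[OF cont_Z[of UNIV]]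
          continuous_on_slice_y[OF cb[of UNIV]]) auto
  qed
  let ?s = "side_x (\<lambda>p. f (Z p) * a p) x0 x1" and ?t = "\<lambda>x. side_y (\<lambda>p. f (Z p) * b p) x y0 y1"
  have 1: "(f has_contour_integral ?s y0) (Zc \<circ> linepath (Complex x0 y0) (Complex x1 y0))"
    using contour_integral_horizontal[OF hor, of y0 x0 x1] assms by (simp add: side_x_def)
  have 2: "(f has_contour_integral ?t x1) (Zc \<circ> linepath (Complex x1 y0) (Complex x1 y1))"
    using contour_integral_vertical[OF ver, of x1 y0 y1] assms by (simp add: side_y_def)
  have 3: "(f has_contour_integral - ?s y1) (Zc \<circ> linepath (Complex x1 y1) (Complex x0 y1))"
    using contour_integral_horizontal[OF hor, of y1 x1 x0] assms by (simp add: side_x_def)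
  have 4: "(f has_contour_integral - ?t x0) (Zc \<circ> linepath (Complex x0 y1) (Complex x0 y0))"
    using contour_integral_vertical[OF ver, of x0 y1 y0] assms by (simp add: side_y_def)
  have "(f has_contour_integral (?s y0 + (?t x1 + (- ?s y1 + - ?t x0)))) (Zc \<circ> rectpath (Complex x0 y0) (Complex x1 y1))"
    unfolding rectpath_def Let_def path_compose_join complex.sel
    by (intro has_contour_integral_join 1 2 3 4 valid_path_join valid_path_line)
      (auto simp: pathfinish_compose pathstart_compose)
  then show ?thesis by (simp add: rect_integral_def algebra_simps)
qed

text \<open>The constant is 2 \<pi> i times the index that the images of all the rectangles share.
  The global Cauchy formula requires index 0 at points off the domain of \<open>H\<close>; these are
  images of points outside the rectangle.\<close>

lemma rect_Cauchy_formula: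
  obtains \<kappa> :: complex where "\<kappa> \<noteq> 0"
    "\<And>H x0 x1 y0 y1 q. - N < x0 \<Longrightarrow> x0 < x1 \<Longrightarrow> x1 < N \<Longrightarrow> - N < y0 \<Longrightarrow> y0 < y1 \<Longrightarrow> y1 < N \<Longrightarrow>
       H holomorphic_on Z ` box (-N, -N) (N, N) \<Longrightarrow> q \<in> box (-N, -N) (N, N) \<Longrightarrow>
       q \<notin> cbox (x0, y0) (x1, y1) - box (x0, y0) (x1, y1) \<Longrightarrow>
       rect_integral (\<lambda>p. H (Z p) / (Z p - Z q) * a p) (\<lambda>p. H (Z p) / (Z p - Z q) * b p) x0 x1 y0 y1
         = (if q \<in> cbox (x0, y0) (x1, y1) then \<kappa> * H (Z q) else 0)"
proof -
  obtain n where n: "n \<noteq> 0"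
    and n1: "\<And>x0 x1 y0 y1 c. x0 < x1 \<Longrightarrow> y0 < y1 \<Longrightarrow> x0 \<ge> - N \<Longrightarrow> x1 \<le> N \<Longrightarrow> y0 \<ge> - N \<Longrightarrow> y1 \<le> N \<Longrightarrow>
       c \<in> box (Complex x0 y0) (Complex x1 y1) \<Longrightarrow>
       winding_number (Zc \<circ> rectpath (Complex x0 y0) (Complex x1 y1)) (Zc c) = n"
    and n0: "\<And>x0 x1 y0 y1 c. x0 \<le> x1 \<Longrightarrow> y0 \<le> y1 \<Longrightarrow> c \<notin> cbox (Complex x0 y0) (Complex x1 y1) \<Longrightarrow>
       winding_number (Zc \<circ> rectpath (Complex x0 y0) (Complex x1 y1)) (Zc c) = 0"
    using winding_number_homeomorphic_rectpath[OF bij_Zc cont_Zc, of N] by blast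
  have box_iff: "(x, y) \<in> box (u, v) (u', v') \<longleftrightarrow> u < x \<and> x < u' \<and> v < y \<and> y < v'" for x y u v u' v' :: real
    by (auto simp: mem_box Basis_prod_def)
  show ?thesis
  proof (rule that[of "2 * pi * \<i> * n"])
    show "2 * pi * \<i> * n \<noteq> 0" using n by simp
    fix H x0 x1 y0 y1 q
    assume x: "- N < x0" "x0 < x1" "x1 < N" and y: "- N < y0" "y0 < y1" "y1 < N"
      and H: "H holomorphic_on Z ` box (-N, -N) (N, N)" and q: "q \<in> box (-N, -N) (N, N)"
      and qR: "q \<notin> cbox (x0, y0) (x1, y1) - box (x0, y0) (x1, y1)"
    define \<gamma> where "\<gamma> = rectpath (Complex x0 y0) (Complex x1 y1)"
    define c where "c = Complex (fst q) (snd q)"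
    have qc: "Z q = Zc c" by (simp add: c_def)
    have cin: "c \<in> cbox (Complex x0 y0) (Complex x1 y1) \<longleftrightarrow> q \<in> cbox (x0, y0) (x1, y1)"
      by (cases q) (auto simp: c_def in_cbox_complex_iff cbox_Pair_eq)
    have cin': "c \<in> box (Complex x0 y0) (Complex x1 y1) \<longleftrightarrow> q \<in> box (x0, y0) (x1, y1)"
      by (cases q) (auto simp: c_def in_box_complex_iff box_iff)
    have PI: "path_image \<gamma> = cbox (Complex x0 y0) (Complex x1 y1) - box (Complex x0 y0) (Complex x1 y1)"
      unfolding \<gamma>_def using x y by (intro path_image_rectpath_cbox_minus_box) auto
    have cP: "c \<notin> path_image \<gamma>" using qR cin cin' PI by auto
    have sub: "Zc ` path_image \<gamma> \<subseteq> Z ` box (-N, -N) (N, N)"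
    proof
      fix w assume "w \<in> Zc ` path_image \<gamma>"
      then obtain d where d: "d \<in> cbox (Complex x0 y0) (Complex x1 y1)" "w = Zc d" using PI by auto
      then have "pair_of d \<in> box (-N, -N) (N, N)" using x y by (auto simp: pair_of_def box_iff in_cbox_complex_iff)
      then show "w \<in> Z ` box (-N, -N) (N, N)" by (auto simp: d Zc_def)
    qed
    have nz: "Zc d \<noteq> Z q" if "d \<in> path_image \<gamma>" for d using that cP qc by auto
    have pi: "path_image (Zc \<circ> \<gamma>) = Zc ` path_image \<gamma>" by (simp add: path_image_compose)
    have "((\<lambda>w. H w / (w - Z q)) has_contour_integral (2 * pi * \<i> * winding_number (Zc \<circ> \<gamma>) (Z q) * H (Z q))) (Zc \<circ> \<gamma>)"
    proof (rule Cauchy_integral_formula_global[OF open_Z[OF open_box] H])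
      show "Z q \<in> Z ` box (-N, -N) (N, N)" using q by simp
      show "valid_path (Zc \<circ> \<gamma>)" unfolding \<gamma>_def by (rule valid_path_rect)
      show "path_image (Zc \<circ> \<gamma>) \<subseteq> Z ` box (-N, -N) (N, N) - {Z q}" using sub nz by (auto simp: pi)
      show "pathfinish (Zc \<circ> \<gamma>) = pathstart (Zc \<circ> \<gamma>)" by (simp add: \<gamma>_def pathfinish_compose pathstart_compose)
      fix w assume w: "w \<notin> Z ` box (-N, -N) (N, N)"
      define d where "d = inv Zc w"
      have wd: "w = Zc d" using bij_Zc by (simp add: d_def bij_is_surj surj_f_inv_f)
      have "d \<notin> cbox (Complex x0 y0) (Complex x1 y1)"
      proof
        assume "d \<in> cbox (Complex x0 y0) (Complex x1 y1)"
        then have "pair_of d \<in> box (-N, -N) (N, N)" using x y by (auto simp: pair_of_def box_iff in_cbox_complex_iff)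
        then show False using w by (auto simp: wd Zc_def)
      qed
      then show "winding_number (Zc \<circ> \<gamma>) w = 0" unfolding \<gamma>_def wd using x y by (intro n0) auto
    qed
    moreover have "((\<lambda>w. H w / (w - Z q)) has_contour_integral
       rect_integral (\<lambda>p. H (Z p) / (Z p - Z q) * a p) (\<lambda>p. H (Z p) / (Z p - Z q) * b p) x0 x1 y0 y1) (Zc \<circ> \<gamma>)"
      unfolding \<gamma>_def
    proof (rule contour_integral_rect)
      show "continuous_on (Zc ` path_image (rectpath (Complex x0 y0) (Complex x1 y1))) (\<lambda>w. H w / (w - Z q))"
        using sub nz holomorphic_on_imp_continuous_on[OF H] unfolding \<gamma>_def
        by (intro continuous_intros) (auto intro: continuous_on_subset)
    qed (use x y in auto)
    ultimately have "rect_integral (\<lambda>p. H (Z p) / (Z p - Z q) * a p) (\<lambda>p. H (Z p) / (Z p - Z q) * b p) x0 x1 y0 y1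
        = 2 * pi * \<i> * winding_number (Zc \<circ> \<gamma>) (Z q) * H (Z q)"
      by (rule has_contour_integral_unique[symmetric])
    moreover have "winding_number (Zc \<circ> \<gamma>) (Z q) = (if q \<in> cbox (x0, y0) (x1, y1) then n else 0)"
    proof (cases "q \<in> cbox (x0, y0) (x1, y1)")
      case True
      then have "c \<in> box (Complex x0 y0) (Complex x1 y1)" using cin cin' qR by auto
      then show ?thesis using True x y unfolding qc \<gamma>_def by (subst n1) auto
    next
      case False
      then show ?thesis using n0[of x0 x1 y0 y1 c] cin x y unfolding qc \<gamma>_def by simp
    qed
    ultimately show "rect_integral (\<lambda>p. H (Z p) / (Z p - Z q) * a p) (\<lambda>p. H (Z p) / (Z p - Z q) * b p) x0 x1 y0 y1
         = (if q \<in> cbox (x0, y0) (x1, y1) then 2 * pi * \<i> * n * H (Z q) else 0)"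
      by simp
  qed
qed

end

subsection \<open>The Cauchy transform\<close>

text \<open>Let u \<le> v be the distances from z and d the distance of the two points. The
  difference has modulus d/(u v), and d \<le> 2 v. Writing d = d^\<theta> d^(1-\<theta>) and
  absorbing the second factor into v leaves d^\<theta> times u to the power -(1 + \<theta>).\<close>

lemma cauchy_kernel_Holder:
  fixes z w w' :: complex
  assumes "0 < \<theta>" "\<theta> < 1"
  shows "norm (1 / (w - z) - 1 / (w' - z)) \<le>
    2 * norm (w - w') powr \<theta> * (norm (w - z) powr - (1 + \<theta>) + norm (w' - z) powr - (1 + \<theta>))"
proof -
  have main: "norm (1 / (w - z) - 1 / (w' - z)) \<le>
      2 * norm (w - w') powr \<theta> * norm (w - z) powr - (1 + \<theta>)"
    if ne: "w \<noteq> z" "w' \<noteq> z" "w \<noteq> w'" and le: "norm (w - z) \<le> norm (w' - z)" for w w' :: complex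
  proof -
    define u v d where "u = norm (w - z)" and "v = norm (w' - z)" and "d = norm (w - w')"
    have pos: "u > 0" "v > 0" "d > 0" "u \<le> v" using ne le by (auto simp: u_def v_def d_def)
    have "d \<le> u + v" unfolding u_def v_def d_def
      using norm_triangle_ineq4[of "w - z" "w' - z"] by simp
    then have d2: "d \<le> 2 * v" using pos by simp
    have "norm (1 / (w - z) - 1 / (w' - z)) = d / (u * v)"
      using ne by (simp add: u_def v_def d_def divide_simps norm_divide norm_mult norm_minus_commute)
    also have "d = d powr \<theta> * d powr (1 - \<theta>)" using pos by (simp flip: powr_add)
    also have "d powr \<theta> * d powr (1 - \<theta>) / (u * v) \<le> d powr \<theta> * (2 * v powr (1 - \<theta>)) / (u * v)"
    proof -
      have "d powr (1 - \<theta>) \<le> (2 * v) powr (1 - \<theta>)"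
        using d2 pos assms by (intro powr_mono2) auto
      also have "\<dots> = 2 powr (1 - \<theta>) * v powr (1 - \<theta>)" using pos by (simp add: powr_mult)
      also have "\<dots> \<le> 2 powr 1 * v powr (1 - \<theta>)"
        using assms by (intro mult_right_mono powr_mono) auto
      finally show ?thesis using pos by (intro divide_right_mono mult_left_mono) auto
    qed
    also have "\<dots> = 2 * d powr \<theta> * (v powr - \<theta> / u)"
      using pos by (simp add: powr_diff powr_minus field_simps)
    also have "\<dots> \<le> 2 * d powr \<theta> * (u powr - \<theta> / u)"
      using pos assms by (intro mult_left_mono divide_right_mono powr_mono2') auto
    also have "u powr - \<theta> / u = u powr - (1 + \<theta>)"
    proof -
      have "u powr (- \<theta> - 1) = u powr - \<theta> / u" using pos by (simp add: powr_diff)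
      then show ?thesis by (metis add.commute minus_add_distrib uminus_add_conv_diff)
    qed
    finally show ?thesis by (simp add: u_def d_def)
  qed
  \<comment> \<open>Since 1/0 = 0 and 0 powr y = 0, the estimate also holds when \<open>z\<close>
    coincides with \<open>w\<close> or \<open>w'\<close>, so no exceptional points arise under the
    integral.\<close>
  consider "w = z" | "w' = z" | "w = w'" | "w \<noteq> z" "w' \<noteq> z" "w \<noteq> w'" by blast
  then show ?thesis
  proof cases
    case 1
    show ?thesis
    proof (cases "w' = z")
      case False
      then have n: "norm (w' - z) > 0" by simp
      have "norm (w' - z) powr \<theta> * norm (w' - z) powr - (1 + \<theta>) = norm (w' - z) powr (-1)"
        by (simp flip: powr_add)
      then show ?thesis using 1 n by (simp add: norm_divide norm_minus_commute powr_minus divide_simps)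
    qed (use 1 in simp)
  next
    case 2
    show ?thesis
    proof (cases "w = z")
      case False
      then have n: "norm (w - z) > 0" by simp
      have "norm (w - z) powr \<theta> * norm (w - z) powr - (1 + \<theta>) = norm (w - z) powr (-1)"
        by (simp flip: powr_add)
      then show ?thesis using 2 n by (simp add: norm_divide norm_minus_commute powr_minus divide_simps)
    qed (use 2 in simp)
  next
    case 4
    have nn: "0 \<le> 2 * norm (w - w') powr \<theta> * x powr y" for x y by simp
    show ?thesis
    proof (cases "norm (w - z) \<le> norm (w' - z)")
      case True
      show ?thesis using main[OF 4 True] nn[of "norm (w' - z)" "- (1 + \<theta>)"]
        unfolding distrib_left by linarith
    next
      case False
      then have "norm (1 / (w' - z) - 1 / (w - z)) \<le> 2 * norm (w' - w) powr \<theta> * norm (w' - z) powr - (1 + \<theta>)"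
        using main[of w' w] 4 by auto
      then show ?thesis using nn[of "norm (w - z)" "- (1 + \<theta>)"]
        unfolding distrib_left norm_minus_commute[of w' w] norm_minus_commute[of "1 / (w' - z)"] by linarith
    qed
  qed simp
qed

text \<open>The number \<theta> is the surplus of integrability beyond the kernel 1/(Z p - Z q); it
  reappears as the Hoelder exponent of the transform.\<close>

locale cauchy_transform = plane_chart +
  fixes K :: "(real \<times> real) set" and \<theta> :: real
  assumes compact_K: "compact K" and \<theta>: "0 < \<theta>" "\<theta> < 1"
begin

abbreviation M :: "(real \<times> real) measure" where "M \<equiv> lebesgue_on K"

lemma K_meas: "K \<in> sets lebesgue" "K \<in> lmeasurable"
  using lmeasurable_compact[OF compact_K] by (auto dest: fmeasurableD)

lemma space_M [simp]: "space M = K" by simp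

sublocale M: finite_measure M
  using K_meas by (rule_tac finite_measure_lebesgue_on)

sublocale MM: pair_sigma_finite M M ..

lemma meas_cont: "continuous_on K f \<Longrightarrow> f \<in> borel_measurable M" for f :: "real \<times> real \<Rightarrow> 'b::euclidean_space"
  by (rule continuous_imp_measurable_on_sets_lebesgue[OF _ K_meas(1)])

lemma meas_Z [measurable]: "Z \<in> borel_measurable M"
  by (rule meas_cont[OF cont_Z])

lemma AE_neq: "AE q in M. q \<noteq> p"
proof -
  have "{p} \<inter> K \<in> null_sets lebesgue" 
    by (metis negligible_iff_null_sets negligible_Int negligible_sing)
  then show ?thesis
    using K_meas by (intro AE_I'[of "{p} \<inter> K"]) (auto simp: null_sets_restrict_space)
qed

text \<open>Densities whose potential for a slightly more singular kernel is bounded uniformly on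
  \<open>K\<close>. The class is stable under multiplication by continuous functions, which the
  repeated transforms below demand.\<close>

definition adm :: "(real \<times> real \<Rightarrow> complex) \<Rightarrow> bool"
  where "adm g \<longleftrightarrow> g \<in> borel_measurable M \<and>
    (\<exists>B. \<forall>p\<in>K. (\<integral>\<^sup>+q. ennreal (norm (g q) * norm (Z p - Z q) powr - (1 + \<theta>)) \<partial>M) \<le> ennreal B)"

text \<open>The integration is over Lebesgue measure in the \<open>(x, y)\<close> plane, not over
  area in the image of \<open>Z\<close>, so nothing is divided by the Jacobian of \<open>Z\<close>,
  which may vanish. The usual factor 1/\<pi> is absent; its role is played later by
  \<kappa>.\<close>

definition T :: "(real \<times> real \<Rightarrow> complex) \<Rightarrow> real \<times> real \<Rightarrow> complex"
  where "T g p = (LINT q|M. g q / (Z p - Z q))"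

lemma adm_mult:
  assumes g: "adm g" and \<phi>: "continuous_on K \<phi>"
  shows "adm (\<lambda>q. g q * \<phi> q)"
proof -
  obtain B where B: "\<And>p. p \<in> K \<Longrightarrow> (\<integral>\<^sup>+q. ennreal (norm (g q) * norm (Z p - Z q) powr - (1 + \<theta>)) \<partial>M) \<le> ennreal B"
    using g by (auto simp: adm_def)
  have "bounded (\<phi> ` K)" using compact_K \<phi> by (intro compact_imp_bounded compact_continuous_image)
  then obtain C where C: "\<And>q. q \<in> K \<Longrightarrow> norm (\<phi> q) \<le> C" by (auto simp: bounded_iff)
  have [measurable]: "g \<in> borel_measurable M" "\<phi> \<in> borel_measurable M"
    using g \<phi> by (auto simp: adm_def meas_cont)
  have "(\<integral>\<^sup>+q. ennreal (norm (g q * \<phi> q) * norm (Z p - Z q) powr - (1 + \<theta>)) \<partial>M) \<le> ennreal (\<bar>C\<bar> * B)" if p: "p \<in> K" for p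
  proof -
    have "(\<integral>\<^sup>+q. ennreal (norm (g q * \<phi> q) * norm (Z p - Z q) powr - (1 + \<theta>)) \<partial>M)
        \<le> (\<integral>\<^sup>+q. ennreal \<bar>C\<bar> * ennreal (norm (g q) * norm (Z p - Z q) powr - (1 + \<theta>)) \<partial>M)"
    proof (rule nn_integral_mono)
      fix q assume "q \<in> space M"
      then have "norm (\<phi> q) \<le> \<bar>C\<bar>" using C[of q] by auto
      then have "norm (g q * \<phi> q) * norm (Z p - Z q) powr - (1 + \<theta>) \<le> \<bar>C\<bar> * (norm (g q) * norm (Z p - Z q) powr - (1 + \<theta>))"
        by (auto simp: norm_mult mult_ac intro!: mult_right_mono mult_left_mono)
      then show "ennreal (norm (g q * \<phi> q) * norm (Z p - Z q) powr - (1 + \<theta>)) \<le> ennreal \<bar>C\<bar> * ennreal (norm (g q) * norm (Z p - Z q) powr - (1 + \<theta>))"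
        by (simp add: ennreal_leI flip: ennreal_mult)
    qed
    also have "\<dots> = ennreal \<bar>C\<bar> * (\<integral>\<^sup>+q. ennreal (norm (g q) * norm (Z p - Z q) powr - (1 + \<theta>)) \<partial>M)"
      by (rule nn_integral_cmult) measurable
    also have "\<dots> \<le> ennreal \<bar>C\<bar> * ennreal B" using B[OF p] by (intro mult_left_mono) auto
    also have "\<dots> = ennreal (\<bar>C\<bar> * B)" by (rule ennreal_mult'[symmetric]) simp
    finally show ?thesis .
  qed
  moreover have "(\<lambda>q. g q * \<phi> q) \<in> borel_measurable M" by measurable
  ultimately show ?thesis unfolding adm_def by blast
qed

lemma adm_bound:
  assumes g: "adm g"
  shows "\<exists>B\<ge>0. \<forall>p\<in>K. integrable M (\<lambda>q. norm (g q) * norm (Z p - Z q) powr - (1 + \<theta>)) \<and>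
    (LINT q|M. norm (g q) * norm (Z p - Z q) powr - (1 + \<theta>)) \<le> B"
proof -
  obtain B where B: "\<And>p. p \<in> K \<Longrightarrow> (\<integral>\<^sup>+q. ennreal (norm (g q) * norm (Z p - Z q) powr - (1 + \<theta>)) \<partial>M) \<le> ennreal B"
    using g by (auto simp: adm_def)
  have [measurable]: "g \<in> borel_measurable M" using g by (simp add: adm_def)
  have int: "integrable M (\<lambda>q. norm (g q) * norm (Z p - Z q) powr - (1 + \<theta>))" if "p \<in> K" for p
  proof (rule integrableI_bounded)
    show "(\<integral>\<^sup>+q. ennreal (norm (norm (g q) * norm (Z p - Z q) powr - (1 + \<theta>))) \<partial>M) < \<infinity>"
      using B[OF that] by (auto simp: abs_mult intro: le_less_trans)
  qed measurable
  show ?thesis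
  proof (intro exI[of _ "\<bar>B\<bar>"] conjI ballI)
    show "(LINT q|M. norm (g q) * norm (Z p - Z q) powr - (1 + \<theta>)) \<le> \<bar>B\<bar>" if p: "p \<in> K" for p
    proof -
      have "ennreal (LINT q|M. norm (g q) * norm (Z p - Z q) powr - (1 + \<theta>)) \<le> ennreal B"
        using nn_integral_eq_integral[OF int[OF p]] B[OF p] by simp
      also have "\<dots> \<le> ennreal \<bar>B\<bar>" by (rule ennreal_leI) simp
      finally show ?thesis by (simp add: ennreal_le_iff)
    qed
  qed (use int in auto)
qed

lemma adm_kernel:
  assumes g: "adm g"
  shows "\<exists>B\<ge>0. \<forall>p\<in>K. integrable M (\<lambda>q. g q / (Z p - Z q)) \<and> (LINT q|M. norm (g q / (Z p - Z q))) \<le> B"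
proof -
  obtain B where B0: "B \<ge> 0" and B1: "\<forall>p\<in>K. integrable M (\<lambda>q. norm (g q) * norm (Z p - Z q) powr - (1 + \<theta>)) \<and> (LINT q|M. norm (g q) * norm (Z p - Z q) powr - (1 + \<theta>)) \<le> B"
    using adm_bound[OF g] by (elim exE conjE)
  have B: "B \<ge> 0" "\<And>p. p \<in> K \<Longrightarrow> integrable M (\<lambda>q. norm (g q) * norm (Z p - Z q) powr - (1 + \<theta>))" "\<And>p. p \<in> K \<Longrightarrow> (LINT q|M. norm (g q) * norm (Z p - Z q) powr - (1 + \<theta>)) \<le> B"
    using B0 B1 by simp_all
  have [measurable]: "g \<in> borel_measurable M" using g by (simp add: adm_def)
  have "bounded (Z ` K)" using compact_K by (intro compact_imp_bounded compact_continuous_image cont_Z)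
  then obtain C where C: "C > 0" "\<And>q. q \<in> K \<Longrightarrow> norm (Z q) \<le> C" by (auto simp: bounded_pos)
  \<comment> \<open>\<open>2 * C\<close> bounds all distances d between values of \<open>Z\<close>
    on \<open>K\<close>, so 1/d = d^\<theta> d^-(1+\<theta>) is at most \<open>D\<close> times the
    more singular kernel.\<close>
  define D where "D = (2 * C) powr \<theta>"
  have D: "D \<ge> 0" by (simp add: D_def)
  have le: "norm (g q / (Z p - Z q)) \<le> D * (norm (g q) * norm (Z p - Z q) powr - (1 + \<theta>))" if "p \<in> K" "q \<in> K" for p q
  proof (cases "p = q")
    case False
    define d where "d = norm (Z p - Z q)"
    have d: "d > 0" using False by (simp add: d_def)
    have "d \<le> 2 * C" using C(2)[OF that(1)] C(2)[OF that(2)] norm_triangle_ineq4[of "Z p" "Z q"] by (simp add: d_def)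
    then have "d powr \<theta> \<le> D" unfolding D_def using d \<theta> by (intro powr_mono2) auto
    then have "d powr \<theta> * d powr - (1 + \<theta>) \<le> D * d powr - (1 + \<theta>)" by (intro mult_right_mono) auto
    moreover have "d powr \<theta> * d powr - (1 + \<theta>) = 1 / d"
      using d by (simp add: powr_minus divide_simps flip: powr_add)
    ultimately have "1 / d \<le> D * d powr - (1 + \<theta>)" by simp
    then have "norm (g q) * (1 / d) \<le> norm (g q) * (D * d powr - (1 + \<theta>))" by (intro mult_left_mono) auto
    then show ?thesis by (simp add: norm_divide d_def mult_ac)
  qed simp
  have int: "integrable M (\<lambda>q. g q / (Z p - Z q))" if p: "p \<in> K" for p
  proof (rule Bochner_Integration.integrable_bound)
    show "integrable M (\<lambda>q. D * (norm (g q) * norm (Z p - Z q) powr - (1 + \<theta>)))"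
      using B(2)[OF p] by (rule integrable_mult_right)
    show "AE q in M. norm (g q / (Z p - Z q)) \<le> norm (D * (norm (g q) * norm (Z p - Z q) powr - (1 + \<theta>)))"
      using le[OF p] D by (intro AE_I2) (auto simp: abs_mult)
  qed measurable
  show ?thesis
  proof (intro exI[of _ "D * B"] conjI ballI)
    fix p assume p: "p \<in> K"
    have "(LINT q|M. norm (g q / (Z p - Z q))) \<le> (LINT q|M. D * (norm (g q) * norm (Z p - Z q) powr - (1 + \<theta>)))"
      using le[OF p] int[OF p] B(2)[OF p] by (intro integral_mono) auto
    also have "\<dots> \<le> D * B" using B(3)[OF p] D by (simp add: mult_left_mono)
    finally show "(LINT q|M. norm (g q / (Z p - Z q))) \<le> D * B" .
  qed (use B D int in auto)
qed

lemma adm_integrable: "adm g \<Longrightarrow> p \<in> K \<Longrightarrow> integrable M (\<lambda>q. g q / (Z p - Z q))"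
  using adm_kernel by blast

text \<open>The increment is measured in \<open>Z\<close>, where the kernel estimate lives; the
  potentials at \<open>p\<close> and at \<open>p'\<close> are each at most \<open>B\<close>, which
  gives the constant 2 (B + B).\<close>

lemma T_Holder:
  assumes g: "adm g"
  obtains B where "\<And>p p'. p \<in> K \<Longrightarrow> p' \<in> K \<Longrightarrow> norm (T g p - T g p') \<le> B * norm (Z p - Z p') powr \<theta>"
proof -
  obtain B where B1: "\<forall>p\<in>K. integrable M (\<lambda>q. norm (g q) * norm (Z p - Z q) powr - (1 + \<theta>)) \<and> (LINT q|M. norm (g q) * norm (Z p - Z q) powr - (1 + \<theta>)) \<le> B"
    using adm_bound[OF g] by (elim exE conjE)
  have B: "\<And>p. p \<in> K \<Longrightarrow> integrable M (\<lambda>q. norm (g q) * norm (Z p - Z q) powr - (1 + \<theta>))" "\<And>p. p \<in> K \<Longrightarrow> (LINT q|M. norm (g q) * norm (Z p - Z q) powr - (1 + \<theta>)) \<le> B"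
    using B1 by simp_all
  note B' = adm_integrable[OF g]
  show ?thesis
  proof (rule that[of "4 * B"])
    fix p p' assume p: "p \<in> K" "p' \<in> K"
    define d where "d = norm (Z p - Z p') powr \<theta>"
    let ?k = "\<lambda>p q. norm (g q) * norm (Z p - Z q) powr - (1 + \<theta>)"
    have "T g p - T g p' = (LINT q|M. g q / (Z p - Z q) - g q / (Z p' - Z q))"
      unfolding T_def by (rule Bochner_Integration.integral_diff[symmetric]) (use B' p in auto)
    also have "norm \<dots> \<le> (LINT q|M. 2 * d * (?k p q + ?k p' q))"
    proof (rule order_trans[OF integral_norm_bound], rule integral_mono)
      fix q
      have "norm (g q / (Z p - Z q) - g q / (Z p' - Z q)) = norm (g q) * norm (1 / (Z p - Z q) - 1 / (Z p' - Z q))"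
        by (simp flip: norm_mult add: algebra_simps)
      also have "\<dots> \<le> norm (g q) * (2 * d * (norm (Z p - Z q) powr - (1 + \<theta>) + norm (Z p' - Z q) powr - (1 + \<theta>)))"
        unfolding d_def by (intro mult_left_mono cauchy_kernel_Holder \<theta>) auto
      finally show "norm (g q / (Z p - Z q) - g q / (Z p' - Z q)) \<le> 2 * d * (?k p q + ?k p' q)"
        by (simp add: algebra_simps)
    qed (use B B' p in auto)
    also have "\<dots> = 2 * d * ((LINT q|M. ?k p q) + (LINT q|M. ?k p' q))"
      using B p by simp
    also have "\<dots> \<le> 2 * d * (B + B)"
      using B p by (intro mult_left_mono add_mono) (auto simp: d_def)
    finally show "norm (T g p - T g p') \<le> 4 * B * norm (Z p - Z p') powr \<theta>" by (simp add: d_def mult_ac)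
  qed
qed

lemma T_continuous:
  assumes g: "adm g"
  shows "continuous_on K (T g)"
  unfolding continuous_on_def
proof
  fix p assume p: "p \<in> K"
  obtain B where B: "\<And>p p'. p \<in> K \<Longrightarrow> p' \<in> K \<Longrightarrow> norm (T g p - T g p') \<le> B * norm (Z p - Z p') powr \<theta>"
    using T_Holder[OF g] by blast
  have "((\<lambda>x. norm (Z x - Z p)) \<longlongrightarrow> 0) (at p within K)"
    using cont_Z[of K] p by (intro tendsto_norm_zero LIM_zero) (auto simp: continuous_on_def)
  then have "((\<lambda>x. norm (Z x - Z p) powr \<theta>) \<longlongrightarrow> 0) (at p within K)"
    by (rule tendsto_zero_powrI) (use \<theta> in \<open>auto intro!: tendsto_const\<close>)
  then have lim: "((\<lambda>x. B * norm (Z x - Z p) powr \<theta>) \<longlongrightarrow> 0) (at p within K)"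
    by (rule tendsto_mult_right_zero)
  have "((\<lambda>x. T g x - T g p) \<longlongrightarrow> 0) (at p within K)"
    by (rule Lim_null_comparison[OF _ lim]) (use B p in \<open>auto simp: eventually_at_filter\<close>)
  then show "(T g \<longlongrightarrow> T g p) (at p within K)" by (rule LIM_zero_cancel)
qed

text \<open>The uniform bound of \<open>adm_kernel\<close> on the integral of the modulus makes the
  double integral absolutely convergent. The measure \<open>P\<close> with the map \<open>c\<close>
  stands for a side of a rectangle, or, in the product rule, for \<open>K\<close> itself with
  \<open>c\<close> the identity.\<close>

lemma T_Fubini:
  fixes P :: "'x measure" and c :: "'x \<Rightarrow> real \<times> real" and m :: "'x \<Rightarrow> complex"
  assumes g: "adm g" and P: "sigma_finite_measure P"
    and c: "\<And>x. x \<in> space P \<Longrightarrow> c x \<in> K" and Zc: "(\<lambda>x. Z (c x)) \<in> borel_measurable P"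
    and m: "integrable P m"
  shows "integrable M (\<lambda>q. g q * (LINT x|P. m x / (Z (c x) - Z q)))" (is ?A)
    and "(LINT x|P. m x * T g (c x)) = (LINT q|M. g q * (LINT x|P. m x / (Z (c x) - Z q)))" (is ?B)
proof -
  interpret P: sigma_finite_measure P by fact
  interpret PM: pair_sigma_finite P M ..
  obtain B where B1: "\<forall>p\<in>K. integrable M (\<lambda>q. g q / (Z p - Z q)) \<and> (LINT q|M. norm (g q / (Z p - Z q))) \<le> B"
    using adm_kernel[OF g] by (elim exE conjE)
  have B: "\<And>p. p \<in> K \<Longrightarrow> integrable M (\<lambda>q. g q / (Z p - Z q))" "\<And>p. p \<in> K \<Longrightarrow> (LINT q|M. norm (g q / (Z p - Z q))) \<le> B"
    using B1 by simp_all
  have [measurable]: "g \<in> borel_measurable M" using g by (simp add: adm_def)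
  have [measurable]: "m \<in> borel_measurable P" using m by simp
  note Zc [measurable]
  define F where "F = (\<lambda>x q. m x * (g q / (Z (c x) - Z q)))"
  have F [measurable]: "case_prod F \<in> borel_measurable (P \<Otimes>\<^sub>M M)"
    unfolding F_def by measurable
  have int: "integrable (P \<Otimes>\<^sub>M M) (case_prod F)"
  proof (rule PM.Fubini_integrable[OF F])
    show "integrable P (\<lambda>x. LINT q|M. norm (case_prod F (x, q)))"
    proof (rule Bochner_Integration.integrable_bound)
      show "integrable P (\<lambda>x. norm (m x) * B)" using m by auto
      show "(\<lambda>x. LINT q|M. norm (case_prod F (x, q))) \<in> borel_measurable P" by measurable
      show "AE x in P. norm (LINT q|M. norm (case_prod F (x, q))) \<le> norm (norm (m x) * B)"
      proof (rule AE_I2)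
        fix x assume x: "x \<in> space P"
        have "(LINT q|M. norm (case_prod F (x, q))) = norm (m x) * (LINT q|M. norm (g q / (Z (c x) - Z q)))"
          unfolding F_def prod.case norm_mult by (rule integral_mult_right_zero)
        also have "\<dots> \<le> norm (m x) * B" using B(2)[OF c[OF x]] by (rule mult_left_mono) simp
        finally show "norm (LINT q|M. norm (case_prod F (x, q))) \<le> norm (norm (m x) * B)"
          by (simp add: integral_nonneg_AE)
      qed
    qed
    show "AE x in P. integrable M (\<lambda>q. case_prod F (x, q))"
      unfolding F_def prod.case by (intro AE_I2 integrable_mult_right B(1) c)
  qed
  have eq: "(LINT x|P. F x q) = g q * (LINT x|P. m x / (Z (c x) - Z q))" for q
  proof -
    have "F x q = g q * (m x / (Z (c x) - Z q))" for x by (simp add: F_def)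
    then show ?thesis by (simp only: integral_mult_right_zero)
  qed
  have "integrable M (\<lambda>q. LINT x|P. F x q)" using PM.integrable_snd[OF int] .
  then show ?A by (simp add: eq)
  have "(LINT x|P. m x * T g (c x)) = (LINT x|P. LINT q|M. F x q)"
    unfolding F_def T_def by (simp only: integral_mult_right_zero)
  also have "\<dots> = (LINT q|M. LINT x|P. F x q)" using PM.Fubini_integral[OF int] by simp
  finally show ?B by (simp add: eq)
qed

text \<open>The Leibniz rule in integrated form; it comes from the partial fraction
  \<open>1 / ((p - x)(p - y)) = 1 / ((p - y)(y - x)) + 1 / ((p - x)(x - y))\<close>.\<close>

lemma T_mult:
  assumes f: "adm f" and g: "adm g" and p: "p \<in> K"
  shows "T f p * T g p = T (\<lambda>q. g q * T f q) p + T (\<lambda>q. f q * T g q) p"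
proof -
  have [measurable]: "f \<in> borel_measurable M" "g \<in> borel_measurable M" using f g by (auto simp: adm_def)
  have fi: "integrable M (\<lambda>q. f q / (Z r - Z q))" if "r \<in> K" for r by (rule adm_integrable[OF f that])
  have gi: "integrable M (\<lambda>q. g q / (Z p - Z q))" by (rule adm_integrable[OF g p])
  have gT: "integrable M (\<lambda>y. g y * T f y / (Z p - Z y))"
    by (rule adm_integrable[OF adm_mult[OF g T_continuous[OF f]] p])
  note FUB = T_Fubini[OF g M.sigma_finite_measure_axioms, of "\<lambda>x. x" "\<lambda>x. f x / (Z p - Z x)"]
  have FA: "integrable M (\<lambda>y. g y * (LINT x|M. f x / (Z p - Z x) / (Z x - Z y)))"
    by (rule FUB(1)) (use fi[OF p] in auto)
  have FB: "(LINT x|M. f x / (Z p - Z x) * T g x) = (LINT y|M. g y * (LINT x|M. f x / (Z p - Z x) / (Z x - Z y)))"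
    by (rule FUB(2)) (use fi[OF p] in auto)
  have "T f p * T g p = (LINT y|M. T f p * (g y / (Z p - Z y)))"
    unfolding T_def[of g] by (rule integral_mult_right_zero[symmetric])
  also have "\<dots> = (LINT y|M. g y * T f y / (Z p - Z y) + g y * (LINT x|M. f x / (Z p - Z x) / (Z x - Z y)))"
  proof (rule integral_cong_AE)
    show "AE y in M. T f p * (g y / (Z p - Z y)) = g y * T f y / (Z p - Z y) + g y * (LINT x|M. f x / (Z p - Z x) / (Z x - Z y))"
      using AE_neq[of p] AE_space[of M]
    proof eventually_elim
      case (elim y)
      then have yp: "Z y \<noteq> Z p" and yK: "y \<in> K" by auto
      \<comment> \<open>The partial fraction identity may fail where a denominator vanishes, that is
        at \<open>x = p\<close> and \<open>x = y\<close>; single points are null.\<close>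
      have pf: "AE x in M. f x / (Z p - Z x) / (Z x - Z y) = f x / (Z p - Z x) / (Z p - Z y) - f x / (Z y - Z x) / (Z p - Z y)"
        using AE_neq[of p] AE_neq[of y]
      proof eventually_elim
        case (elim x)
        then have "Z p - Z x \<noteq> 0" "Z x - Z y \<noteq> 0" "Z y - Z x \<noteq> 0" "Z p - Z y \<noteq> 0" using yp by auto
        then show ?case by (simp add: divide_simps) (simp add: algebra_simps)
      qed
      have "(LINT x|M. f x / (Z p - Z x) / (Z x - Z y))
          = (LINT x|M. f x / (Z p - Z x) / (Z p - Z y) - f x / (Z y - Z x) / (Z p - Z y))"
        by (rule integral_cong_AE[OF _ _ pf]) measurable
      also have "\<dots> = T f p / (Z p - Z y) - T f y / (Z p - Z y)"
        unfolding T_def integral_divide_zero[symmetric]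
        by (rule Bochner_Integration.integral_diff) (intro integrable_divide fi p yK)+
      finally have eq: "(LINT x|M. f x / (Z p - Z x) / (Z x - Z y)) = T f p / (Z p - Z y) - T f y / (Z p - Z y)" .
      show ?case unfolding eq by (simp add: algebra_simps)
    qed
    show "(\<lambda>y. T f p * (g y / (Z p - Z y))) \<in> borel_measurable M" by measurable
    show "(\<lambda>y. g y * T f y / (Z p - Z y) + g y * (LINT x|M. f x / (Z p - Z x) / (Z x - Z y))) \<in> borel_measurable M"
      using gT FA by (intro borel_measurable_add borel_measurable_integrable)
  qed
  also have "\<dots> = T (\<lambda>q. g q * T f q) p + (LINT y|M. g y * (LINT x|M. f x / (Z p - Z x) / (Z x - Z y)))"
    using gT FA by (subst Bochner_Integration.integral_add) (auto simp: T_def)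
  also have "(LINT y|M. g y * (LINT x|M. f x / (Z p - Z x) / (Z x - Z y))) = T (\<lambda>q. f q * T g q) p"
    unfolding FB[symmetric] T_def[of "\<lambda>q. f q * T g q"] by (simp add: mult.commute)
  finally show ?thesis .
qed

lemma T_cong: "(\<And>q. q \<in> K \<Longrightarrow> f q = g q) \<Longrightarrow> T f p = T g p"
  unfolding T_def by (rule Bochner_Integration.integral_cong) auto

lemma T_cmult: "T (\<lambda>q. c * f q) p = c * T f p"
  unfolding T_def times_divide_eq_right[symmetric] by (rule integral_mult_right_zero)

lemma T_add: "adm f \<Longrightarrow> adm g \<Longrightarrow> p \<in> K \<Longrightarrow> T (\<lambda>q. f q + g q) p = T f p + T g p"
  unfolding T_def add_divide_distrib
  by (rule Bochner_Integration.integral_add) (simp_all add: adm_integrable)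

lemma T_diff: "adm f \<Longrightarrow> adm g \<Longrightarrow> p \<in> K \<Longrightarrow> T (\<lambda>q. f q - g q) p = T f p - T g p"
  unfolding T_def diff_divide_distrib
  by (rule Bochner_Integration.integral_diff) (simp_all add: adm_integrable)

text \<open>The integrated form of d(W^(k+1)) = (k+1) W^k dW for W = \<open>T g\<close>. One more
  factor is brought in by \<open>T_mult\<close>, and the summand with a nested transform collapses
  by the induction hypothesis.\<close>

lemma T_power:
  assumes g: "adm g" and p: "p \<in> K"
  shows "T g p ^ Suc k = of_nat (Suc k) * T (\<lambda>q. g q * T g q ^ k) p"
  using p
proof (induction k arbitrary: p)
  case (Suc k)
  have c: "continuous_on K (T g)" by (rule T_continuous[OF g])
  have ak: "adm (\<lambda>q. g q * T g q ^ k)" by (intro adm_mult[OF g] continuous_intros c)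
  have "T g p ^ Suc (Suc k) = of_nat (Suc k) * (T (\<lambda>q. g q * T g q ^ k) p * T g p)"
    using Suc.IH[OF Suc.prems] by simp
  also have "T (\<lambda>q. g q * T g q ^ k) p * T g p
     = T (\<lambda>q. g q * T (\<lambda>q. g q * T g q ^ k) q) p + T (\<lambda>q. g q * T g q ^ k * T g q) p"
    by (rule T_mult[OF ak g Suc.prems])
  also have "T (\<lambda>q. g q * T (\<lambda>q. g q * T g q ^ k) q) p = T (\<lambda>q. 1 / of_nat (Suc k) * (g q * T g q ^ Suc k)) p"
    by (rule T_cong) (simp add: Suc.IH del: power_Suc of_nat_Suc)
  also have "\<dots> = 1 / of_nat (Suc k) * T (\<lambda>q. g q * T g q ^ Suc k) p" by (rule T_cmult)
  also have "T (\<lambda>q. g q * T g q ^ k * T g q) p = T (\<lambda>q. g q * T g q ^ Suc k) p"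
    by (simp add: mult_ac)
  finally have "T g p ^ Suc (Suc k) = of_nat (Suc k) * (1 / of_nat (Suc k) * T (\<lambda>q. g q * T g q ^ Suc k) p + T (\<lambda>q. g q * T g q ^ Suc k) p)" .
  also have "\<dots> = of_nat (Suc (Suc k)) * T (\<lambda>q. g q * T g q ^ Suc k) p"
  proof -
    have "(of_nat (Suc k) :: complex) \<noteq> 0" by (simp del: of_nat_Suc)
    then show ?thesis by (simp add: distrib_left of_nat_Suc[of "Suc k"] del: of_nat_Suc) (simp add: algebra_simps)
  qed
  finally show ?case .
qed simp

text \<open>The integrated form of d exp(-W) = - exp(-W) dW. The Taylor polynomials satisfy this
  relation exactly, with the degree shifted by one, and a uniform bound on W lets the limit pass
  under the integral. The 1 is the constant Taylor term.\<close>

lemma T_exp: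
  assumes g: "adm g" and p: "p \<in> K"
  shows "exp (- T g p) = 1 - T (\<lambda>q. g q * exp (- T g q)) p"
proof -
  have c: "continuous_on K (T g)" by (rule T_continuous[OF g])
  have "bounded (T g ` K)" using compact_K c by (intro compact_imp_bounded compact_continuous_image)
  then obtain W where W: "\<And>q. q \<in> K \<Longrightarrow> norm (T g q) \<le> W" by (auto simp: bounded_iff)
  define S where "S n q = (\<Sum>k<n. (- T g q) ^ k /\<^sub>R fact k)" for n q
  have [measurable]: "g \<in> borel_measurable M" "T g \<in> borel_measurable M" using g c by (auto simp: adm_def meas_cont)
  have Sm [measurable]: "S n \<in> borel_measurable M" for n unfolding S_def[abs_def] by measurable
  have Scont: "continuous_on K (S n)" for n unfolding S_def[abs_def] by (intro continuous_intros c)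
  have Slim: "(\<lambda>n. S n q) \<longlonglongrightarrow> exp (- T g q)" for q
    unfolding S_def using exp_converges[of "- T g q"] by (simp add: sums_def)
  have Sb: "norm (S n q) \<le> exp W" if "q \<in> K" for n q
  proof -
    have "norm (S n q) \<le> (\<Sum>k<n. W ^ k /\<^sub>R fact k)"
      unfolding S_def
      using W[OF that] by (intro sum_norm_le) (auto simp: norm_power intro!: divide_right_mono power_mono mult_left_mono)
    also have "\<dots> \<le> exp W"
      using W[OF that] order_trans[OF norm_ge_zero W[OF that]] unfolding exp_def
      by (intro sum_le_suminf summable_exp_generic) (auto intro!: mult_nonneg_nonneg)
    finally show ?thesis .
  qed
  have rec: "S (Suc n) p = 1 - T (\<lambda>q. g q * S n q) p" for n
  proof (induction n)
    case 0
    have "T (\<lambda>q. g q * 0) p = 0" by (simp add: T_def)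
    then show ?case by (simp add: S_def)
  next
    case (Suc n)
    have a1: "adm (\<lambda>q. g q * S n q)" by (intro adm_mult g Scont)
    have a2: "adm (\<lambda>q. (- 1) ^ n / fact n * (g q * T g q ^ n))"
      using adm_mult[OF g, of "\<lambda>q. (- 1) ^ n / fact n * T g q ^ n"] c by (simp add: mult_ac continuous_intros)
    have "T (\<lambda>q. g q * S (Suc n) q) p = T (\<lambda>q. g q * S n q + (- 1) ^ n / fact n * (g q * T g q ^ n)) p"
      by (rule T_cong) (simp add: S_def algebra_simps power_minus[of "T g _"] scaleR_conv_of_real divide_inverse)
    also have "\<dots> = T (\<lambda>q. g q * S n q) p + (- 1) ^ n / fact n * T (\<lambda>q. g q * T g q ^ n) p"
      unfolding T_add[OF a1 a2 p] T_cmult ..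
    also have "(- 1) ^ n / fact n * T (\<lambda>q. g q * T g q ^ n) p = - ((- T g p) ^ Suc n /\<^sub>R fact (Suc n))"
    proof -
      have "T (\<lambda>q. g q * T g q ^ n) p = T g p ^ Suc n / of_nat (Suc n)"
        using T_power[OF g p, of n] by (simp del: of_nat_Suc power_Suc)
      moreover have "(- w) ^ Suc n = - ((- 1) ^ n * w ^ Suc n)" for w :: complex
        by (simp add: power_minus[of w n])
      ultimately show ?thesis
        by (simp add: scaleR_conv_of_real fact_Suc divide_simps del: of_nat_Suc power_Suc)
    qed
    finally show ?case using Suc.IH by (simp add: S_def)
  qed
  have "(\<lambda>n. T (\<lambda>q. g q * S n q) p) \<longlonglongrightarrow> T (\<lambda>q. g q * exp (- T g q)) p"
    unfolding T_def[where p = p]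
  proof (rule integral_dominated_convergence[where w = "\<lambda>q. norm (g q / (Z p - Z q)) * exp W"])
    show "integrable M (\<lambda>q. norm (g q / (Z p - Z q)) * exp W)"
      using adm_integrable[OF g p] by (intro integrable_mult_left integrable_norm)
    show "AE q in M. (\<lambda>n. g q * S n q / (Z p - Z q)) \<longlonglongrightarrow> g q * exp (- T g q) / (Z p - Z q)"
      using Slim unfolding divide_inverse by (intro AE_I2 tendsto_intros)
    show "AE q in M. norm (g q * S n q / (Z p - Z q)) \<le> norm (g q / (Z p - Z q)) * exp W" for n
    proof (rule AE_I2)
      fix q assume "q \<in> space M"
      then have "norm (g q / (Z p - Z q)) * norm (S n q) \<le> norm (g q / (Z p - Z q)) * exp W"
        using Sb[of q n] by (intro mult_left_mono) auto
      then show "norm (g q * S n q / (Z p - Z q)) \<le> norm (g q / (Z p - Z q)) * exp W"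
        by (simp add: norm_mult norm_divide)
    qed
  qed measurable
  then have "(\<lambda>n. S (Suc n) p) \<longlonglongrightarrow> 1 - T (\<lambda>q. g q * exp (- T g q)) p"
    unfolding rec by (intro tendsto_intros)
  moreover have "(\<lambda>n. S (Suc n) p) \<longlonglongrightarrow> exp (- T g p)" using Slim by (rule LIMSEQ_Suc)
  ultimately show ?thesis by (rule LIMSEQ_unique[rotated])
qed

end

lemma box_iff: "(x, y) \<in> box (u, v) (u', v') \<longleftrightarrow> u < x \<and> x < u' \<and> v < y \<and> y < v'" for x y u v u' v' :: real
  by (auto simp: mem_box Basis_prod_def)

lemma rect_integral_degenerate:
  "x0 = x1 \<Longrightarrow> rect_integral f g x0 x1 y0 y1 = 0" "y0 = y1 \<Longrightarrow> rect_integral f g x0 x1 y0 y1 = 0"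
  by (simp_all add: rect_integral_def side_x_def side_y_def)

lemma continuous_side_integral:
  assumes "continuous_on {u..w} (f :: real \<Rightarrow> complex)"
  shows "integral {u..w} f = (LINT x|lebesgue_on {u..w}. f x)"
  using lebesgue_integral_eq_integral[OF continuous_imp_integrable_real[OF assms]] by simp

context plane_chart
begin

text \<open>Rectangles touching the boundary of the square are excluded from the hypothesis, because
  the Cauchy formula reaches only those strictly inside. Holomorphy is local, so every point is
  treated in a smaller concentric square.\<close>

lemma Morera_open:
  assumes v: "continuous_on (box (-N, -N) (N, N)) v"
    and zero: "\<And>x0 x1 y0 y1. - N < x0 \<Longrightarrow> x0 < x1 \<Longrightarrow> x1 < N \<Longrightarrow> - N < y0 \<Longrightarrow> y0 < y1 \<Longrightarrow> y1 < N \<Longrightarrow>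
       rect_integral (\<lambda>p. v p * a p) (\<lambda>p. v p * b p) x0 x1 y0 y1 = 0"
  shows "(v \<circ> Zi) holomorphic_on (Z ` box (-N, -N) (N, N))"
  unfolding holomorphic_on_def
proof
  fix w assume "w \<in> Z ` box (-N, -N) (N, N)"
  then obtain x y where p: "w = Z (x, y)" "(x, y) \<in> box (-N, -N) (N, N)" by auto
  \<comment> \<open>Halfway between \<open>N\<close> and the larger of the two coordinates in
    modulus.\<close>
  define N' where "N' = (N + max \<bar>x\<bar> \<bar>y\<bar>) / 2"
  have N': "N' < N" "\<bar>x\<bar> < N'" "\<bar>y\<bar> < N'" using p(2) by (auto simp: N'_def box_iff max_def)
  have "(v \<circ> Zi) holomorphic_on (Z ` box (-N', -N') (N', N'))"
  proof (rule Morera)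
    show "continuous_on (cbox (- N', - N') (N', N')) v"
      by (rule continuous_on_subset[OF v]) (use N' in \<open>auto simp: box_iff cbox_Pair_eq\<close>)
    fix x0 x1 y0 y1 assume *: "- N' \<le> x0" "x0 \<le> x1" "x1 \<le> N'" "- N' \<le> y0" "y0 \<le> y1" "y1 \<le> N'"
    show "rect_integral (\<lambda>p. v p * a p) (\<lambda>p. v p * b p) x0 x1 y0 y1 = 0"
    proof (cases "x0 = x1 \<or> y0 = y1")
      case False
      then show ?thesis using * N' by (intro zero) auto
    qed (use rect_integral_degenerate in blast)
  qed
  moreover have "w \<in> Z ` box (-N', -N') (N', N')" unfolding p(1) using N' by (intro imageI) (auto simp: box_iff)
  moreover have "open (Z ` box (-N', -N') (N', N'))" by (intro open_Z open_box)
  ultimately have "(v \<circ> Zi) field_differentiable at w"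
    using holomorphic_on_imp_differentiable_at by blast
  then show "(v \<circ> Zi) field_differentiable at w within Z ` box (- N, - N) (N, N)"
    by (rule field_differentiable_at_within)
qed

end

text \<open>The constant \<kappa> comes from \<open>rect_Cauchy_formula\<close> after
  \<open>N\<close> has been chosen, so the two are fixed together here and not with the
  chart.\<close>

locale cauchy_transform_square = cauchy_transform +
  fixes N :: real and \<kappa> :: complex
  assumes K_eq: "K = cbox (-N, -N) (N, N)" and \<kappa>: "\<kappa> \<noteq> 0"
    and Cauchy: "\<And>H x0 x1 y0 y1 q. - N < x0 \<Longrightarrow> x0 < x1 \<Longrightarrow> x1 < N \<Longrightarrow> - N < y0 \<Longrightarrow> y0 < y1 \<Longrightarrow> y1 < N \<Longrightarrow>
       H holomorphic_on Z ` box (-N, -N) (N, N) \<Longrightarrow> q \<in> box (-N, -N) (N, N) \<Longrightarrow>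
       q \<notin> cbox (x0, y0) (x1, y1) - box (x0, y0) (x1, y1) \<Longrightarrow>
       rect_integral (\<lambda>p. H (Z p) / (Z p - Z q) * a p) (\<lambda>p. H (Z p) / (Z p - Z q) * b p) x0 x1 y0 y1
         = (if q \<in> cbox (x0, y0) (x1, y1) then \<kappa> * H (Z q) else 0)"
begin

text \<open>After Fubini the inner boundary integral is the Cauchy formula for
  \<open>v \<circ> Zi\<close>: it is \<open>\<kappa> * v q\<close> inside the rectangle and 0
  outside. In other words \<open>T g\<close> solves the inhomogeneous equation with right-hand side
  \<open>\<kappa> * g\<close>, and a factor holomorphic in \<open>Z\<close> may be carried
  along.\<close>

lemma rect_integral_T:
  assumes g: "adm g" and v: "continuous_on K v" and hol: "(v \<circ> Zi) holomorphic_on Z ` box (-N, -N) (N, N)"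
    and x: "- N < x0" "x0 < x1" "x1 < N" and y: "- N < y0" "y0 < y1" "y1 < N"
  shows "rect_integral (\<lambda>p. v p * T g p * a p) (\<lambda>p. v p * T g p * b p) x0 x1 y0 y1
     = \<kappa> * (LINT q|M. (if q \<in> cbox (x0, y0) (x1, y1) then g q * v q else 0))"
proof -
  let ?R = "cbox (x0, y0) (x1, y1)"
  have KI: "(s, t) \<in> K" if "s \<in> {x0..x1}" "t \<in> {y0..y1}" for s t
    using that x y by (auto simp: K_eq cbox_Pair_eq)
  have ca: "continuous_on K a" and cb: "continuous_on K b"
    using cont_a cont_b continuous_on_subset by blast+
  define mx where "mx s t = v (s, t) * a (s, t)" for s t
  define my where "my s t = v (s, t) * b (s, t)" for s t
  define Jx where "Jx t q = (LINT s|lebesgue_on {x0..x1}. mx s t / (Z (s, t) - Z q))" for t q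
  define Jy where "Jy s q = (LINT t|lebesgue_on {y0..y1}. my s t / (Z (s, t) - Z q))" for s q
  have sf: "sigma_finite_measure (lebesgue_on {u..w})" for u w :: real
    using finite_measure_lebesgue_on[of "{u..w}"] finite_measure_def by auto
  have mxc: "continuous_on {x0..x1} (\<lambda>s. mx s t)" if "t \<in> {y0..y1}" for t
    unfolding mx_def using KI that
    by (intro continuous_on_mult continuous_on_slice_x[OF v] continuous_on_slice_x[OF ca]) auto
  have myc: "continuous_on {y0..y1} (\<lambda>t. my s t)" if "s \<in> {x0..x1}" for s
    unfolding my_def using KI that
    by (intro continuous_on_mult continuous_on_slice_y[OF v] continuous_on_slice_y[OF cb]) auto
  have hor: "integrable M (\<lambda>q. g q * Jx t q)" "side_x (\<lambda>p. v p * T g p * a p) x0 x1 t = (LINT q|M. g q * Jx t q)"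
    if t: "t \<in> {y0..y1}" for t
  proof -
    have Zm: "(\<lambda>s. Z (s, t)) \<in> borel_measurable (lebesgue_on {x0..x1})"
      by (intro continuous_imp_measurable_on_sets_lebesgue continuous_on_slice_x[OF cont_Z[of UNIV]]) auto
    show "integrable M (\<lambda>q. g q * Jx t q)"
      unfolding Jx_def by (rule T_Fubini(1)[OF g sf _ Zm continuous_imp_integrable_real[OF mxc[OF t]]]) (use KI t in auto)
    have "side_x (\<lambda>p. v p * T g p * a p) x0 x1 t = (LINT s|lebesgue_on {x0..x1}. mx s t * T g (s, t))"
      unfolding side_x_def
    proof (subst continuous_side_integral)
      show "continuous_on {x0..x1} (\<lambda>x. v (x, t) * T g (x, t) * a (x, t))"
        using KI t by (intro continuous_on_mult continuous_on_slice_x[OF v] continuous_on_slice_x[OF ca]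
          continuous_on_slice_x[OF T_continuous[OF g]]) auto
    qed (simp add: mx_def mult_ac)
    also have "\<dots> = (LINT q|M. g q * Jx t q)"
      unfolding Jx_def by (rule T_Fubini(2)[OF g sf _ Zm continuous_imp_integrable_real[OF mxc[OF t]]]) (use KI t in auto)
    finally show "side_x (\<lambda>p. v p * T g p * a p) x0 x1 t = (LINT q|M. g q * Jx t q)" .
  qed
  have ver: "integrable M (\<lambda>q. g q * Jy s q)" "side_y (\<lambda>p. v p * T g p * b p) s y0 y1 = (LINT q|M. g q * Jy s q)"
    if s: "s \<in> {x0..x1}" for s
  proof -
    have Zm: "(\<lambda>t. Z (s, t)) \<in> borel_measurable (lebesgue_on {y0..y1})"
      by (intro continuous_imp_measurable_on_sets_lebesgue continuous_on_slice_y[OF cont_Z[of UNIV]]) auto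
    show "integrable M (\<lambda>q. g q * Jy s q)"
      unfolding Jy_def by (rule T_Fubini(1)[OF g sf _ Zm continuous_imp_integrable_real[OF myc[OF s]]]) (use KI s in auto)
    have "side_y (\<lambda>p. v p * T g p * b p) s y0 y1 = (LINT t|lebesgue_on {y0..y1}. my s t * T g (s, t))"
      unfolding side_y_def
    proof (subst continuous_side_integral)
      show "continuous_on {y0..y1} (\<lambda>y. v (s, y) * T g (s, y) * b (s, y))"
        using KI s by (intro continuous_on_mult continuous_on_slice_y[OF v] continuous_on_slice_y[OF cb]
          continuous_on_slice_y[OF T_continuous[OF g]]) auto
    qed (simp add: my_def mult_ac)
    also have "\<dots> = (LINT q|M. g q * Jy s q)"
      unfolding Jy_def by (rule T_Fubini(2)[OF g sf _ Zm continuous_imp_integrable_real[OF myc[OF s]]]) (use KI s in auto)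
    finally show "side_y (\<lambda>p. v p * T g p * b p) s y0 y1 = (LINT q|M. g q * Jy s q)" .
  qed
  have pts: "y0 \<in> {y0..y1}" "y1 \<in> {y0..y1}" "x0 \<in> {x0..x1}" "x1 \<in> {x0..x1}" using x y by auto
  have J: "Jx y0 q + Jy x1 q - Jx y1 q - Jy x0 q = (if q \<in> ?R then \<kappa> * v q else 0)"
    if qK: "q \<in> box (-N, -N) (N, N)" and qR: "q \<notin> ?R - box (x0, y0) (x1, y1)" for q
  proof -
    have ne: "(s, t) \<noteq> q" if "s \<in> {x0..x1}" "t \<in> {y0..y1}" "s \<in> {x0, x1} \<or> t \<in> {y0, y1}" for s t
    proof
      assume "(s, t) = q"
      then have "q \<in> ?R - box (x0, y0) (x1, y1)" using that by (auto simp: cbox_Pair_eq box_iff)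
      then show False using qR by simp
    qed
    have 1: "Jx t q = side_x (\<lambda>p. (v \<circ> Zi) (Z p) / (Z p - Z q) * a p) x0 x1 t" if t: "t \<in> {y0, y1}" for t
    proof -
      have "continuous_on {x0..x1} (\<lambda>s. mx s t / (Z (s, t) - Z q))"
      proof (intro continuous_on_divide continuous_on_diff continuous_on_const mxc continuous_on_slice_x[OF cont_Z[of UNIV]] ballI)
        show "t \<in> {y0..y1}" using t y by auto
        fix s assume "s \<in> {x0..x1}"
        then have "(s, t) \<noteq> q" by (intro ne) (use t y in auto)
        then show "Z (s, t) - Z q \<noteq> 0" by simp
      qed auto
      from continuous_side_integral[OF this] show ?thesis
        by (simp add: Jx_def side_x_def mx_def)
    qed
    have 2: "Jy s q = side_y (\<lambda>p. (v \<circ> Zi) (Z p) / (Z p - Z q) * b p) s y0 y1" if s: "s \<in> {x0, x1}" for s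
    proof -
      have "continuous_on {y0..y1} (\<lambda>t. my s t / (Z (s, t) - Z q))"
      proof (intro continuous_on_divide continuous_on_diff continuous_on_const myc continuous_on_slice_y[OF cont_Z[of UNIV]] ballI)
        show "s \<in> {x0..x1}" using s x by auto
        fix t assume "t \<in> {y0..y1}"
        then have "(s, t) \<noteq> q" by (intro ne) (use s x in auto)
        then show "Z (s, t) - Z q \<noteq> 0" by simp
      qed auto
      from continuous_side_integral[OF this] show ?thesis
        by (simp add: Jy_def side_y_def my_def)
    qed
    show ?thesis
      using Cauchy[OF x y hol qK qR] by (simp add: 1 2 rect_integral_def)
  qed
  \<comment> \<open>Removed are the frontiers of the rectangle and of \<open>K\<close>, where the
    Cauchy formula says nothing; both are null.\<close>
  have AE1: "AE q in M. q \<in> box (-N, -N) (N, N) \<and> q \<notin> ?R - box (x0, y0) (x1, y1)"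
  proof -
    have "negligible ((K - box (-N, -N) (N, N)) \<union> (?R - box (x0, y0) (x1, y1)))"
      unfolding K_eq by (intro negligible_Un negligible_frontier_interval)
    then have "negligible (K \<inter> ((K - box (-N, -N) (N, N)) \<union> (?R - box (x0, y0) (x1, y1))))"
      by (rule negligible_subset) blast
    then have "K \<inter> ((K - box (-N, -N) (N, N)) \<union> (?R - box (x0, y0) (x1, y1))) \<in> null_sets M"
      using K_meas by (auto simp: negligible_iff_null_sets null_sets_restrict_space)
    then show ?thesis by (rule AE_I') auto
  qed
  have "rect_integral (\<lambda>p. v p * T g p * a p) (\<lambda>p. v p * T g p * b p) x0 x1 y0 y1
    = (LINT q|M. g q * Jx y0 q + g q * Jy x1 q - g q * Jx y1 q - g q * Jy x0 q)"
    unfolding rect_integral_def hor(2)[OF pts(1)] hor(2)[OF pts(2)] ver(2)[OF pts(3)] ver(2)[OF pts(4)]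
    by (simp only: Bochner_Integration.integral_add Bochner_Integration.integral_diff
        Bochner_Integration.integrable_add Bochner_Integration.integrable_diff hor(1) ver(1) pts)
  also have "\<dots> = (LINT q|M. \<kappa> * (if q \<in> ?R then g q * v q else 0))"
  proof (rule integral_cong_AE)
    show "(\<lambda>q. g q * Jx y0 q + g q * Jy x1 q - g q * Jx y1 q - g q * Jy x0 q) \<in> borel_measurable M"
      using hor ver pts by (intro borel_measurable_integrable Bochner_Integration.integrable_add Bochner_Integration.integrable_diff hor(1) ver(1) pts)
    have [measurable]: "g \<in> borel_measurable M" "v \<in> borel_measurable M" using g v by (auto simp: adm_def meas_cont)
    have [measurable]: "Measurable.pred M (\<lambda>q. q \<in> ?R)"
    proof -
      have "{q \<in> space M. q \<in> ?R} = K \<inter> ?R" by auto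
      moreover have "K \<inter> ?R \<in> sets M" using K_meas by (simp add: sets_restrict_space_iff sets.Int)
      ultimately show ?thesis by (simp add: pred_def)
    qed
    show "(\<lambda>q. \<kappa> * (if q \<in> ?R then g q * v q else 0)) \<in> borel_measurable M" by measurable
    show "AE q in M. g q * Jx y0 q + g q * Jy x1 q - g q * Jx y1 q - g q * Jy x0 q = \<kappa> * (if q \<in> ?R then g q * v q else 0)"
      using AE1
    proof eventually_elim
      case (elim q)
      have "g q * Jx y0 q + g q * Jy x1 q - g q * Jx y1 q - g q * Jy x0 q = g q * (Jx y0 q + Jy x1 q - Jx y1 q - Jy x0 q)"
        by (simp add: algebra_simps)
      also have "\<dots> = g q * (if q \<in> ?R then \<kappa> * v q else 0)" using J elim by simp
      finally show ?case by simp
    qed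
  qed
  also have "\<dots> = \<kappa> * (LINT q|M. (if q \<in> ?R then g q * v q else 0))" by (rule integral_mult_right_zero)
  finally show ?thesis .
qed

lemma rect_integral_add:
  assumes f: "continuous_on K f" and g: "continuous_on K g"
    and x: "- N < x0" "x0 < x1" "x1 < N" and y: "- N < y0" "y0 < y1" "y1 < N"
  shows "rect_integral (\<lambda>p. (f p + g p) * a p) (\<lambda>p. (f p + g p) * b p) x0 x1 y0 y1 =
    rect_integral (\<lambda>p. f p * a p) (\<lambda>p. f p * b p) x0 x1 y0 y1 + rect_integral (\<lambda>p. g p * a p) (\<lambda>p. g p * b p) x0 x1 y0 y1"
proof -
  have KI: "(s, t) \<in> K" if "s \<in> {x0..x1}" "t \<in> {y0..y1}" for s t
    using that x y by (auto simp: K_eq cbox_Pair_eq)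
  have ca: "continuous_on K a" and cb: "continuous_on K b"
    using cont_a cont_b continuous_on_subset by blast+
  have "side_x (\<lambda>p. (f p + g p) * a p) x0 x1 t = side_x (\<lambda>p. f p * a p) x0 x1 t + side_x (\<lambda>p. g p * a p) x0 x1 t"
    if "t \<in> {y0..y1}" for t
    unfolding side_x_def distrib_right using KI that f g ca
    by (intro integral_add integrable_continuous_real continuous_on_mult) (auto intro: continuous_on_slice_x)
  moreover have "side_y (\<lambda>p. (f p + g p) * b p) s y0 y1 = side_y (\<lambda>p. f p * b p) s y0 y1 + side_y (\<lambda>p. g p * b p) s y0 y1"
    if "s \<in> {x0..x1}" for s
    unfolding side_y_def distrib_right using KI that f g cb
    by (intro integral_add integrable_continuous_real continuous_on_mult) (auto intro: continuous_on_slice_y)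
  ultimately show ?thesis using x y by (simp add: rect_integral_def)
qed

lemma rect_integral_diff:
  assumes f: "continuous_on K f" and g: "continuous_on K g"
    and x: "- N < x0" "x0 < x1" "x1 < N" and y: "- N < y0" "y0 < y1" "y1 < N"
  shows "rect_integral (\<lambda>p. (f p - g p) * a p) (\<lambda>p. (f p - g p) * b p) x0 x1 y0 y1 =
    rect_integral (\<lambda>p. f p * a p) (\<lambda>p. f p * b p) x0 x1 y0 y1 - rect_integral (\<lambda>p. g p * a p) (\<lambda>p. g p * b p) x0 x1 y0 y1"
  using rect_integral_add[OF continuous_on_diff[OF f g] g x y] by simp

text \<open>The similarity principle. With \<open>g = C exp (- T C)\<close> the product rule for \<open>T\<close> turns
  \<open>u exp (- T C)\<close> into \<open>v - v T g + T (g v)\<close>, where \<open>v = u - T (C u)\<close> is holomorphic in \<open>Z\<close>.\<close>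

lemma similarity_principle:
  assumes C: "adm C" and u: "continuous_on K u"
    and eq: "\<And>x0 x1 y0 y1. - N < x0 \<Longrightarrow> x0 < x1 \<Longrightarrow> x1 < N \<Longrightarrow> - N < y0 \<Longrightarrow> y0 < y1 \<Longrightarrow> y1 < N \<Longrightarrow>
       rect_integral (\<lambda>p. u p * a p) (\<lambda>p. u p * b p) x0 x1 y0 y1
         = (LINT q|M. (if q \<in> cbox (x0, y0) (x1, y1) then C q * u q else 0))"
  shows "\<exists>W. continuous_on K W \<and> ((\<lambda>p. u p * exp (- W p)) \<circ> Zi) holomorphic_on Z ` box (-N, -N) (N, N)"
proof -
  \<comment> \<open>Dividing by \<kappa> normalises the transform: the boundary integral of
    \<open>T D\<close> over a rectangle is then the integral of \<open>C\<close>.\<close>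
  define D where "D q = C q * (1 / \<kappa>)" for q
  define W where "W = T D"
  define E where "E q = exp (- W q)" for q
  define g where "g q = D q * E q" for q
  define f where "f q = D q * u q" for q
  define v where "v p = u p - T f p" for p
  have D: "adm D" unfolding D_def by (intro adm_mult[OF C] continuous_intros)
  have Wc: "continuous_on K W" unfolding W_def by (rule T_continuous[OF D])
  have Ec: "continuous_on K E" unfolding E_def by (intro continuous_intros Wc)
  have g: "adm g" unfolding g_def by (rule adm_mult[OF D Ec])
  have f: "adm f" unfolding f_def by (rule adm_mult[OF D u])
  have Tf: "continuous_on K (T f)" and Tg: "continuous_on K (T g)" by (intro T_continuous f g)+
  have vc: "continuous_on K v" unfolding v_def by (intro continuous_intros u Tf)
  have sub: "box (-N, -N) (N, N) \<subseteq> K" unfolding K_eq by (rule box_subset_cbox)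
  have vz: "rect_integral (\<lambda>p. v p * a p) (\<lambda>p. v p * b p) x0 x1 y0 y1 = 0"
    if r: "- N < x0" "x0 < x1" "x1 < N" "- N < y0" "y0 < y1" "y1 < N" for x0 x1 y0 y1
  proof -
    have one: "((\<lambda>_. 1) \<circ> Zi) holomorphic_on Z ` box (-N, -N) (N, N)" by (simp add: comp_def)
    have "rect_integral (\<lambda>p. T f p * a p) (\<lambda>p. T f p * b p) x0 x1 y0 y1
       = \<kappa> * (LINT q|M. (if q \<in> cbox (x0, y0) (x1, y1) then f q else 0))"
      using rect_integral_T[OF f continuous_on_const one r] unfolding mult_1_left mult_1_right .
    also have "\<dots> = (LINT q|M. \<kappa> * (if q \<in> cbox (x0, y0) (x1, y1) then f q else 0))"
      by (rule integral_mult_right_zero[symmetric])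
    also have "\<dots> = (LINT q|M. (if q \<in> cbox (x0, y0) (x1, y1) then C q * u q else 0))"
      using \<kappa> by (intro Bochner_Integration.integral_cong) (auto simp: f_def D_def)
    finally show ?thesis
      using rect_integral_diff[OF u Tf r] eq[OF r] by (simp add: v_def)
  qed
  have vhol: "(v \<circ> Zi) holomorphic_on Z ` box (-N, -N) (N, N)"
  proof (rule Morera_open)
    show "continuous_on (box (-N, -N) (N, N)) v" using vc sub continuous_on_subset by blast
    fix x0 x1 y0 y1 assume r: "- N < x0" "x0 < x1" "x1 < N" "- N < y0" "y0 < y1" "y1 < N"
    then show "rect_integral (\<lambda>p. v p * a p) (\<lambda>p. v p * b p) x0 x1 y0 y1 = 0" by (rule vz)
  qed
  have gv: "adm (\<lambda>q. g q * v q)" by (rule adm_mult[OF g vc])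
  have key: "u p * E p = v p - v p * T g p + T (\<lambda>q. g q * v q) p" if p: "p \<in> K" for p
  proof -
    \<comment> \<open>This is \<open>T_exp\<close> for \<open>D\<close>: the density of 1 - exp(-W)
      is \<open>D * E\<close>, which is \<open>g\<close>.\<close>
    have E1: "E q = 1 - T g q" if "q \<in> K" for q
    proof -
      have "g = (\<lambda>q. D q * exp (- T D q))" by (simp add: fun_eq_iff g_def E_def W_def)
      then show ?thesis using T_exp[OF D that] by (simp add: E_def W_def)
    qed
    have a1: "adm (\<lambda>q. g q * u q)" by (rule adm_mult[OF g u])
    have "T f p * T g p = T (\<lambda>q. g q * T f q) p + T (\<lambda>q. f q * T g q) p"
      by (rule T_mult[OF f g p])
    also have "T (\<lambda>q. g q * T f q) p = T (\<lambda>q. g q * u q - g q * v q) p"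
      by (rule T_cong) (simp add: v_def algebra_simps)
    also have "\<dots> = T (\<lambda>q. g q * u q) p - T (\<lambda>q. g q * v q) p" by (rule T_diff[OF a1 gv p])
    also have "T (\<lambda>q. f q * T g q) p = T (\<lambda>q. f q - g q * u q) p"
    proof (rule T_cong)
      fix q assume "q \<in> K"
      then have t: "T g q = 1 - E q" using E1 by simp
      have "f q * T g q = f q * (1 - E q)" by (simp only: t)
      also have "\<dots> = f q - g q * u q" by (simp add: f_def g_def algebra_simps)
      finally show "f q * T g q = f q - g q * u q" .
    qed
    also have "\<dots> = T f p - T (\<lambda>q. g q * u q) p" by (rule T_diff[OF f a1 p])
    finally have fg: "T f p * T g p = T f p - T (\<lambda>q. g q * v q) p" by simp
    \<comment> \<open>In \<open>fg\<close> the transforms of \<open>g * u\<close> have cancelled.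
      What remains are transforms whose densities carry the holomorphic factor \<open>v\<close>, to
      which \<open>rect_integral_T\<close> applies.\<close>
    have "u p * E p = (v p + T f p) * (1 - T g p)"
      unfolding E1[OF p] by (simp add: v_def)
    also have "\<dots> = v p - v p * T g p + (T f p - T f p * T g p)" by (simp add: algebra_simps)
    finally show ?thesis unfolding fg by simp
  qed
  have "((\<lambda>p. u p * E p) \<circ> Zi) holomorphic_on Z ` box (-N, -N) (N, N)"
  proof (rule Morera_open)
    have uE: "continuous_on K (\<lambda>p. u p * E p)" by (intro continuous_intros u Ec)
    then show "continuous_on (box (-N, -N) (N, N)) (\<lambda>p. u p * E p)" using sub continuous_on_subset by blast
    fix x0 x1 y0 y1 assume r: "- N < x0" "x0 < x1" "x1 < N" "- N < y0" "y0 < y1" "y1 < N"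
    have KI: "(s, t) \<in> K" if "s \<in> {x0..x1}" "t \<in> {y0..y1}" for s t
      using that r by (auto simp: K_eq cbox_Pair_eq)
    have one: "((\<lambda>_. 1) \<circ> Zi) holomorphic_on Z ` box (-N, -N) (N, N)" by (simp add: comp_def)
    let ?T = "T (\<lambda>q. g q * v q)"
    have Tgv: "continuous_on K ?T" by (rule T_continuous[OF gv])
    have vTg: "continuous_on K (\<lambda>p. v p * T g p)" by (intro continuous_intros vc Tg)
    have "rect_integral (\<lambda>p. u p * E p * a p) (\<lambda>p. u p * E p * b p) x0 x1 y0 y1
       = rect_integral (\<lambda>p. (v p - v p * T g p + ?T p) * a p) (\<lambda>p. (v p - v p * T g p + ?T p) * b p) x0 x1 y0 y1"
      unfolding rect_integral_def side_x_def side_y_def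
      using r by (intro arg_cong2[where f = minus] arg_cong2[where f = plus] integral_cong) (simp_all add: key KI)
    also have "\<dots> = rect_integral (\<lambda>p. ?T p * a p) (\<lambda>p. ?T p * b p) x0 x1 y0 y1
        - rect_integral (\<lambda>p. v p * T g p * a p) (\<lambda>p. v p * T g p * b p) x0 x1 y0 y1"
      using rect_integral_add[OF continuous_on_diff[OF vc vTg] Tgv r] rect_integral_diff[OF vc vTg r] vz[OF r] by simp
    \<comment> \<open>Both boundary integrals are \<kappa> times the integral of
      \<open>g * v\<close> over the rectangle, by \<open>rect_integral_T\<close> with the factors 1
      and \<open>v\<close>.\<close>
    also have "\<dots> = 0"
      using rect_integral_T[OF gv continuous_on_const one r, unfolded mult_1_left mult_1_right] rect_integral_T[OF g vc vhol r] by simp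
    finally show "rect_integral (\<lambda>p. u p * E p * a p) (\<lambda>p. u p * E p * b p) x0 x1 y0 y1 = 0" .
  qed
  then show ?thesis using Wc unfolding E_def by blast
qed

end

subsection \<open>Zeros of doubly periodic functions\<close>

text \<open>The factor exp(-sW) with s running from 0 to 1 never vanishes and deforms one loop into
  the other in the punctured plane.\<close>

lemma winding_number_mult_exp:
  assumes U: "continuous_on S U" and W: "continuous_on S W" and g: "path g" "path_image g \<subseteq> S"
    and loop: "pathfinish g = pathstart g" and nz: "\<And>z. z \<in> path_image g \<Longrightarrow> U z \<noteq> 0"
  shows "winding_number ((\<lambda>z. U z * exp (- W z)) \<circ> g) 0 = winding_number (U \<circ> g) (0 :: complex)"
proof (rule winding_number_homotopic_loops[symmetric])
  have gc: "continuous_on {0..1} g" and gS: "g ` {0..1} \<subseteq> S" using g by (auto simp: path_def path_image_def)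
  show "homotopic_loops (- {0}) (U \<circ> g) ((\<lambda>z. U z * exp (- W z)) \<circ> g)"
    unfolding homotopic_loops
  proof (intro exI[of _ "\<lambda>x. U (g (snd x)) * exp (- (of_real (fst x) * W (g (snd x))))"] conjI ballI)
    have "continuous_on ({0..1} \<times> {0..1}) (\<lambda>x. U (g (snd x)))" "continuous_on ({0..1} \<times> {0..1}) (\<lambda>x. W (g (snd x)))"
      using gS by (auto intro!: continuous_on_compose2[OF U] continuous_on_compose2[OF W]
         continuous_on_compose2[OF gc] continuous_intros)
    then show "continuous_on ({0..1} \<times> {0..1}) (\<lambda>x. U (g (snd x)) * exp (- (of_real (fst x) * W (g (snd x)))))"
      by (intro continuous_intros)
    show "(\<lambda>x. U (g (snd x)) * exp (- (of_real (fst x) * W (g (snd x))))) \<in> {0..1} \<times> {0..1} \<rightarrow> - {0}"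
      using nz by (auto simp: path_image_def)
  qed (use loop in \<open>auto simp: pathstart_def pathfinish_def\<close>)
qed

text \<open>Periodicity turns the image of the boundary into p, q, reversed p, reversed q. The
  contributions cancel in pairs, and zeros have to be excluded on two sides only.\<close>

lemma winding_number_doubly_periodic:
  fixes U :: "complex \<Rightarrow> complex"
  assumes U: "continuous_on UNIV U" and per: "\<And>z. U (z + 1) = U z" "\<And>z. U (z + \<tau>) = U z"
    and nz: "\<And>z. z \<in> closed_segment A (A + 1) \<Longrightarrow> U z \<noteq> 0" "\<And>z. z \<in> closed_segment A (A + \<tau>) \<Longrightarrow> U z \<noteq> 0"
  shows "winding_number (U \<circ> (linepath A (A + 1) +++ linepath (A + 1) (A + 1 + \<tau>) +++
            linepath (A + 1 + \<tau>) (A + \<tau>) +++ linepath (A + \<tau>) A)) 0 = 0"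
proof -
  define p q where "p = U \<circ> linepath A (A + 1)" and "q = U \<circ> linepath A (A + \<tau>)"
  have 2: "U \<circ> linepath (A + 1) (A + 1 + \<tau>) = q"
  proof
    fix t
    have "linepath (A + 1) (A + 1 + \<tau>) t = linepath A (A + \<tau>) t + 1"
      by (simp add: linepath_def scaleR_conv_of_real algebra_simps)
    then show "(U \<circ> linepath (A + 1) (A + 1 + \<tau>)) t = q t" by (simp add: q_def per)
  qed
  have 3: "U \<circ> linepath (A + 1 + \<tau>) (A + \<tau>) = reversepath p"
  proof
    fix t
    have "linepath (A + 1 + \<tau>) (A + \<tau>) t = linepath A (A + 1) (1 - t) + \<tau>"
      by (simp add: linepath_def scaleR_conv_of_real algebra_simps)
    then show "(U \<circ> linepath (A + 1 + \<tau>) (A + \<tau>)) t = reversepath p t" by (simp add: p_def per reversepath_def)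
  qed
  have 4: "U \<circ> linepath (A + \<tau>) A = reversepath q"
    by (auto simp: fun_eq_iff q_def reversepath_def linepath_def scaleR_conv_of_real algebra_simps)
  have path: "path p" "path q"
    unfolding p_def q_def using U by (auto intro!: path_continuous_image intro: continuous_on_subset)
  have img: "0 \<notin> path_image p" "0 \<notin> path_image q"
    using nz by (auto simp: p_def q_def path_image_compose)
  have ends: "pathfinish p = U A" "pathstart p = U A" "pathfinish q = U A" "pathstart q = U A"
    by (auto simp: p_def q_def pathfinish_compose pathstart_compose per)
  show ?thesis
    unfolding path_compose_join 2 3 4 p_def[symmetric]
    using path img ends
    by (simp add: winding_number_join winding_number_reversepath path_image_join not_in_path_image_join)
qed

text \<open>The number of zeros in a period parallelogram is the degree of \<open>U\<close> along its boundary, which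
  vanishes because opposite sides cancel.\<close>

lemma doubly_periodic_no_zeros:
  fixes U W :: "complex \<Rightarrow> complex" and \<tau> :: complex
  assumes \<tau>: "Im \<tau> > 0" and U: "continuous_on UNIV U"
    and per: "\<And>z. U (z + 1) = U z" "\<And>z. U (z + \<tau>) = U z"
    and \<Omega>: "open \<Omega>" "connected \<Omega>" and W: "continuous_on \<Omega> W"
    and hol: "(\<lambda>z. U z * exp (- W z)) holomorphic_on \<Omega>"
    and \<Omega>_big: "\<And>s t. \<bar>s\<bar> \<le> 2 \<Longrightarrow> \<bar>t\<bar> \<le> 2 \<Longrightarrow> z0 + of_real s + of_real t * \<tau> \<in> \<Omega>"
    and z1: "z1 \<in> \<Omega>" "U z1 \<noteq> 0"
  shows "U z0 \<noteq> 0"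
proof
  assume z0: "U z0 = 0"
  define h where "h z = U z * exp (- W z)" for z
  \<comment> \<open>Coordinates along the two periods, centred at \<open>z0\<close>: axis-parallel
    unit squares become period parallelograms, and \<open>fi\<close> is the inverse.\<close>
  define f where "f c = z0 + of_real (Re c) + of_real (Im c) * \<tau>" for c
  define fi where "fi z = Complex (Re (z - z0) - Im (z - z0) / Im \<tau> * Re \<tau>) (Im (z - z0) / Im \<tau>)" for z
  have ffi: "f (fi z) = z" and fif: "fi (f c) = c" for z c
    using \<tau> by (auto simp: f_def fi_def complex_eq_iff)
  have f_eq [simp]: "f c = f d \<longleftrightarrow> c = d" for c d using fif by metis
  have bij: "bij f" by (rule bij_betw_byWitness[where f' = fi]) (auto simp: ffi fif)
  have fc: "continuous_on S f" for S unfolding f_def by (intro continuous_intros)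
  have fic: "continuous_on S fi" for S
    unfolding fi_def Complex_eq using \<tau> by (intro continuous_intros) auto
  have hol: "h holomorphic_on \<Omega>" using hol by (simp add: h_def[abs_def])
  have h0: "h z = 0 \<longleftrightarrow> U z = 0" for z by (simp add: h_def)
  define S where "S = f ` box (Complex (-2) (-2)) (Complex 2 2)"
  define S' where "S' = f ` cbox (Complex (-2) (-2)) (Complex 2 2)"
  have SS': "S \<subseteq> S'" unfolding S_def S'_def by (intro image_mono box_subset_cbox)
  have S'\<Omega>: "S' \<subseteq> \<Omega>" unfolding S'_def f_def using \<Omega>_big by (auto simp: in_cbox_complex_iff abs_le_iff)
  have "compact S'" unfolding S'_def by (intro compact_continuous_image fc compact_cbox)
  have "open S" unfolding S_def by (rule invariance_of_domain_gen) (auto intro: fc simp: inj_on_def)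
  have "connected S" unfolding S_def by (intro connected_continuous_image fc convex_connected) simp
  \<comment> \<open>\<open>h\<close> vanishes at \<open>z0\<close> but not at \<open>z1\<close>. By
    the identity theorem on the connected \<Omega> the compact \<open>S'\<close> then contains
    finitely many zeros.\<close>
  have nconst: "\<not> h constant_on \<Omega>"
  proof
    assume "h constant_on \<Omega>"
    moreover have "z0 \<in> \<Omega>" using \<Omega>_big[of 0 0] by simp
    ultimately show False using z0 z1 h0 by (metis constant_on_def)
  qed
  have fin: "finite {z\<in>S'. h z = 0}"
    by (rule holomorphic_compact_finite_zeros[OF hol \<Omega> \<open>compact S'\<close> S'\<Omega> nconst])
  \<comment> \<open>Finitely many zeros forbid finitely many positions of the sides. The range from
    -1 to 0 keeps the coordinate 0 of \<open>z0\<close> strictly between \<open>\<alpha>\<close> and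
    \<open>\<alpha> + 1\<close>; \<open>\<beta>\<close> is chosen likewise for the other
    direction.\<close>
  obtain \<alpha> where \<alpha>: "-1 < \<alpha>" "\<alpha> < 0" "\<And>z. z \<in> S' \<Longrightarrow> h z = 0 \<Longrightarrow> Re (fi z) \<noteq> \<alpha>" "\<And>z. z \<in> S' \<Longrightarrow> h z = 0 \<Longrightarrow> Re (fi z) \<noteq> \<alpha> + 1"
  proof -
    have "infinite ({-1<..<0::real} - ((\<lambda>z. Re (fi z)) ` {z\<in>S'. h z = 0} \<union> (\<lambda>z. Re (fi z) - 1) ` {z\<in>S'. h z = 0}))"
      using fin by (intro Diff_infinite_finite) auto
    then obtain \<alpha> where "\<alpha> \<in> {-1<..<0::real} - ((\<lambda>z. Re (fi z)) ` {z\<in>S'. h z = 0} \<union> (\<lambda>z. Re (fi z) - 1) ` {z\<in>S'. h z = 0})"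
      using infinite_imp_nonempty by blast
    then show ?thesis by (intro that[of \<alpha>]) (auto simp: image_iff)
  qed
  obtain \<beta> where \<beta>: "-1 < \<beta>" "\<beta> < 0" "\<And>z. z \<in> S' \<Longrightarrow> h z = 0 \<Longrightarrow> Im (fi z) \<noteq> \<beta>" "\<And>z. z \<in> S' \<Longrightarrow> h z = 0 \<Longrightarrow> Im (fi z) \<noteq> \<beta> + 1"
  proof -
    have "infinite ({-1<..<0::real} - ((\<lambda>z. Im (fi z)) ` {z\<in>S'. h z = 0} \<union> (\<lambda>z. Im (fi z) - 1) ` {z\<in>S'. h z = 0}))"
      using fin by (intro Diff_infinite_finite) auto
    then obtain \<beta> where "\<beta> \<in> {-1<..<0::real} - ((\<lambda>z. Im (fi z)) ` {z\<in>S'. h z = 0} \<union> (\<lambda>z. Im (fi z) - 1) ` {z\<in>S'. h z = 0})"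
      using infinite_imp_nonempty by blast
    then show ?thesis by (intro that[of \<beta>]) (auto simp: image_iff)
  qed
  define R where "R = rectpath (Complex \<alpha> \<beta>) (Complex (\<alpha> + 1) (\<beta> + 1))"
  define \<gamma> where "\<gamma> = f \<circ> R"
  define A where "A = f (Complex \<alpha> \<beta>)"
  have f_line: "f \<circ> linepath c d = linepath (f c) (f d)" for c d
    by (auto simp: fun_eq_iff linepath_def f_def scaleR_conv_of_real algebra_simps)
  have fA: "f (Complex (\<alpha> + 1) \<beta>) = A + 1" "f (Complex (\<alpha> + 1) (\<beta> + 1)) = A + 1 + \<tau>" "f (Complex \<alpha> (\<beta> + 1)) = A + \<tau>"
    by (auto simp: A_def f_def algebra_simps)
  have \<gamma>_eq: "\<gamma> = linepath A (A + 1) +++ linepath (A + 1) (A + 1 + \<tau>) +++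
            linepath (A + 1 + \<tau>) (A + \<tau>) +++ linepath (A + \<tau>) A"
    by (simp add: \<gamma>_def R_def rectpath_def Let_def path_compose_join f_line fA flip: A_def)
  have "valid_path \<gamma>" unfolding \<gamma>_eq by (intro valid_path_join) auto
  have loop: "pathfinish \<gamma> = pathstart \<gamma>" by (simp add: \<gamma>_eq)
  have PR: "path_image R = {z. Re z \<in> {\<alpha>, \<alpha> + 1} \<and> Im z \<in> {\<beta>..\<beta> + 1}} \<union> {z. Im z \<in> {\<beta>, \<beta> + 1} \<and> Re z \<in> {\<alpha>..\<alpha> + 1}}"
    unfolding R_def by (subst path_image_rectpath) auto
  have P\<gamma>: "path_image \<gamma> = f ` path_image R" by (simp add: \<gamma>_def path_image_compose)
  have PS: "path_image \<gamma> \<subseteq> S"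
    unfolding P\<gamma> S_def PR using \<alpha>(1,2) \<beta>(1,2) by (intro image_mono) (auto simp: in_box_complex_iff)
  have Pnz: "h z \<noteq> 0" if zP: "z \<in> path_image \<gamma>" for z
  proof
    assume "h z = 0"
    obtain c where c: "c \<in> path_image R" "z = f c" using zP P\<gamma> by auto
    have "z \<in> S'" using zP PS SS' by blast
    then show False using \<alpha>(3,4)[of z] \<beta>(3,4)[of z] \<open>h z = 0\<close> c by (auto simp: PR fif)
  qed
  obtain n where n: "n \<noteq> 0"
    and n1: "\<And>x0 x1 y0 y1 c. x0 < x1 \<Longrightarrow> y0 < y1 \<Longrightarrow> x0 \<ge> - 2 \<Longrightarrow> x1 \<le> 2 \<Longrightarrow> y0 \<ge> - 2 \<Longrightarrow> y1 \<le> 2 \<Longrightarrow>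
       c \<in> box (Complex x0 y0) (Complex x1 y1) \<Longrightarrow>
       winding_number (f \<circ> rectpath (Complex x0 y0) (Complex x1 y1)) (f c) = n"
    and n0: "\<And>x0 x1 y0 y1 c. x0 \<le> x1 \<Longrightarrow> y0 \<le> y1 \<Longrightarrow> c \<notin> cbox (Complex x0 y0) (Complex x1 y1) \<Longrightarrow>
       winding_number (f \<circ> rectpath (Complex x0 y0) (Complex x1 y1)) (f c) = 0"
    using winding_number_homeomorphic_rectpath[OF bij fc, of 2] by blast
  define B where "B = cbox (Complex \<alpha> \<beta>) (Complex (\<alpha> + 1) (\<beta> + 1))"
  \<comment> \<open>Every zero inside counts with the same nonzero index \<open>n\<close>, so no
    cancellation between zeros can occur.\<close>
  have wn: "winding_number \<gamma> z = (if fi z \<in> B then n else 0)" if "z \<notin> path_image \<gamma>" for z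
  proof (cases "fi z \<in> B")
    case True
    moreover have "fi z \<notin> path_image R" using that ffi[of z] unfolding P\<gamma> by (metis imageI)
    ultimately have "fi z \<in> box (Complex \<alpha> \<beta>) (Complex (\<alpha> + 1) (\<beta> + 1))"
      unfolding PR B_def by (auto simp: in_cbox_complex_iff in_box_complex_iff)
    then show ?thesis using n1[of \<alpha> "\<alpha> + 1" \<beta> "\<beta> + 1" "fi z"] \<alpha>(1,2) \<beta>(1,2) True
      by (simp add: \<gamma>_def R_def ffi)
  next
    case False
    then show ?thesis using n0[of \<alpha> "\<alpha> + 1" \<beta> "\<beta> + 1" "fi z"] by (simp add: \<gamma>_def R_def ffi B_def)
  qed
  have "contour_integral \<gamma> (\<lambda>x. deriv h x * 1 / h x)
     = 2 * pi * \<i> * (\<Sum>p\<in>{w\<in>S. h w = 0 \<or> w \<in> {}}. winding_number \<gamma> p * 1 * zorder h p)"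
  proof (rule argument_principle[OF \<open>open S\<close> \<open>connected S\<close> _ _ \<open>valid_path \<gamma>\<close> loop])
    show "h holomorphic_on S - {}" using hol SS' S'\<Omega> holomorphic_on_subset by (metis Diff_empty subset_trans)
    show "path_image \<gamma> \<subseteq> S - {w\<in>S. h w = 0 \<or> w \<in> {}}" using PS Pnz by auto
    show "\<forall>z. z \<notin> S \<longrightarrow> winding_number \<gamma> z = 0"
    proof (intro allI impI)
      fix z assume z: "z \<notin> S"
      have "fi z \<notin> B"
      proof
        assume "fi z \<in> B"
        then have "fi z \<in> box (Complex (-2) (-2)) (Complex 2 2)"
          using \<alpha>(1,2) \<beta>(1,2) by (auto simp: B_def in_cbox_complex_iff in_box_complex_iff)
        then show False using z ffi[of z] by (metis S_def imageI)
      qed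
      then show "winding_number \<gamma> z = 0" using wn[of z] z PS by auto
    qed
    show "finite {w\<in>S. h w = 0 \<or> w \<in> {}}" by (rule finite_subset[OF _ fin]) (use SS' in auto)
  qed auto
  also have "(\<Sum>p\<in>{w\<in>S. h w = 0 \<or> w \<in> {}}. winding_number \<gamma> p * 1 * zorder h p)
    = n * of_int (\<Sum>p\<in>{w\<in>S. h w = 0 \<and> fi w \<in> B}. zorder h p)"
  proof -
    have fS: "finite {w\<in>S. h w = 0}" by (rule finite_subset[OF _ fin]) (use SS' in auto)
    have "(\<Sum>p\<in>{w\<in>S. h w = 0 \<or> w \<in> {}}. winding_number \<gamma> p * 1 * zorder h p)
       = (\<Sum>p\<in>{w\<in>S. h w = 0}. if fi p \<in> B then n * zorder h p else 0)"
    proof (rule sum.cong)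
      fix p assume "p \<in> {w\<in>S. h w = 0}"
      then have "p \<notin> path_image \<gamma>" using Pnz[of p] by auto
      then show "winding_number \<gamma> p * 1 * zorder h p = (if fi p \<in> B then n * zorder h p else 0)"
        by (simp add: wn)
    qed auto
    also have "\<dots> = (\<Sum>p\<in>{w\<in>S. h w = 0 \<and> fi w \<in> B}. n * zorder h p)"
      using fS by (simp add: sum.inter_filter[symmetric] Collect_conj_eq Int_assoc conj_assoc cong: conj_cong)
    finally show ?thesis by (simp add: sum_distrib_left)
  qed
  finally have eq: "contour_integral \<gamma> (\<lambda>x. deriv h x * 1 / h x)
     = 2 * pi * \<i> * (n * of_int (\<Sum>p\<in>{w\<in>S. h w = 0 \<and> fi w \<in> B}. zorder h p))" .
  \<comment> \<open>All orders are positive because \<open>h\<close> is holomorphic, and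
    \<open>z0\<close> is one of the zeros in the parallelogram.\<close>
  have "(\<Sum>p\<in>{w\<in>S. h w = 0 \<and> fi w \<in> B}. zorder h p) > 0"
  proof -
    have pos: "zorder h p > 0" if "p \<in> S" "h p = 0" for p
      using zorder_exist_zero[OF hol \<Omega>, of p] that SS' S'\<Omega> z1 h0 by (auto simp: subset_iff)
    have fS: "finite {w\<in>S. h w = 0 \<and> fi w \<in> B}" by (rule finite_subset[OF _ fin]) (use SS' in auto)
    have fi0: "fi z0 = 0" by (simp add: fi_def complex_eq_iff)
    have "z0 \<in> S" unfolding S_def by (rule image_eqI[of _ _ 0]) (auto simp: f_def in_box_complex_iff)
    then have "z0 \<in> {w\<in>S. h w = 0 \<and> fi w \<in> B}"
      using z0 h0 \<alpha>(1,2) \<beta>(1,2) by (auto simp: fi0 B_def in_cbox_complex_iff)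
    then show ?thesis using fS pos by (intro sum_pos2[of _ z0]) (auto intro: less_imp_le)
  qed
  then have "contour_integral \<gamma> (\<lambda>x. deriv h x * 1 / h x) \<noteq> 0"
    unfolding eq using n by (simp del: of_int_sum)
  \<comment> \<open>Up to 2 \<pi> i the integral of the logarithmic derivative is the winding number
    of \<open>h \<circ> \<gamma>\<close> around 0, which equals that of
    \<open>U \<circ> \<gamma>\<close>, and periodicity makes the latter zero.\<close>
  moreover have "contour_integral \<gamma> (\<lambda>x. deriv h x * 1 / h x) = 0"
  proof -
    have an: "h analytic_on S" using hol SS' S'\<Omega> \<open>open S\<close> analytic_on_open holomorphic_on_subset by (meson subset_trans)
    have hS: "h holomorphic_on S" using an analytic_imp_holomorphic by blast
    have vp: "valid_path (h \<circ> \<gamma>)"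
      by (rule valid_path_compose_holomorphic[OF \<open>valid_path \<gamma>\<close> hS \<open>open S\<close> PS])
    have "winding_number (h \<circ> \<gamma>) 0 = winding_number (U \<circ> \<gamma>) 0"
      unfolding h_def[abs_def]
    proof (rule winding_number_mult_exp[of S'])
      show "continuous_on S' U" using U continuous_on_subset by blast
      show "continuous_on S' W" using W S'\<Omega> continuous_on_subset by blast
      show "path \<gamma>" using \<open>valid_path \<gamma>\<close> by (rule valid_path_imp_path)
      show "path_image \<gamma> \<subseteq> S'" using PS SS' by blast
    qed (use loop Pnz h0 in auto)
    also have "\<dots> = 0"
      unfolding \<gamma>_eq
    proof (rule winding_number_doubly_periodic[OF U per])
      show "U z \<noteq> 0" if "z \<in> closed_segment A (A + 1)" for z
        using that Pnz[of z] h0 by (auto simp: \<gamma>_eq path_image_join)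
      show "U z \<noteq> 0" if "z \<in> closed_segment A (A + \<tau>)" for z
        using that Pnz[of z] h0 by (auto simp: \<gamma>_eq path_image_join closed_segment_commute)
    qed
    finally have "winding_number (h \<circ> \<gamma>) 0 = 0" .
    moreover have "0 \<notin> path_image (h \<circ> \<gamma>)" using Pnz by (auto simp: path_image_compose)
    ultimately have "contour_integral (h \<circ> \<gamma>) (\<lambda>w. 1 / w) = 0"
      using winding_number_valid_path[OF vp, of 0] by simp
    moreover have "contour_integral (h \<circ> \<gamma>) (\<lambda>w. 1 / w) = contour_integral \<gamma> (\<lambda>w. deriv h w * (1 / h w))"
      by (rule contour_integral_comp_analyticW[OF an \<open>valid_path \<gamma>\<close> PS])
    ultimately show ?thesis by simp
  qed
  ultimately show False by contradiction
qed

subsection \<open>Normal forms and the measure of sublevel sets\<close>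

text \<open>One format for characteristic points, with \<open>lam x\<close> equal to |x|^\<sigma>,
  and for all other points, with \<sigma> = 0 and \<open>lam\<close> constant.
  \<open>Lam_lower\<close> is a quantitative monotonicity: where the weight vanishes,
  \<open>Lam\<close> has no linear lower bound.\<close>

locale normal_chart =
  fixes a b :: "real \<times> real \<Rightarrow> complex" and \<sigma> :: real and p0 :: "real \<times> real" and S :: "(real \<times> real) set"
    and s t sx sy tx ty :: "real \<times> real \<Rightarrow> real" and lam Lam :: "real \<Rightarrow> real" and c :: real and m :: "real \<times> real \<Rightarrow> complex"
  assumes S: "open S" "p0 \<in> S"
    and ds: "\<And>p. p \<in> S \<Longrightarrow> (s has_derivative dform (sx p) (sy p)) (at p)"
    and dt: "\<And>p. p \<in> S \<Longrightarrow> (t has_derivative dform (tx p) (ty p)) (at p)"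
    and cont: "continuous_on S sx" "continuous_on S sy" "continuous_on S tx" "continuous_on S ty"
    and det: "\<And>p. p \<in> S \<Longrightarrow> sx p * ty p - sy p * tx p \<noteq> 0"
    and Lam: "\<And>x. (Lam has_real_derivative lam x) (at x)" "\<And>x. lam x \<ge> 0"
    and \<sigma>: "\<sigma> \<ge> 0" and c: "c > 0" and Lam_lower: "\<And>x y. c * \<bar>x - y\<bar> powr (1 + \<sigma>) \<le> \<bar>Lam x - Lam y\<bar>"
    and m: "continuous (at p0) m" "m p0 \<noteq> 0"
    and form: "\<And>p h. p \<in> S \<Longrightarrow> dform (a p) (b p) h =
       m p * (of_real (dform (sx p) (sy p) h) + \<i> * of_real (lam (t p) * dform (tx p) (ty p) h))"
begin

text \<open>The model first integral: dW = ds + i \<open>lam (t p)\<close> dt, so the given form is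
  \<open>m p\<close> times dW.\<close>

definition W where "W p = Complex (s p) (Lam (t p))"

lemma increment:
  assumes F: "\<And>p. p \<in> S \<Longrightarrow> (F has_derivative dform (v p * a p) (v p * b p)) (at p)"
    and v: "continuous (at p0) v" and e: "e > 0"
  shows "\<exists>r>0. \<forall>p\<in>ball p0 r. \<forall>q\<in>ball p0 r. norm (F q - F p - v p0 * m p0 * (W q - W p)) \<le> e * norm (W q - W p)"
  unfolding W_def
proof (rule primitive_increment[where k = "\<lambda>p. v p * m p", OF S ds dt cont det Lam _ _ e])
  show "continuous (at p0) (\<lambda>p. v p * m p)" using v m(1) by (rule continuous_mult)
  show "(F has_derivative (\<lambda>h. v p * m p * (of_real (dform (sx p) (sy p) h) + \<i> * of_real (lam (t p) * dform (tx p) (ty p) h)))) (at p)"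
    if p: "p \<in> S" for p
  proof -
    have "dform (v p * a p) (v p * b p) = (\<lambda>h. v p * dform (a p) (b p) h)"
      by (auto simp: dform_def fun_eq_iff algebra_simps scaleR_conv_of_real)
    then show ?thesis using F[OF p] by (simp add: form[OF p] mult.assoc)
  qed
qed

lemma coords_le_norm_W: "\<bar>s q - s p\<bar> \<le> norm (W q - W p)" "c * \<bar>t q - t p\<bar> powr (1 + \<sigma>) \<le> norm (W q - W p)"
proof -
  show "\<bar>s q - s p\<bar> \<le> norm (W q - W p)"
    using abs_Re_le_cmod[of "W q - W p"] by (simp add: W_def)
  show "c * \<bar>t q - t p\<bar> powr (1 + \<sigma>) \<le> norm (W q - W p)"
    using abs_Im_le_cmod[of "W q - W p"] Lam_lower[of "t q" "t p"] by (simp add: W_def)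
qed

context
  fixes Z assumes Z: "\<And>p. (Z has_derivative dform (a p) (b p)) (at p)"
begin

text \<open>The increment of \<open>Z\<close> is \<open>m p0\<close> times that of \<open>W\<close>,
  up to an error of at most half that size.\<close>

lemma norm_W_le: "\<exists>r>0. \<forall>p\<in>ball p0 r. \<forall>q\<in>ball p0 r. norm (m p0) / 2 * norm (W q - W p) \<le> norm (Z q - Z p)"
proof -
  have m0: "norm (m p0) / 2 > 0" using m by simp
  obtain r where r: "r > 0" and *: "\<And>p q. p \<in> ball p0 r \<Longrightarrow> q \<in> ball p0 r \<Longrightarrow>
      norm (Z q - Z p - m p0 * (W q - W p)) \<le> norm (m p0) / 2 * norm (W q - W p)"
    using increment[of Z "\<lambda>_. 1", OF _ _ m0] Z by auto
  have "norm (m p0) / 2 * norm (W q - W p) \<le> norm (Z q - Z p)" if "p \<in> ball p0 r" "q \<in> ball p0 r" for p q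
    using *[OF that] norm_triangle_ineq3[of "Z q - Z p" "m p0 * (W q - W p)"] by (simp add: norm_mult) 
  then show ?thesis using r by blast
qed

text \<open>Two consequences are drawn from these bounds for pairs of points: equal values of
  \<open>Z\<close> force equal coordinates, which is local injectivity, and a small difference of
  values confines the second point to a thin box, which is the measure estimate.\<close>

lemma chart_lower_bounds:
  "\<exists>r>0. \<exists>c0>0. \<exists>c1>0. \<forall>p\<in>ball p0 r. \<forall>q\<in>ball p0 r. norm (q - p) \<le> c0 * (\<bar>s q - s p\<bar> + \<bar>t q - t p\<bar>) \<and>
     c1 * \<bar>s q - s p\<bar> \<le> norm (Z q - Z p) \<and> c1 * \<bar>t q - t p\<bar> powr (1 + \<sigma>) \<le> norm (Z q - Z p)"
proof -
  obtain r1 where r1: "r1 > 0" and 1: "\<And>p q. p \<in> ball p0 r1 \<Longrightarrow> q \<in> ball p0 r1 \<Longrightarrow>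
      norm (m p0) / 2 * norm (W q - W p) \<le> norm (Z q - Z p)"
    using norm_W_le by blast
  have ca: "continuous (at p0) sx" "continuous (at p0) sy" "continuous (at p0) tx" "continuous (at p0) ty"
    using cont S by (auto simp: continuous_on_eq_continuous_at)
  obtain r2 c0 where r2: "r2 > 0" "c0 > 0" and 2: "\<And>p q. p \<in> ball p0 r2 \<Longrightarrow> q \<in> ball p0 r2 \<Longrightarrow>
      norm (q - p) \<le> c0 * (\<bar>s q - s p\<bar> + \<bar>t q - t p\<bar>)"
    using coords_lower_bound[OF S ds dt ca det[OF S(2)]] by blast
  define c1 where "c1 = norm (m p0) / 2 * min 1 c"
  have m0: "norm (m p0) / 2 > 0" using m by simp
  have c1: "c1 > 0" using m0 c by (auto simp: c1_def)
  have "c1 * \<bar>s q - s p\<bar> \<le> norm (Z q - Z p) \<and> c1 * \<bar>t q - t p\<bar> powr (1 + \<sigma>) \<le> norm (Z q - Z p)"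
    if pq: "p \<in> ball p0 r1" "q \<in> ball p0 r1" for p q
  proof
    have "min 1 c * \<bar>s q - s p\<bar> \<le> 1 * \<bar>s q - s p\<bar>" by (intro mult_right_mono) auto
    then have "min 1 c * \<bar>s q - s p\<bar> \<le> norm (W q - W p)" using coords_le_norm_W(1)[of q p] by simp
    then have "c1 * \<bar>s q - s p\<bar> \<le> norm (m p0) / 2 * norm (W q - W p)"
      unfolding c1_def mult.assoc using m0 by (intro mult_left_mono) auto
    then show "c1 * \<bar>s q - s p\<bar> \<le> norm (Z q - Z p)" using 1[OF pq] by simp
    have "min 1 c * \<bar>t q - t p\<bar> powr (1 + \<sigma>) \<le> c * \<bar>t q - t p\<bar> powr (1 + \<sigma>)" by (intro mult_right_mono) auto
    then have "min 1 c * \<bar>t q - t p\<bar> powr (1 + \<sigma>) \<le> norm (W q - W p)" using coords_le_norm_W(2)[of q p] by simp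
    then have "c1 * \<bar>t q - t p\<bar> powr (1 + \<sigma>) \<le> norm (m p0) / 2 * norm (W q - W p)"
      unfolding c1_def mult.assoc using m0 by (intro mult_left_mono) auto
    then show "c1 * \<bar>t q - t p\<bar> powr (1 + \<sigma>) \<le> norm (Z q - Z p)" using 1[OF pq] by simp
  qed
  then show ?thesis using r1 r2 c1 2
    by (intro exI[of _ "min r1 r2"] conjI exI[of _ c0] exI[of _ c1] ballI) auto
qed

lemma chart_locally_injective: "\<exists>r>0. inj_on Z (ball p0 r)"
proof -
  obtain r c0 c1 where r: "r > 0" "c1 > 0" and *: "\<And>p q. p \<in> ball p0 r \<Longrightarrow> q \<in> ball p0 r \<Longrightarrow>
     norm (q - p) \<le> c0 * (\<bar>s q - s p\<bar> + \<bar>t q - t p\<bar>) \<and>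
     c1 * \<bar>s q - s p\<bar> \<le> norm (Z q - Z p) \<and> c1 * \<bar>t q - t p\<bar> powr (1 + \<sigma>) \<le> norm (Z q - Z p)"
    using chart_lower_bounds by blast
  have "inj_on Z (ball p0 r)"
  proof (rule inj_onI)
    fix p q assume pq: "p \<in> ball p0 r" "q \<in> ball p0 r" "Z p = Z q"
    have "s q = s p" using *[OF pq(1,2)] pq(3) r(2) by (simp add: mult_le_0_iff)
    moreover have "t q = t p" using *[OF pq(1,2)] pq(3) r(2) by (simp add: mult_le_0_iff)
    ultimately show "p = q" using *[OF pq(1,2)] by simp
  qed
  then show ?thesis using r by blast
qed

text \<open>The increments of \<open>F\<close> and \<open>Z\<close> from \<open>p0\<close> are that
  of \<open>W\<close> times \<open>v p0 * m p0\<close> and \<open>m p0\<close>, with errors small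
  relative to \<open>W\<close>, while \<open>norm_W_le\<close> keeps the denominator from being
  small relative to \<open>W\<close>.\<close>

lemma chart_primitive_quotient:
  assumes F: "\<And>p. p \<in> S' \<Longrightarrow> (F has_derivative dform (v p * a p) (v p * b p)) (at p)"
    and S': "open S'" "p0 \<in> S'" and v: "continuous_on S' v"
  shows "((\<lambda>p. (F p - F p0) / (Z p - Z p0)) \<longlongrightarrow> v p0) (at p0)"
proof -
  \<comment> \<open>The same chart cut down to the domain of the primitive, so that
    \<open>increment\<close> applies to \<open>F\<close>.\<close>
  interpret N: normal_chart a b \<sigma> p0 "S \<inter> S'" s t sx sy tx ty lam Lam c m
    using S S' ds dt cont det Lam \<sigma> c Lam_lower m form
    by unfold_locales (auto intro: continuous_on_subset)
  have vc: "continuous (at p0) v" using v S' by (simp add: continuous_on_eq_continuous_at)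
  have m0: "norm (m p0) > 0" using m by simp
  obtain r0 where r0: "r0 > 0" and inj: "inj_on Z (ball p0 r0)" using chart_locally_injective by blast
  obtain r1 where r1: "r1 > 0" and 1: "\<And>p q. p \<in> ball p0 r1 \<Longrightarrow> q \<in> ball p0 r1 \<Longrightarrow>
      norm (m p0) / 2 * norm (W q - W p) \<le> norm (Z q - Z p)"
    using norm_W_le by blast
  show ?thesis
  proof (rule tendstoI)
    fix e :: real assume e: "e > 0"
    \<comment> \<open>The two errors contribute \<open>d\<close> and \<open>norm (v p0) * d\<close>;
      the choice makes their sum (e/2) (|m p0|/2), where |m p0|/2 is the constant of
      \<open>norm_W_le\<close>.\<close>
    define d where "d = e * norm (m p0) / (4 * (1 + norm (v p0)))"
    have d: "d > 0" using e m0 by (auto simp: d_def intro!: divide_pos_pos mult_pos_pos add_pos_nonneg)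
    have F': "\<And>p. p \<in> S \<inter> S' \<Longrightarrow> (F has_derivative dform (v p * a p) (v p * b p)) (at p)" using F by blast
    obtain r2 where r2: "r2 > 0" and 2: "\<And>p q. p \<in> ball p0 r2 \<Longrightarrow> q \<in> ball p0 r2 \<Longrightarrow>
       norm (F q - F p - v p0 * m p0 * (W q - W p)) \<le> d * norm (W q - W p)"
      using N.increment[OF F' vc d] unfolding W_def N.W_def by blast
    obtain r3 where r3: "r3 > 0" and 3: "\<And>p q. p \<in> ball p0 r3 \<Longrightarrow> q \<in> ball p0 r3 \<Longrightarrow>
       norm (Z q - Z p - m p0 * (W q - W p)) \<le> d * norm (W q - W p)"
      using increment[of Z "\<lambda>_. 1", OF _ _ d] Z by auto
    define r where "r = min (min r0 r1) (min r2 r3)"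
    have "r > 0" using r0 r1 r2 r3 by (simp add: r_def)
    moreover have "dist ((F p - F p0) / (Z p - Z p0)) (v p0) < e" if p: "p \<noteq> p0" "dist p p0 < r" for p
    proof -
      have inb: "p \<in> ball p0 r0" "p0 \<in> ball p0 r0" "p \<in> ball p0 r1" "p0 \<in> ball p0 r1" "p \<in> ball p0 r2" "p0 \<in> ball p0 r2"
         "p \<in> ball p0 r3" "p0 \<in> ball p0 r3"
        using p r0 r1 r2 r3 by (auto simp: r_def dist_commute)
      have Zne: "Z p \<noteq> Z p0" using inj inb p(1) by (metis inj_onD)
      define w where "w = norm (W p - W p0)"
      define z where "z = norm (Z p - Z p0)"
      have z: "z > 0" using Zne by (simp add: z_def)
      have wz: "norm (m p0) / 2 * w \<le> z" using 1[of p0 p] inb by (simp add: w_def z_def)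
      have "norm (F p - F p0 - v p0 * (Z p - Z p0)) =
        norm ((F p - F p0 - v p0 * m p0 * (W p - W p0)) - v p0 * (Z p - Z p0 - m p0 * (W p - W p0)))"
        by (simp add: algebra_simps)
      also have "\<dots> \<le> d * w + norm (v p0) * (d * w)"
      proof (rule order_trans[OF norm_triangle_ineq4 add_mono])
        show "norm (F p - F p0 - v p0 * m p0 * (W p - W p0)) \<le> d * w"
          unfolding w_def by (rule 2[OF inb(6,5)])
        show "norm (v p0 * (Z p - Z p0 - m p0 * (W p - W p0))) \<le> norm (v p0) * (d * w)"
          unfolding w_def norm_mult by (rule mult_left_mono[OF 3[OF inb(8,7)]]) simp
      qed
      also have "\<dots> = e / 2 * (norm (m p0) / 2 * w)"
      proof -
        have "1 + norm (v p0) > 0" by (simp add: add_pos_nonneg)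
        then show ?thesis by (simp add: d_def divide_simps) (simp add: algebra_simps)
      qed
      also have "\<dots> \<le> e / 2 * z" using wz e by (intro mult_left_mono) auto
      finally have "norm (F p - F p0 - v p0 * (Z p - Z p0)) \<le> e / 2 * z" .
      then have "norm (F p - F p0 - v p0 * (Z p - Z p0)) / z \<le> e / 2"
        using z by (simp add: pos_divide_le_eq)
      moreover have "(F p - F p0) / (Z p - Z p0) - v p0 = (F p - F p0 - v p0 * (Z p - Z p0)) / (Z p - Z p0)"
        using Zne by (simp add: diff_divide_distrib)
      ultimately have "norm ((F p - F p0) / (Z p - Z p0) - v p0) \<le> e / 2"
        by (simp only: norm_divide z_def)
      then show ?thesis using e by (simp add: dist_norm)
    qed
    ultimately show "\<forall>\<^sub>F x in at p0. dist ((F x - F p0) / (Z x - Z p0)) (v p0) < e"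
      unfolding eventually_at by blast
  qed
qed

end

end

section \<open>Measure of sublevel sets and integrability of the kernel\<close>

lemma emeasure_square:
  fixes q :: "real \<times> real"
  assumes "r \<ge> 0"
  shows "emeasure lborel (cbox (q - (r, r)) (q + (r, r))) = ennreal ((2 * r) ^ 2)"
proof -
  obtain x y where q: "q = (x, y)" by (cases q)
  have "cbox (q - (r, r)) (q + (r, r)) = {x - r..x + r} \<times> {y - r..y + r}" by (simp add: q cbox_Pair_eq)
  then have "emeasure lborel (cbox (q - (r, r)) (q + (r, r))) = emeasure (lborel \<Otimes>\<^sub>M lborel) ({x - r..x + r} \<times> {y - r..y + r})"
    by (simp add: lborel_prod)
  also have "\<dots> = ennreal (2 * r) * ennreal (2 * r)"
    using assms by (subst lborel.emeasure_pair_measure_Times) auto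
  finally show ?thesis using assms by (simp add: power2_eq_square flip: ennreal_mult)
qed

text \<open>The sublevel set lies in a \<open>\<delta> \<times> \<delta> powr (1 / (1 + \<sigma>))\<close> box of the chart, which is cut into squares
  of side \<open>\<delta>\<close>; the inverse chart is Lipschitz.\<close>

lemma sublevel_measure_local:
  fixes Z :: "real \<times> real \<Rightarrow> complex" and s t :: "real \<times> real \<Rightarrow> real"
  assumes Zc: "continuous_on UNIV Z" and \<sigma>: "\<sigma> \<ge> 0" and pos: "c0 > 0" "c1 > 0"
    and bd: "\<And>p q. p \<in> B \<Longrightarrow> q \<in> B \<Longrightarrow> norm (q - p) \<le> c0 * (\<bar>s q - s p\<bar> + \<bar>t q - t p\<bar>) \<and>
     c1 * \<bar>s q - s p\<bar> \<le> norm (Z q - Z p) \<and> c1 * \<bar>t q - t p\<bar> powr (1 + \<sigma>) \<le> norm (Z q - Z p)"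
  shows "\<exists>C>0. \<forall>p\<in>B. \<forall>\<delta>\<in>{0<..1}. \<forall>E\<in>sets lborel. E \<subseteq> {q\<in>B. norm (Z p - Z q) \<le> \<delta>} \<longrightarrow>
     emeasure lborel E \<le> ennreal (C * \<delta> powr (1 + 1 / (1 + \<sigma>)))"
proof -
  define k where "k = 1 / (1 + \<sigma>)"
  have k: "0 < k" "k \<le> 1" using \<sigma> by (auto simp: k_def)
  \<comment> \<open>Inside one strip s varies by at most 2 \<delta>/c1 and t by at most \<delta>, so
    \<open>L * \<delta>\<close> bounds the diameter.\<close>
  define L where "L = c0 * (2 / c1 + 1)"
  define A where "A = (1 / c1) powr k"
  have L: "L > 0" using pos by (auto simp: L_def intro!: mult_pos_pos add_pos_pos)
  have A: "A > 0" using pos by (simp add: A_def)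
  \<comment> \<open>There are at most 2 \<eta>/\<delta> + 1 strips with \<eta> = A \<delta>^k, each
    inside a square of side 2 L \<delta>. The lone 1 is harmless because \<delta>^2 \<le>
    \<delta>^(1+k).\<close>
  define C where "C = (2 * A + 1) * (2 * L) ^ 2"
  have "emeasure lborel E \<le> ennreal (C * \<delta> powr (1 + k))"
    if p: "p \<in> B" and \<delta>: "0 < \<delta>" "\<delta> \<le> 1" and E: "E \<in> sets lborel" "E \<subseteq> {q\<in>B. norm (Z p - Z q) \<le> \<delta>}" for p \<delta> E
  proof -
    define \<eta> where "\<eta> = A * \<delta> powr k"
    have \<eta>: "\<eta> > 0" using A \<delta> by (simp add: \<eta>_def)
    have sE: "\<bar>s q - s p\<bar> \<le> \<delta> / c1" and tE: "\<bar>t q - t p\<bar> \<le> \<eta>" if q: "q \<in> E" for q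
    proof -
      have q': "q \<in> B" "norm (Z q - Z p) \<le> \<delta>" using q E(2) by (auto simp: norm_minus_commute)
      show "\<bar>s q - s p\<bar> \<le> \<delta> / c1" using bd[OF p q'(1)] q'(2) pos by (auto simp: field_simps)
      have "\<bar>t q - t p\<bar> powr (1 + \<sigma>) \<le> \<delta> / c1" using bd[OF p q'(1)] q'(2) pos by (auto simp: field_simps)
      then have "(\<bar>t q - t p\<bar> powr (1 + \<sigma>)) powr k \<le> (\<delta> / c1) powr k" using k by (intro powr_mono2) auto
      moreover have "(\<bar>t q - t p\<bar> powr (1 + \<sigma>)) powr k = \<bar>t q - t p\<bar>"
        using \<sigma> by (simp add: powr_powr k_def powr_one_eq_one)
      moreover have "(\<delta> / c1) powr k = \<eta>"
        using \<delta> pos powr_mult[of "1 / c1" \<delta> k] by (simp add: \<eta>_def A_def)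
      ultimately show "\<bar>t q - t p\<bar> \<le> \<eta>" by simp
    qed
    define j where "j q = nat \<lfloor>(t q - t p + \<eta>) / \<delta>\<rfloor>" for q
    define n where "n = nat \<lfloor>2 * \<eta> / \<delta>\<rfloor>"
    have jn: "j q \<le> n" if "q \<in> E" for q
      unfolding j_def n_def using tE[OF that] \<delta> by (intro nat_mono floor_mono divide_right_mono) auto
    have close: "norm (q - q') \<le> L * \<delta>" if q: "q \<in> E" "q' \<in> E" "j q = j q'" for q q'
    proof -
      have nn: "(t q - t p + \<eta>) / \<delta> \<ge> 0" "(t q' - t p + \<eta>) / \<delta> \<ge> 0"
        using tE[OF q(1)] tE[OF q(2)] \<delta> by (auto intro!: divide_nonneg_pos)
      then have "\<lfloor>(t q - t p + \<eta>) / \<delta>\<rfloor> = \<lfloor>(t q' - t p + \<eta>) / \<delta>\<rfloor>"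
        using q(3) by (simp add: j_def nat_eq_iff2)
      then have "\<bar>(t q - t p + \<eta>) / \<delta> - (t q' - t p + \<eta>) / \<delta>\<bar> \<le> 1" by linarith
      moreover have "(t q - t p + \<eta>) / \<delta> - (t q' - t p + \<eta>) / \<delta> = (t q - t q') / \<delta>" by (simp add: diff_divide_distrib add_divide_distrib)
      ultimately have "\<bar>(t q - t q') / \<delta>\<bar> \<le> 1" by simp
      then have "\<bar>t q - t q'\<bar> \<le> \<delta>" using \<delta> by (simp add: abs_divide pos_divide_le_eq)
      moreover have "\<bar>s q - s q'\<bar> \<le> 2 * \<delta> / c1" using sE[OF q(1)] sE[OF q(2)] by linarith
      moreover have "norm (q - q') \<le> c0 * (\<bar>s q - s q'\<bar> + \<bar>t q - t q'\<bar>)" using bd[of q' q] q E by auto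
      ultimately have "norm (q - q') \<le> c0 * (2 * \<delta> / c1 + \<delta>)"
        using pos by (meson add_mono mult_left_mono order_trans less_imp_le)
      then show ?thesis by (simp add: L_def algebra_simps)
    qed
    \<comment> \<open>A centre for every strip that meets \<open>E\<close>. For the other strips the
      choice is arbitrary and merely adds a square to the cover.\<close>
    define x where "x i = (SOME q. q \<in> E \<and> j q = i)" for i
    have x: "x (j q) \<in> E \<and> j (x (j q)) = j q" if "q \<in> E" for q
      unfolding x_def by (rule someI[of "\<lambda>q'. q' \<in> E \<and> j q' = j q" q]) (use that in auto)
    have r: "L * \<delta> \<ge> 0" using L \<delta> by simp
    have cover: "E \<subseteq> (\<Union>i\<le>n. cbox (x i - (L * \<delta>, L * \<delta>)) (x i + (L * \<delta>, L * \<delta>)))"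
    proof
      fix q assume q: "q \<in> E"
      have "norm (q - x (j q)) \<le> L * \<delta>" using close[of q "x (j q)"] x[OF q] q by auto
      then have "\<bar>fst q - fst (x (j q))\<bar> \<le> L * \<delta>" "\<bar>snd q - snd (x (j q))\<bar> \<le> L * \<delta>"
        using norm_fst_le[of "fst (q - x (j q))" "snd (q - x (j q))", unfolded prod.collapse]
          norm_snd_le[of "snd (q - x (j q))" "fst (q - x (j q))", unfolded prod.collapse] by auto
      then have "q \<in> cbox (x (j q) - (L * \<delta>, L * \<delta>)) (x (j q) + (L * \<delta>, L * \<delta>))"
        by (cases q, cases "x (j q)") (auto simp: cbox_Pair_eq abs_le_iff)
      then show "q \<in> (\<Union>i\<le>n. cbox (x i - (L * \<delta>, L * \<delta>)) (x i + (L * \<delta>, L * \<delta>)))" using jn[OF q] by blast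
    qed
    have "emeasure lborel E \<le> emeasure lborel (\<Union>i\<le>n. cbox (x i - (L * \<delta>, L * \<delta>)) (x i + (L * \<delta>, L * \<delta>)))"
      by (rule emeasure_mono[OF cover]) auto
    also have "\<dots> \<le> (\<Sum>i\<le>n. emeasure lborel (cbox (x i - (L * \<delta>, L * \<delta>)) (x i + (L * \<delta>, L * \<delta>))))"
      by (rule emeasure_subadditive_finite) auto
    also have "\<dots> = (\<Sum>i\<le>n. ennreal ((2 * (L * \<delta>)) ^ 2))"
      using r by (simp only: emeasure_square)
    also have "\<dots> = ennreal ((\<Sum>i\<le>n. (2 * (L * \<delta>)) ^ 2))" by (rule sum_ennreal) simp
    also have "(\<Sum>i\<le>n. (2 * (L * \<delta>)) ^ 2) = (real n + 1) * ((2 * L) ^ 2 * \<delta> ^ 2)" by (simp add: power_mult_distrib)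
    also have "\<dots> \<le> (2 * \<eta> / \<delta> + 1) * ((2 * L) ^ 2 * \<delta> ^ 2)"
    proof (intro mult_right_mono add_right_mono)
      have "2 * \<eta> / \<delta> \<ge> 0" using \<eta> \<delta> by simp
      then show "real n \<le> 2 * \<eta> / \<delta>" by (simp add: n_def)
    qed auto
    also have "\<dots> = (2 * A * (\<delta> powr k * \<delta>) + \<delta> ^ 2) * (2 * L) ^ 2"
      using \<delta> by (simp add: \<eta>_def divide_simps power2_eq_square) (simp add: algebra_simps)
    also have "\<dots> \<le> (2 * A * \<delta> powr (1 + k) + \<delta> powr (1 + k)) * (2 * L) ^ 2"
    proof (intro mult_right_mono add_mono mult_left_mono)
      show "\<delta> powr k * \<delta> \<le> \<delta> powr (1 + k)" using \<delta> by (simp add: powr_add)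
      have "\<delta> ^ 2 = \<delta> powr 2" using \<delta> by (simp add: powr_numeral)
      also have "\<dots> \<le> \<delta> powr (1 + k)" using \<delta> k by (intro powr_mono') auto
      finally show "\<delta> ^ 2 \<le> \<delta> powr (1 + k)" .
    qed (use A in auto)
    also have "\<dots> = C * \<delta> powr (1 + k)" by (simp add: C_def algebra_simps)
    finally show ?thesis by (simp add: ennreal_leI)
  qed
  moreover have "C > 0" using A L by (simp add: C_def add_pos_pos)
  ultimately show ?thesis unfolding k_def by (intro exI[of _ C]) auto
qed

text \<open>Dyadic shells: where \<phi> lies between 2^-(k+1) and 2^-k its power is at most
  \<open>w k\<close>, and the sublevel bound makes the sum geometric with ratio 2^(\<rho> - \<nu>) <
  1. The part with \<phi> \<ge> 1 contributes at most the total mass.\<close>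

lemma nn_integral_powr_sublevel:
  fixes \<phi> :: "'x \<Rightarrow> real"
  assumes [measurable]: "\<phi> \<in> borel_measurable M" and \<phi>0: "\<And>x. \<phi> x \<ge> 0" and \<rho>: "0 < \<rho>" "\<rho> < \<nu>" and C: "C \<ge> 0"
    and sub: "\<And>\<delta>. 0 < \<delta> \<Longrightarrow> \<delta> \<le> 1 \<Longrightarrow> emeasure M {x\<in>space M. \<phi> x \<le> \<delta>} \<le> ennreal (C * \<delta> powr \<nu>)"
  shows "(\<integral>\<^sup>+x. ennreal (\<phi> x powr - \<rho>) \<partial>M) \<le> emeasure M (space M) + ennreal (C * 2 powr \<rho> / (1 - 2 powr (\<rho> - \<nu>)))"
proof -
  define A where "A k = {x\<in>space M. \<phi> x \<le> 2 powr - real k}" for k :: nat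
  have [measurable]: "A k \<in> sets M" for k unfolding A_def by measurable
  define w where "w k = (2 :: real) powr (real k * \<rho> + \<rho>)" for k :: nat
  have pt: "ennreal (\<phi> x powr - \<rho>) \<le> 1 + (\<Sum>k. ennreal (w k) * indicator (A k) x)" if x: "x \<in> space M" for x
  \<comment> \<open>At \<phi> = 0 the value 0 powr - \<rho> is 0 and not infinite, so the zero set
    joins the harmless case.\<close>
  proof (cases "\<phi> x = 0 \<or> \<phi> x \<ge> 1")
    case True
    then have "\<phi> x powr - \<rho> \<le> 1"
      using \<rho> powr_mono2'[of "- \<rho>" 1 "\<phi> x"] by auto
    then have "ennreal (\<phi> x powr - \<rho>) \<le> 1" using ennreal_leI[of _ 1] by simp
    then show ?thesis by (rule order_trans) simp
  next
    case False
    then have f: "0 < \<phi> x" "\<phi> x < 1" using \<phi>0[of x] by auto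
    define l where "l = - log 2 (\<phi> x)"
    define k where "k = nat \<lfloor>l\<rfloor>"
    have l: "l > 0" using f by (simp add: l_def)
    then have kl: "real k \<le> l" "l < real k + 1" by (auto simp: k_def)
    have fl: "\<phi> x = 2 powr - l" using f by (simp add: l_def)
    have "x \<in> A k" using x kl by (simp add: A_def fl)
    have "\<phi> x powr - \<rho> = 2 powr (l * \<rho>)" by (simp add: fl powr_powr)
    also have "\<dots> \<le> w k" unfolding w_def using mult_right_mono[of l "real k + 1" \<rho>] kl \<rho> by (intro powr_mono) (auto simp: algebra_simps)
    finally have "ennreal (\<phi> x powr - \<rho>) \<le> ennreal (w k) * indicator (A k) x"
      using \<open>x \<in> A k\<close> by (simp add: ennreal_leI)
    also have "\<dots> \<le> (\<Sum>k. ennreal (w k) * indicator (A k) x)"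
    proof -
      have "f k \<le> suminf f" for f :: "nat \<Rightarrow> ennreal" using sum_le_suminf[of f "{k}"] by simp
      then show ?thesis .
    qed
    also have "\<dots> \<le> 1 + \<dots>" by simp
    finally show ?thesis .
  qed
  have "(\<integral>\<^sup>+x. ennreal (\<phi> x powr - \<rho>) \<partial>M) \<le> (\<integral>\<^sup>+x. 1 + (\<Sum>k. ennreal (w k) * indicator (A k) x) \<partial>M)"
    by (rule nn_integral_mono) (rule pt)
  also have "\<dots> = emeasure M (space M) + (\<integral>\<^sup>+x. (\<Sum>k. ennreal (w k) * indicator (A k) x) \<partial>M)"
    by (subst nn_integral_add) auto
  also have "(\<integral>\<^sup>+x. (\<Sum>k. ennreal (w k) * indicator (A k) x) \<partial>M) = (\<Sum>k. ennreal (w k) * emeasure M (A k))"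
    by (subst nn_integral_suminf) (auto simp: nn_integral_cmult_indicator)
  also have "\<dots> \<le> (\<Sum>k. ennreal (C * 2 powr \<rho> * (2 powr (\<rho> - \<nu>)) ^ k))"
  proof (rule suminf_le)
    fix k
    have "emeasure M (A k) \<le> ennreal (C * (2 powr - real k) powr \<nu>)" unfolding A_def by (rule sub) (auto simp: powr_minus_divide divide_simps ge_one_powr_ge_zero)
    then have "ennreal (w k) * emeasure M (A k) \<le> ennreal (w k) * ennreal (C * (2 powr - real k) powr \<nu>)"
      by (rule mult_left_mono) simp
    also have "\<dots> = ennreal (C * (w k * (2 powr - real k) powr \<nu>))"
      using C by (simp add: w_def mult_ac flip: ennreal_mult)
    also have "w k * (2 powr - real k) powr \<nu> = 2 powr \<rho> * (2 powr (\<rho> - \<nu>)) ^ k"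
      unfolding w_def powr_powr powr_realpow[symmetric, OF powr_gt_zero[of 2, THEN iffD2, OF zero_neq_numeral[symmetric]]]
      by (simp add: algebra_simps flip: powr_add)
    finally show "ennreal (w k) * emeasure M (A k) \<le> ennreal (C * 2 powr \<rho> * (2 powr (\<rho> - \<nu>)) ^ k)"
      by (simp add: mult.assoc)
  qed auto
  also have "\<dots> = ennreal (\<Sum>k. C * 2 powr \<rho> * (2 powr (\<rho> - \<nu>)) ^ k)"
  proof (rule suminf_ennreal2)
    show "summable (\<lambda>k. C * 2 powr \<rho> * (2 powr (\<rho> - \<nu>)) ^ k)"
      using \<rho> by (intro summable_mult summable_geometric) (simp add: powr_less_one)
  qed (use C in auto)
  also have "(\<Sum>k. C * 2 powr \<rho> * (2 powr (\<rho> - \<nu>)) ^ k) = C * 2 powr \<rho> / (1 - 2 powr (\<rho> - \<nu>))"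
  proof -
    have "norm (2 powr (\<rho> - \<nu>) :: real) < 1" using \<rho> by (simp add: powr_less_one)
    from suminf_mult[OF summable_geometric[OF this], of "C * 2 powr \<rho>"] suminf_geometric[OF this]
    show ?thesis by simp
  qed
  finally show ?thesis by (simp add: add_left_mono)
qed

text \<open>The local estimate sees only points near \<open>p0\<close>. By compactness and
  injectivity the values of \<open>Z\<close> on the rest of \<open>K\<close> keep a distance
  \<open>m\<close> from \<open>Z p\<close> for \<open>p\<close> near \<open>p0\<close>, so that rest
  is invisible when \<delta> < m; for larger \<delta> the measure of \<open>K\<close> is itself a
  bound of the required kind.\<close>

lemma sublevel_measure_compact:
  fixes Z :: "real \<times> real \<Rightarrow> complex"
  assumes Zc: "continuous_on UNIV Z" and inj: "inj Z" and K: "compact K" and \<sigma>: "\<sigma> \<ge> 0"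
    and loc: "\<And>p0. \<exists>s t. \<exists>r>0. \<exists>c0>0. \<exists>c1>0. \<exists>\<sigma>0. 0 \<le> \<sigma>0 \<and> \<sigma>0 \<le> \<sigma> \<and> (\<forall>p\<in>ball p0 r. \<forall>q\<in>ball p0 r.
      norm (q - p) \<le> c0 * (\<bar>s q - s p :: real\<bar> + \<bar>t q - t p :: real\<bar>) \<and>
      c1 * \<bar>s q - s p\<bar> \<le> norm (Z q - Z p) \<and> c1 * \<bar>t q - t p\<bar> powr (1 + \<sigma>0) \<le> norm (Z q - Z p))"
  shows "\<exists>C>0. \<forall>p\<in>K. \<forall>\<delta>. 0 < \<delta> \<longrightarrow> \<delta> \<le> 1 \<longrightarrow>
     emeasure (lebesgue_on K) {q\<in>space (lebesgue_on K). norm (Z p - Z q) \<le> \<delta>} \<le> ennreal (C * \<delta> powr (1 + 1 / (1 + \<sigma>)))"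
proof -
  define \<nu> where "\<nu> = 1 + 1 / (1 + \<sigma>)"
  have \<nu>: "\<nu> > 0" using \<sigma> by (simp add: \<nu>_def add_pos_nonneg)
  define E where "E p \<delta> = {q\<in>K. norm (Z p - Z q) \<le> \<delta>}" for p \<delta>
  have Kl: "K \<in> sets lebesgue" using lmeasurable_compact[OF K] by (auto dest: fmeasurableD)
  have closed: "closed (E p \<delta>)" for p \<delta>
  proof -
    have "closed {q. norm (Z p - Z q) \<le> \<delta>}"
      by (intro closed_Collect_le continuous_intros Zc)
    then have "closed (K \<inter> {q. norm (Z p - Z q) \<le> \<delta>})" using compact_imp_closed[OF K] by (rule closed_Int[rotated])
    then show ?thesis by (simp add: E_def Int_def)
  qed
  have eE: "emeasure (lebesgue_on K) (E p \<delta>) = emeasure lborel (E p \<delta>)" for p \<delta>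
  proof -
    have "E p \<delta> \<in> sets borel" by (rule borel_closed[OF closed])
    then show ?thesis using Kl by (subst emeasure_restrict_space) (auto simp: E_def)
  qed
  define \<mu> where "\<mu> = measure lborel K"
  have \<mu>: "emeasure lborel K = ennreal \<mu>" "\<mu> \<ge> 0"
    using emeasure_bounded_finite[OF compact_imp_bounded[OF K]] by (auto simp: \<mu>_def emeasure_eq_ennreal_measure less_top)
  \<comment> \<open>The constant appears as a reciprocal so that the property passes to smaller
    \<open>d\<close>, as \<open>uniform_on_compact\<close> requires.\<close>
  have "\<exists>d>0. \<forall>p\<in>K. \<forall>\<delta>. 0 < \<delta> \<longrightarrow> \<delta> \<le> 1 \<longrightarrow> emeasure lborel (E p \<delta>) \<le> ennreal (\<delta> powr \<nu> / d)"
  proof (rule uniform_on_compact[OF K])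
    fix p0 assume p0: "p0 \<in> K"
    obtain s t :: "real \<times> real \<Rightarrow> real" and r c0 c1 \<sigma>0 where r: "r > 0" and c01: "c0 > 0" "c1 > 0" and \<sigma>0: "0 \<le> \<sigma>0" "\<sigma>0 \<le> \<sigma>"
      and bd0: "\<forall>p\<in>ball p0 r. \<forall>q\<in>ball p0 r. norm (q - p) \<le> c0 * (\<bar>s q - s p\<bar> + \<bar>t q - t p\<bar>) \<and>
      c1 * \<bar>s q - s p\<bar> \<le> norm (Z q - Z p) \<and> c1 * \<bar>t q - t p\<bar> powr (1 + \<sigma>0) \<le> norm (Z q - Z p)"
      using loc[of p0] by (elim exE conjE)
    have bd: "norm (q - p) \<le> c0 * (\<bar>s q - s p\<bar> + \<bar>t q - t p\<bar>) \<and>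
      c1 * \<bar>s q - s p\<bar> \<le> norm (Z q - Z p) \<and> c1 * \<bar>t q - t p\<bar> powr (1 + \<sigma>0) \<le> norm (Z q - Z p)"
      if "p \<in> ball p0 r" "q \<in> ball p0 r" for p q
      by (rule bspec[OF bspec[OF bd0 that(1)] that(2)])
    have "\<exists>C>0. \<forall>p\<in>ball p0 r. \<forall>\<delta>\<in>{0<..1}. \<forall>E\<in>sets lborel.
        E \<subseteq> {q\<in>ball p0 r. norm (Z p - Z q) \<le> \<delta>} \<longrightarrow> emeasure lborel E \<le> ennreal (C * \<delta> powr (1 + 1 / (1 + \<sigma>0)))"
      by (rule sublevel_measure_local[OF Zc \<sigma>0(1) c01]) (rule bd)
    then obtain C where C: "C > 0" and CE0: "\<forall>p\<in>ball p0 r. \<forall>\<delta>\<in>{0<..1}. \<forall>E\<in>sets lborel.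
        E \<subseteq> {q\<in>ball p0 r. norm (Z p - Z q) \<le> \<delta>} \<longrightarrow> emeasure lborel E \<le> ennreal (C * \<delta> powr (1 + 1 / (1 + \<sigma>0)))"
      by (elim exE conjE)
    note CE = bspec[OF bspec[OF bspec[OF CE0]], THEN mp]
    have "\<exists>m>0. \<forall>p\<in>cball p0 (r/2). \<forall>q\<in>K - ball p0 r. m \<le> norm (Z p - Z q)"
    proof (cases "K - ball p0 r = {}")
      case False
      let ?P = "cball p0 (r/2) \<times> (K - ball p0 r)"
      have 1: "compact ?P" using K by (intro compact_Times compact_cball compact_diff) auto
      have 2: "?P \<noteq> {}" using False r by auto
      have 3: "continuous_on ?P (\<lambda>x. norm (Z (fst x) - Z (snd x)))"
        by (intro continuous_intros continuous_on_compose2[OF Zc]) auto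
      obtain x where x: "x \<in> ?P" and xmin: "\<forall>y\<in>?P. norm (Z (fst x) - Z (snd x)) \<le> norm (Z (fst y) - Z (snd y))"
        using continuous_attains_inf[OF 1 2 3] by (elim bexE)
      have "fst x \<noteq> snd x"
      proof
        assume "fst x = snd x"
        then have "dist p0 (fst x) \<le> r/2" "\<not> dist p0 (fst x) < r" using x by (auto simp: mem_Times_iff)
        then show False using r by simp
      qed
      then have "norm (Z (fst x) - Z (snd x)) > 0" using inj by (simp add: inj_eq)
      moreover have "norm (Z (fst x) - Z (snd x)) \<le> norm (Z p - Z q)" if "p \<in> cball p0 (r/2)" "q \<in> K - ball p0 r" for p q
        using bspec[OF xmin, of "(p, q)"] that by simp
      ultimately show ?thesis by blast
    qed (use zero_less_one in blast)
    then obtain m where m: "m > 0" "\<And>p q. p \<in> cball p0 (r/2) \<Longrightarrow> q \<in> K - ball p0 r \<Longrightarrow> m \<le> norm (Z p - Z q)" by blast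
    define C' where "C' = max C (\<mu> / m powr \<nu>)"
    have C': "C' > 0" using C by (simp add: C'_def)
    have "emeasure lborel (E p \<delta>) \<le> ennreal (\<delta> powr \<nu> / (1 / C'))" if p: "p \<in> ball p0 (r/2)" and \<delta>: "0 < \<delta>" "\<delta> \<le> 1" for p \<delta>
    proof (cases "\<delta> < m")
      case True
      have "E p \<delta> \<subseteq> {q\<in>ball p0 r. norm (Z p - Z q) \<le> \<delta>}"
      proof
        fix q assume q: "q \<in> E p \<delta>"
        have "q \<in> ball p0 r"
        proof (rule ccontr)
          assume "q \<notin> ball p0 r"
          then have "m \<le> norm (Z p - Z q)" using q p by (intro m(2)) (auto simp: E_def)
          then show False using q True by (simp add: E_def)
        qed
        then show "q \<in> {q\<in>ball p0 r. norm (Z p - Z q) \<le> \<delta>}" using q by (simp add: E_def)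
      qed
      moreover have "p \<in> ball p0 r" using p r by simp
      ultimately have "emeasure lborel (E p \<delta>) \<le> ennreal (C * \<delta> powr (1 + 1 / (1 + \<sigma>0)))"
        using \<delta> closed by (intro CE) auto
      also have "\<dots> \<le> ennreal (C' * \<delta> powr \<nu>)"
      proof (rule ennreal_leI, rule mult_mono)
        have "1 / (1 + \<sigma>) \<le> 1 / (1 + \<sigma>0)" using \<sigma>0 by (intro divide_left_mono) auto
        then show "\<delta> powr (1 + 1 / (1 + \<sigma>0)) \<le> \<delta> powr \<nu>" unfolding \<nu>_def using \<delta> by (intro powr_mono') auto
      qed (use C in \<open>auto simp: C'_def\<close>)
      finally show ?thesis by (simp add: mult.commute)
    next
      case False
      have "emeasure lborel (E p \<delta>) \<le> emeasure lborel K"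
        using K by (intro emeasure_mono) (auto simp: E_def compact_imp_closed)
      also have "\<dots> = ennreal \<mu>" by (rule \<mu>)
      also have "\<dots> \<le> ennreal (C' * \<delta> powr \<nu>)"
      proof (rule ennreal_leI)
        have "\<mu> = \<mu> / m powr \<nu> * m powr \<nu>" using m by simp
        also have "\<dots> \<le> C' * \<delta> powr \<nu>"
          using False m \<nu> \<mu>(2) C' by (intro mult_mono powr_mono2) (auto simp: C'_def)
        finally show "\<mu> \<le> C' * \<delta> powr \<nu>" .
      qed
      finally show ?thesis by (simp add: mult.commute)
    qed
    then show "\<exists>\<eta>>0. \<exists>d>0. \<forall>p\<in>ball p0 \<eta>. \<forall>\<delta>. 0 < \<delta> \<longrightarrow> \<delta> \<le> 1 \<longrightarrow> emeasure lborel (E p \<delta>) \<le> ennreal (\<delta> powr \<nu> / d)"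
      using r C' by (intro exI[of _ "r/2"] conjI exI[of _ "1 / C'"]) auto
  next
    fix p d d' assume *: "\<forall>\<delta>. 0 < \<delta> \<longrightarrow> \<delta> \<le> 1 \<longrightarrow> emeasure lborel (E p \<delta>) \<le> ennreal (\<delta> powr \<nu> / d)" "0 < d'" "d' \<le> d"
    show "\<forall>\<delta>. 0 < \<delta> \<longrightarrow> \<delta> \<le> 1 \<longrightarrow> emeasure lborel (E p \<delta>) \<le> ennreal (\<delta> powr \<nu> / d')"
    proof (intro allI impI)
      fix \<delta> :: real assume \<delta>: "0 < \<delta>" "\<delta> \<le> 1"
      then have "emeasure lborel (E p \<delta>) \<le> ennreal (\<delta> powr \<nu> / d)" using * by blast
      also have "\<dots> \<le> ennreal (\<delta> powr \<nu> / d')" using * by (intro ennreal_leI divide_left_mono) auto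
      finally show "emeasure lborel (E p \<delta>) \<le> ennreal (\<delta> powr \<nu> / d')" .
    qed
  qed
  then obtain d where d: "d > 0" and "\<And>p \<delta>. p \<in> K \<Longrightarrow> 0 < \<delta> \<Longrightarrow> \<delta> \<le> 1 \<Longrightarrow> emeasure lborel (E p \<delta>) \<le> ennreal (\<delta> powr \<nu> / d)"
    by blast
  then show ?thesis
    using eE by (intro exI[of _ "1 / d"]) (simp add: E_def \<nu>_def)
qed

text \<open>Young's inequality with both constants enlarged to 1. According to whether
  \<open>y\<close> is below \<open>x powr (q - 1)\<close>, one of the two terms alone dominates the
  product.\<close>

lemma mult_le_powr_add_powr:
  fixes x y q :: real
  assumes "x \<ge> 0" "y \<ge> 0" "q > 1"
  shows "x * y \<le> x powr q + y powr (q / (q - 1))"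
proof (cases "x = 0 \<or> y = 0")
  case False
  then have xy: "x > 0" "y > 0" using assms by auto
  show ?thesis
  proof (cases "y \<le> x powr (q - 1)")
    case True
    then have "x * y \<le> x powr 1 * x powr (q - 1)" using xy by (intro mult_mono) auto
    also have "\<dots> = x powr q" unfolding powr_add[symmetric] by simp
    also have "\<dots> \<le> x powr q + y powr (q / (q - 1))" by simp
    finally show ?thesis .
  next
    case False
    have "x = (x powr (q - 1)) powr (1 / (q - 1))" using xy assms by (simp add: powr_powr)
    also have "\<dots> \<le> y powr (1 / (q - 1))" using False xy assms by (intro powr_mono2) auto
    finally have "x * y \<le> y powr (1 / (q - 1)) * y powr 1" using xy by (intro mult_mono) auto
    also have "\<dots> = y powr (1 / (q - 1) + 1)" by (simp only: powr_add)
    also have "1 / (q - 1) + 1 = q / (q - 1)" using assms by (simp add: divide_simps)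
    finally show ?thesis by (simp add: add_increasing)
  qed
qed auto

context cauchy_transform
begin

text \<open>Young's inequality separates density and kernel: the first term does not depend on
  \<open>p\<close>, and the second carries the exponent \<rho> < \<nu>, for which the sublevel
  estimate is uniform in \<open>p\<close>.\<close>

lemma adm_if_powr_integrable:
  assumes C: "C > 0" and sub: "\<And>p \<delta>. p \<in> K \<Longrightarrow> 0 < \<delta> \<Longrightarrow> \<delta> \<le> 1 \<Longrightarrow>
       emeasure M {q\<in>space M. norm (Z p - Z q) \<le> \<delta>} \<le> ennreal (C * \<delta> powr \<nu>)"
    and r: "r > 1" "(1 + \<theta>) * (r / (r - 1)) < \<nu>"
    and g [measurable]: "g \<in> borel_measurable M" and int: "integrable M (\<lambda>q. norm (g q) powr r)"
  shows "adm g"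
  unfolding adm_def
proof (intro conjI exI ballI g)
  define \<rho> where "\<rho> = (1 + \<theta>) * (r / (r - 1))"
  have \<rho>: "0 < \<rho>" "\<rho> < \<nu>" using r \<theta> by (auto simp: \<rho>_def intro!: mult_pos_pos divide_pos_pos)
  let ?G = "LINT q|M. norm (g q) powr r"
  let ?B = "?G + (measure M K + C * 2 powr \<rho> / (1 - 2 powr (\<rho> - \<nu>)))"
  fix p assume p: "p \<in> K"
  have "(\<integral>\<^sup>+q. ennreal (norm (g q) * norm (Z p - Z q) powr - (1 + \<theta>)) \<partial>M)
     \<le> (\<integral>\<^sup>+q. ennreal (norm (g q) powr r) + ennreal (norm (Z p - Z q) powr - \<rho>) \<partial>M)"
  proof (rule nn_integral_mono)
    fix q
    have "norm (g q) * norm (Z p - Z q) powr - (1 + \<theta>)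
       \<le> norm (g q) powr r + (norm (Z p - Z q) powr - (1 + \<theta>)) powr (r / (r - 1))"
      using r by (intro mult_le_powr_add_powr) auto
    also have "(norm (Z p - Z q) powr - (1 + \<theta>)) powr (r / (r - 1)) = norm (Z p - Z q) powr - \<rho>"
      unfolding powr_powr \<rho>_def by (simp only: mult_minus_left)
    finally show "ennreal (norm (g q) * norm (Z p - Z q) powr - (1 + \<theta>))
       \<le> ennreal (norm (g q) powr r) + ennreal (norm (Z p - Z q) powr - \<rho>)"
      by (simp add: ennreal_leI flip: ennreal_plus)
  qed
  also have "\<dots> = (\<integral>\<^sup>+q. ennreal (norm (g q) powr r) \<partial>M) + (\<integral>\<^sup>+q. ennreal (norm (Z p - Z q) powr - \<rho>) \<partial>M)"
    by (rule nn_integral_add) auto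
  also have "(\<integral>\<^sup>+q. ennreal (norm (g q) powr r) \<partial>M) = ennreal ?G"
    by (rule nn_integral_eq_integral[OF int]) auto
  also have "(\<integral>\<^sup>+q. ennreal (norm (Z p - Z q) powr - \<rho>) \<partial>M)
     \<le> emeasure M (space M) + ennreal (C * 2 powr \<rho> / (1 - 2 powr (\<rho> - \<nu>)))"
    by (rule nn_integral_powr_sublevel[OF _ _ \<rho>]) (use C sub[OF p] in auto)
  also have "emeasure M (space M) = ennreal (measure M K)"
    by (simp add: M.emeasure_eq_measure)
  also have "ennreal ?G + (ennreal (measure M K) + ennreal (C * 2 powr \<rho> / (1 - 2 powr (\<rho> - \<nu>)))) = ennreal ?B"
  proof -
    have "2 powr (\<rho> - \<nu>) < (1 :: real)" using \<rho> by (simp add: powr_less_one)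
    then have "C * 2 powr \<rho> / (1 - 2 powr (\<rho> - \<nu>)) \<ge> 0" using C by simp
    moreover have "?G \<ge> 0" by (intro integral_nonneg_AE) auto
    ultimately show ?thesis by (simp flip: ennreal_plus)
  qed
  finally show "(\<integral>\<^sup>+q. ennreal (norm (g q) * norm (Z p - Z q) powr - (1 + \<theta>)) \<partial>M) \<le> ennreal ?B"
    by (simp add: add_left_mono)
qed

end

section \<open>Construction of the charts from the form on the torus\<close>

lemma differentiable_imp_dform:
  assumes "f differentiable (at p)"
  shows "(f has_derivative dform (partial_x f p) (partial_y f p)) (at p)"
proof -
  have D: "(f has_derivative frechet_derivative f (at p)) (at p)"
    using assms by (simp add: frechet_derivative_works)
  then interpret bounded_linear "frechet_derivative f (at p)" by (rule has_derivative_bounded_linear)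
  have "frechet_derivative f (at p) h = dform (partial_x f p) (partial_y f p) h" for h
  proof -
    have "h = fst h *\<^sub>R (1, 0) + snd h *\<^sub>R (0, 1)" by (simp add: prod_eq_iff)
    then have "frechet_derivative f (at p) h = frechet_derivative f (at p) (fst h *\<^sub>R (1, 0) + snd h *\<^sub>R (0, 1))" by simp
    then show ?thesis by (simp only: add scaleR dform_def partial_x_def partial_y_def)
  qed
  then have "frechet_derivative f (at p) = dform (partial_x f p) (partial_y f p)" by (rule ext)
  then show ?thesis using D by simp
qed

lemma C1_onD:
  assumes "C1_on U f"
  shows "\<And>p. proj p \<in> U \<Longrightarrow> ((f \<circ> proj) has_derivative dform (partial_x (f \<circ> proj) p) (partial_y (f \<circ> proj) p)) (at p)"
    and "continuous_on (proj -` U) (partial_x (f \<circ> proj))" "continuous_on (proj -` U) (partial_y (f \<circ> proj))"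
  using assms by (auto simp: C1_on_def intro!: differentiable_imp_dform)

lemma powr_weight_primitive:
  assumes "\<sigma> > 0"
  shows "((\<lambda>x. x * \<bar>x\<bar> powr \<sigma> / (1 + \<sigma>)) has_real_derivative \<bar>x\<bar> powr \<sigma>) (at x)"
proof -
  consider "x > 0" | "x < 0" | "x = 0" by linarith
  then show ?thesis
  proof cases
    case 1
    have "((\<lambda>x. x powr (1 + \<sigma>) / (1 + \<sigma>)) has_real_derivative x powr \<sigma>) (at x)"
      using 1 assms by (auto intro!: derivative_eq_intros)
    then have "((\<lambda>x. x * \<bar>x\<bar> powr \<sigma> / (1 + \<sigma>)) has_real_derivative x powr \<sigma>) (at x)"
      by (rule has_field_derivative_transform_within_open[of _ _ _ "{0<..}"]) (use 1 in \<open>auto simp: powr_add\<close>)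
    then show ?thesis using 1 by simp
  next
    case 2
    have "((\<lambda>x. - ((- x) powr (1 + \<sigma>)) / (1 + \<sigma>)) has_real_derivative (- x) powr \<sigma>) (at x)"
      using 2 assms by (auto intro!: derivative_eq_intros)
    then have "((\<lambda>x. x * \<bar>x\<bar> powr \<sigma> / (1 + \<sigma>)) has_real_derivative (- x) powr \<sigma>) (at x)"
      by (rule has_field_derivative_transform_within_open[of _ _ _ "{..<0}"]) (use 2 in \<open>auto simp: powr_add\<close>)
    then show ?thesis using 2 by simp
  next
    case 3
    have "((\<lambda>y. \<bar>y\<bar> powr \<sigma> / (1 + \<sigma>)) \<longlongrightarrow> 0) (at 0)"
    proof -
      have "((\<lambda>y. \<bar>y\<bar> powr \<sigma>) \<longlongrightarrow> 0) (at (0::real))"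
        by (rule tendsto_zero_powrI[where b = \<sigma>]) (use assms in \<open>auto intro: tendsto_rabs_zero\<close>)
      then show ?thesis by (rule tendsto_divide_zero)
    qed
    moreover have "\<forall>\<^sub>F y in at (0::real). \<bar>y\<bar> powr \<sigma> / (1 + \<sigma>) = (y * \<bar>y\<bar> powr \<sigma> / (1 + \<sigma>) - 0 * \<bar>0\<bar> powr \<sigma> / (1 + \<sigma>)) / (y - 0)"
      by (auto simp: eventually_at_filter)
    ultimately show ?thesis
      unfolding 3 has_field_derivative_iff using assms by (auto elim: Lim_transform_eventually)
  qed
qed

text \<open>For equal signs the power is superadditive. For opposite signs one of |x| and |y| is at
  least half of |x - y|, which costs the factor (1/2)^(1+\<sigma>).\<close>

lemma powr_weight_primitive_lower:
  fixes x y \<sigma> :: real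
  assumes "\<sigma> > 0"
  shows "(1/2) powr (1 + \<sigma>) / (1 + \<sigma>) * \<bar>x - y\<bar> powr (1 + \<sigma>) \<le> \<bar>x * \<bar>x\<bar> powr \<sigma> / (1 + \<sigma>) - y * \<bar>y\<bar> powr \<sigma> / (1 + \<sigma>)\<bar>"
proof -
  have half: "(1/2) powr (1 + \<sigma>) \<le> (1::real)" using assms by (simp add: powr_le1)
  have same: "\<bar>x - y\<bar> powr (1 + \<sigma>) \<le> \<bar>x * \<bar>x\<bar> powr \<sigma> - y * \<bar>y\<bar> powr \<sigma>\<bar>" if "0 \<le> y" "y \<le> x" for x y :: real
  proof (cases "x = y")
    case False
    have "(x - y) powr (1 + \<sigma>) = (x - y) * (x - y) powr \<sigma>" using that False by (simp add: powr_add)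
    also have "\<dots> \<le> (x - y) * x powr \<sigma>" using that assms by (intro mult_left_mono powr_mono2) auto
    also have "\<dots> = x * x powr \<sigma> - y * x powr \<sigma>" by (simp add: algebra_simps)
    also have "\<dots> \<le> x * x powr \<sigma> - y * y powr \<sigma>"
      using that assms by (intro diff_left_mono mult_left_mono powr_mono2) auto
    finally show ?thesis using that by simp
  qed simp
  have opp: "(1/2) powr (1 + \<sigma>) * \<bar>x - y\<bar> powr (1 + \<sigma>) \<le> \<bar>x * \<bar>x\<bar> powr \<sigma> - y * \<bar>y\<bar> powr \<sigma>\<bar>"
    if "y \<le> 0" "0 \<le> x" for x y :: real
  proof -
    define z where "z = max x (- y)"
    have z: "z \<ge> 0" "(x - y) / 2 \<le> z" "(x - y) / 2 \<ge> 0" using that by (auto simp: z_def max_def)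
    have p: "w * w powr \<sigma> = w powr (1 + \<sigma>)" if "w \<ge> 0" for w :: real
      using that by (cases "w = 0") (auto simp: powr_add)
    have "(1/2) powr (1 + \<sigma>) * \<bar>x - y\<bar> powr (1 + \<sigma>) = ((x - y) / 2) powr (1 + \<sigma>)"
      using that by (simp flip: powr_mult)
    also have "\<dots> \<le> z powr (1 + \<sigma>)" using z assms by (intro powr_mono2) auto
    also have "\<dots> \<le> x powr (1 + \<sigma>) + (- y) powr (1 + \<sigma>)" by (auto simp: z_def max_def)
    also have "\<dots> = x * \<bar>x\<bar> powr \<sigma> - y * \<bar>y\<bar> powr \<sigma>" using p[of x] p[of "- y"] that by simp
    finally show ?thesis by simp
  qed
  have same': "(1/2) powr (1 + \<sigma>) * \<bar>x - y\<bar> powr (1 + \<sigma>) \<le> \<bar>x * \<bar>x\<bar> powr \<sigma> - y * \<bar>y\<bar> powr \<sigma>\<bar>" if "0 \<le> y" "y \<le> x" for x y :: real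
    using same[OF that] mult_right_mono[OF half, of "\<bar>x - y\<bar> powr (1 + \<sigma>)"] by simp
  have main: "(1/2) powr (1 + \<sigma>) * \<bar>x - y\<bar> powr (1 + \<sigma>) \<le> \<bar>x * \<bar>x\<bar> powr \<sigma> - y * \<bar>y\<bar> powr \<sigma>\<bar>" if "y \<le> x" for x y :: real
  proof -
    consider "0 \<le> y" | "y \<le> 0" "0 \<le> x" | "x \<le> 0" by linarith
    then show ?thesis
    proof cases
      case 3
      have "(1/2) powr (1 + \<sigma>) * \<bar>- y - - x\<bar> powr (1 + \<sigma>) \<le> \<bar>- y * \<bar>- y\<bar> powr \<sigma> - - x * \<bar>- x\<bar> powr \<sigma>\<bar>"
        using 3 that by (intro same') auto
      then show ?thesis by (simp add: abs_minus_commute)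
    qed (use that same' opp in auto)
  qed
  have "(1/2) powr (1 + \<sigma>) * \<bar>x - y\<bar> powr (1 + \<sigma>) \<le> \<bar>x * \<bar>x\<bar> powr \<sigma> - y * \<bar>y\<bar> powr \<sigma>\<bar>"
    using main[of x y] main[of y x] by (cases "y \<le> x") (auto simp: abs_minus_commute)
  then have "(1/2) powr (1 + \<sigma>) * \<bar>x - y\<bar> powr (1 + \<sigma>) / (1 + \<sigma>) \<le> \<bar>x * \<bar>x\<bar> powr \<sigma> - y * \<bar>y\<bar> powr \<sigma>\<bar> / (1 + \<sigma>)"
    using assms by (intro divide_right_mono) auto
  then show ?thesis using assms by (simp add: abs_divide flip: diff_divide_distrib)
qed

text \<open>The Poincare lemma along rays: after differentiation under the integral, closedness
  turns the integrand into the r-derivative of r A(r x, r y), respectively of r B(r x, r y).\<close>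

lemma form_integral_deriv:
  fixes a b :: "torus \<Rightarrow> complex"
  assumes a: "C1_on UNIV a" and b: "C1_on UNIV b" and closed: "closed_form a b"
  shows "((\<lambda>p. form_integral a b (fst p) (snd p)) has_derivative dform (a (proj p)) (b (proj p))) (at p)"
proof -
  define A B where "A = a \<circ> proj" and "B = b \<circ> proj"
  define A1 A2 B1 B2 where "A1 = partial_x A" and "A2 = partial_y A" and "B1 = partial_x B" and "B2 = partial_y B"
  have dA: "(A has_derivative dform (A1 p) (A2 p)) (at p)" and dB: "(B has_derivative dform (B1 p) (B2 p)) (at p)" for p
    using C1_onD(1)[OF a] C1_onD(1)[OF b] by (auto simp: A_def B_def A1_def A2_def B1_def B2_def)
  have cont: "continuous_on UNIV A1" "continuous_on UNIV A2" "continuous_on UNIV B1" "continuous_on UNIV B2"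
    using C1_onD(2,3)[OF a] C1_onD(2,3)[OF b] by (auto simp: A_def B_def A1_def A2_def B1_def B2_def)
  have cAB: "continuous_on UNIV A" "continuous_on UNIV B"
    using dA dB by (meson continuous_at_imp_continuous_on has_derivative_continuous)+
  have B1: "B1 = A2" using closed by (auto simp: closed_form_def A_def B_def A2_def B1_def fun_eq_iff)
  define G where "G x y = form_integral a b x y" for x y
  have Geq: "G x y = integral (cbox 0 1) (\<lambda>r. A (r * x, r * y) * of_real x + B (r * x, r * y) * of_real y)" for x y
    by (simp add: G_def form_integral_def A_def B_def)
  have scal: "((\<lambda>r. f (r * x, r * y)) has_vector_derivative dform (f1 (r * x, r * y)) (f2 (r * x, r * y)) (x, y)) (at r within S)"
    if "\<And>p. (f has_derivative dform (f1 p) (f2 p)) (at p)" for f f1 f2 :: "real \<times> real \<Rightarrow> complex" and x y r S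
  proof -
    have "((\<lambda>r. (r * x, r * y)) has_vector_derivative (x, y)) (at r)"
      by (auto intro!: has_vector_derivative_Pair derivative_eq_intros)
    from has_derivative_has_vector_derivative_line[OF that this] show ?thesis by (rule has_vector_derivative_at_within)
  qed
  have hor: "((\<lambda>x. f (r * x, r * y)) has_vector_derivative of_real r * f1 (r * x, r * y)) (at x within S)"
    if "\<And>p. (f has_derivative dform (f1 p) (f2 p)) (at p)" for f f1 f2 :: "real \<times> real \<Rightarrow> complex" and x y r S
  proof -
    have "((\<lambda>x. (r * x, r * y)) has_vector_derivative (r, 0)) (at x)"
      by (auto intro!: has_vector_derivative_Pair derivative_eq_intros)
    from has_vector_derivative_at_within[OF has_derivative_has_vector_derivative_line[OF that this]] show ?thesis
      by (simp add: dform_def scaleR_conv_of_real)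
  qed
  have ver: "((\<lambda>y. f (r * x, r * y)) has_vector_derivative of_real r * f2 (r * x, r * y)) (at y within S)"
    if "\<And>p. (f has_derivative dform (f1 p) (f2 p)) (at p)" for f f1 f2 :: "real \<times> real \<Rightarrow> complex" and x y r S
  proof -
    have "((\<lambda>y. (r * x, r * y)) has_vector_derivative (0, r)) (at y)"
      by (auto intro!: has_vector_derivative_Pair derivative_eq_intros)
    from has_vector_derivative_at_within[OF has_derivative_has_vector_derivative_line[OF that this]] show ?thesis
      by (simp add: dform_def scaleR_conv_of_real)
  qed
  have Gint: "(\<lambda>r. A (r * x, r * y) * of_real x + B (r * x, r * y) * of_real y) integrable_on cbox 0 1" for x y
    by (intro integrable_continuous continuous_intros continuous_on_compose2[OF cAB(1)] continuous_on_compose2[OF cAB(2)]) auto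
  have Gx: "((\<lambda>x. G x y) has_vector_derivative A (x, y)) (at x)" for x y
  proof -
    define fx where "fx x r = of_real r * A1 (r * x, r * y) * of_real x + A (r * x, r * y) + of_real r * A2 (r * x, r * y) * of_real y" for x r
    have "((\<lambda>x. integral (cbox 0 1) ((\<lambda>x r. A (r * x, r * y) * of_real x + B (r * x, r * y) * of_real y) x)) has_vector_derivative
        integral (cbox 0 1) (fx x)) (at x within UNIV)"
    proof (rule leibniz_rule_vector_derivative)
      fix x r
      show "((\<lambda>x. A (r * x, r * y) * of_real x + B (r * x, r * y) * of_real y) has_vector_derivative fx x r) (at x within UNIV)"
        by (rule derivative_eq_intros hor[OF dA] hor[OF dB] has_vector_derivative_of_real refl | simp)+
          (simp add: fx_def B1 algebra_simps)
    next
      show "continuous_on (UNIV \<times> cbox 0 1) (\<lambda>(x, r). fx x r)"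
        unfolding fx_def case_prod_unfold
        by (intro continuous_intros continuous_on_compose2[OF cAB(1)] continuous_on_compose2[OF cont(1)] continuous_on_compose2[OF cont(2)]) auto
    qed (use Gint in auto)
    moreover have "integral (cbox 0 1) (fx x) = A (x, y)"
    proof -
      have "((\<lambda>r. of_real r * A (r * x, r * y)) has_vector_derivative fx x r) (at r within {0..1})" for r
        by (rule derivative_eq_intros scal[OF dA] has_vector_derivative_of_real refl | simp)+
          (simp add: fx_def dform_def scaleR_conv_of_real algebra_simps)
      then have "(fx x has_integral (of_real 1 * A (1 * x, 1 * y) - of_real 0 * A (0 * x, 0 * y))) {0..1}"
        by (intro fundamental_theorem_of_calculus) auto
      then show ?thesis by (simp add: integral_unique)
    qed
    ultimately show ?thesis by (simp add: Geq[abs_def])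
  qed
  have Gy: "((\<lambda>y. G x y) has_vector_derivative B (x, y)) (at y)" for x y
  proof -
    define fy where "fy y r = of_real r * A2 (r * x, r * y) * of_real x + B (r * x, r * y) + of_real r * B2 (r * x, r * y) * of_real y" for y r
    have "((\<lambda>y. integral (cbox 0 1) ((\<lambda>y r. A (r * x, r * y) * of_real x + B (r * x, r * y) * of_real y) y)) has_vector_derivative
        integral (cbox 0 1) (fy y)) (at y within UNIV)"
    proof (rule leibniz_rule_vector_derivative)
      fix y r
      show "((\<lambda>y. A (r * x, r * y) * of_real x + B (r * x, r * y) * of_real y) has_vector_derivative fy y r) (at y within UNIV)"
        by (rule derivative_eq_intros ver[OF dA] ver[OF dB] has_vector_derivative_of_real refl | simp)+
          (simp add: fy_def algebra_simps)
    next
      show "continuous_on (UNIV \<times> cbox 0 1) (\<lambda>(y, r). fy y r)"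
        unfolding fy_def case_prod_unfold
        by (intro continuous_intros continuous_on_compose2[OF cAB(2)] continuous_on_compose2[OF cont(2)] continuous_on_compose2[OF cont(4)]) auto
    qed (use Gint in auto)
    moreover have "integral (cbox 0 1) (fy y) = B (x, y)"
    proof -
      have "((\<lambda>r. of_real r * B (r * x, r * y)) has_vector_derivative fy y r) (at r within {0..1})" for r
        by (rule derivative_eq_intros scal[OF dB] has_vector_derivative_of_real refl | simp)+
          (simp add: fy_def dform_def scaleR_conv_of_real B1 algebra_simps)
      then have "(fy y has_integral (of_real 1 * B (1 * x, 1 * y) - of_real 0 * B (0 * x, 0 * y))) {0..1}"
        by (intro fundamental_theorem_of_calculus) auto
      then show ?thesis by (simp add: integral_unique)
    qed
    ultimately show ?thesis by (simp add: Geq[abs_def])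
  qed
  obtain x y where p: "p = (x, y)" by (cases p)
  have "((\<lambda>(x, y). G x y) has_derivative (\<lambda>(tx, ty). tx *\<^sub>R A (x, y) + blinfun_scaleR_left (B (x, y)) ty)) (at (x, y) within UNIV \<times> UNIV)"
  proof (rule has_derivative_partialsI)
    show "((\<lambda>x. G x y) has_derivative (\<lambda>tx. tx *\<^sub>R A (x, y))) (at x within UNIV)"
      using Gx by (simp add: has_vector_derivative_def)
    show "(G x has_derivative blinfun_apply (blinfun_scaleR_left (B (x, y)))) (at y within UNIV)" for x y
      using Gy[of x y] by (simp add: has_vector_derivative_def blinfun_scaleR_left.rep_eq)
    have "continuous_on UNIV (\<lambda>p. blinfun_scaleR_left (B p))" by (intro continuous_intros cAB)
    then show "continuous (at (x, y) within UNIV \<times> UNIV) (\<lambda>(x, y). blinfun_scaleR_left (B (x, y)))"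
      by (simp add: continuous_on_eq_continuous_at case_prod_unfold)
  qed auto
  then show ?thesis by (simp add: p G_def A_def B_def blinfun_scaleR_left.rep_eq case_prod_unfold dform_def[abs_def])
qed

lemma quasiperiodic_int_shift:
  fixes f :: "real \<Rightarrow> complex" and m :: int
  assumes "\<And>x. f (x + 1) = f x + c"
  shows "f (x + of_int m) = f x + of_int m * c"
proof (induction m rule: int_induct[of _ 0])
  case (step1 i)
  then show ?case using assms[of "x + of_int i"] by (simp add: algebra_simps)
next
  case (step2 i)
  then show ?case using assms[of "x + of_int (i - 1)"] by (simp add: algebra_simps)
qed simp

text \<open>Where the form and its conjugate are independent, the real and imaginary parts of
  \<open>Z\<close> are themselves coordinates, and the multiplier and the weight are 1.\<close>

lemma noncharacteristic_normal_chart: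
  fixes a b Z :: "real \<times> real \<Rightarrow> complex"
  assumes Z: "\<And>p. (Z has_derivative dform (a p) (b p)) (at p)"
    and c: "continuous_on UNIV a" "continuous_on UNIV b"
    and nc: "a p0 * cnj (b p0) - b p0 * cnj (a p0) \<noteq> 0"
  shows "\<exists>S s t sx sy tx ty lam Lam m. normal_chart a b 0 p0 S s t sx sy tx ty lam Lam 1 m"
proof -
  define S where "S = {p. Re (a p) * Im (b p) - Re (b p) * Im (a p) \<noteq> 0}"
  have "normal_chart a b 0 p0 S (\<lambda>p. Re (Z p)) (\<lambda>p. Im (Z p)) (\<lambda>p. Re (a p)) (\<lambda>p. Re (b p)) (\<lambda>p. Im (a p)) (\<lambda>p. Im (b p))
      (\<lambda>_. 1) (\<lambda>x. x) 1 (\<lambda>_. 1)"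
  proof
    show "open S" unfolding S_def by (intro open_Collect_neq continuous_intros c)
    show "p0 \<in> S" using nc by (auto simp: S_def complex_eq_iff algebra_simps)
    have re: "(\<lambda>h. Re (dform (a p) (b p) h)) = dform (Re (a p)) (Re (b p))"
      and im: "(\<lambda>h. Im (dform (a p) (b p) h)) = dform (Im (a p)) (Im (b p))" for p
      by (auto simp: dform_def fun_eq_iff)
    show "((\<lambda>p. Re (Z p)) has_derivative dform (Re (a p)) (Re (b p))) (at p)" for p
      using bounded_linear.has_derivative[OF bounded_linear_Re Z[of p]] by (simp add: re)
    show "((\<lambda>p. Im (Z p)) has_derivative dform (Im (a p)) (Im (b p))) (at p)" for p
      using bounded_linear.has_derivative[OF bounded_linear_Im Z[of p]] by (simp add: im)
    show "continuous_on S (\<lambda>p. Re (a p))" "continuous_on S (\<lambda>p. Re (b p))" "continuous_on S (\<lambda>p. Im (a p))" "continuous_on S (\<lambda>p. Im (b p))"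
      using c by (auto intro!: continuous_intros intro: continuous_on_subset)
    show "p \<in> S \<Longrightarrow> Re (a p) * Im (b p) - Re (b p) * Im (a p) \<noteq> 0" for p by (simp add: S_def)
    show "dform (a p) (b p) h = 1 * (of_real (dform (Re (a p)) (Re (b p)) h) + \<i> * of_real (1 * dform (Im (a p)) (Im (b p)) h))" for p h
      by (auto simp: dform_def complex_eq_iff)
  qed auto
  then show ?thesis by blast
qed

text \<open>The normal form says nothing about continuity of the multiplier, on which the increment
  estimate relies. It is recovered as a quotient: some first derivative of s is nonzero at
  \<open>p0\<close>, and it is the real part of the factor that multiplies \<open>m\<close> in the
  corresponding coefficient.\<close>

lemma characteristic_normal_chart:
  fixes a b :: "torus \<Rightarrow> complex"
  assumes c: "continuous_on UNIV (a \<circ> proj)" "continuous_on UNIV (b \<circ> proj)"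
    and nf: "normal_form_along a b M \<sigma>" and M: "proj p0 \<in> M" and \<sigma>: "\<sigma> > 0"
  shows "\<exists>S s t sx sy tx ty lam Lam c m. normal_chart (a \<circ> proj) (b \<circ> proj) \<sigma> p0 S s t sx sy tx ty lam Lam c m"
proof -
  obtain U s t m where U: "proj p0 \<in> U" "C1_coords U s t"
    and form0: "\<forall>z \<in> proj -` U. m (proj z) \<noteq> 0 \<and>
          a (proj z) = m (proj z) * (of_real (partial_x (s \<circ> proj) z)
            + \<i> * of_real (\<bar>t (proj z)\<bar> powr \<sigma>) * of_real (partial_x (t \<circ> proj) z)) \<and>
          b (proj z) = m (proj z) * (of_real (partial_y (s \<circ> proj) z)
            + \<i> * of_real (\<bar>t (proj z)\<bar> powr \<sigma>) * of_real (partial_y (t \<circ> proj) z))"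
    using bspec[OF nf[unfolded normal_form_along_def] M] by (elim exE conjE)
  note form = bspec[OF form0, OF vimageI2]
  define S where "S = proj -` U"
  have C1: "C1_on U s" "C1_on U t" and oU: "open U"
    and det: "\<And>z. z \<in> S \<Longrightarrow> partial_x (s \<circ> proj) z * partial_y (t \<circ> proj) z - partial_y (s \<circ> proj) z * partial_x (t \<circ> proj) z \<noteq> 0"
    using U(2) by (auto simp: C1_coords_def S_def)
  have oS: "open S" using oU by (simp add: open_torus_def S_def)
  have p0: "p0 \<in> S" using U by (simp add: S_def)
  define sx sy tx ty where "sx = partial_x (s \<circ> proj)" and "sy = partial_y (s \<circ> proj)"
    and "tx = partial_x (t \<circ> proj)" and "ty = partial_y (t \<circ> proj)"
  have cs: "continuous_on S sx" "continuous_on S sy" "continuous_on S tx" "continuous_on S ty"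
    using C1_onD(2,3)[OF C1(1)] C1_onD(2,3)[OF C1(2)] by (auto simp: sx_def sy_def tx_def ty_def S_def)
  have dst: "((s \<circ> proj) has_derivative dform (sx p) (sy p)) (at p)" "((t \<circ> proj) has_derivative dform (tx p) (ty p)) (at p)"
    if "p \<in> S" for p
    using C1_onD(1)[OF C1(1), of p] C1_onD(1)[OF C1(2), of p] that by (auto simp: sx_def sy_def tx_def ty_def S_def)
  define w where "w = (\<lambda>p. of_real (\<bar>t (proj p)\<bar> powr \<sigma>) :: complex)"
  have tc: "continuous_on S (t \<circ> proj)"
    using dst(2) by (meson continuous_at_imp_continuous_on has_derivative_continuous)
  have wc: "continuous_on S w"
    unfolding w_def using tc \<sigma> by (intro continuous_intros continuous_on_powr') (auto simp: comp_def)
  have mc: "continuous (at p0) (m \<circ> proj)"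
  proof -
    have d: "sx p0 \<noteq> 0 \<or> sy p0 \<noteq> 0" using det[OF p0] by (auto simp: sx_def sy_def)
    have *: "continuous (at p0) (m \<circ> proj)"
      if f: "continuous_on UNIV f" and x: "continuous_on S x" and y: "continuous_on S y" and x0: "x p0 \<noteq> 0"
        and eq: "\<And>p. p \<in> S \<Longrightarrow> f p = m (proj p) * (of_real (x p) + \<i> * w p * of_real (y p))"
      for f :: "real \<times> real \<Rightarrow> complex" and x y :: "real \<times> real \<Rightarrow> real"
    proof -
      define D where "D p = of_real (x p) + \<i> * w p * of_real (y p)" for p
      have Re: "Re (D p) = x p" for p by (simp add: D_def w_def)
      have ev: "\<forall>\<^sub>F p in nhds p0. p \<in> S \<and> x p \<noteq> 0"
      proof -
        have "open (S \<inter> x -` (- {0}))" by (rule continuous_open_preimage[OF x oS]) auto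
        then have "\<forall>\<^sub>F p in nhds p0. p \<in> S \<inter> x -` (- {0})"
          by (rule eventually_nhds_in_open) (use p0 x0 in simp)
        then show ?thesis by (rule eventually_mono) auto
      qed
      have "continuous_on S D" unfolding D_def using x y wc by (intro continuous_intros)
      then have "isCont D p0" using oS p0 by (simp add: continuous_on_eq_continuous_at)
      moreover have "isCont f p0" using f by (simp add: continuous_on_eq_continuous_at)
      moreover have "D p0 \<noteq> 0" using x0 Re[of p0] by auto
      ultimately have k1: "isCont (\<lambda>p. f p / D p) p0" by (intro continuous_intros)
      have k2: "\<forall>\<^sub>F p in nhds p0. f p / D p = (m \<circ> proj) p"
        using ev
      proof eventually_elim
        case (elim p)
        then have "D p \<noteq> 0" using Re[of p] by auto
        then show ?case using eq[of p] elim by (simp add: D_def)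
      qed
      show ?thesis using k1 isCont_cong[OF k2] by (simp only:)
    qed
    show ?thesis
      using d
    proof
      assume "sx p0 \<noteq> 0"
      then show ?thesis
        by (rule *[OF c(1) cs(1) cs(3)]) (use form in \<open>auto simp: S_def sx_def tx_def w_def\<close>)
    next
      assume "sy p0 \<noteq> 0"
      then show ?thesis
        by (rule *[OF c(2) cs(2) cs(4)]) (use form in \<open>auto simp: S_def sy_def ty_def w_def\<close>)
    qed
  qed
  have "normal_chart (a \<circ> proj) (b \<circ> proj) \<sigma> p0 S (s \<circ> proj) (t \<circ> proj) sx sy tx ty
     (\<lambda>x. \<bar>x\<bar> powr \<sigma>) (\<lambda>x. x * \<bar>x\<bar> powr \<sigma> / (1 + \<sigma>)) ((1/2) powr (1 + \<sigma>) / (1 + \<sigma>)) (m \<circ> proj)"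
  proof
    show "(m \<circ> proj) p0 \<noteq> 0" using form U by simp
    show "p \<in> S \<Longrightarrow> sx p * ty p - sy p * tx p \<noteq> 0" for p using det by (simp add: sx_def sy_def tx_def ty_def)
    show "dform ((a \<circ> proj) p) ((b \<circ> proj) p) h = (m \<circ> proj) p * (of_real (dform (sx p) (sy p) h) +
       \<i> * of_real (\<bar>(t \<circ> proj) p\<bar> powr \<sigma> * dform (tx p) (ty p) h))" if "p \<in> S" for p h
      using form[of p] that
      by (simp add: S_def dform_def scaleR_conv_of_real sx_def sy_def tx_def ty_def algebra_simps)
    show "\<And>x y. (1/2) powr (1 + \<sigma>) / (1 + \<sigma>) * \<bar>x - y\<bar> powr (1 + \<sigma>) \<le> \<bar>x * \<bar>x\<bar> powr \<sigma> / (1 + \<sigma>) - y * \<bar>y\<bar> powr \<sigma> / (1 + \<sigma>)\<bar>"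
      by (rule powr_weight_primitive_lower[OF \<sigma>])
  qed (use oS p0 dst cs powr_weight_primitive[OF \<sigma>] \<sigma> mc in auto)
  then show ?thesis by blast
qed

subsection \<open>From the weak equation to rectangles\<close>

abbreviation unit_leb :: "real measure" where "unit_leb \<equiv> lebesgue_on {0..1}"

lemma unit_leb_integrable_bounded:
  fixes f :: "real \<Rightarrow> 'b::euclidean_space"
  assumes "f \<in> borel_measurable unit_leb" "\<And>x. x \<in> {0..1} \<Longrightarrow> norm (f x) \<le> B"
  shows "integrable unit_leb f"
proof -
  interpret finite_measure unit_leb by (rule finite_measure_lebesgue_on) simp
  show ?thesis using assms by (intro integrable_const_bound[of _ B]) auto
qed

text \<open>Laplace's method. Away from the unique maximum w^n is at most \<rho>^n with some \<rho>
  < 1, while the total mass is at least a multiple of \<rho>'^n for every \<rho>' < 1, because w is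
  close to 1 near \<open>x0\<close>. The function \<open>h\<close> may jump elsewhere, since
  indicators will be inserted.\<close>

lemma power_weight_concentrates:
  fixes w :: "real \<Rightarrow> real" and h :: "real \<Rightarrow> complex"
  assumes w: "continuous_on {0..1} w" and w01: "\<And>x. x \<in> {0..1} \<Longrightarrow> 0 \<le> w x" "\<And>x. x \<in> {0..1} \<Longrightarrow> w x \<le> 1"
    and x0: "0 < x0" "x0 < 1" "w x0 = 1" and uniq: "\<And>x. x \<in> {0..1} \<Longrightarrow> w x = 1 \<Longrightarrow> x = x0"
    and h: "h \<in> borel_measurable unit_leb" "\<And>x. x \<in> {0..1} \<Longrightarrow> norm (h x) \<le> B"
    and hc: "continuous (at x0 within {0..1}) h"
  shows "(\<lambda>n. (LINT x|unit_leb. of_real (w x ^ n) * h x) / of_real (LINT x|unit_leb. w x ^ n)) \<longlonglongrightarrow> h x0"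
    and "\<And>n. (LINT x|unit_leb. w x ^ n) > 0"
proof -
  have wm [measurable]: "w \<in> borel_measurable unit_leb"
    using w by (intro continuous_imp_measurable_on_sets_lebesgue) auto
  note h(1) [measurable]
  have wn: "\<bar>w x ^ n\<bar> \<le> 1" "0 \<le> w x ^ n" if "x \<in> {0..1}" for x n
    using w01[OF that] by (auto simp: power_le_one abs_if)
  have wint: "integrable unit_leb (\<lambda>x. w x ^ n)" for n
    using wn by (intro unit_leb_integrable_bounded[of _ 1]) auto
  have B: "B \<ge> 0" using h(2)[of x0] x0 by (intro order_trans[OF norm_ge_zero]) auto
  have lower: "\<exists>c>0. \<forall>n. c * \<rho> ^ n \<le> (LINT x|unit_leb. w x ^ n)" if \<rho>: "0 \<le> \<rho>" "\<rho> < 1" for \<rho>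
  proof -
    have "continuous (at x0 within {0..1}) w" using w x0 by (simp add: continuous_on_eq_continuous_within)
    then have "\<forall>\<^sub>F x in at x0 within {0..1}. w x > \<rho>"
      using \<rho> x0(3) by (simp add: continuous_within order_tendstoD(1))
    then obtain d where d: "d > 0" "\<And>x. x \<in> {0..1} \<Longrightarrow> x \<noteq> x0 \<Longrightarrow> dist x x0 < d \<Longrightarrow> w x > \<rho>"
      by (auto simp: eventually_at)
    \<comment> \<open>An interval to the right of \<open>x0\<close>, inside the unit interval, on
      which w is at least \<rho>; it alone contributes e \<rho>^n.\<close>
    define e where "e = min (d/2) (1 - x0)"
    have e: "e > 0" "e < d" "x0 + e \<le> 1" using d x0 by (auto simp: e_def)
    have "e * \<rho> ^ n \<le> (LINT x|unit_leb. w x ^ n)" for n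
    proof -
      have sub: "{x0..x0+e} \<subseteq> {0..1}" using e x0 by auto
      have "e * \<rho> ^ n = (LINT x|unit_leb. indicator {x0..x0+e} x *\<^sub>R \<rho> ^ n)"
      proof -
        define A where "A = {x0..x0+e}"
        have "A \<inter> space unit_leb = A" using sub by (auto simp: A_def)
        moreover have "measure unit_leb A = e"
          using sub e unfolding A_def by (subst measure_restrict_space) auto
        ultimately show ?thesis unfolding A_def[symmetric] by (simp del: space_restrict_space)
      qed
      also have "\<dots> \<le> (LINT x|unit_leb. w x ^ n)"
      proof (rule integral_mono)
        show "integrable unit_leb (\<lambda>x. indicator {x0..x0+e} x *\<^sub>R \<rho> ^ n)"
        proof (rule unit_leb_integrable_bounded[of _ 1])
          have "{x0..x0+e} \<in> sets unit_leb" using sub by (auto simp: sets_restrict_space_iff)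
          then show "(\<lambda>x. indicator {x0..x0+e} x *\<^sub>R \<rho> ^ n) \<in> borel_measurable unit_leb" by measurable
          show "norm (indicator {x0..x0+e} x *\<^sub>R \<rho> ^ n) \<le> 1" for x :: real
            using \<rho> by (auto simp: indicator_def power_le_one)
        qed
        fix x assume x: "x \<in> space unit_leb"
        show "indicator {x0..x0+e} x *\<^sub>R \<rho> ^ n \<le> w x ^ n"
        proof (cases "x \<in> {x0..x0+e}")
          case True
          have "\<rho> \<le> w x"
          proof (cases "x = x0")
            case False
            then show ?thesis using d(2)[of x] True x e by (auto simp: dist_real_def)
          qed (use x0 \<rho> in simp)
          then show ?thesis using True \<rho> by (simp add: power_mono)
        qed (use wn x in auto)
      qed (rule wint)
      finally show ?thesis .
    qed
    then show ?thesis using e by blast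
  qed
  show pos: "(LINT x|unit_leb. w x ^ n) > 0" for n
  proof -
    obtain c where "c > 0" "c * (1/2) ^ n \<le> (LINT x|unit_leb. w x ^ n)" using lower[of "1/2"] by auto
    then show ?thesis by (smt (verit) mult_pos_pos zero_less_power half_gt_zero zero_less_one)
  qed
  show "(\<lambda>n. (LINT x|unit_leb. of_real (w x ^ n) * h x) / of_real (LINT x|unit_leb. w x ^ n)) \<longlonglongrightarrow> h x0"
  proof (rule LIMSEQ_I)
    fix e :: real assume e: "e > 0"
    obtain d where d: "d > 0" "\<And>x. x \<in> {0..1} \<Longrightarrow> dist x x0 < d \<Longrightarrow> norm (h x - h x0) < e/2"
      using hc e unfolding continuous_within_eps_delta dist_norm by (metis half_gt_zero)
    define F where "F = {x\<in>{0..1}. d \<le> dist x x0}"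
    have "\<exists>\<rho>. 0 \<le> \<rho> \<and> \<rho> < 1 \<and> (\<forall>x\<in>F. w x \<le> \<rho>)"
    proof (cases "F = {}")
      case False
      have "closed {x. d \<le> dist x x0}" by (intro closed_Collect_le continuous_intros)
      moreover have "F = {0..1} \<inter> {x. d \<le> dist x x0}" by (auto simp: F_def)
      ultimately have "compact F" by (simp add: compact_Int_closed)
      moreover have "continuous_on F w" using w by (rule continuous_on_subset) (auto simp: F_def)
      ultimately obtain x where x: "x \<in> F" "\<forall>y\<in>F. w y \<le> w x"
        using continuous_attains_sup False by metis
      have "w x \<noteq> 1" using uniq[of x] x d by (auto simp: F_def)
      then show ?thesis using x w01[of x] by (intro exI[of _ "w x"]) (auto simp: F_def)
    qed (auto intro: exI[of _ 0])
    then obtain \<rho> where \<rho>: "0 \<le> \<rho>" "\<rho> < 1" "\<And>x. x \<in> F \<Longrightarrow> w x \<le> \<rho>" by blast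
    \<comment> \<open>Strictly between the bound off the peak and 1, so that (\<rho>/\<rho>')^n
      tends to 0.\<close>
    define \<rho>' where "\<rho>' = (1 + \<rho>) / 2"
    have \<rho>': "0 < \<rho>'" "\<rho>' < 1" "\<rho> < \<rho>'" using \<rho> by (auto simp: \<rho>'_def)
    obtain c where c: "c > 0" "\<And>n. c * \<rho>' ^ n \<le> (LINT x|unit_leb. w x ^ n)" using lower[of \<rho>'] \<rho>' by auto
    have "(\<lambda>n. 2 * B / c * (\<rho> / \<rho>') ^ n) \<longlonglongrightarrow> 0"
      using \<rho> \<rho>' by (intro tendsto_mult_right_zero LIMSEQ_power_zero) auto
    then obtain N where N: "\<And>n. n \<ge> N \<Longrightarrow> norm (2 * B / c * (\<rho> / \<rho>') ^ n - 0) < e/2"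
      using e LIMSEQ_D half_gt_zero by metis
    have "norm ((LINT x|unit_leb. of_real (w x ^ n) * h x) / of_real (LINT x|unit_leb. w x ^ n) - h x0) < e" if n: "n \<ge> N" for n
    proof -
      define I where "I = (LINT x|unit_leb. w x ^ n)"
      have I: "I > 0" using pos by (simp add: I_def)
      have i1: "integrable unit_leb (\<lambda>x. of_real (w x ^ n) * h x)"
      proof (rule unit_leb_integrable_bounded[of _ B])
        show "norm (of_real (w x ^ n) * h x) \<le> B" if "x \<in> {0..1}" for x
          using mult_mono[OF wn(1)[OF that, of n] h(2)[OF that]] wn[OF that, of n] by (simp add: norm_mult del: of_real_power)
      qed measurable
      have i2: "integrable unit_leb (\<lambda>x. complex_of_real (w x ^ n) * h x0)"
        by (rule integrable_mult_left[OF integrable_of_real[OF wint]])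
      have "(LINT x|unit_leb. of_real (w x ^ n) * h x) - of_real I * h x0 = (LINT x|unit_leb. of_real (w x ^ n) * h x - of_real (w x ^ n) * h x0)"
        unfolding Bochner_Integration.integral_diff[OF i1 i2] I_def by (simp del: of_real_power)
      also have "norm \<dots> \<le> (LINT x|unit_leb. e/2 * w x ^ n + 2 * B * \<rho> ^ n)"
      proof (rule order_trans[OF integral_norm_bound], rule integral_mono)
        interpret finite_measure unit_leb by (rule finite_measure_lebesgue_on) simp
        show "integrable unit_leb (\<lambda>x. e/2 * w x ^ n + 2 * B * \<rho> ^ n)" using wint by auto
        show "integrable unit_leb (\<lambda>x. norm (of_real (w x ^ n) * h x - of_real (w x ^ n) * h x0))"
          using i1 i2 by (intro integrable_norm Bochner_Integration.integrable_diff)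
        fix x assume "x \<in> space unit_leb"
        then have x: "x \<in> {0..1}" by simp
        have eq: "norm (of_real (w x ^ n) * h x - of_real (w x ^ n) * h x0) = w x ^ n * norm (h x - h x0)"
          using wn[OF x, of n] by (simp add: norm_mult del: of_real_power flip: right_diff_distrib)
        show "norm (of_real (w x ^ n) * h x - of_real (w x ^ n) * h x0) \<le> e/2 * w x ^ n + 2 * B * \<rho> ^ n"
        proof (cases "x \<in> F")
          case True
          have "norm (h x - h x0) \<le> 2 * B"
            using h(2)[OF x] h(2)[of x0] x0 norm_triangle_ineq4[of "h x" "h x0"] by auto
          moreover have "w x ^ n \<le> \<rho> ^ n" using \<rho>(3)[OF True] w01[OF x] by (intro power_mono) auto
          ultimately have "w x ^ n * norm (h x - h x0) \<le> \<rho> ^ n * (2 * B)" using \<rho> by (intro mult_mono) auto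
          moreover have "0 \<le> e/2 * w x ^ n" using e wn[OF x] by simp
          ultimately show ?thesis unfolding eq by (simp add: mult_ac)
        next
          case False
          then have "norm (h x - h x0) \<le> e/2" using d(2)[OF x] x by (auto simp: F_def intro: less_imp_le)
          then have "w x ^ n * norm (h x - h x0) \<le> w x ^ n * (e/2)" using wn[OF x] by (intro mult_left_mono) auto
          moreover have "0 \<le> 2 * B * \<rho> ^ n" using B \<rho> by simp
          ultimately show ?thesis unfolding eq by (simp add: mult_ac)
        qed
      qed
      also have "\<dots> = e/2 * I + 2 * B * \<rho> ^ n"
      proof -
        interpret finite_measure unit_leb by (rule finite_measure_lebesgue_on) simp
        have "measure unit_leb {0..1} = 1" by (subst measure_restrict_space) auto
        then show ?thesis unfolding I_def using wint by (subst Bochner_Integration.integral_add) auto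
      qed
      finally have "norm ((LINT x|unit_leb. of_real (w x ^ n) * h x) - of_real I * h x0) / I \<le> (e/2 * I + 2 * B * \<rho> ^ n) / I"
        using I by (intro divide_right_mono) auto
      also have "\<dots> = e/2 + 2 * B * \<rho> ^ n / I" using I by (simp add: add_divide_distrib)
      also have "2 * B * \<rho> ^ n / I \<le> 2 * B * \<rho> ^ n / (c * \<rho>' ^ n)"
        using c(2)[of n] c(1) \<rho>' B \<rho> I unfolding I_def[symmetric] by (intro divide_left_mono) auto
      also have "\<dots> = 2 * B / c * (\<rho> / \<rho>') ^ n" by (simp add: power_divide)
      also have "\<dots> < e/2" by (rule order.strict_trans1[OF abs_ge_self N[OF n, unfolded real_norm_def diff_0_right]])
      finally have "norm ((LINT x|unit_leb. of_real (w x ^ n) * h x) - of_real I * h x0) / I < e" by simp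
      moreover have "(LINT x|unit_leb. of_real (w x ^ n) * h x) / of_real I - h x0 = ((LINT x|unit_leb. of_real (w x ^ n) * h x) - of_real I * h x0) / of_real I"
        using I by (simp add: diff_divide_distrib)
      ultimately show ?thesis using I unfolding I_def[symmetric] by (simp add: norm_divide)
    qed
    then show "\<exists>no. \<forall>n\<ge>no. norm ((LINT x|unit_leb. of_real (w x ^ n) * h x) / of_real (LINT x|unit_leb. w x ^ n) - h x0) < e" by blast
  qed
qed

text \<open>The \<open>F n\<close> are primitives of differences of translated normalized powers of a squared cosine, so
  they are entire and their smoothness on the torus comes for free.\<close>

lemma periodic_test_functions:
  assumes x: "0 < x0" "x0 < x1" "x1 < 1"
  shows "\<exists>F :: nat \<Rightarrow> complex \<Rightarrow> complex. (\<forall>n. F n holomorphic_on UNIV) \<and> (\<forall>n x. F n (of_real (x + 1)) = F n (of_real x)) \<and>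
    (\<forall>n. \<forall>x\<in>{0..1}. norm (F n (of_real x)) \<le> 2) \<and>
    (\<forall>x\<in>{0..1}. x \<noteq> x0 \<longrightarrow> x \<noteq> x1 \<longrightarrow> (\<lambda>n. F n (of_real x)) \<longlonglongrightarrow> indicator {x0..x1} x) \<and>
    (\<forall>h. continuous_on {0..1} h \<longrightarrow> (\<lambda>n. LINT x|unit_leb. deriv (F n) (of_real x) * h x) \<longlonglongrightarrow> h x0 - h x1)"
proof -
  \<comment> \<open>The squared cosine has period 1, attains 1 only at integer distance from
    \<open>y\<close>, and extends to an entire function.\<close>
  define w where "w y x = (cos (pi * (x - y))) ^ 2" for y x :: real
  define J where "J y n = (LINT x|unit_leb. w y x ^ n)" for y n
  have w: "continuous_on {0..1} (w y)" "\<And>x. 0 \<le> w y x" "\<And>x. w y x \<le> 1" "w y y = 1"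
    "\<And>x. x \<in> {0..1} \<Longrightarrow> w y x = 1 \<Longrightarrow> x = y" if y: "0 < y" "y < 1" for y
  proof -
    show "continuous_on {0..1} (w y)" unfolding w_def by (intro continuous_intros)
    show "0 \<le> w y x" "w y x \<le> 1" "w y y = 1" for x by (auto simp: w_def abs_square_le_1)
    fix x assume x: "x \<in> {0..1}" "w y x = 1"
    have "sin (pi * (x - y)) = 0" using x(2) sin_cos_squared_add[of "pi * (x - y)"] by (simp add: w_def)
    then obtain k :: int where "pi * (x - y) = of_int k * pi" using sin_zero_iff_int2 by blast
    then have k: "x - y = of_int k" by simp
    then have "-1 < real_of_int k" "real_of_int k < 1" using x y by auto
    then have "k = 0" by linarith
    then show "x = y" using k by simp
  qed
  have conc: "(\<lambda>n. (LINT x|unit_leb. of_real (w y x ^ n) * h x) / of_real (J y n)) \<longlonglongrightarrow> h y"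
    if "0 < y" "y < 1" "h \<in> borel_measurable unit_leb" "\<And>x. x \<in> {0..1} \<Longrightarrow> norm (h x) \<le> B" "continuous (at y within {0..1}) h"
    for y B :: real and h :: "real \<Rightarrow> complex"
    unfolding J_def by (rule power_weight_concentrates(1)[where B = B]) (use w[OF that(1,2)] that in auto)
  have J: "J y n > 0" if "0 < y" "y < 1" for y n
    unfolding J_def
    by (rule power_weight_concentrates(2)[where h = "\<lambda>_. 0" and B = 0 and ?x0.0 = y]) (use w[OF that] that in auto)
  \<comment> \<open>The kernel of mass 1 on the unit interval, continued to complex
    arguments.\<close>
  define K where "K y n z = (cos (of_real pi * (z - of_real y)) ^ 2) ^ n / of_real (J y n)" for y n and z :: complex
  have K_real: "K y n (of_real x) = of_real (w y x ^ n / J y n)" for y n x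
    by (simp add: K_def w_def cos_of_real flip: of_real_mult of_real_diff of_real_power of_real_divide)
  have hol: "(\<lambda>z. K x0 n z - K x1 n z) holomorphic_on UNIV" for n
    unfolding K_def using J[of x0 n] J[of x1 n] x by (intro holomorphic_intros) auto
  have "\<exists>G. \<forall>z. (G has_field_derivative (K x0 n z - K x1 n z)) (at z)" for n
    by (rule holomorphic_convex_primitive'[OF convex_UNIV open_UNIV hol[of n]]) auto
  then obtain G where G: "\<And>n z. (G n has_field_derivative (K x0 n z - K x1 n z)) (at z)" by metis
  \<comment> \<open>Normalised to vanish at 0, so on the reals it is the integral from 0 of two
    approximate point masses with opposite signs; the limit jumps up at \<open>x0\<close> and down
    at \<open>x1\<close>.\<close>
  define F where "F n z = G n z - G n 0" for n z
  have FD: "(F n has_field_derivative (K x0 n z - K x1 n z)) (at z)" for n z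
    unfolding F_def using G by (auto intro!: derivative_eq_intros)
  have Fhol: "F n holomorphic_on UNIV" for n
    using FD by (meson DERIV_subset field_differentiable_def holomorphic_onI subset_UNIV)
  have dF: "deriv (F n) z = K x0 n z - K x1 n z" for n z using FD by (rule DERIV_imp_deriv)
  have FV: "((\<lambda>x. F n (of_real x)) has_vector_derivative of_real (w x0 x ^ n / J x0 n - w x1 x ^ n / J x1 n)) (at x within S)" for n x S
  proof -
    have "((\<lambda>x. F n (of_real x)) has_vector_derivative (K x0 n (of_real x) - K x1 n (of_real x))) (at x)"
      by (rule has_vector_derivative_real_field[OF FD])
    then show ?thesis by (simp add: K_real has_vector_derivative_at_within)
  qed
  have k_int: "integrable (lebesgue_on {0..c}) (\<lambda>x. complex_of_real (w y x ^ n / J y n))" for y n c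
    unfolding w_def of_real_divide
    by (rule integrable_divide) (intro continuous_imp_integrable_real continuous_intros)
  have Fint: "F n (of_real c) = (LINT x|lebesgue_on {0..c}. of_real (w x0 x ^ n / J x0 n)) - (LINT x|lebesgue_on {0..c}. of_real (w x1 x ^ n / J x1 n))"
    if "c \<ge> 0" for n c
  proof -
    have "((\<lambda>x. of_real (w x0 x ^ n / J x0 n - w x1 x ^ n / J x1 n)) has_integral (F n (of_real c) - F n (of_real 0))) {0..c}"
      using FV that by (intro fundamental_theorem_of_calculus) auto
    then have "F n (of_real c) = integral {0..c} (\<lambda>x. of_real (w x0 x ^ n / J x0 n) - of_real (w x1 x ^ n / J x1 n))"
      by (simp add: F_def integral_unique)
    also have "\<dots> = (LINT x|lebesgue_on {0..c}. of_real (w x0 x ^ n / J x0 n) - of_real (w x1 x ^ n / J x1 n))"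
      by (rule lebesgue_integral_eq_integral[symmetric]) (use k_int in auto)
    also have "\<dots> = (LINT x|lebesgue_on {0..c}. of_real (w x0 x ^ n / J x0 n)) - (LINT x|lebesgue_on {0..c}. of_real (w x1 x ^ n / J x1 n))"
      by (rule Bochner_Integration.integral_diff) (rule k_int)+
    finally show ?thesis .
  qed
  have restr: "(LINT x|lebesgue_on {0..c}. complex_of_real (w y x ^ n / J y n)) = (LINT x|unit_leb. of_real (w y x ^ n) * indicator {..c} x) / of_real (J y n)"
    if "c \<in> {0..1}" for y n c
  proof -
    have "(LINT x|lebesgue_on {0..c}. complex_of_real (w y x ^ n / J y n)) = (LINT x|lebesgue. indicator {0..c} x *\<^sub>R complex_of_real (w y x ^ n / J y n))"
      by (rule integral_restrict_space) auto
    also have "\<dots> = (LINT x|lebesgue. indicator {0..1} x *\<^sub>R (of_real (w y x ^ n) * indicator {..c} x / of_real (J y n)))"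
      using that by (intro Bochner_Integration.integral_cong) (auto simp: indicator_def)
    also have "\<dots> = (LINT x|unit_leb. of_real (w y x ^ n) * indicator {..c} x / of_real (J y n))"
      by (rule integral_restrict_space[symmetric]) auto
    finally show ?thesis by simp
  qed
  have kbound: "norm (LINT x|lebesgue_on {0..c}. complex_of_real (w y x ^ n / J y n)) \<le> 1" if y: "0 < y" "y < 1" and c: "c \<in> {0..1}" for y n c
  proof -
    have "norm (LINT x|unit_leb. complex_of_real (w y x ^ n) * indicator {..c} x) \<le> (LINT x|unit_leb. w y x ^ n)"
    proof (rule order_trans[OF integral_norm_bound], rule integral_mono)
      have wm [measurable]: "w y \<in> borel_measurable unit_leb"
        using w(1)[OF y] by (intro continuous_imp_measurable_on_sets_lebesgue) auto
      have [measurable]: "indicator {..c} \<in> borel_measurable unit_leb"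
        by (intro measurable_restrict_space1 borel_measurable_indicator) auto
      have wn: "\<bar>w y x ^ n\<bar> \<le> 1" "0 \<le> w y x ^ n" for x
        using w(2)[OF y, of x] w(3)[OF y, of x] by (simp_all add: power_le_one)
      show "integrable unit_leb (\<lambda>x. w y x ^ n)" using wn by (intro unit_leb_integrable_bounded[of _ 1]) auto
      show "integrable unit_leb (\<lambda>x. norm (complex_of_real (w y x ^ n) * indicator {..c} x))"
      proof (rule unit_leb_integrable_bounded[of _ 1])
        show "(\<lambda>x. norm (complex_of_real (w y x ^ n) * indicator {..c} x)) \<in> borel_measurable unit_leb" by measurable
      qed (use wn in \<open>auto simp: norm_mult indicator_def simp del: of_real_power\<close>)
      show "norm (complex_of_real (w y x ^ n) * indicator {..c} x) \<le> w y x ^ n" for x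
        using wn[of x] by (auto simp: norm_mult indicator_def simp del: of_real_power)
    qed
    then show ?thesis
      unfolding restr[OF c] norm_divide J_def[symmetric] using J[OF y, of n] by (simp del: of_real_power)
  qed
  have klim: "(\<lambda>n. LINT x|lebesgue_on {0..c}. complex_of_real (w y x ^ n / J y n)) \<longlonglongrightarrow> indicator {..c} y"
    if y: "0 < y" "y < 1" and c: "c \<in> {0..1}" "c \<noteq> y" for y c
    unfolding restr[OF c(1)]
  proof (rule conc[OF y, where B = 1])
    show "(indicator {..c} :: real \<Rightarrow> complex) \<in> borel_measurable unit_leb"
      by (intro measurable_restrict_space1 borel_measurable_indicator) auto
    show "norm (indicator {..c} x :: complex) \<le> 1" for x by (auto simp: indicator_def)
    have "y \<notin> frontier {..c}" using c by simp
    then have "isCont (indicator {..c} :: real \<Rightarrow> complex) y"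
    proof -
      have "open (- {c})" "y \<in> - {c}" using c by auto
      consider "y < c" | "c < y" using c by linarith
      then show ?thesis
      proof cases
        case 1
        have "\<forall>\<^sub>F x in nhds y. x \<in> {..<c}" using 1 by (intro eventually_nhds_in_open) auto
        then have "\<forall>\<^sub>F x in nhds y. (indicator {..c} x :: complex) = 1" by eventually_elim auto
        then show ?thesis using isCont_cong[of "indicator {..c}" "\<lambda>_. 1 :: complex" y] by simp
      next
        case 2
        have "\<forall>\<^sub>F x in nhds y. x \<in> {c<..}" using 2 by (intro eventually_nhds_in_open) auto
        then have "\<forall>\<^sub>F x in nhds y. (indicator {..c} x :: complex) = 0" by eventually_elim auto
        then show ?thesis using isCont_cong[of "indicator {..c}" "\<lambda>_. 0 :: complex" y] by simp
      qed
    qed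
    then show "continuous (at y within {0..1}) (indicator {..c} :: real \<Rightarrow> complex)"
      by (rule continuous_at_imp_continuous_at_within)
  qed
  show ?thesis
  proof (intro exI[of _ F] conjI allI ballI impI)
    show "F n holomorphic_on UNIV" for n by (rule Fhol)
    show "F n (of_real (x + 1)) = F n (of_real x)" for n x
    proof -
      have per: "w y (x + 1) = w y x" for y x
      proof -
        have "pi * (x + 1 - y) = pi * (x - y) + pi" by (simp add: algebra_simps)
        then show ?thesis by (simp add: w_def)
      qed
      \<comment> \<open>Both kernels have mass 1 on a period, so their difference has mean 0 and its
        primitive is periodic.\<close>
      have J1: "(LINT x|unit_leb. complex_of_real (w y x ^ n / J y n)) = 1" if "0 < y" "y < 1" for y
        using J[OF that, of n] by (simp add: J_def[symmetric] flip: of_real_divide of_real_power)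
      define H where "H x = F n (of_real (x + 1)) - F n (of_real x)" for x
      have "(H has_vector_derivative 0) (at x)" for x
      proof -
        have "((\<lambda>x. x + 1) has_vector_derivative 1) (at x)" by (auto intro!: derivative_eq_intros)
        from vector_diff_chain_at[OF this FV[of n "x + 1" UNIV]]
        have "((\<lambda>x. F n (of_real (x + 1))) has_vector_derivative of_real (w x0 x ^ n / J x0 n - w x1 x ^ n / J x1 n)) (at x)"
          by (simp add: comp_def per)
        from has_vector_derivative_diff[OF this FV[of n x UNIV]] show ?thesis by (simp add: H_def[abs_def])
      qed
      then have "(H has_derivative (\<lambda>h. 0)) (at x within UNIV)" for x by (simp add: has_vector_derivative_def)
      then have "H x = H 0" using has_derivative_zero_constant[of UNIV H] by (metis UNIV_I convex_UNIV)
      also have "H 0 = 0"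
        using Fint[of 1 n] J1[of x0] J1[of x1] x by (simp add: H_def F_def)
      finally show ?thesis by (simp add: H_def)
    qed
    show "norm (F n (of_real c)) \<le> 2" if c: "c \<in> {0..1}" for n c
    proof -
      have "norm (F n (of_real c)) \<le> 1 + 1"
        unfolding Fint[of c n, OF atLeastAtMost_iff[THEN iffD1, OF c, THEN conjunct1]]
        using x c by (intro order_trans[OF norm_triangle_ineq4] add_mono kbound) auto
      then show ?thesis by simp
    qed
    show "(\<lambda>n. F n (of_real c)) \<longlonglongrightarrow> indicator {x0..x1} c" if c: "c \<in> {0..1}" "c \<noteq> x0" "c \<noteq> x1" for c
    proof -
      have "(\<lambda>n. F n (of_real c)) \<longlonglongrightarrow> indicator {..c} x0 - indicator {..c} x1"
        unfolding Fint[of c, OF atLeastAtMost_iff[THEN iffD1, OF c(1), THEN conjunct1]]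
        using x c by (intro tendsto_diff klim) auto
      moreover have "indicator {..c} x0 - indicator {..c} x1 = (indicator {x0..x1} c :: complex)"
        using x c by (auto simp: indicator_def)
      ultimately show ?thesis by simp
    qed
    show "(\<lambda>n. LINT x|unit_leb. deriv (F n) (of_real x) * h x) \<longlonglongrightarrow> h x0 - h x1" if h: "continuous_on {0..1} h" for h
    proof -
      have "bounded (h ` {0..1})" using h by (intro compact_imp_bounded compact_continuous_image) auto
      then obtain B where B: "\<And>x. x \<in> {0..1} \<Longrightarrow> norm (h x) \<le> B" unfolding bounded_iff by blast
      have hm: "h \<in> borel_measurable unit_leb" using h by (intro continuous_imp_measurable_on_sets_lebesgue) auto
      have i: "integrable unit_leb (\<lambda>x. complex_of_real (w y x ^ n / J y n) * h x)" for y n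
        unfolding w_def of_real_divide times_divide_eq_left
        by (rule integrable_divide) (intro continuous_imp_integrable_real continuous_intros h)
      have e: "(LINT x|unit_leb. complex_of_real (w y x ^ n / J y n) * h x) = (LINT x|unit_leb. of_real (w y x ^ n) * h x) / of_real (J y n)" for y n
      proof -
        have "(\<lambda>x. complex_of_real (w y x ^ n / J y n) * h x) = (\<lambda>x. of_real (w y x ^ n) * h x / of_real (J y n))" by auto
        then show ?thesis by simp
      qed
      have "(LINT x|unit_leb. deriv (F n) (of_real x) * h x) = (LINT x|unit_leb. of_real (w x0 x ^ n) * h x) / of_real (J x0 n)
         - (LINT x|unit_leb. of_real (w x1 x ^ n) * h x) / of_real (J x1 n)" for n
        unfolding dF K_real left_diff_distrib Bochner_Integration.integral_diff[OF i i] e ..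
      moreover have "(\<lambda>n. (LINT x|unit_leb. of_real (w y x ^ n) * h x) / of_real (J y n)) \<longlonglongrightarrow> h y" if "0 < y" "y < 1" for y
        using h that by (intro conc[where B = B] hm B) (auto simp: continuous_on_eq_continuous_within)
      ultimately show ?thesis using x by (simp only:) (intro tendsto_diff, auto)
    qed
  qed
qed

section \<open>Testing the weak equation with products of entire periodic functions\<close>

lemma product_has_derivative:
  fixes f g :: "complex \<Rightarrow> complex"
  assumes f: "f holomorphic_on UNIV" and g: "g holomorphic_on UNIV"
  shows "((\<lambda>z. f (of_real (fst z)) * g (of_real (snd z))) has_derivative
     dform (deriv f (of_real (fst z)) * g (of_real (snd z))) (f (of_real (fst z)) * deriv g (of_real (snd z)))) (at z)"
proof -
  have df: "(f has_derivative (\<lambda>h. h * deriv f w)) (at w)" and dg: "(g has_derivative (\<lambda>h. h * deriv g w)) (at w)" for w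
    using holomorphic_derivI[OF f open_UNIV, of w UNIV] holomorphic_derivI[OF g open_UNIV, of w UNIV]
    by (simp_all add: has_field_derivative_def mult_commute_abs)
  have 1: "((\<lambda>z. f (of_real (fst z))) has_derivative (\<lambda>h. of_real (fst h) * deriv f (of_real (fst z)))) (at z)"
    by (rule has_derivative_compose[OF _ df]) (intro derivative_intros)
  have 2: "((\<lambda>z. g (of_real (snd z))) has_derivative (\<lambda>h. of_real (snd h) * deriv g (of_real (snd z)))) (at z)"
    by (rule has_derivative_compose[OF _ dg]) (intro derivative_intros)
  from has_derivative_mult[OF 1 2] show ?thesis
    by (rule has_derivative_eq_rhs) (auto simp: dform_def scaleR_conv_of_real algebra_simps)
qed

lemma partials_eqI:
  assumes "(f has_derivative dform fx fy) (at z)"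
  shows "partial_x f z = fx" "partial_y f z = fy"
  unfolding partial_x_def partial_y_def frechet_derivative_at[OF assms, symmetric] by (simp_all add: dform_def)

text \<open>Both partial derivatives are again products of entire functions, so the induction runs
  over all pairs \<open>f\<close>, \<open>g\<close> at once.\<close>

lemma Ck_product:
  assumes "f holomorphic_on UNIV" "g holomorphic_on UNIV"
  shows "Ck k (\<lambda>z. f (of_real (fst z)) * g (of_real (snd z)))"
  using assms
proof (induction k arbitrary: f g)
  case 0
  have "continuous_on UNIV f" "continuous_on UNIV g" using 0 by (auto intro: holomorphic_on_imp_continuous_on)
  then show ?case by (auto intro!: continuous_intros continuous_on_compose2[of UNIV f] continuous_on_compose2[of UNIV g])
next
  case (Suc k)
  have d: "deriv f holomorphic_on UNIV" "deriv g holomorphic_on UNIV" using Suc.prems by (auto intro: holomorphic_deriv)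
  have "partial_x (\<lambda>z. f (of_real (fst z)) * g (of_real (snd z))) = (\<lambda>z. deriv f (of_real (fst z)) * g (of_real (snd z)))"
    "partial_y (\<lambda>z. f (of_real (fst z)) * g (of_real (snd z))) = (\<lambda>z. f (of_real (fst z)) * deriv g (of_real (snd z)))"
    using partials_eqI[OF product_has_derivative[OF Suc.prems]] by auto
  then show ?case
    using Suc.IH[OF d(1) Suc.prems(2)] Suc.IH[OF Suc.prems(1) d(2)] product_has_derivative[OF Suc.prems]
    by (auto simp: differentiable_def)
qed

lemma weak_L_eq_product_test:
  assumes weak: "weak_L_eq a b u F" and f: "f holomorphic_on UNIV" and g: "g holomorphic_on UNIV"
    and fp: "\<And>x. f (of_real (x + 1)) = f (of_real x)" and gp: "\<And>x. g (of_real (x + 1)) = g (of_real x)"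
  shows "- (LINT z|lebesgue_on unit_square. u (proj z) * (b (proj z) * (deriv f (of_real (fst z)) * g (of_real (snd z)))
             - a (proj z) * (f (of_real (fst z)) * deriv g (of_real (snd z)))))
    = (LINT z|lebesgue_on unit_square. F (proj z) * (f (of_real (fst z)) * g (of_real (snd z))))"
proof -
  define \<psi> where "\<psi> z = f (of_real (fst z)) * g (of_real (snd z))" for z :: "real \<times> real"
  \<comment> \<open>The product descends to the torus through an arbitrary lift; the periods of
    \<open>f\<close> and \<open>g\<close> make the choice irrelevant.\<close>
  define \<phi> where "\<phi> p = \<psi> (SOME z. proj z = p)" for p
  have \<phi>: "\<phi> \<circ> proj = \<psi>"
  proof
    fix z
    define z' where "z' = (SOME z'. proj z' = proj z)"
    have "proj z' = proj z" unfolding z'_def by (rule someI[of _ z]) simp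
    then obtain m n where mn: "fst z' - fst z = of_int m" "snd z' - snd z = of_int n"
      unfolding proj_eq_iff by (auto elim!: Ints_cases)
    have "f (of_real (fst z + of_int m)) = f (of_real (fst z))" "g (of_real (snd z + of_int n)) = g (of_real (snd z))"
      using quasiperiodic_int_shift[of "\<lambda>x. f (of_real x)" 0] quasiperiodic_int_shift[of "\<lambda>x. g (of_real x)" 0] fp gp by simp_all
    moreover have "fst z' = fst z + of_int m" "snd z' = snd z + of_int n" using mn by auto
    ultimately show "(\<phi> \<circ> proj) z = \<psi> z" by (simp add: \<phi>_def \<psi>_def flip: z'_def)
  qed
  have "smooth \<phi>" unfolding smooth_def \<phi> \<psi>_def[abs_def] using Ck_product[OF f g] by blast
  with weak have "- (LINT z|lebesgue_on unit_square. u (proj z) * L_op a b \<phi> z) = (LINT z|lebesgue_on unit_square. F (proj z) * \<phi> (proj z))"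
    by (simp add: weak_L_eq_def)
  moreover have "\<phi> (proj z) = \<psi> z" for z using \<phi> by (metis comp_apply)
  moreover have "L_op a b \<phi> z = b (proj z) * (deriv f (of_real (fst z)) * g (of_real (snd z)))
             - a (proj z) * (f (of_real (fst z)) * deriv g (of_real (snd z)))" for z
    unfolding L_op_def \<phi> \<psi>_def[abs_def] using partials_eqI[OF product_has_derivative[OF f g]] by simp
  ultimately show ?thesis by (simp add: \<psi>_def)
qed

abbreviation square_leb :: "(real \<times> real) measure" where "square_leb \<equiv> lebesgue_on unit_square"

lemma unit_square_sets: "unit_square \<in> sets lebesgue" "unit_square \<in> lmeasurable"
  by (auto simp: unit_square_def)

lemma unit_square_iff: "(x, y) \<in> unit_square \<longleftrightarrow> x \<in> {0..1} \<and> y \<in> {0..1}"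
  by (auto simp: unit_square_def cbox_Pair_eq)

lemma Fubini_rectangle:
  fixes \<phi> :: "real \<times> real \<Rightarrow> complex"
  assumes c: "continuous_on (cbox (x0, y0) (x1, y1)) \<phi>"
  shows "(LINT z|lebesgue_on (cbox (x0, y0) (x1, y1)). \<phi> z) = (LINT x|lebesgue_on {x0..x1}. integral {y0..y1} (\<lambda>y. \<phi> (x, y)))"
    and "(LINT z|lebesgue_on (cbox (x0, y0) (x1, y1)). \<phi> z) = (LINT y|lebesgue_on {y0..y1}. integral {x0..x1} (\<lambda>x. \<phi> (x, y)))"
    and "continuous_on {x0..x1} (\<lambda>x. integral {y0..y1} (\<lambda>y. \<phi> (x, y)))"
    and "continuous_on {y0..y1} (\<lambda>y. integral {x0..x1} (\<lambda>x. \<phi> (x, y)))"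
proof -
  have c': "continuous_on (cbox (y0, x0) (y1, x1)) (\<lambda>(y, x). \<phi> (x, y))"
    unfolding case_prod_unfold
    by (rule continuous_on_compose2[OF c]) (auto intro!: continuous_intros simp: cbox_Pair_eq)
  show cx: "continuous_on {x0..x1} (\<lambda>x. integral {y0..y1} (\<lambda>y. \<phi> (x, y)))"
    using integral_continuous_on_param[where f = "\<lambda>x y. \<phi> (x, y)" and U = "{x0..x1}" and a = y0 and b = y1] c by (simp add: cbox_Pair_eq)
  show cy: "continuous_on {y0..y1} (\<lambda>y. integral {x0..x1} (\<lambda>x. \<phi> (x, y)))"
    using integral_continuous_on_param[where f = "\<lambda>y x. \<phi> (x, y)" and U = "{y0..y1}" and a = x0 and b = x1] c' by (simp add: cbox_Pair_eq)
  have 0: "(LINT z|lebesgue_on (cbox (x0, y0) (x1, y1)). \<phi> z) = integral (cbox (x0, y0) (x1, y1)) \<phi>"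
    by (rule lebesgue_integral_eq_integral[OF continuous_imp_integrable[OF c]]) simp
  have 1: "\<dots> = integral {x0..x1} (\<lambda>x. integral {y0..y1} (\<lambda>y. \<phi> (x, y)))"
    using integral_prod_continuous[OF c] by simp
  have 2: "\<dots> = integral {y0..y1} (\<lambda>y. integral {x0..x1} (\<lambda>x. \<phi> (x, y)))"
    using integral_swap_continuous[where f = "\<lambda>x y. \<phi> (x, y)" and a = x0 and c = y0 and b = x1 and d = y1] c by (simp add: case_prod_unfold)
  show "(LINT z|lebesgue_on (cbox (x0, y0) (x1, y1)). \<phi> z) = (LINT x|lebesgue_on {x0..x1}. integral {y0..y1} (\<lambda>y. \<phi> (x, y)))"
    unfolding 0 1 by (rule continuous_side_integral[OF cx])
  show "(LINT z|lebesgue_on (cbox (x0, y0) (x1, y1)). \<phi> z) = (LINT y|lebesgue_on {y0..y1}. integral {x0..x1} (\<lambda>x. \<phi> (x, y)))"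
    unfolding 0 1 2 by (rule continuous_side_integral[OF cy])
qed

lemma integral_lebesgue_on_subset:
  fixes f :: "'b::euclidean_space \<Rightarrow> complex"
  assumes "S \<in> sets lebesgue" "T \<in> sets lebesgue" "S \<subseteq> T"
  shows "(LINT x|lebesgue_on T. f x * indicator S x) = (LINT x|lebesgue_on S. f x)"
proof -
  have "(LINT x|lebesgue_on T. f x * indicator S x) = (LINT x|lebesgue. indicator T x *\<^sub>R (f x * indicator S x))"
    using assms by (intro integral_restrict_space) auto
  also have "\<dots> = (LINT x|lebesgue. indicator S x *\<^sub>R f x)"
    using assms by (intro Bochner_Integration.integral_cong) (auto simp: indicator_def)
  also have "\<dots> = (LINT x|lebesgue_on S. f x)"
    using assms by (intro integral_restrict_space[symmetric]) auto
  finally show ?thesis .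
qed

lemma AE_square_neq: "AE z in square_leb. fst z \<noteq> c \<and> snd z \<noteq> c'"
proof -
  have "negligible {z :: real \<times> real. z \<bullet> (1, 0) = c}" "negligible {z :: real \<times> real. z \<bullet> (0, 1) = c'}"
    by (rule negligible_standard_hyperplane, simp add: Basis_prod_def)+
  then have "negligible ({z :: real \<times> real. fst z = c} \<union> {z. snd z = c'})"
    by (intro negligible_Un) (simp_all add: inner_prod_def)
  then have "negligible (unit_square \<inter> ({z :: real \<times> real. fst z = c} \<union> {z. snd z = c'}))"
    by (rule negligible_subset) auto
  then have "unit_square \<inter> ({z :: real \<times> real. fst z = c} \<union> {z. snd z = c'}) \<in> null_sets square_leb"
    using unit_square_sets by (auto simp: negligible_iff_null_sets null_sets_restrict_space)
  then show ?thesis by (rule AE_I') auto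
qed

lemma AE_unit_neq: "AE x in unit_leb. x \<noteq> c"
proof -
  have "negligible ({0..1} \<inter> {c})" by (intro negligible_Int) auto
  then have "{0..1} \<inter> {c} \<in> null_sets unit_leb"
    by (auto simp: negligible_iff_null_sets null_sets_restrict_space)
  then show ?thesis by (rule AE_I') auto
qed

lemma borel_imp_square_measurable: "f \<in> borel_measurable borel \<Longrightarrow> f \<in> borel_measurable square_leb"
  by (intro measurable_restrict_space1) (auto intro: measurable_completion)

text \<open>The x-derivative of a product test function concentrates on the vertical sides, the
  y-derivative on the horizontal ones. The limits are taken one after the other: the derivatives are
  used only through their integrals against continuous functions of one variable, and these arise by
  integrating out the other variable first.\<close>

lemma rect_integral_unit_square_interior:
  fixes UA UB Fl :: "real \<times> real \<Rightarrow> complex"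
  assumes UA: "continuous_on UNIV UA" and UB: "continuous_on UNIV UB" and Fl: "integrable square_leb Fl"
    and test: "\<And>f g. f holomorphic_on UNIV \<Longrightarrow> g holomorphic_on UNIV \<Longrightarrow>
       (\<And>x. f (of_real (x + 1)) = f (of_real x)) \<Longrightarrow> (\<And>x. g (of_real (x + 1)) = g (of_real x)) \<Longrightarrow>
       - (LINT z|square_leb. UB z * (deriv f (of_real (fst z)) * g (of_real (snd z))) - UA z * (f (of_real (fst z)) * deriv g (of_real (snd z))))
       = (LINT z|square_leb. Fl z * (f (of_real (fst z)) * g (of_real (snd z))))"
    and x: "0 < x0" "x0 < x1" "x1 < 1" and y: "0 < y0" "y0 < y1" "y1 < 1"
  shows "rect_integral UA UB x0 x1 y0 y1 = (LINT z|lebesgue_on (cbox (x0, y0) (x1, y1)). Fl z)"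
proof -
  let ?r = "of_real :: real \<Rightarrow> complex"
  obtain F :: "nat \<Rightarrow> complex \<Rightarrow> complex" where F1: "\<forall>n. F n holomorphic_on UNIV" and F2: "\<forall>n x. F n (?r (x + 1)) = F n (?r x)"
    and F3: "\<forall>n. \<forall>x\<in>{0..1}. norm (F n (?r x)) \<le> 2"
    and F4: "\<forall>x\<in>{0..1}. x \<noteq> x0 \<longrightarrow> x \<noteq> x1 \<longrightarrow> (\<lambda>n. F n (?r x)) \<longlonglongrightarrow> indicator {x0..x1} x"
    and F5: "\<forall>h. continuous_on {0..1} h \<longrightarrow> (\<lambda>n. LINT x|unit_leb. deriv (F n) (?r x) * h x) \<longlonglongrightarrow> h x0 - h x1"
    using periodic_test_functions[OF x] by (elim exE conjE)
  note F = F1[rule_format] F2[rule_format] F3[rule_format] F4[rule_format] F5[rule_format]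
  obtain G :: "nat \<Rightarrow> complex \<Rightarrow> complex" where G1: "\<forall>n. G n holomorphic_on UNIV" and G2: "\<forall>n x. G n (?r (x + 1)) = G n (?r x)"
    and G3: "\<forall>n. \<forall>x\<in>{0..1}. norm (G n (?r x)) \<le> 2"
    and G4: "\<forall>x\<in>{0..1}. x \<noteq> y0 \<longrightarrow> x \<noteq> y1 \<longrightarrow> (\<lambda>n. G n (?r x)) \<longlonglongrightarrow> indicator {y0..y1} x"
    and G5: "\<forall>h. continuous_on {0..1} h \<longrightarrow> (\<lambda>n. LINT x|unit_leb. deriv (G n) (?r x) * h x) \<longlonglongrightarrow> h y0 - h y1"
    using periodic_test_functions[OF y] by (elim exE conjE)
  note G = G1[rule_format] G2[rule_format] G3[rule_format] G4[rule_format] G5[rule_format]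
  have ent: "continuous_on S (\<lambda>x. f (?r (k x)))" if "f holomorphic_on UNIV" "continuous_on S k" for f S and k :: "'z::topological_space \<Rightarrow> real"
    by (rule continuous_on_compose2[OF holomorphic_on_imp_continuous_on[OF that(1)]]) (auto intro!: continuous_intros that(2))
  have cm: "f \<in> borel_measurable square_leb" if "continuous_on UNIV f" for f :: "real \<times> real \<Rightarrow> complex"
    using that unit_square_sets by (intro continuous_imp_measurable_on_sets_lebesgue) (auto intro: continuous_on_subset)
  have ci: "integrable square_leb f" if "continuous_on UNIV f" for f :: "real \<times> real \<Rightarrow> complex"
    unfolding unit_square_def using that by (intro continuous_imp_integrable) (auto intro: continuous_on_subset)
  define I1 where "I1 z = (indicator {x0..x1} (fst z) :: complex)" for z :: "real \<times> real"
  define I2 where "I2 z = (indicator {y0..y1} (snd z) :: complex)" for z :: "real \<times> real"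
  have "I1 = indicator ({x0..x1} \<times> UNIV)" "I2 = indicator (UNIV \<times> {y0..y1})"
    by (auto simp: fun_eq_iff I1_def I2_def indicator_def)
  moreover have "closed ({x0..x1} \<times> (UNIV :: real set))" "closed ((UNIV :: real set) \<times> {y0..y1})"
    by (intro closed_Times closed_UNIV closed_real_atLeastAtMost)+
  ultimately have I1m [measurable]: "I1 \<in> borel_measurable square_leb" and I2m [measurable]: "I2 \<in> borel_measurable square_leb"
    by (simp_all only: borel_imp_square_measurable borel_measurable_indicator borel_closed)
  have Fm [measurable]: "Fl \<in> borel_measurable square_leb" using Fl by simp
  have dom: "(\<lambda>n. LINT z|square_leb. \<phi> z * (f n z)) \<longlonglongrightarrow> (LINT z|square_leb. \<phi> z * f' z)"
    if \<phi>: "integrable square_leb \<phi>" and f: "\<And>n. f n \<in> borel_measurable square_leb" "f' \<in> borel_measurable square_leb"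
      and b: "\<And>n z. z \<in> unit_square \<Longrightarrow> norm (f n z) \<le> 2" and lim: "AE z in square_leb. (\<lambda>n. f n z) \<longlonglongrightarrow> f' z"
    for \<phi> f' :: "real \<times> real \<Rightarrow> complex" and f
  proof (rule integral_dominated_convergence[where w = "\<lambda>z. norm (\<phi> z) * 2"])
    show "integrable square_leb (\<lambda>z. norm (\<phi> z) * 2)" using \<phi> by auto
    show "AE z in square_leb. (\<lambda>n. \<phi> z * f n z) \<longlonglongrightarrow> \<phi> z * f' z"
      using lim by eventually_elim (intro tendsto_intros)
    show "AE z in square_leb. norm (\<phi> z * f n z) \<le> norm (\<phi> z) * 2" for n
      using b by (intro AE_I2) (auto simp: norm_mult intro: mult_left_mono)
  qed (use \<phi> f in measurable)
  \<comment> \<open>First limit, in the x-factor, with \<open>g\<close> fixed: the factor becomes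
    the indicator \<open>I1\<close>, and its derivative becomes a difference of boundary
    values.\<close>
  have step1: "- (integral {0..1} (\<lambda>y. UB (x0, y) * g (?r y)) - integral {0..1} (\<lambda>y. UB (x1, y) * g (?r y))
       - (LINT z|square_leb. (UA z * deriv g (?r (snd z))) * I1 z))
     = (LINT z|square_leb. (Fl z * g (?r (snd z))) * I1 z)"
    if g: "g holomorphic_on UNIV" "\<And>x. g (?r (x + 1)) = g (?r x)" for g
  proof -
    have dg: "deriv g holomorphic_on UNIV" using g by (auto intro: holomorphic_deriv)
    define H where "H x = integral {0..1} (\<lambda>y. UB (x, y) * g (?r y))" for x
    have cUBg: "continuous_on S (\<lambda>z. UB z * g (?r (snd z)))" for S
      by (intro continuous_on_mult ent[OF g(1)] continuous_intros continuous_on_subset[OF UB]) auto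
    have Hc: "continuous_on {0..1} H"
    proof -
      have "continuous_on {0..1} (\<lambda>x. integral {0..1} (\<lambda>y. (\<lambda>z. UB z * g (?r (snd z))) (x, y)))"
        by (rule Fubini_rectangle(3)[OF cUBg])
      then show ?thesis by (simp add: H_def[abs_def])
    qed
    have t1: "(LINT z|square_leb. UB z * (deriv (F n) (?r (fst z)) * g (?r (snd z)))) = (LINT x|unit_leb. deriv (F n) (?r x) * H x)" for n
    proof -
      have dF: "deriv (F n) holomorphic_on UNIV" using F by (auto intro: holomorphic_deriv)
      have c: "continuous_on S (\<lambda>z. UB z * (deriv (F n) (?r (fst z)) * g (?r (snd z))))" for S
        by (intro continuous_on_mult ent[OF g(1)] ent[OF dF] continuous_intros continuous_on_subset[OF UB]) auto
      have "(LINT z|square_leb. UB z * (deriv (F n) (?r (fst z)) * g (?r (snd z))))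
         = (LINT x|unit_leb. integral {0..1} (\<lambda>y. UB (x, y) * (deriv (F n) (?r x) * g (?r y))))"
        unfolding unit_square_def using Fubini_rectangle(1)[OF c, of 0 0 1 1] by simp
      also have "\<dots> = (LINT x|unit_leb. deriv (F n) (?r x) * H x)"
        unfolding H_def integral_mult_right[symmetric] by (simp only: mult_ac)
      finally show ?thesis .
    qed
    have L1: "(\<lambda>n. LINT z|square_leb. UB z * (deriv (F n) (?r (fst z)) * g (?r (snd z)))) \<longlonglongrightarrow> H x0 - H x1"
      unfolding t1 by (rule F(5)[OF Hc])
    have FA: "AE z in square_leb. (\<lambda>n. F n (?r (fst z))) \<longlonglongrightarrow> I1 z"
      using AE_square_neq[of x0 x0] AE_square_neq[of x1 x1] AE_space[of square_leb]
      by eventually_elim (use F(4) in \<open>auto simp: I1_def unit_square_def cbox_Pair_eq\<close>)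
    have Fmeas: "(\<lambda>z. F n (?r (fst z))) \<in> borel_measurable square_leb" for n
      by (intro cm ent[OF F(1)] continuous_intros)
    have Fb: "norm (F n (?r (fst z))) \<le> 2" if "z \<in> unit_square" for n z
      using F(3)[of "fst z" n] that by (cases z) (auto simp: unit_square_iff)
    have i2: "integrable square_leb (\<lambda>z. UA z * deriv g (?r (snd z)))"
      by (intro ci continuous_on_mult UA ent[OF dg] continuous_intros)
    have L2: "(\<lambda>n. LINT z|square_leb. (UA z * deriv g (?r (snd z))) * F n (?r (fst z))) \<longlonglongrightarrow> (LINT z|square_leb. (UA z * deriv g (?r (snd z))) * I1 z)"
      by (rule dom[OF i2 Fmeas I1m Fb FA])
    have i3: "integrable square_leb (\<lambda>z. Fl z * g (?r (snd z)))"
    proof -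
      have "continuous_on unit_square (\<lambda>z. g (?r (snd z)))" by (intro ent[OF g(1)] continuous_intros)
      then have "bounded ((\<lambda>z. g (?r (snd z))) ` unit_square)"
        unfolding unit_square_def by (intro compact_imp_bounded compact_continuous_image) auto
      then obtain B where B: "\<And>z. z \<in> unit_square \<Longrightarrow> norm (g (?r (snd z))) \<le> B" by (auto simp: bounded_iff)
      show ?thesis
      proof (rule Bochner_Integration.integrable_bound)
        show "integrable square_leb (\<lambda>z. norm (Fl z) * B)" using Fl by auto
        have [measurable]: "(\<lambda>z. g (?r (snd z))) \<in> borel_measurable square_leb" by (intro cm ent[OF g(1)] continuous_intros)
        show "(\<lambda>z. Fl z * g (?r (snd z))) \<in> borel_measurable square_leb" by measurable
        show "AE z in square_leb. norm (Fl z * g (?r (snd z))) \<le> norm (norm (Fl z) * B)"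
        proof (rule AE_I2)
          fix z assume "z \<in> space square_leb"
          then have "norm (Fl z) * norm (g (?r (snd z))) \<le> norm (Fl z) * B" using B[of z] by (intro mult_left_mono) auto
          also have "\<dots> \<le> norm (norm (Fl z) * B)" by simp
          finally show "norm (Fl z * g (?r (snd z))) \<le> norm (norm (Fl z) * B)" by (simp add: norm_mult)
        qed
      qed
    qed
    have L3: "(\<lambda>n. LINT z|square_leb. (Fl z * g (?r (snd z))) * F n (?r (fst z))) \<longlonglongrightarrow> (LINT z|square_leb. (Fl z * g (?r (snd z))) * I1 z)"
      by (rule dom[OF i3 Fmeas I1m Fb FA])
    have eq: "- ((LINT z|square_leb. UB z * (deriv (F n) (?r (fst z)) * g (?r (snd z))))
         - (LINT z|square_leb. (UA z * deriv g (?r (snd z))) * F n (?r (fst z))))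
        = (LINT z|square_leb. (Fl z * g (?r (snd z))) * F n (?r (fst z)))" for n
    proof -
      have dF: "deriv (F n) holomorphic_on UNIV" using F by (auto intro: holomorphic_deriv)
      have "(LINT z|square_leb. UB z * (deriv (F n) (?r (fst z)) * g (?r (snd z))) - UA z * (F n (?r (fst z)) * deriv g (?r (snd z))))
        = (LINT z|square_leb. UB z * (deriv (F n) (?r (fst z)) * g (?r (snd z)))) - (LINT z|square_leb. UA z * (F n (?r (fst z)) * deriv g (?r (snd z))))"
        by (intro Bochner_Integration.integral_diff ci continuous_on_mult UA UB ent[OF g(1)] ent[OF dg] ent[OF F(1)] ent[OF dF] continuous_intros)
      with test[OF F(1) g(1) F(2) g(2), of n] show ?thesis by (simp add: mult_ac)
    qed
    have "(\<lambda>n. - ((LINT z|square_leb. UB z * (deriv (F n) (?r (fst z)) * g (?r (snd z))))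
         - (LINT z|square_leb. (UA z * deriv g (?r (snd z))) * F n (?r (fst z))))) \<longlonglongrightarrow>
         - (H x0 - H x1 - (LINT z|square_leb. (UA z * deriv g (?r (snd z))) * I1 z))"
      by (intro tendsto_intros L1 L2)
    then show ?thesis unfolding eq H_def using L3 LIMSEQ_unique by blast
  qed
  \<comment> \<open>Second limit, in the y-factor. The horizontal sides are collected in a
    continuous function of the height, to which the concentrating derivatives can be
    applied.\<close>
  define P where "P y = side_x UA x0 x1 y" for y
  have sub: "cbox (x0, 0) (x1, 1) \<subseteq> unit_square" "cbox (x0, y0) (x1, y1) \<subseteq> unit_square"
    using x y by (auto simp: unit_square_def cbox_Pair_eq)
  have Pc: "continuous_on {0..1} P"
    unfolding P_def side_x_def
    using Fubini_rectangle(4)[of x0 0 x1 1 UA] UA continuous_on_subset by blast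
  have t2: "(LINT z|square_leb. (UA z * deriv (G n) (?r (snd z))) * I1 z) = (LINT y|unit_leb. deriv (G n) (?r y) * P y)" for n
  proof -
    have dG: "deriv (G n) holomorphic_on UNIV" using G by (auto intro: holomorphic_deriv)
    have c: "continuous_on S (\<lambda>z. UA z * deriv (G n) (?r (snd z)))" for S
      by (intro continuous_on_mult ent[OF dG] continuous_intros continuous_on_subset[OF UA]) auto
    have "(LINT z|square_leb. (UA z * deriv (G n) (?r (snd z))) * I1 z)
       = (LINT z|square_leb. (UA z * deriv (G n) (?r (snd z))) * indicator (cbox (x0, 0) (x1, 1)) z)"
      by (rule Bochner_Integration.integral_cong) (auto simp: I1_def indicator_def unit_square_def cbox_Pair_eq)
    also have "\<dots> = (LINT z|lebesgue_on (cbox (x0, 0) (x1, 1)). UA z * deriv (G n) (?r (snd z)))"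
      using sub unit_square_sets by (intro integral_lebesgue_on_subset) auto
    also have "\<dots> = (LINT y|unit_leb. integral {x0..x1} (\<lambda>x. UA (x, y) * deriv (G n) (?r y)))"
      using Fubini_rectangle(2)[OF c, of x0 0 x1 1] by simp
    also have "\<dots> = (LINT y|unit_leb. deriv (G n) (?r y) * P y)"
      unfolding P_def side_x_def integral_mult_right[symmetric] by (simp only: mult_ac)
    finally show ?thesis .
  qed
  have M2: "(\<lambda>n. LINT z|square_leb. (UA z * deriv (G n) (?r (snd z))) * I1 z) \<longlonglongrightarrow> P y0 - P y1"
    unfolding t2 by (rule G(5)[OF Pc])
  have M1: "(\<lambda>n. integral {0..1} (\<lambda>y. UB (s, y) * G n (?r y))) \<longlonglongrightarrow> side_y UB s y0 y1" for s
  proof -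
    have cs: "continuous_on S (\<lambda>y. UB (s, y))" for S by (rule continuous_on_slice_y[OF UB]) auto
    have cu: "continuous_on {0..1} (\<lambda>y. UB (s, y) * G n (?r y))" for n
      by (intro continuous_on_mult ent[OF G(1)] continuous_intros cs)
    have "(\<lambda>n. LINT y|unit_leb. UB (s, y) * G n (?r y)) \<longlonglongrightarrow> (LINT y|unit_leb. UB (s, y) * indicator {y0..y1} y)"
    proof (rule integral_dominated_convergence[where w = "\<lambda>y. norm (UB (s, y)) * 2"])
      have i: "integrable unit_leb (\<lambda>y. UB (s, y))" by (rule continuous_imp_integrable_real[OF cs])
      then have [measurable]: "(\<lambda>y. UB (s, y)) \<in> borel_measurable unit_leb" by simp
      have [measurable]: "(indicator {y0..y1} :: real \<Rightarrow> complex) \<in> borel_measurable unit_leb"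
        by (intro measurable_restrict_space1 borel_measurable_indicator) auto
      show "(\<lambda>y. UB (s, y) * indicator {y0..y1} y) \<in> borel_measurable unit_leb" by measurable
      show "(\<lambda>y. UB (s, y) * G n (?r y)) \<in> borel_measurable unit_leb" for n
        using continuous_imp_integrable_real[OF cu] by auto
      show "integrable unit_leb (\<lambda>y. norm (UB (s, y)) * 2)" using i by auto
      show "AE y in unit_leb. (\<lambda>n. UB (s, y) * G n (?r y)) \<longlonglongrightarrow> UB (s, y) * indicator {y0..y1} y"
        using AE_unit_neq[of y0] AE_unit_neq[of y1] AE_space[of unit_leb]
        by eventually_elim (intro tendsto_mult tendsto_const G(4), auto)
      show "AE y in unit_leb. norm (UB (s, y) * G n (?r y)) \<le> norm (UB (s, y)) * 2" for n
        using G(3) by (intro AE_I2) (auto simp: norm_mult intro: mult_left_mono)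
    qed
    moreover have "(LINT y|unit_leb. UB (s, y) * indicator {y0..y1} y) = side_y UB s y0 y1"
    proof -
      have "(LINT y|unit_leb. UB (s, y) * indicator {y0..y1} y) = (LINT y|lebesgue_on {y0..y1}. UB (s, y))"
        using y by (intro integral_lebesgue_on_subset) auto
      then show ?thesis unfolding side_y_def using continuous_side_integral[OF cs] by simp
    qed
    ultimately show ?thesis using continuous_side_integral[OF cu] by simp
  qed
  have M3: "(\<lambda>n. LINT z|square_leb. (Fl z * G n (?r (snd z))) * I1 z) \<longlonglongrightarrow> (LINT z|lebesgue_on (cbox (x0, y0) (x1, y1)). Fl z)"
  proof -
    have FA: "AE z in square_leb. (\<lambda>n. G n (?r (snd z))) \<longlonglongrightarrow> I2 z"
      using AE_square_neq[of y0 y0] AE_square_neq[of y1 y1] AE_space[of square_leb]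
      by eventually_elim (use G(4) in \<open>auto simp: I2_def unit_square_def cbox_Pair_eq\<close>)
    have Gmeas: "(\<lambda>z. G n (?r (snd z))) \<in> borel_measurable square_leb" for n
      by (intro cm ent[OF G(1)] continuous_intros)
    have Gb: "norm (G n (?r (snd z))) \<le> 2" if "z \<in> unit_square" for n z
      using G(3)[of "snd z" n] that by (cases z) (auto simp: unit_square_iff)
    have i: "integrable square_leb (\<lambda>z. Fl z * I1 z)"
    proof (rule Bochner_Integration.integrable_bound[OF Fl])
      show "(\<lambda>z. Fl z * I1 z) \<in> borel_measurable square_leb" by measurable
    qed (auto simp: I1_def norm_mult indicator_def intro!: AE_I2)
    have "(\<lambda>n. LINT z|square_leb. (Fl z * I1 z) * G n (?r (snd z))) \<longlonglongrightarrow> (LINT z|square_leb. (Fl z * I1 z) * I2 z)"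
      by (rule dom[OF i Gmeas I2m Gb FA])
    moreover have "(LINT z|square_leb. (Fl z * I1 z) * I2 z) = (LINT z|square_leb. Fl z * indicator (cbox (x0, y0) (x1, y1)) z)"
      by (rule Bochner_Integration.integral_cong) (auto simp: I1_def I2_def indicator_def cbox_Pair_eq)
    moreover have "\<dots> = (LINT z|lebesgue_on (cbox (x0, y0) (x1, y1)). Fl z)"
      using sub unit_square_sets by (intro integral_lebesgue_on_subset) auto
    ultimately show ?thesis by (simp add: mult_ac)
  qed
  have "(\<lambda>n. - (integral {0..1} (\<lambda>y. UB (x0, y) * G n (?r y)) - integral {0..1} (\<lambda>y. UB (x1, y) * G n (?r y))
       - (LINT z|square_leb. (UA z * deriv (G n) (?r (snd z))) * I1 z))) \<longlonglongrightarrow>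
       - (side_y UB x0 y0 y1 - side_y UB x1 y0 y1 - (P y0 - P y1))"
    by (intro tendsto_intros M1 M2)
  then have "- (side_y UB x0 y0 y1 - side_y UB x1 y0 y1 - (P y0 - P y1)) = (LINT z|lebesgue_on (cbox (x0, y0) (x1, y1)). Fl z)"
    unfolding step1[OF G(1) G(2)] using M3 LIMSEQ_unique by blast
  then show ?thesis by (simp add: rect_integral_def P_def algebra_simps)
qed

section \<open>From interior rectangles to all rectangles\<close>

lemma indicator_shrinking_box:
  fixes u w :: "nat \<Rightarrow> real" and x u0 w0 :: real
  assumes lim: "u \<longlonglongrightarrow> u0" "w \<longlonglongrightarrow> w0" and x: "x \<noteq> u0" "x \<noteq> w0"
  shows "\<forall>\<^sub>F k in sequentially. (u k \<le> x \<and> x \<le> w k) = (u0 \<le> x \<and> x \<le> w0)"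
proof -
  have 1: "\<forall>\<^sub>F k in sequentially. (u k \<le> x) = (u0 \<le> x)"
  proof (cases "u0 < x")
    case True
    show ?thesis by (rule eventually_mono[OF order_tendstoD(2)[OF lim(1) True]]) (use True in auto)
  next
    case False
    then have l: "x < u0" using x by auto
    show ?thesis by (rule eventually_mono[OF order_tendstoD(1)[OF lim(1) l]]) (use l in auto)
  qed
  have 2: "\<forall>\<^sub>F k in sequentially. (x \<le> w k) = (x \<le> w0)"
  proof (cases "x < w0")
    case True
    show ?thesis by (rule eventually_mono[OF order_tendstoD(1)[OF lim(2) True]]) (use True in auto)
  next
    case False
    then have l: "w0 < x" using x by auto
    show ?thesis by (rule eventually_mono[OF order_tendstoD(2)[OF lim(2) l]]) (use l in auto)
  qed
  show ?thesis using 1 2 by eventually_elim auto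
qed

lemma side_x_tendsto:
  fixes f :: "real \<times> real \<Rightarrow> complex"
  assumes f: "continuous_on UNIV f" and lim: "u \<longlonglongrightarrow> u0" "w \<longlonglongrightarrow> w0" "v \<longlonglongrightarrow> v0"
    and in01: "\<And>k. 0 \<le> u k" "\<And>k. w k \<le> 1" "\<And>k. v k \<in> {0..1}" "0 \<le> u0" "w0 \<le> 1"
  shows "(\<lambda>k. side_x f (u k) (w k) (v k)) \<longlonglongrightarrow> side_x f u0 w0 v0"
proof -
  have slice: "continuous_on S (\<lambda>x. f (x, y))" for S y by (rule continuous_on_slice_x[OF f]) auto
  have conv: "side_x f s t y = (LINT x|unit_leb. f (x, y) * indicator {s..t} x)" if "0 \<le> s" "t \<le> 1" for s t y
    unfolding side_x_def continuous_side_integral[OF slice]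
    using that by (intro integral_lebesgue_on_subset[symmetric]) auto
  have "bounded (f ` unit_square)"
    unfolding unit_square_def by (intro compact_imp_bounded compact_continuous_image continuous_on_subset[OF f]) auto
  then obtain B where B: "\<And>z. z \<in> unit_square \<Longrightarrow> norm (f z) \<le> B" unfolding bounded_iff by blast
  have "(\<lambda>k. LINT x|unit_leb. f (x, v k) * indicator {u k..w k} x) \<longlonglongrightarrow> (LINT x|unit_leb. f (x, v0) * indicator {u0..w0} x)"
  proof (rule integral_dominated_convergence[where w = "\<lambda>x. \<bar>B\<bar>"])
    interpret finite_measure unit_leb by (rule finite_measure_lebesgue_on) simp
    show "integrable unit_leb (\<lambda>x. \<bar>B\<bar>)" by simp
    have [measurable]: "(\<lambda>x. f (x, y)) \<in> borel_measurable unit_leb" for y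
      using slice by (intro continuous_imp_measurable_on_sets_lebesgue) auto
    have [measurable]: "(indicator {s..t} :: real \<Rightarrow> complex) \<in> borel_measurable unit_leb" for s t
      by (intro measurable_restrict_space1 borel_measurable_indicator) auto
    show "(\<lambda>x. f (x, v0) * indicator {u0..w0} x) \<in> borel_measurable unit_leb" by measurable
    show "(\<lambda>x. f (x, v k) * indicator {u k..w k} x) \<in> borel_measurable unit_leb" for k by measurable
    show "AE x in unit_leb. norm (f (x, v k) * indicator {u k..w k} x) \<le> \<bar>B\<bar>" for k
    proof (rule AE_I2)
      fix x assume "x \<in> space unit_leb"
      then have "norm (f (x, v k)) \<le> B" using in01(3)[of k] by (intro B) (auto simp: unit_square_iff)
      then show "norm (f (x, v k) * indicator {u k..w k} x) \<le> \<bar>B\<bar>" by (auto simp: norm_mult indicator_def)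
    qed
    show "AE x in unit_leb. (\<lambda>k. f (x, v k) * indicator {u k..w k} x) \<longlonglongrightarrow> f (x, v0) * indicator {u0..w0} x"
      using AE_unit_neq[of u0] AE_unit_neq[of w0]
    proof eventually_elim
      case (elim x)
      have "(\<lambda>k. f (x, v k)) \<longlonglongrightarrow> f (x, v0)"
        using continuous_on_tendsto_compose[OF f, of "\<lambda>k. (x, v k)" "(x, v0)"] tendsto_Pair[OF tendsto_const lim(3)] by auto
      moreover have "(\<lambda>k. indicator {u k..w k} x :: complex) \<longlonglongrightarrow> indicator {u0..w0} x"
      proof (rule tendsto_eventually)
        show "\<forall>\<^sub>F k in sequentially. (indicator {u k..w k} x :: complex) = indicator {u0..w0} x"
          using indicator_shrinking_box[OF lim(1,2) elim] by eventually_elim (auto simp: indicator_def)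
      qed
      ultimately show ?case by (rule tendsto_mult)
    qed
  qed
  then show ?thesis using in01 by (simp add: conv)
qed

lemma side_y_eq_side_x: "side_y f x y0 y1 = side_x (\<lambda>z. f (snd z, fst z)) y0 y1 x"
  by (simp add: side_x_def side_y_def)

lemma side_y_tendsto:
  fixes f :: "real \<times> real \<Rightarrow> complex"
  assumes f: "continuous_on UNIV f" and lim: "u \<longlonglongrightarrow> u0" "w \<longlonglongrightarrow> w0" "v \<longlonglongrightarrow> v0"
    and in01: "\<And>k. 0 \<le> u k" "\<And>k. w k \<le> 1" "\<And>k. v k \<in> {0..1}" "0 \<le> u0" "w0 \<le> 1"
  shows "(\<lambda>k. side_y f (v k) (u k) (w k)) \<longlonglongrightarrow> side_y f v0 u0 w0"
  unfolding side_y_eq_side_x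
  by (rule side_x_tendsto[OF _ lim in01]) (auto intro!: continuous_on_compose2[OF f] continuous_intros)

text \<open>The test functions require sides inside the open unit square. Rectangles touching its
  boundary, which appear when larger ones are tiled, are limits of slightly smaller ones.\<close>

lemma rect_integral_unit_square_limit:
  fixes UA UB Fl :: "real \<times> real \<Rightarrow> complex"
  assumes UA: "continuous_on UNIV UA" and UB: "continuous_on UNIV UB" and Fl: "integrable square_leb Fl"
    and int: "\<And>x0 x1 y0 y1. 0 < x0 \<Longrightarrow> x0 < x1 \<Longrightarrow> x1 < 1 \<Longrightarrow> 0 < y0 \<Longrightarrow> y0 < y1 \<Longrightarrow> y1 < 1 \<Longrightarrow>
       rect_integral UA UB x0 x1 y0 y1 = (LINT z|lebesgue_on (cbox (x0, y0) (x1, y1)). Fl z)"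
    and x: "0 \<le> x0" "x0 < x1" "x1 \<le> 1" and y: "0 \<le> y0" "y0 < y1" "y1 \<le> 1"
  shows "rect_integral UA UB x0 x1 y0 y1 = (LINT z|lebesgue_on (cbox (x0, y0) (x1, y1)). Fl z)"
proof -
  \<comment> \<open>At most 1/3, so that a rectangle shrunk by the fraction \<open>d k\<close> on
    every side stays nondegenerate.\<close>
  define d where "d k = 1 / (real k + 3)" for k
  have d: "0 < d k" "d k < 1/2" for k by (auto simp: d_def divide_simps)
  have dlim: "d \<longlonglongrightarrow> 0"
  proof -
    have "(\<lambda>k. inverse (real (Suc (k + 2)))) \<longlonglongrightarrow> 0" using LIMSEQ_ignore_initial_segment[OF LIMSEQ_inverse_real_of_nat, of 2] .
    then show ?thesis by (simp add: d_def[abs_def] divide_inverse add_ac)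
  qed
  define u w p q where "u k = x0 + d k * (x1 - x0)" and "w k = x1 - d k * (x1 - x0)"
    and "p k = y0 + d k * (y1 - y0)" and "q k = y1 - d k * (y1 - y0)" for k
  have dx: "0 < d k * (x1 - x0)" "d k * (x1 - x0) < 1/2 * (x1 - x0)" "0 < d k * (y1 - y0)" "d k * (y1 - y0) < 1/2 * (y1 - y0)" for k
    using d[of k] x y by (auto intro: mult_strict_right_mono)
  have r: "0 < u k" "u k < w k" "w k < 1" "0 < p k" "p k < q k" "q k < 1" for k
  proof -
    note a = dx[of k] x y
    show "0 < u k" using a unfolding u_def by linarith
    have half: "s + t < s' - t" if "t < 1/2 * (s' - s)" for s s' t :: real using that by (simp add: field_simps)
    show "u k < w k" unfolding u_def w_def by (rule half[OF a(2)])
    show "w k < 1" using a unfolding w_def by linarith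
    show "0 < p k" using a unfolding p_def by linarith
    show "p k < q k" unfolding p_def q_def by (rule half[OF a(4)])
    show "q k < 1" using a unfolding q_def by linarith
  qed
  have lim: "u \<longlonglongrightarrow> x0" "w \<longlonglongrightarrow> x1" "p \<longlonglongrightarrow> y0" "q \<longlonglongrightarrow> y1"
    unfolding u_def w_def p_def q_def by (auto intro!: tendsto_eq_intros dlim)
  have "(\<lambda>k. rect_integral UA UB (u k) (w k) (p k) (q k)) \<longlonglongrightarrow> rect_integral UA UB x0 x1 y0 y1"
    unfolding rect_integral_def
  proof (intro tendsto_diff tendsto_add side_x_tendsto side_y_tendsto UA UB lim)
    have "0 \<le> u k \<and> u k \<le> 1 \<and> 0 \<le> w k \<and> w k \<le> 1 \<and> 0 \<le> p k \<and> p k \<le> 1 \<and> 0 \<le> q k \<and> q k \<le> 1" for k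
      using r[of k] by auto
    then show "\<And>k. 0 \<le> u k" "\<And>k. w k \<le> 1" "\<And>k. p k \<in> {0..1}" "\<And>k. w k \<in> {0..1}" "\<And>k. 0 \<le> p k" "\<And>k. q k \<le> 1"
      "\<And>k. q k \<in> {0..1}" "\<And>k. u k \<in> {0..1}" by auto
    then show "\<And>k. 0 \<le> u k" "\<And>k. w k \<le> 1" "\<And>k. 0 \<le> p k" "\<And>k. q k \<le> 1" by auto
  qed (use x y in auto)
  moreover have "(\<lambda>k. LINT z|lebesgue_on (cbox (u k, p k) (w k, q k)). Fl z) \<longlonglongrightarrow> (LINT z|lebesgue_on (cbox (x0, y0) (x1, y1)). Fl z)"
  proof -
    have sub: "(LINT z|lebesgue_on (cbox (s, t) (s', t')). Fl z) = (LINT z|square_leb. Fl z * indicator (cbox (s, t) (s', t')) z)"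
      if "0 \<le> s" "s' \<le> 1" "0 \<le> t" "t' \<le> 1" for s s' t t'
    proof -
      have "cbox (s, t) (s', t') \<subseteq> unit_square" using that by (auto simp: unit_square_def cbox_Pair_eq)
      moreover have "cbox (s, t) (s', t') \<in> sets lebesgue" using lmeasurable_cbox by blast
      ultimately show ?thesis by (intro integral_lebesgue_on_subset[symmetric] unit_square_sets)
    qed
    have "(\<lambda>k. LINT z|square_leb. Fl z * indicator (cbox (u k, p k) (w k, q k)) z) \<longlonglongrightarrow> (LINT z|square_leb. Fl z * indicator (cbox (x0, y0) (x1, y1)) z)"
    proof (rule integral_dominated_convergence[where w = "\<lambda>z. norm (Fl z)"])
      have [measurable]: "Fl \<in> borel_measurable square_leb" using Fl by simp
      have [measurable]: "(indicator (cbox e f) :: real \<times> real \<Rightarrow> complex) \<in> borel_measurable square_leb" for e f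
        by (intro borel_imp_square_measurable borel_measurable_indicator) auto
      show "(\<lambda>z. Fl z * indicator (cbox (x0, y0) (x1, y1)) z) \<in> borel_measurable square_leb" by measurable
      show "(\<lambda>z. Fl z * indicator (cbox (u k, p k) (w k, q k)) z) \<in> borel_measurable square_leb" for k by measurable
      show "integrable square_leb (\<lambda>z. norm (Fl z))" using Fl by simp
      show "AE z in square_leb. norm (Fl z * indicator (cbox (u k, p k) (w k, q k)) z) \<le> norm (Fl z)" for k
        by (auto simp: norm_mult indicator_def intro!: AE_I2)
      show "AE z in square_leb. (\<lambda>k. Fl z * indicator (cbox (u k, p k) (w k, q k)) z) \<longlonglongrightarrow> Fl z * indicator (cbox (x0, y0) (x1, y1)) z"
        using AE_square_neq[of x0 y0] AE_square_neq[of x1 y1]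
      proof eventually_elim
        case (elim z)
        have "\<forall>\<^sub>F k in sequentially. (indicator (cbox (u k, p k) (w k, q k)) z :: complex) = indicator (cbox (x0, y0) (x1, y1)) z"
          using indicator_shrinking_box[OF lim(1,2), of "fst z"] indicator_shrinking_box[OF lim(3,4), of "snd z"] elim
          by (cases z) (auto simp: indicator_def cbox_Pair_eq elim: eventually_elim2)
        then show ?case by (intro tendsto_mult tendsto_const tendsto_eventually)
      qed
    qed
    moreover have "0 \<le> u k" "w k \<le> 1" "0 \<le> p k" "q k \<le> 1" for k using r[of k] by auto
    ultimately show ?thesis using x y by (simp add: sub)
  qed
  moreover have "rect_integral UA UB (u k) (w k) (p k) (q k) = (LINT z|lebesgue_on (cbox (u k, p k) (w k, q k)). Fl z)" for k
    by (rule int[OF r])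
  ultimately show ?thesis using LIMSEQ_unique by simp
qed

text \<open>The interval is cut at the integers; the induction counts the unit intervals to the
  right of the one that contains \<open>x0\<close>.\<close>

lemma interval_induct_additive:
  fixes Q :: "real \<Rightarrow> real \<Rightarrow> bool"
  assumes base: "\<And>(m::int) x0 x1. of_int m \<le> x0 \<Longrightarrow> x0 \<le> x1 \<Longrightarrow> x1 \<le> of_int m + 1 \<Longrightarrow> Q x0 x1"
    and add: "\<And>x0 x1 x2. x0 \<le> x1 \<Longrightarrow> x1 \<le> x2 \<Longrightarrow> Q x0 x1 \<Longrightarrow> Q x1 x2 \<Longrightarrow> Q x0 x2"
    and le: "x0 \<le> x1"
  shows "Q x0 x1"
proof -
  have "Q x0 x1" if "x0 \<le> x1" "x1 \<le> of_int \<lfloor>x0\<rfloor> + 1 + real k" for k x1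
    using that
  proof (induction k arbitrary: x1)
    case 0
    then show ?case by (intro base[of "\<lfloor>x0\<rfloor>"]) auto
  next
    case (Suc k)
    define m where "m = \<lfloor>x0\<rfloor> + 1 + int k"
    show ?case
    proof (cases "x1 \<le> of_int m")
      case True
      then show ?thesis using Suc by (simp add: m_def)
    next
      case False
      have xm: "x0 \<le> of_int m" unfolding m_def by simp linarith
      have "Q x0 (of_int m)" using xm by (intro Suc.IH) (auto simp: m_def)
      moreover have "Q (of_int m) x1" using False Suc.prems by (intro base[of m]) (auto simp: m_def)
      ultimately show ?thesis using False xm by (intro add[of x0 "of_int m" x1]) auto
    qed
  qed
  moreover obtain k :: nat where "x1 \<le> of_int \<lfloor>x0\<rfloor> + 1 + real k"
    using real_arch_simple[of "x1 - of_int \<lfloor>x0\<rfloor> - 1"] by (auto simp: algebra_simps)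
  ultimately show ?thesis using le by blast
qed

definition biperiodic :: "(real \<times> real \<Rightarrow> 'a) \<Rightarrow> bool"
  where "biperiodic f \<longleftrightarrow> (\<forall>p (m::int) (n::int). f (p + (of_int m, of_int n)) = f p)"

lemma biperiodic_proj [simp]: "biperiodic (\<lambda>p. f (proj p))"
proof -
  have "proj (p + (of_int m, of_int n)) = proj p" for p and m n :: int by (simp add: proj_eq_iff)
  then show ?thesis by (simp add: biperiodic_def)
qed

lemma biperiodic_shift:
  assumes "biperiodic f" shows "f \<circ> (+) (of_int m, of_int n) = f"
  using assms by (auto simp: biperiodic_def fun_eq_iff add.commute)

lemma biperiodic_absolutely_integrable:
  fixes f :: "real \<times> real \<Rightarrow> 'b::euclidean_space"
  assumes per: "biperiodic f" and f: "f absolutely_integrable_on unit_square"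
  shows "f absolutely_integrable_on (cbox a b)"
proof -
  define sq where "sq m n = cbox (of_int m :: real, of_int n :: real) (of_int m + 1, of_int n + 1)" for m n :: int
  have sq: "f absolutely_integrable_on sq m n" for m n
  proof -
    have pn: "biperiodic (\<lambda>p. norm (f p))" using per by (simp add: biperiodic_def)
    have "f integrable_on sq m n"
      using integrable_on_shift_cbox[of f "(of_int m, of_int n)" "(0, 0)" "(1, 1)"] biperiodic_shift[OF per, of m n] f
      by (simp add: absolutely_integrable_on_def unit_square_def sq_def add.commute)
    moreover have "(\<lambda>p. norm (f p)) integrable_on sq m n"
      using integrable_on_shift_cbox[of "\<lambda>p. norm (f p)" "(of_int m, of_int n)" "(0, 0)" "(1, 1)"] biperiodic_shift[OF pn, of m n] f
      by (simp add: absolutely_integrable_on_def unit_square_def sq_def add.commute)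
    ultimately show ?thesis by (simp add: absolutely_integrable_on_def)
  qed
  have Un: "f absolutely_integrable_on (\<Union>i\<in>I. g i)" if "finite I" "\<And>i. i \<in> I \<Longrightarrow> f absolutely_integrable_on g i" for g and I :: "(int \<times> int) set"
    using that by (induction I) (auto intro: absolutely_integrable_Un)
  define I where "I = {\<lfloor>fst a\<rfloor>..\<lfloor>fst b\<rfloor>} \<times> {\<lfloor>snd a\<rfloor>..\<lfloor>snd b\<rfloor>}"
  have "cbox a b \<subseteq> (\<Union>i\<in>I. sq (fst i) (snd i))"
  proof
    fix p assume "p \<in> cbox a b"
    then have "fst a \<le> fst p" "fst p \<le> fst b" "snd a \<le> snd p" "snd p \<le> snd b"
      by (cases p, cases a, cases b, simp add: cbox_Pair_eq)+
    then have "(\<lfloor>fst p\<rfloor>, \<lfloor>snd p\<rfloor>) \<in> I" by (auto simp: I_def intro: floor_mono)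
    moreover have "p \<in> sq \<lfloor>fst p\<rfloor> \<lfloor>snd p\<rfloor>"
      by (cases p) (auto simp: sq_def cbox_Pair_eq intro: less_imp_le)
    ultimately show "p \<in> (\<Union>i\<in>I. sq (fst i) (snd i))" by (intro UN_I[of "(\<lfloor>fst p\<rfloor>, \<lfloor>snd p\<rfloor>)"]) auto
  qed
  moreover have "f absolutely_integrable_on (\<Union>i\<in>I. sq (fst i) (snd i))"
    by (rule Un) (auto simp: I_def sq)
  ultimately show ?thesis by (rule absolutely_integrable_on_subcbox[rotated])
qed

text \<open>Both sides are additive under cutting and invariant under lattice translations. The
  cutting is done in x while y stays within one unit, and afterwards in y.\<close>

lemma rect_integral_periodic:
  fixes UA UB Fl :: "real \<times> real \<Rightarrow> complex"
  assumes UA: "continuous_on UNIV UA" "biperiodic UA" and UB: "continuous_on UNIV UB" "biperiodic UB"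
    and Fl: "Fl absolutely_integrable_on unit_square" "biperiodic Fl"
    and sq: "\<And>x0 x1 y0 y1. 0 \<le> x0 \<Longrightarrow> x0 < x1 \<Longrightarrow> x1 \<le> 1 \<Longrightarrow> 0 \<le> y0 \<Longrightarrow> y0 < y1 \<Longrightarrow> y1 \<le> 1 \<Longrightarrow>
       rect_integral UA UB x0 x1 y0 y1 = integral (cbox (x0, y0) (x1, y1)) Fl"
    and le: "x0 \<le> x1" "y0 \<le> y1"
  shows "rect_integral UA UB x0 x1 y0 y1 = integral (cbox (x0, y0) (x1, y1)) Fl"
proof -
  have slx: "continuous_on S (\<lambda>x. UA (x, y))" for S y by (rule continuous_on_slice_x[OF UA(1)]) auto
  have sly: "continuous_on S (\<lambda>y. UB (x, y))" for S x by (rule continuous_on_slice_y[OF UB(1)]) auto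
  have Fi: "Fl integrable_on cbox p q" for p q
    using biperiodic_absolutely_integrable[OF Fl(2,1)] absolutely_integrable_on_def by blast
  define Q where "Q x0 x1 y0 y1 \<longleftrightarrow> rect_integral UA UB x0 x1 y0 y1 = integral (cbox (x0, y0) (x1, y1)) Fl" for x0 x1 y0 y1
  \<comment> \<open>Cuts may produce rectangles of zero width or height; these are negligible and
    their boundary integrals cancel.\<close>
  have deg: "Q x0 x1 y0 y1" if "x0 = x1 \<or> y0 = y1" for x0 x1 y0 y1
  proof -
    have "negligible {z :: real \<times> real. z \<bullet> (1, 0) = x1}" "negligible {z :: real \<times> real. z \<bullet> (0, 1) = y1}"
      by (rule negligible_standard_hyperplane, simp add: Basis_prod_def)+
    then have "negligible ({z :: real \<times> real. z \<bullet> (1, 0) = x1} \<inter> cbox (x0, y0) (x1, y1))"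
      "negligible ({z :: real \<times> real. z \<bullet> (0, 1) = y1} \<inter> cbox (x0, y0) (x1, y1))"
      by (auto intro: negligible_Int)
    moreover have "cbox (x0, y0) (x1, y1) = {z :: real \<times> real. z \<bullet> (1, 0) = x1} \<inter> cbox (x0, y0) (x1, y1) \<or>
        cbox (x0, y0) (x1, y1) = {z :: real \<times> real. z \<bullet> (0, 1) = y1} \<inter> cbox (x0, y0) (x1, y1)"
      using that by (auto simp: cbox_Pair_eq inner_prod_def)
    ultimately have "negligible (cbox (x0, y0) (x1, y1))" by metis
    then have "integral (cbox (x0, y0) (x1, y1)) Fl = 0"
      by (intro integral_unique has_integral_negligible) auto
    then show ?thesis using that rect_integral_degenerate by (auto simp: Q_def)
  qed
  have base: "Q x0 x1 y0 y1"
    if xm: "of_int m \<le> x0" "x0 \<le> x1" "x1 \<le> of_int m + 1" and yn: "of_int n \<le> y0" "y0 \<le> y1" "y1 \<le> of_int n + 1" for m n :: int and x0 x1 y0 y1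
  proof (cases "x0 = x1 \<or> y0 = y1")
    case False
    let ?x0 = "x0 - of_int m" and ?x1 = "x1 - of_int m" and ?y0 = "y0 - of_int n" and ?y1 = "y1 - of_int n"
    have "rect_integral UA UB ?x0 ?x1 ?y0 ?y1 = integral (cbox (?x0, ?y0) (?x1, ?y1)) Fl"
      using False xm yn by (intro sq) auto
    moreover have "side_x UA ?x0 ?x1 (y - of_int n) = side_x UA x0 x1 y" for y
    proof -
      have "UA (x + of_int m, y) = UA (x, y - of_int n)" for x
        using UA(2)[unfolded biperiodic_def, rule_format, of "(x, y - of_int n)" m n] by simp
      then have "(\<lambda>x. UA (x, y)) \<circ> (+) (of_int m) = (\<lambda>x. UA (x, y - of_int n))" by (auto simp: fun_eq_iff add.commute)
      then show ?thesis
        unfolding side_x_def using integral_shift_Icc_real[of ?x0 ?x1 "\<lambda>x. UA (x, y)" "of_int m"] by simp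
    qed
    moreover have "side_y UB (x - of_int m) ?y0 ?y1 = side_y UB x y0 y1" for x
    proof -
      have "UB (x, y + of_int n) = UB (x - of_int m, y)" for y
        using UB(2)[unfolded biperiodic_def, rule_format, of "(x - of_int m, y)" m n] by simp
      then have "(\<lambda>y. UB (x, y)) \<circ> (+) (of_int n) = (\<lambda>y. UB (x - of_int m, y))" by (auto simp: fun_eq_iff add.commute)
      then show ?thesis
        unfolding side_y_def using integral_shift_Icc_real[of ?y0 ?y1 "\<lambda>y. UB (x, y)" "of_int n"] by simp
    qed
    moreover have "integral (cbox (?x0, ?y0) (?x1, ?y1)) Fl = integral (cbox (x0, y0) (x1, y1)) Fl"
      using integral_shift_cbox_plus[of "(?x0, ?y0)" "(?x1, ?y1)" Fl "(of_int m, of_int n)"] biperiodic_shift[OF Fl(2), of m n] by simp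
    ultimately show ?thesis by (simp add: Q_def rect_integral_def)
  qed (rule deg)
  have addx: "Q x0 x2 y0 y1" if "x0 \<le> x1" "x1 \<le> x2" "Q x0 x1 y0 y1" "Q x1 x2 y0 y1" for x0 x1 x2 y0 y1
  proof -
    have "side_x UA x0 x2 y = side_x UA x0 x1 y + side_x UA x1 x2 y" for y
      unfolding side_x_def using that
      by (intro Henstock_Kurzweil_Integration.integral_combine[symmetric] integrable_continuous_real slx) auto
    moreover have "integral (cbox (x0, y0) (x2, y1)) Fl = integral (cbox (x0, y0) (x1, y1)) Fl + integral (cbox (x1, y0) (x2, y1)) Fl"
    proof -
      have eq: "cbox (x0, y0) (x2, y1) = cbox (x0, y0) (x1, y1) \<union> cbox (x1, y0) (x2, y1)" using that by (auto simp: cbox_Pair_eq)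
      have "negligible {z :: real \<times> real. z \<bullet> (1, 0) = x1}" by (rule negligible_standard_hyperplane) (simp add: Basis_prod_def)
      then have "negligible (cbox (x0, y0) (x1, y1) \<inter> cbox (x1, y0) (x2, y1))"
        by (rule negligible_subset) (auto simp: cbox_Pair_eq inner_prod_def)
      then show ?thesis unfolding eq by (intro Henstock_Kurzweil_Integration.integral_Un Fi)
    qed
    ultimately show ?thesis using that(3,4) by (simp add: Q_def rect_integral_def algebra_simps)
  qed
  have addy: "Q x0 x1 y0 y2" if "y0 \<le> y1" "y1 \<le> y2" "Q x0 x1 y0 y1" "Q x0 x1 y1 y2" for x0 x1 y0 y1 y2
  proof -
    have "side_y UB x y0 y2 = side_y UB x y0 y1 + side_y UB x y1 y2" for x
      unfolding side_y_def using that
      by (intro Henstock_Kurzweil_Integration.integral_combine[symmetric] integrable_continuous_real sly) auto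
    then have "rect_integral UA UB x0 x1 y0 y2 = rect_integral UA UB x0 x1 y0 y1 + rect_integral UA UB x0 x1 y1 y2"
      by (simp add: rect_integral_def)
    moreover have "integral (cbox (x0, y0) (x1, y2)) Fl = integral (cbox (x0, y0) (x1, y1)) Fl + integral (cbox (x0, y1) (x1, y2)) Fl"
    proof -
      have eq: "cbox (x0, y0) (x1, y2) = cbox (x0, y0) (x1, y1) \<union> cbox (x0, y1) (x1, y2)" using that by (auto simp: cbox_Pair_eq)
      have "negligible {z :: real \<times> real. z \<bullet> (0, 1) = y1}" by (rule negligible_standard_hyperplane) (simp add: Basis_prod_def)
      then have "negligible (cbox (x0, y0) (x1, y1) \<inter> cbox (x0, y1) (x1, y2))"
        by (rule negligible_subset) (auto simp: cbox_Pair_eq inner_prod_def)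
      then show ?thesis unfolding eq by (intro Henstock_Kurzweil_Integration.integral_Un Fi)
    qed
    ultimately show ?thesis using that(3,4) by (simp add: Q_def)
  qed
  have "Q x0 x1 y0 y1" if yn: "of_int n \<le> y0" "y0 \<le> y1" "y1 \<le> of_int n + 1" for n :: int and y0 y1
    by (rule interval_induct_additive[where Q = "\<lambda>x0 x1. Q x0 x1 y0 y1", OF _ _ le(1)]) (use base yn addx in blast)+
  then have "Q x0 x1 y0 y1"
    by (intro interval_induct_additive[where Q = "Q x0 x1", OF _ _ le(2)]) (use addy in blast)+
  then show ?thesis by (simp add: Q_def)
qed

subsection \<open>Solutions on the torus\<close>

lemma integrable_lebesgue_on_iff_absolutely_integrable:
  fixes f :: "'a::euclidean_space \<Rightarrow> 'b::euclidean_space"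
  assumes "S \<in> sets lebesgue"
  shows "integrable (lebesgue_on S) f \<longleftrightarrow> f absolutely_integrable_on S"
  using assms by (simp add: integrable_restrict_space set_integrable_def)

lemma Lq_imp_integrable:
  assumes A: "Lq q A" and q: "q \<ge> 1"
  shows "integrable square_leb (\<lambda>z. A (proj z))"
proof -
  interpret finite_measure square_leb by (rule finite_measure_lebesgue_on) (rule unit_square_sets)
  have m: "(\<lambda>z. A (proj z)) \<in> borel_measurable square_leb" using A by (simp add: Lq_def comp_def)
  show ?thesis
  proof (rule Bochner_Integration.integrable_bound[OF _ m])
    show "integrable square_leb (\<lambda>z. 1 + norm (A (proj z)) powr q)" using A by (simp add: Lq_def)
    show "AE z in square_leb. norm (A (proj z)) \<le> norm (1 + norm (A (proj z)) powr q)"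
    proof (rule AE_I2)
      fix z
      show "norm (A (proj z)) \<le> norm (1 + norm (A (proj z)) powr q)"
      proof (cases "norm (A (proj z)) \<le> 1")
        case False
        then have "norm (A (proj z)) powr 1 \<le> norm (A (proj z)) powr q" using q by (intro powr_mono) auto
        then show ?thesis by simp
      qed (auto intro: order_trans)
    qed
  qed
qed

lemma Lq_on_box:
  assumes A: "Lq q A" and q: "q \<ge> 1"
  shows "(\<lambda>z. A (proj z)) \<in> borel_measurable (lebesgue_on (cbox s t))"
    and "integrable (lebesgue_on (cbox s t)) (\<lambda>z. norm (A (proj z)) powr q)"
proof -
  have "(\<lambda>z. A (proj z)) absolutely_integrable_on cbox s t"
    using Lq_imp_integrable[OF A q] unit_square_sets
    by (intro biperiodic_absolutely_integrable biperiodic_proj) (simp add: integrable_lebesgue_on_iff_absolutely_integrable)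
  then show "(\<lambda>z. A (proj z)) \<in> borel_measurable (lebesgue_on (cbox s t))"
    by (rule absolutely_integrable_imp_borel_measurable) simp
  have "(\<lambda>z. norm (A (proj z)) powr q) absolutely_integrable_on cbox s t"
    using A unit_square_sets biperiodic_proj[of "\<lambda>p. norm (A p) powr q"]
    by (intro biperiodic_absolutely_integrable) (simp_all add: Lq_def flip: integrable_lebesgue_on_iff_absolutely_integrable)
  then show "integrable (lebesgue_on (cbox s t)) (\<lambda>z. norm (A (proj z)) powr q)"
    by (simp add: integrable_lebesgue_on_iff_absolutely_integrable)
qed

lemma weak_L_eq_imp_rect_integral:
  assumes a: "continuous_on UNIV (a \<circ> proj)" and b: "continuous_on UNIV (b \<circ> proj)" and u: "continuous_on UNIV (u \<circ> proj)"
    and F: "integrable square_leb (\<lambda>z. F (proj z))" and weak: "weak_L_eq a b u F" and le: "x0 \<le> x1" "y0 \<le> y1"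
  shows "rect_integral (\<lambda>z. u (proj z) * a (proj z)) (\<lambda>z. u (proj z) * b (proj z)) x0 x1 y0 y1
     = (LINT z|lebesgue_on (cbox (x0, y0) (x1, y1)). F (proj z))"
    and "integrable (lebesgue_on (cbox (x0, y0) (x1, y1))) (\<lambda>z. F (proj z))"
proof -
  let ?UA = "\<lambda>z. u (proj z) * a (proj z)" and ?UB = "\<lambda>z. u (proj z) * b (proj z)"
  have UA: "continuous_on UNIV ?UA" and UB: "continuous_on UNIV ?UB"
    using a b u by (auto simp: comp_def intro!: continuous_intros)
  have Fa: "(\<lambda>z. F (proj z)) absolutely_integrable_on cbox s t" for s t
    using F unit_square_sets by (intro biperiodic_absolutely_integrable biperiodic_proj) (simp add: integrable_lebesgue_on_iff_absolutely_integrable)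
  then have Fi: "integrable (lebesgue_on (cbox s t)) (\<lambda>z. F (proj z))" for s t
    by (simp add: integrable_lebesgue_on_iff_absolutely_integrable)
  have test: "- (LINT z|square_leb. ?UB z * (deriv f (of_real (fst z)) * g (of_real (snd z))) - ?UA z * (f (of_real (fst z)) * deriv g (of_real (snd z))))
       = (LINT z|square_leb. F (proj z) * (f (of_real (fst z)) * g (of_real (snd z))))"
    if "f holomorphic_on UNIV" "g holomorphic_on UNIV" "\<And>x. f (of_real (x + 1)) = f (of_real x)" "\<And>x. g (of_real (x + 1)) = g (of_real x)" for f g
    using weak_L_eq_product_test[OF weak that] by (simp add: right_diff_distrib mult.assoc)
  have int: "rect_integral ?UA ?UB x0 x1 y0 y1 = (LINT z|lebesgue_on (cbox (x0, y0) (x1, y1)). F (proj z))"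
    if "0 < x0" "x0 < x1" "x1 < 1" "0 < y0" "y0 < y1" "y1 < 1" for x0 x1 y0 y1
    by (rule rect_integral_unit_square_interior[OF UA UB F test that])
  have sq: "rect_integral ?UA ?UB x0 x1 y0 y1 = integral (cbox (x0, y0) (x1, y1)) (\<lambda>z. F (proj z))"
    if "0 \<le> x0" "x0 < x1" "x1 \<le> 1" "0 \<le> y0" "y0 < y1" "y1 \<le> 1" for x0 x1 y0 y1
    using rect_integral_unit_square_limit[OF UA UB F int that] lebesgue_integral_eq_integral[OF Fi] by simp
  have "rect_integral ?UA ?UB x0 x1 y0 y1 = integral (cbox (x0, y0) (x1, y1)) (\<lambda>z. F (proj z))"
  proof (rule rect_integral_periodic[OF UA _ UB _ _ _ sq le])
    show "biperiodic ?UA" using biperiodic_proj[of "\<lambda>p. u p * a p"] .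
    show "biperiodic ?UB" using biperiodic_proj[of "\<lambda>p. u p * b p"] .
    show "(\<lambda>z. F (proj z)) absolutely_integrable_on unit_square" using Fa by (simp add: unit_square_def)
  qed auto
  then show "rect_integral ?UA ?UB x0 x1 y0 y1 = (LINT z|lebesgue_on (cbox (x0, y0) (x1, y1)). F (proj z))"
    using lebesgue_integral_eq_integral[OF Fi] by simp
  show "integrable (lebesgue_on (cbox (x0, y0) (x1, y1))) (\<lambda>z. F (proj z))" by (rule Fi)
qed

lemma Holder_continuous_imp_continuous:
  assumes "Holder_continuous u" shows "continuous_on UNIV (u \<circ> proj)"
proof -
  obtain \<alpha> C where \<alpha>: "0 < \<alpha>" and H: "\<And>z w. norm (u (proj z) - u (proj w)) \<le> C * dist z w powr \<alpha>"
    using assms unfolding Holder_continuous_def by blast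
  have "isCont (u \<circ> proj) w" for w
  proof -
    have "((\<lambda>z. dist z w) \<longlongrightarrow> 0) (at w)" 
    proof -
      have "((\<lambda>z. dist z w) \<longlongrightarrow> dist w w) (at w)" by (intro tendsto_dist tendsto_ident_at tendsto_const)
      then show ?thesis by simp
    qed
    then have "((\<lambda>z. dist z w powr \<alpha>) \<longlongrightarrow> 0) (at w)"
      by (rule tendsto_zero_powrI) (use \<alpha> in \<open>auto intro!: tendsto_const\<close>)
    then have lim: "((\<lambda>z. C * dist z w powr \<alpha>) \<longlongrightarrow> 0) (at w)" by (rule tendsto_mult_right_zero)
    have "((\<lambda>z. u (proj z) - u (proj w)) \<longlongrightarrow> 0) (at w)"
      by (rule Lim_null_comparison[OF _ lim]) (use H in auto)
    then show ?thesis unfolding isCont_def comp_def by (rule LIM_zero_cancel)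
  qed
  then show ?thesis unfolding continuous_on_eq_continuous_at[OF open_UNIV] by blast
qed

lemma max_exponent_ge:
  assumes "finite (components (char_set a b))" "M \<in> components (char_set a b)"
  shows "\<sigma> M \<le> max_exponent a b \<sigma>"
  using assms unfolding max_exponent_def by (intro Max_ge) auto

lemma max_exponent_nonneg:
  assumes "finite (components (char_set a b))" shows "0 \<le> max_exponent a b \<sigma>"
  using assms unfolding max_exponent_def by (intro Max_ge) auto

text \<open>The condition q > 2 + \<sigma> amounts to q/(q - 1) < (2 + \<sigma>)/(1 + \<sigma>) = 1
  + 1/(1 + \<sigma>); the strict gap leaves room for a factor 1 + \<theta>.\<close>

lemma exists_kernel_exponent:
  fixes q \<sigma> :: real
  assumes "\<sigma> \<ge> 0" "q > 2 + \<sigma>"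
  shows "\<exists>\<theta>. 0 < \<theta> \<and> \<theta> < 1 \<and> (1 + \<theta>) * (q / (q - 1)) < 1 + 1 / (1 + \<sigma>)"
proof -
  define \<nu> where "\<nu> = 1 + 1 / (1 + \<sigma>)"
  define Q where "Q = q / (q - 1)"
  have Q: "Q > 0" using assms by (simp add: Q_def)
  have "Q < \<nu>" using assms by (simp add: Q_def \<nu>_def field_simps)
  define R where "R = \<nu> / Q"
  \<comment> \<open>Half of the available surplus \<open>R - 1\<close> keeps the inequality strict;
    the cap 1/2 ensures \<theta> < 1.\<close>
  define \<theta> where "\<theta> = min (1/2) ((R - 1) / 2)"
  have r: "R > 1" using \<open>Q < \<nu>\<close> Q by (simp add: R_def field_simps)
  have "0 < \<theta>" "\<theta> < 1" using r by (auto simp: \<theta>_def)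
  moreover have "1 + \<theta> < R"
  proof -
    have "1 + \<theta> \<le> 1 + (R - 1) / 2" unfolding \<theta>_def by (intro add_left_mono min.cobounded2)
    also have "\<dots> < R" using r by (simp add: field_simps)
    finally show ?thesis .
  qed
  then have "(1 + \<theta>) * Q < \<nu>" using Q by (simp add: R_def pos_less_divide_eq)
  ultimately show ?thesis unfolding Q_def \<nu>_def by blast
qed

lemma exists_normal_chart:
  fixes a b :: "torus \<Rightarrow> complex"
  assumes Z: "\<And>p. (Z has_derivative dform ((a \<circ> proj) p) ((b \<circ> proj) p)) (at p)"
    and c: "continuous_on UNIV (a \<circ> proj)" "continuous_on UNIV (b \<circ> proj)"
    and fin: "finite (components (char_set a b))"
    and pos: "\<And>M. M \<in> components (char_set a b) \<Longrightarrow> \<sigma> M > 0"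
    and nf: "\<And>M. M \<in> components (char_set a b) \<Longrightarrow> normal_form_along a b M (\<sigma> M)"
  shows "\<exists>\<sigma>0 S s t sx sy tx ty lam Lam c m. \<sigma>0 \<le> max_exponent a b \<sigma> \<and>
    normal_chart (a \<circ> proj) (b \<circ> proj) \<sigma>0 p0 S s t sx sy tx ty lam Lam c m"
proof (cases "proj p0 \<in> char_set a b")
  case True
  define M where "M = connected_component_set (char_set a b) (proj p0)"
  have M: "M \<in> components (char_set a b)" "proj p0 \<in> M"
    using True by (auto simp: M_def components_def)
  show ?thesis
    using characteristic_normal_chart[OF c nf[OF M(1)] M(2) pos[OF M(1)]] max_exponent_ge[OF fin M(1), of \<sigma>] by blast
next
  case False
  then have "(a \<circ> proj) p0 * cnj ((b \<circ> proj) p0) - (b \<circ> proj) p0 * cnj ((a \<circ> proj) p0) \<noteq> 0"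
    by (simp add: char_set_def form_wedge_cnj_def)
  from noncharacteristic_normal_chart[OF Z c this] max_exponent_nonneg[OF fin, of \<sigma>] show ?thesis by blast
qed

text \<open>The similarity principle is applied on a single square. Its image contains enough
  periods around \<open>Z p0\<close> for a full parallelogram about that point, and it contains
  \<open>Z p1\<close>, which keeps the holomorphic function from vanishing identically.\<close>

lemma solution_no_zeros:
  fixes a b Z ul C :: "real \<times> real \<Rightarrow> complex" and \<tau> :: complex
  assumes chart: "plane_chart a b Z" and \<tau>: "Im \<tau> > 0"
    and per: "\<And>p (m::int) (n::int). Z (p + (of_int m, of_int n)) = Z p + of_int m + of_int n * \<tau>"
    and \<sigma>: "\<sigma> \<ge> 0" and q: "q > 2 + \<sigma>"
    and loc: "\<And>p0. \<exists>s t. \<exists>r>0. \<exists>c0>0. \<exists>c1>0. \<exists>\<sigma>0. 0 \<le> \<sigma>0 \<and> \<sigma>0 \<le> \<sigma> \<and> (\<forall>p\<in>ball p0 r. \<forall>q\<in>ball p0 r.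
      norm (q - p) \<le> c0 * (\<bar>s q - s p :: real\<bar> + \<bar>t q - t p :: real\<bar>) \<and>
      c1 * \<bar>s q - s p\<bar> \<le> norm (Z q - Z p) \<and> c1 * \<bar>t q - t p\<bar> powr (1 + \<sigma>0) \<le> norm (Z q - Z p))"
    and u: "continuous_on UNIV ul" "biperiodic ul"
    and C: "\<And>s t. C \<in> borel_measurable (lebesgue_on (cbox s t))"
      "\<And>s t. integrable (lebesgue_on (cbox s t)) (\<lambda>z. norm (C z) powr q)"
    and rect: "\<And>x0 x1 y0 y1. x0 \<le> x1 \<Longrightarrow> y0 \<le> y1 \<Longrightarrow> rect_integral (\<lambda>p. ul p * a p) (\<lambda>p. ul p * b p) x0 x1 y0 y1
       = (LINT z|lebesgue_on (cbox (x0, y0) (x1, y1)). C z * ul z)"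
    and nz: "ul p1 \<noteq> 0"
  shows "ul p0 \<noteq> 0"
proof -
  interpret plane_chart a b Z by (rule chart)
  \<comment> \<open>The range of period coordinates that \<open>doubly_periodic_no_zeros\<close>
    demands; its preimage is compact and therefore fits into a square.\<close>
  define P where "P = (\<lambda>x. Z p0 + of_real (fst x) + of_real (snd x) * \<tau>) ` cbox (-2, -2) (2, 2)"
  have "compact P" unfolding P_def by (intro compact_continuous_image continuous_intros compact_cbox)
  then have "bounded (Zi ` P \<union> {p1})"
    by (intro bounded_Un[THEN iffD2] conjI compact_imp_bounded compact_continuous_image cont_Zi) auto
  then obtain N0 where N0: "\<And>p. p \<in> Zi ` P \<union> {p1} \<Longrightarrow> norm p \<le> N0" unfolding bounded_iff by blast
  define N where "N = max N0 0 + 1"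
  define K where "K = cbox (-N, -N) (N, N :: real)"
  have in_box: "p \<in> box (-N, -N) (N, N)" if "p \<in> Zi ` P \<union> {p1}" for p
  proof -
    have "norm p < N" using N0[OF that] by (simp add: N_def)
    then have "\<bar>fst p\<bar> < N" "\<bar>snd p\<bar> < N"
      using norm_fst_le[of "fst p" "snd p"] norm_snd_le[of "snd p" "fst p"] by auto
    then show ?thesis by (cases p) (auto simp: box_iff)
  qed
  obtain \<kappa> where \<kappa>: "\<kappa> \<noteq> 0" and Cauchy: "\<And>H x0 x1 y0 y1 q. - N < x0 \<Longrightarrow> x0 < x1 \<Longrightarrow> x1 < N \<Longrightarrow> - N < y0 \<Longrightarrow> y0 < y1 \<Longrightarrow> y1 < N \<Longrightarrow>
       H holomorphic_on Z ` box (-N, -N) (N, N) \<Longrightarrow> q \<in> box (-N, -N) (N, N) \<Longrightarrow>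
       q \<notin> cbox (x0, y0) (x1, y1) - box (x0, y0) (x1, y1) \<Longrightarrow>
       rect_integral (\<lambda>p. H (Z p) / (Z p - Z q) * a p) (\<lambda>p. H (Z p) / (Z p - Z q) * b p) x0 x1 y0 y1
         = (if q \<in> cbox (x0, y0) (x1, y1) then \<kappa> * H (Z q) else 0)"
    by (rule rect_Cauchy_formula[of N]) blast
  obtain \<theta> where \<theta>: "0 < \<theta>" "\<theta> < 1" and \<theta>_q: "(1 + \<theta>) * (q / (q - 1)) < 1 + 1 / (1 + \<sigma>)"
    using exists_kernel_exponent[OF \<sigma> q] by blast
  interpret cauchy_transform_square a b Z K \<theta> N \<kappa>
    by unfold_locales (use \<theta> \<kappa> Cauchy in \<open>auto simp: K_def\<close>)
  have "\<exists>D>0. \<forall>p\<in>K. \<forall>\<delta>. 0 < \<delta> \<longrightarrow> \<delta> \<le> 1 \<longrightarrow>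
     emeasure M {q\<in>space M. norm (Z p - Z q) \<le> \<delta>} \<le> ennreal (D * \<delta> powr (1 + 1 / (1 + \<sigma>)))"
    by (rule sublevel_measure_compact[OF cont_Z bij_is_inj[OF bij_Z] compact_K \<sigma> loc])
  then obtain D where D: "D > 0" and D1: "\<forall>p\<in>K. \<forall>\<delta>. 0 < \<delta> \<longrightarrow> \<delta> \<le> 1 \<longrightarrow>
     emeasure M {q\<in>space M. norm (Z p - Z q) \<le> \<delta>} \<le> ennreal (D * \<delta> powr (1 + 1 / (1 + \<sigma>)))"
    by (elim exE conjE)
  have admC: "adm C"
  proof (rule adm_if_powr_integrable[OF D D1[rule_format] _ \<theta>_q])
    show "q > 1" using q \<sigma> by simp
    show "C \<in> borel_measurable M" "integrable M (\<lambda>z. norm (C z) powr q)" unfolding K_def by (rule C)+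
  qed
  have uK: "continuous_on K ul" using u(1) continuous_on_subset by blast
  have "rect_integral (\<lambda>p. ul p * a p) (\<lambda>p. ul p * b p) x0 x1 y0 y1 = (LINT q|M. (if q \<in> cbox (x0, y0) (x1, y1) then C q * ul q else 0))"
    if r: "- N < x0" "x0 < x1" "x1 < N" "- N < y0" "y0 < y1" "y1 < N" for x0 x1 y0 y1
  proof -
    have "rect_integral (\<lambda>p. ul p * a p) (\<lambda>p. ul p * b p) x0 x1 y0 y1 = (LINT z|lebesgue_on (cbox (x0, y0) (x1, y1)). C z * ul z)"
      using r by (intro rect) auto
    also have "\<dots> = (LINT z|M. C z * ul z * indicator (cbox (x0, y0) (x1, y1)) z)"
    proof -
      have "cbox (x0, y0) (x1, y1) \<subseteq> K" using r by (auto simp: K_def cbox_Pair_eq)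
      moreover have "cbox (x0, y0) (x1, y1) \<in> sets lebesgue" "K \<in> sets lebesgue"
        unfolding K_def using lmeasurable_cbox by blast+
      ultimately show ?thesis by (intro integral_lebesgue_on_subset[symmetric])
    qed
    also have "\<dots> = (LINT q|M. (if q \<in> cbox (x0, y0) (x1, y1) then C q * ul q else 0))"
      by (rule Bochner_Integration.integral_cong) (auto simp: indicator_def)
    finally show ?thesis .
  qed
  from similarity_principle[OF admC uK this]
  obtain W where W: "continuous_on K W" and hol: "((\<lambda>p. ul p * exp (- W p)) \<circ> Zi) holomorphic_on Z ` box (-N, -N) (N, N)"
    by blast
  \<comment> \<open>The inverse of \<open>Z\<close> carries the lattice generated by 1 and \<tau> to
    the integer lattice, so \<open>ul\<close> read in the coordinate \<open>Z\<close> is doubly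
    periodic.\<close>
  have shift: "Zi (w + of_int m + of_int n * \<tau>) = Zi w + (of_int m, of_int n)" for w and m n :: int
  proof -
    have "Z (Zi w + (of_int m, of_int n)) = w + of_int m + of_int n * \<tau>" by (simp add: per)
    then show ?thesis by (metis Zi_Z)
  qed
  have "(ul \<circ> Zi) (Z p0) \<noteq> 0"
  proof (rule doubly_periodic_no_zeros[OF \<tau>, where U = "ul \<circ> Zi" and ?z0.0 = "Z p0" and W = "W \<circ> Zi" and \<Omega> = "Z ` box (-N, -N) (N, N)" and ?z1.0 = "Z p1"])
    show "continuous_on UNIV (ul \<circ> Zi)" using u(1) cont_Zi by (intro continuous_on_compose) (auto intro: continuous_on_subset)
    show "(ul \<circ> Zi) (z + 1) = (ul \<circ> Zi) z" for z
      using shift[of z 1 0] u(2)[unfolded biperiodic_def, rule_format, of "Zi z" 1 0] by simp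
    show "(ul \<circ> Zi) (z + \<tau>) = (ul \<circ> Zi) z" for z
      using shift[of z 0 1] u(2)[unfolded biperiodic_def, rule_format, of "Zi z" 0 1] by simp
    show "open (Z ` box (-N, -N) (N, N))" by (intro open_Z open_box)
    show "connected (Z ` box (-N, -N) (N, N))"
      by (intro connected_continuous_image cont_Z convex_connected convex_box)
    show "continuous_on (Z ` box (-N, -N) (N, N)) (W \<circ> Zi)"
    proof (intro continuous_on_compose cont_Zi continuous_on_subset[OF W])
      have "Zi ` Z ` box (-N, -N) (N, N) = box (-N, -N) (N, N)" by (simp add: image_image)
      then show "Zi ` Z ` box (-N, -N) (N, N) \<subseteq> K" using box_subset_cbox unfolding K_def by blast
    qed
    show "(\<lambda>z. (ul \<circ> Zi) z * exp (- (W \<circ> Zi) z)) holomorphic_on Z ` box (-N, -N) (N, N)"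
      using hol by (simp add: comp_def)
    show "Z p0 + of_real s + of_real t * \<tau> \<in> Z ` box (-N, -N) (N, N)" if "\<bar>s\<bar> \<le> 2" "\<bar>t\<bar> \<le> 2" for s t
    proof -
      have "Z p0 + of_real s + of_real t * \<tau> \<in> P"
        unfolding P_def using that by (intro image_eqI[of _ _ "(s, t)"]) (auto simp: cbox_Pair_eq abs_le_iff)
      then have "Zi (Z p0 + of_real s + of_real t * \<tau>) \<in> box (-N, -N) (N, N)" by (intro in_box) blast
      then show ?thesis by (metis Z_Zi imageI)
    qed
    show "Z p1 \<in> Z ` box (-N, -N) (N, N)" using in_box by blast
    show "(ul \<circ> Zi) (Z p1) \<noteq> 0" using nz by simp
  qed
  then show ?thesis by simp
qed

theorem mainTheorem4:
  fixes a b A B u :: "torus \<Rightarrow> complex"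
    and \<sigma> :: "torus set \<Rightarrow> real"
    and \<epsilon> q :: real
    and \<tau> :: complex
  assumes "0 < \<epsilon>" and "\<epsilon> < 1"
    and "C1_Holder_on \<epsilon> UNIV a" and "C1_Holder_on \<epsilon> UNIV b"
    and "\<forall>p. (a p, b p) \<noteq> (0, 0)"
    and "closed_form a b"
    and "embedded_curve (char_set a b)"
    and "finite (components (char_set a b))"
    and "\<forall>M \<in> components (char_set a b). \<sigma> M > 0 \<and> vanishes_to_order a b M (\<sigma> M)"
    and "hypocomplex \<epsilon> a b"
    and "\<forall>M \<in> components (char_set a b). normal_form_along a b M (\<sigma> M)"
    and "Im \<tau> > 0"
    and "\<forall>x y. form_integral a b (x + 1) y = form_integral a b x y + 1"
    and "\<forall>x y. form_integral a b x (y + 1) = form_integral a b x y + \<tau>"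
    and "q > 2 + max_exponent a b \<sigma>"
    and "Lq q A" and "Lq q B"
    and "Holder_continuous u"
    and "weak_L_eq a b u (\<lambda>p. A p * u p + B p * cnj (u p))"
    and "\<exists>p. u p \<noteq> 0"
  shows "\<forall>p. u p \<noteq> 0"
proof
  fix p
  define Z where "Z z = form_integral a b (fst z) (snd z)" for z
  define \<sigma>m where "\<sigma>m = max_exponent a b \<sigma>"
  have C1: "C1_on UNIV a" "C1_on UNIV b" using assms(3,4) by (auto simp: C1_Holder_on_def)
  have Z: "(Z has_derivative dform ((a \<circ> proj) z) ((b \<circ> proj) z)) (at z)" for z
    using form_integral_deriv[OF C1 assms(6), of z] by (simp add: Z_def[abs_def])
  have ca: "continuous_on UNIV (a \<circ> proj)" and cb: "continuous_on UNIV (b \<circ> proj)"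
    using C1_onD(1)[OF C1(1)] C1_onD(1)[OF C1(2)] by (meson UNIV_I continuous_at_imp_continuous_on has_derivative_continuous)+
  have cZ: "continuous_on UNIV Z" using Z by (meson continuous_at_imp_continuous_on has_derivative_continuous)
  have per: "Z (z + (of_int m, of_int n)) = Z z + of_int m + of_int n * \<tau>" for z and m n :: int
  proof -
    have "form_integral a b (x + of_int m) y = form_integral a b x y + of_int m * 1" for x y
      using quasiperiodic_int_shift[of "\<lambda>x. form_integral a b x y" 1] assms(13) by blast
    moreover have "form_integral a b x (y + of_int n) = form_integral a b x y + of_int n * \<tau>" for x y
      using quasiperiodic_int_shift[of "\<lambda>y. form_integral a b x y" \<tau>] assms(14) by blast
    ultimately show ?thesis by (simp add: Z_def)
  qed
  have charts: "\<exists>\<sigma>0 S s t sx sy tx ty lam Lam c m. \<sigma>0 \<le> \<sigma>m \<and>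
    normal_chart (a \<circ> proj) (b \<circ> proj) \<sigma>0 z S s t sx sy tx ty lam Lam c m" for z
    unfolding \<sigma>m_def using exists_normal_chart[OF Z ca cb assms(8), of \<sigma> z] assms(9,11) by blast
  have chart: "plane_chart (a \<circ> proj) (b \<circ> proj) Z"
  proof
    show "bij Z"
    proof (rule bij_if_quasiperiodic_locally_injective[OF cZ per])
      fix z
      obtain \<sigma>0 S s t sx sy tx ty lam Lam c m where
        "normal_chart (a \<circ> proj) (b \<circ> proj) \<sigma>0 z S s t sx sy tx ty lam Lam c m" using charts[of z] by (elim exE conjE)
      from normal_chart.chart_locally_injective[OF this Z] show "\<exists>\<rho>>0. inj_on Z (ball z \<rho>)" .
    qed
    fix S F v z
    assume *: "open S" "z \<in> S" "continuous_on S v"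
      "\<And>p. p \<in> S \<Longrightarrow> (F has_derivative dform (v p * (a \<circ> proj) p) (v p * (b \<circ> proj) p)) (at p)"
    obtain \<sigma>0 S' s t sx sy tx ty lam Lam c m where
      "normal_chart (a \<circ> proj) (b \<circ> proj) \<sigma>0 z S' s t sx sy tx ty lam Lam c m" using charts[of z] by (elim exE conjE)
    from normal_chart.chart_primitive_quotient[OF this Z *(4) *(1,2,3)]
    show "((\<lambda>p. (F p - F z) / (Z p - Z z)) \<longlongrightarrow> v z) (at z)" by simp
  qed (use Z ca cb in auto)
  have \<sigma>m: "\<sigma>m \<ge> 0" unfolding \<sigma>m_def by (rule max_exponent_nonneg[OF assms(8)])
  have q: "q > 2 + \<sigma>m" "q \<ge> 1" using assms(15) \<sigma>m by (auto simp: \<sigma>m_def)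
  have loc: "\<exists>s t. \<exists>r>0. \<exists>c0>0. \<exists>c1>0. \<exists>\<sigma>0. 0 \<le> \<sigma>0 \<and> \<sigma>0 \<le> \<sigma>m \<and> (\<forall>p\<in>ball p0 r. \<forall>q\<in>ball p0 r.
      norm (q - p) \<le> c0 * (\<bar>s q - s p :: real\<bar> + \<bar>t q - t p :: real\<bar>) \<and>
      c1 * \<bar>s q - s p\<bar> \<le> norm (Z q - Z p) \<and> c1 * \<bar>t q - t p\<bar> powr (1 + \<sigma>0) \<le> norm (Z q - Z p))" for p0
  proof -
    obtain \<sigma>0 S s t sx sy tx ty lam Lam c m where \<sigma>0: "\<sigma>0 \<le> \<sigma>m" and
      nc: "normal_chart (a \<circ> proj) (b \<circ> proj) \<sigma>0 p0 S s t sx sy tx ty lam Lam c m" using charts[of p0] by (elim exE conjE)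
    obtain r c0 c1 where r: "r > 0" "c0 > 0" "c1 > 0"
      and bd: "\<forall>p\<in>ball p0 r. \<forall>q\<in>ball p0 r. norm (q - p) \<le> c0 * (\<bar>s q - s p\<bar> + \<bar>t q - t p\<bar>) \<and>
        c1 * \<bar>s q - s p\<bar> \<le> norm (Z q - Z p) \<and> c1 * \<bar>t q - t p\<bar> powr (1 + \<sigma>0) \<le> norm (Z q - Z p)"
      using normal_chart.chart_lower_bounds[OF nc Z] by (elim exE conjE)
    show ?thesis
      by (rule exI[of _ s], rule exI[of _ t], rule exI[of _ r], rule conjI[OF r(1)], rule exI[of _ c0], rule conjI[OF r(2)],
          rule exI[of _ c1], rule conjI[OF r(3)], rule exI[of _ \<sigma>0], intro conjI bd \<sigma>0 normal_chart.\<sigma>[OF nc])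
  qed
  have cu: "continuous_on UNIV (u \<circ> proj)" by (rule Holder_continuous_imp_continuous[OF assms(18)])
  \<comment> \<open>Where \<open>u\<close> vanishes the quotient is 0 by convention and both sides
    of \<open>Cu\<close> are 0 as well. So the equation becomes complex linear with a coefficient
    bounded by |A| + |B| everywhere.\<close>
  define C where "C z = A (proj z) + B (proj z) * (cnj (u (proj z)) / u (proj z))" for z
  have Cu: "C z * u (proj z) = A (proj z) * u (proj z) + B (proj z) * cnj (u (proj z))" for z
    by (cases "u (proj z) = 0") (auto simp: C_def algebra_simps)
  have Cle: "norm (C z) \<le> norm (A (proj z)) + norm (B (proj z))" for z
  proof -
    have "norm (cnj (u (proj z)) / u (proj z)) \<le> 1" by (simp add: norm_divide)
    then have "norm (B (proj z)) * norm (cnj (u (proj z)) / u (proj z)) \<le> norm (B (proj z)) * 1" by (rule mult_left_mono) simp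
    then show ?thesis unfolding C_def by (intro order_trans[OF norm_triangle_ineq] add_left_mono) (simp only: norm_mult mult_1_right)
  qed
  have Cm: "C \<in> borel_measurable (lebesgue_on (cbox s t))" for s t
  proof -
    have [measurable]: "(\<lambda>z. A (proj z)) \<in> borel_measurable (lebesgue_on (cbox s t))" "(\<lambda>z. B (proj z)) \<in> borel_measurable (lebesgue_on (cbox s t))"
      by (rule Lq_on_box(1)[OF assms(16) q(2)] Lq_on_box(1)[OF assms(17) q(2)])+
    have [measurable]: "(\<lambda>z. u (proj z)) \<in> borel_measurable (lebesgue_on (cbox s t))"
      "(\<lambda>z. cnj (u (proj z))) \<in> borel_measurable (lebesgue_on (cbox s t))"
      using continuous_on_subset[OF cu subset_UNIV, of "cbox s t"]
      by (auto intro!: continuous_imp_measurable_on_sets_lebesgue continuous_intros simp: comp_def)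
    show ?thesis unfolding C_def[abs_def] by measurable
  qed
  have Ci: "integrable (lebesgue_on (cbox s t)) (\<lambda>z. norm (C z) powr q)" for s t
  proof (rule Bochner_Integration.integrable_bound)
    show "integrable (lebesgue_on (cbox s t)) (\<lambda>z. 2 powr q * (norm (A (proj z)) powr q + norm (B (proj z)) powr q))"
      using Lq_on_box(2)[OF assms(16) q(2)] Lq_on_box(2)[OF assms(17) q(2)] by (intro integrable_mult_right Bochner_Integration.integrable_add)
    show "(\<lambda>z. norm (C z) powr q) \<in> borel_measurable (lebesgue_on (cbox s t))" using Cm[of s t] by measurable
    show "AE z in lebesgue_on (cbox s t). norm (norm (C z) powr q) \<le> norm (2 powr q * (norm (A (proj z)) powr q + norm (B (proj z)) powr q))"
    proof (rule AE_I2)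
      fix z
      \<comment> \<open>The comparison is (x + y)^q \<le> (2 max x y)^q \<le> 2^q (x^q +
        y^q).\<close>
      define M where "M = max (norm (A (proj z))) (norm (B (proj z)))"
      have "norm (C z) powr q \<le> (2 * M) powr q" using Cle[of z] q by (intro powr_mono2) (auto simp: M_def)
      also have "\<dots> = 2 powr q * M powr q" by (rule powr_mult)
      also have "\<dots> \<le> 2 powr q * (norm (A (proj z)) powr q + norm (B (proj z)) powr q)"
        by (intro mult_left_mono) (auto simp: M_def max_def)
      finally show "norm (norm (C z) powr q) \<le> norm (2 powr q * (norm (A (proj z)) powr q + norm (B (proj z)) powr q))" by simp
    qed
  qed
  define F where "F p = A p * u p + B p * cnj (u p)" for p
  have Fi: "integrable square_leb (\<lambda>z. F (proj z))"
  proof -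
    have "bounded ((u \<circ> proj) ` unit_square)"
      unfolding unit_square_def by (intro compact_imp_bounded compact_continuous_image continuous_on_subset[OF cu]) auto
    then obtain D where D: "\<And>z. z \<in> unit_square \<Longrightarrow> norm (u (proj z)) \<le> D" unfolding bounded_iff by auto
    show ?thesis
    proof (rule Bochner_Integration.integrable_bound)
      show "integrable square_leb (\<lambda>z. (norm (A (proj z)) + norm (B (proj z))) * D)"
        using Lq_imp_integrable[OF assms(16) q(2)] Lq_imp_integrable[OF assms(17) q(2)] by auto
      have "(\<lambda>z. C z * (u \<circ> proj) z) \<in> borel_measurable square_leb"
        unfolding unit_square_def
        by (intro borel_measurable_times Cm continuous_imp_measurable_on_sets_lebesgue continuous_on_subset[OF cu]) auto
      then show "(\<lambda>z. F (proj z)) \<in> borel_measurable square_leb" by (simp add: F_def Cu)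
      show "AE z in square_leb. norm (F (proj z)) \<le> norm ((norm (A (proj z)) + norm (B (proj z))) * D)"
      proof (rule AE_I2)
        fix z assume "z \<in> space square_leb"
        then have "norm (C z) * norm (u (proj z)) \<le> (norm (A (proj z)) + norm (B (proj z))) * D"
          using Cle[of z] D[of z] by (intro mult_mono) auto
        then show "norm (F (proj z)) \<le> norm ((norm (A (proj z)) + norm (B (proj z))) * D)"
          by (simp add: F_def Cu[symmetric] norm_mult)
      qed
    qed
  qed
  have rect: "rect_integral (\<lambda>z. (u \<circ> proj) z * (a \<circ> proj) z) (\<lambda>z. (u \<circ> proj) z * (b \<circ> proj) z) x0 x1 y0 y1
     = (LINT z|lebesgue_on (cbox (x0, y0) (x1, y1)). C z * (u \<circ> proj) z)" if "x0 \<le> x1" "y0 \<le> y1" for x0 x1 y0 y1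
    using weak_L_eq_imp_rect_integral(1)[OF ca cb cu Fi _ that] assms(19) by (simp add: F_def[abs_def] Cu)
  obtain p0 p1 where p: "proj p0 = p" "u (proj p1) \<noteq> 0" using proj_surj assms(20) by metis
  have "(u \<circ> proj) p0 \<noteq> 0"
    by (rule solution_no_zeros[OF chart assms(12) per \<sigma>m q(1) loc cu _ Cm Ci rect, of p1])
      (use p biperiodic_proj[of u] in \<open>auto simp: comp_def\<close>)
  then show "u p \<noteq> 0" using p by simp
qed

end
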